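(* Let $(k_N)_{N\in\mathbb N}$ be a sequence of positive integers and $(G_N)_{N\in\mathbb N}$ a sequence of finite, Abelian groups; for each $N$, draw $Z_1,\dots,Z_{k_N}$ i.i.d. uniformly from $G_N$. Suppose that $\lim_N|G_N|=\infty$, $\lim_N(k_N-d(G_N))=\infty$ and $$\frac{k_N-d(G_N)-1}{k_N}\ \ge\ 5\,\frac{k_N}{\log|G_N|}+2\,\frac{d(G_N)\log\log k_N}{\log|G_N|}\qquad\text{for all }N\in\mathbb N.$$ For $\alpha\in\mathbb R$, write $\mathfrak t_{\alpha,N}:=\mathfrak t_\alpha(k_N,|G_N|)$. Let $\alpha\in\mathbb R$. Then, as $N\to\infty$, $$\mathfrak t_{\alpha,N}/\mathfrak t_{0,N}\to1\qquad\text{and}\qquad d_{G_k,N}(\mathfrak t_{\alpha,N})\to\Psi(\alpha)\ \text{ in probability}.$$ That is, with high probability there is total variation cutoff at $\mathfrak t_0$ with profile given by $\{\mathfrak t_\alpha\}_{\alpha\in\mathbb R}$: for all $\varepsilon\in(0,1)$, the difference in the mixing times $t_{\mathrm{mix}}(\varepsilon)-t_{\mathrm{mix}}(\frac12)$ is given, up to smaller order terms, by $\mathfrak t_{\Psi^{-1}(\varepsilon)}-\mathfrak t_0$. Moreover, the implicit lower bound on the total variation distance holds deterministically, i.e. for all choices of generators: the total variation distance at time $\mathfrak t_{\alpha,N}$ is at least $\Psi(\alpha)-o(1)$ for every choice of $k_N$ generators of the Cayley graph.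
   Context: $d(G)$ is the minimal size of a generating set of $G$. $\Psi(\alpha)=\mathbb P(\mathcal N(0,1)\ge\alpha)$ is the standard Gaussian tail. Random Cayley graph and walk. For a multiset $Z=[Z_1,\dots,Z_k]$ of elements of $G$, the directed (undirected) Cayley graph $G^+(Z)$ ($G^-(Z)$) is the multigraph with vertex set $G$ and edges $(g,gz)$ (respectively $\{g,gz\}$) for $g\in G$, $z\in Z$. The random walk (RW) $S=(S(t))_{t\ge0}$ is in continuous time at rate 1, started from the identity: at each step, from $g$, $z\in Z$ is chosen uniformly and the walk moves to $gz$ for $G^+(Z)$, or to one of $gz$, $gz^{-1}$ with probability $1/2$ each for $G^-(Z)$. The statement holds in both cases. $d_{G_k,N}(t)$ is the total variation distance, given $Z=[Z_1,\dots,Z_{k_N}]$, between the law of $S(t)$ on the Cayley graph of $G_N$ generated by $Z$ and the uniform distribution on $G_N$; it is a random variable. $t_{\mathrm{mix}}(\varepsilon)=\inf\{t\ge0: d_{G_k,N}(t)\le\varepsilon\}$. Entropic and cutoff times. Let $W=(W_1,\dots,W_k)$ be the rate-1 RW on $\mathbb Z^k$ started at $0$: at rate 1 a uniformly chosen coordinate is incremented by $+1$ (directed case), or by $+1$ or $-1$ with probability $1/2$ each (undirected case). Let $\nu_s$ be the law of $W_1(sk)$ and $Q_1(t)=-\log\nu_{t/k}(W_1(t))$; so $\mathbb E(Q_1(t))$ is the entropy of $W_1(t)$, which is an increasing bijection in $t$ from $[0,\infty)$ to $[0,\infty)$. For $k,n\in\mathbb N$ and $\alpha\in\mathbb R$,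 $\mathfrak t_\alpha=\mathfrak t_\alpha(k,n)$ is defined by $$\mathbb E\big(Q_1(\mathfrak t_\alpha)\big)=\big(\log n+\alpha\sqrt{vk}\big)/k,\qquad v:=\mathrm{Var}\big(Q_1(\mathfrak t_0)\big),$$ assuming that $\log n+\alpha\sqrt{vk}\ge0$. *)

theory Defs
  imports
    "HOL-Probability.Probability"
    "HOL-Library.Multiset"
    "HOL-Algebra.Coset"
    "HOL-Algebra.Generated_Groups"
begin

definition min_gens :: "('a, 'b) monoid_scheme \<Rightarrow> nat" where
  "min_gens G = (LEAST m. \<exists>A \<subseteq> carrier G. finite A \<and> card A = m \<and> generate G A = carrier G)"

definition Gauss_tail :: "real \<Rightarrow> real" where
  "Gauss_tail \<alpha> = measure std_normal_distribution {\<alpha>..}"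

datatype orientation = Directed | Undirected

text \<open>
  Law at time \<open>t \<ge> 0\<close> of the continuous-time walk started at \<open>x\<close> that jumps at the points of a
  rate 1 Poisson process according to the transition kernel \<open>step\<close>. The library's
  \<^const>\<open>poisson_pmf\<close> is only specified for positive parameters, hence the case distinction.
\<close>

definition jump_count :: "real \<Rightarrow> nat pmf" where
  "jump_count t = (if t > 0 then poisson_pmf t else return_pmf 0)"

definition rate1_walk :: "('s \<Rightarrow> 's pmf) \<Rightarrow> 's \<Rightarrow> real \<Rightarrow> 's pmf" where
  "rate1_walk step x t =
     bind_pmf (jump_count t) (\<lambda>m. ((\<lambda>p. bind_pmf p step) ^^ m) (return_pmf x))"

definition cayley_step ::
  "orientation \<Rightarrow> ('a, 'b) monoid_scheme \<Rightarrow> 'a multiset \<Rightarrow> 'a \<Rightarrow> 'a pmf" where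
  "cayley_step dir G Z g =
     bind_pmf (pmf_of_multiset Z) (\<lambda>z.
       case dir of
         Directed \<Rightarrow> return_pmf (g \<otimes>\<^bsub>G\<^esub> z)
       | Undirected \<Rightarrow>
           map_pmf (\<lambda>b. if b then g \<otimes>\<^bsub>G\<^esub> z else g \<otimes>\<^bsub>G\<^esub> inv\<^bsub>G\<^esub> z) (bernoulli_pmf (1/2)))"

definition cayley_walk ::
  "orientation \<Rightarrow> ('a, 'b) monoid_scheme \<Rightarrow> 'a multiset \<Rightarrow> real \<Rightarrow> 'a pmf" where
  "cayley_walk dir G Z t = rate1_walk (cayley_step dir G Z) \<one>\<^bsub>G\<^esub> t"

definition tv_dist :: "'s pmf \<Rightarrow> 's pmf \<Rightarrow> real" where
  "tv_dist p q = (SUP A. \<bar>measure_pmf.prob p A - measure_pmf.prob q A\<bar>)"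

definition mix_dist ::
  "orientation \<Rightarrow> ('a, 'b) monoid_scheme \<Rightarrow> 'a multiset \<Rightarrow> real \<Rightarrow> real" where
  "mix_dist dir G Z t = tv_dist (cayley_walk dir G Z t) (pmf_of_set (carrier G))"

text \<open>
  If \<open>Z\<close> does not generate \<open>G\<close>, the set below may be empty and the mixing time, mathematically
  infinite, is then an unspecified real number.
\<close>

definition t_mix ::
  "orientation \<Rightarrow> ('a, 'b) monoid_scheme \<Rightarrow> 'a multiset \<Rightarrow> real \<Rightarrow> real" where
  "t_mix dir G Z \<epsilon> = Inf {t. t \<ge> 0 \<and> mix_dist dir G Z t \<le> \<epsilon>}"

text \<open>
  The law of the multiset of \<open>k\<close> i.i.d. uniform elements. The second argument of
  \<^const>\<open>Pi_pmf\<close> is the value of the random function outside the index set and plays no role.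
\<close>

definition random_gens :: "nat \<Rightarrow> ('a, 'b) monoid_scheme \<Rightarrow> 'a multiset pmf" where
  "random_gens k G =
     map_pmf (\<lambda>z. image_mset z (mset_set {..<k}))
       (Pi_pmf {..<k} \<one>\<^bsub>G\<^esub> (\<lambda>_. pmf_of_set (carrier G)))"

text \<open>
  The rate 1 walk on \<open>\<int>\<^sup>k\<close>. Vectors are functions on the naturals that vanish from \<open>k\<close> on, with
  coordinates numbered from 0, so that \<open>W\<^sub>1\<close> is the value at 0.
\<close>

definition lattice_step :: "orientation \<Rightarrow> nat \<Rightarrow> (nat \<Rightarrow> int) \<Rightarrow> (nat \<Rightarrow> int) pmf" where
  "lattice_step dir k w =
     bind_pmf (pmf_of_set {..<k}) (\<lambda>i.
       case dir of
         Directed \<Rightarrow> return_pmf (w(i := w i + 1))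
       | Undirected \<Rightarrow>
           map_pmf (\<lambda>b. if b then w(i := w i + 1) else w(i := w i - 1)) (bernoulli_pmf (1/2)))"

definition lattice_walk :: "orientation \<Rightarrow> nat \<Rightarrow> real \<Rightarrow> (nat \<Rightarrow> int) pmf" where
  "lattice_walk dir k t = rate1_walk (lattice_step dir k) (\<lambda>_. 0) t"

definition nu :: "orientation \<Rightarrow> nat \<Rightarrow> real \<Rightarrow> int pmf" where
  "nu dir k s = map_pmf (\<lambda>w. w 0) (lattice_walk dir k (s * real k))"

definition Q1 :: "orientation \<Rightarrow> nat \<Rightarrow> real \<Rightarrow> (nat \<Rightarrow> int) \<Rightarrow> real" where
  "Q1 dir k t w = - ln (pmf (nu dir k (t / real k)) (w 0))"

definition Q1_mean :: "orientation \<Rightarrow> nat \<Rightarrow> real \<Rightarrow> real" where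
  "Q1_mean dir k t = measure_pmf.expectation (lattice_walk dir k t) (Q1 dir k t)"

definition Q1_var :: "orientation \<Rightarrow> nat \<Rightarrow> real \<Rightarrow> real" where
  "Q1_var dir k t = measure_pmf.variance (lattice_walk dir k t) (Q1 dir k t)"

text \<open>
  \<^const>\<open>Q1_mean\<close> is an increasing bijection from \<open>[0, \<infinity>)\<close> to itself for \<open>k \<ge> 1\<close>, so the two descriptions
  below are proper as soon as the prescribed mean is nonnegative. The time for \<open>\<alpha> = 0\<close> does not
  involve the variance and is introduced first, as the variance is taken at this time.
\<close>

definition ent_time0 :: "orientation \<Rightarrow> nat \<Rightarrow> nat \<Rightarrow> real" where
  "ent_time0 dir k n = (THE t. t \<ge> 0 \<and> Q1_mean dir k t = ln (real n) / real k)"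

definition ent_time :: "orientation \<Rightarrow> nat \<Rightarrow> nat \<Rightarrow> real \<Rightarrow> real" where
  "ent_time dir k n \<alpha> =
     (THE t. t \<ge> 0 \<and>
        Q1_mean dir k t =
          (ln (real n) + \<alpha> * sqrt (Q1_var dir k (ent_time0 dir k n) * real k)) / real k)"

lemma ent_time_0: "ent_time dir k n 0 = ent_time0 dir k n"
  by (simp add: ent_time_def ent_time0_def)

definition tendsto_in_prob ::
  "(nat \<Rightarrow> 's pmf) \<Rightarrow> (nat \<Rightarrow> 's \<Rightarrow> real) \<Rightarrow> real \<Rightarrow> bool" where
  "tendsto_in_prob P X c \<longleftrightarrow>
     (\<forall>\<eta>>0. (\<lambda>N. measure_pmf.prob (P N) {\<omega>. \<bar>X N \<omega> - c\<bar> > \<eta>}) \<longlonglongrightarrow> 0)"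

end

(*
The walk at time t is the image, under w |-> Z_1^{w_1} ... Z_k^{w_k}, of the walk W on Z^k, whose
coordinates at time t are independent copies of the rate 1 walk on Z at time s = t/k. Hence
-log P(W = w) is a sum of k independent surprisals. By the local behaviour of the law of a coordinate,
a surprisal is z^2/2 + O(s^{-1/2}) up to a constant, z being the standardised coordinate, so that its
variance tends to 1/2 and its third moment stays bounded. The central limit theorem then yields, at
time t_alpha, P(|G| P(W = w) >= e^{omega}) -> Psi(alpha) for omega -> +-infinity, |omega| << sqrt k.

Lower bound: for omega > 0 the likely words number at most |G| e^{-omega}, hence cover a vanishing
proportion of G, for every choice of generators.

Upper bound: discard the words with |G| P(W = w) > e^{-omega} or with an unusually large coordinate,
and bound the expected L2 distance of the rest to uniform. For two words whose difference has gcd g,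
the collision probability over uniform generators is 1/|G^g| <= g^{d(G)}/|G| by Bezout; g divides the
difference with probability at most (1/g + O(s^{-1/2}))^k since the law of a coordinate is unimodal.
The hypothesis on k, d(G) and |G| makes the sum over g >= 2 vanish.

The mixing times follow from the limit profile since the total variation distance is decreasing in
time and, with s * d(entropy)/ds bounded away from 0 and infinity, alpha |-> t_alpha is bi-Lipschitz
after rescaling.
*)

theory Submission
  imports Defs "HOL-Library.Nat_Bijection" "HOL-Algebra.FiniteProduct" "HOL-Real_Asymp.Real_Asymp"
begin

section \<open>Independence of the coordinates\<close>

text \<open>The hypothesis makes the entropy per coordinate at least 5 for large \<open>N\<close>,
  hence \<open>s \<ge> 100\<close>, but \<open>s\<close> need not tend to infinity: \<open>k\<close>
  may be comparable with \<open>ln (order G)\<close>. Limits in \<open>s\<close> alone are therefore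
  not enough. Variance and third moment of the surprisal are bounded for all
  \<open>s \<ge> 100\<close>, and the variance is shown to be uniformly continuous in
  \<open>ln s\<close>, which allows the variance at t_0 to stand in for the one at t_\<alpha>. For
  the same reason the entropy \<open>H\<close> of a coordinate is enclosed with explicit constants,
  \<open>ln s / 2 - ln 2 \<le> H \<le> ln s / 2 + 37/20\<close>; the constants 5 and 2 of the
  hypothesis are spent on these. Asymptotics of Poisson or Bessel weights are avoided. Both
  orientations satisfy the recursion \<open>x * p x = s * (u * p (x - 1) - d * p (x + 1))\<close>,
  with \<open>u\<close> and \<open>d\<close> the probabilities of a step up and down. It yields the
  moments, unimodality, and two-sided bounds on the increments of \<open>- ln p\<close>; summing
  these increments gives the Gaussian shape with an error polynomial in the standardised
  coordinate.\<close>

lemma pmf_jump_count: "t \<ge> 0 \<Longrightarrow> pmf (jump_count t) n = t ^ n / fact n * exp (- t)"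
  by (cases "t = 0") (auto simp: jump_count_def indicator_def power_0_left)

section \<open>Mixtures of commuting kernels and thinning of the Poisson clock\<close>

definition kpow :: "('s \<Rightarrow> 's pmf) \<Rightarrow> nat \<Rightarrow> 's \<Rightarrow> 's pmf" where
  "kpow K m x = ((\<lambda>p. bind_pmf p K) ^^ m) (return_pmf x)"

lemma kpow_0 [simp]: "kpow K 0 = return_pmf"
  by (simp add: fun_eq_iff kpow_def)

lemma kpow_Suc: "kpow K (Suc m) x = bind_pmf (kpow K m x) K"
  by (simp add: kpow_def)

lemma kpow_Suc': "kpow K (Suc m) x = bind_pmf (K x) (kpow K m)"
proof (induction m arbitrary: x)
  case 0
  then show ?case by (simp add: kpow_Suc bind_return_pmf bind_return_pmf')
next
  case (Suc m)
  have "kpow K (Suc (Suc m)) x = bind_pmf (kpow K (Suc m) x) K"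
    by (rule kpow_Suc)
  also have "\<dots> = bind_pmf (bind_pmf (K x) (kpow K m)) K"
    by (simp only: Suc)
  also have "\<dots> = bind_pmf (K x) (kpow K (Suc m))"
    by (simp add: bind_assoc_pmf kpow_Suc[abs_def])
  finally show ?case .
qed

lemma rate1_walk_kpow: "rate1_walk K x t = bind_pmf (jump_count t) (\<lambda>m. kpow K m x)"
  by (simp add: rate1_walk_def kpow_def)

lemma rate1_walk_0 [simp]: "rate1_walk K x 0 = return_pmf x"
  by (simp add: rate1_walk_kpow jump_count_def bind_return_pmf)

lemma kpow_map:
  assumes "\<And>x. map_pmf h (K x) = L (h x)"
  shows "map_pmf h (kpow K m x) = kpow L m (h x)"
proof (induction m)
  case (Suc m)
  have "map_pmf h (kpow K (Suc m) x) = bind_pmf (kpow K m x) (\<lambda>y. L (h y))"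
    by (simp add: kpow_Suc map_bind_pmf assms)
  also have "\<dots> = bind_pmf (map_pmf h (kpow K m x)) L"
    by (simp add: bind_map_pmf)
  finally show ?case by (simp add: Suc kpow_Suc)
qed simp

lemma rate1_walk_map:
  assumes "\<And>x. map_pmf h (K x) = L (h x)"
  shows "map_pmf h (rate1_walk K x t) = rate1_walk L (h x) t"
  by (simp add: rate1_walk_kpow map_bind_pmf kpow_map[of h K L, OF assms])

lemma kpow_commute:
  assumes "\<And>x. bind_pmf (K x) L = bind_pmf (L x) K"
  shows "bind_pmf (kpow K m x) L = bind_pmf (L x) (kpow K m)"
proof (induction m arbitrary: x)
  case (Suc m)
  have "bind_pmf (kpow K (Suc m) x) L = bind_pmf (K x) (\<lambda>y. bind_pmf (L y) (kpow K m))"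
    by (simp add: kpow_Suc' bind_assoc_pmf Suc)
  also have "\<dots> = bind_pmf (bind_pmf (L x) K) (kpow K m)"
    by (simp add: assms flip: bind_assoc_pmf)
  also have "\<dots> = bind_pmf (L x) (kpow K (Suc m))"
    by (simp add: bind_assoc_pmf kpow_Suc'[abs_def])
  finally show ?case .
qed (simp add: bind_return_pmf bind_return_pmf')

text \<open>Because \<open>K\<close> and \<open>L\<close> commute, only the number \<open>j\<close>
  of \<open>K\<close>-steps among the \<open>m\<close> matters, not their positions; this number is
  binomial, and the \<open>K\<close>-steps may be performed first.\<close>

lemma kpow_mixture:
  assumes comm: "\<And>x. bind_pmf (K x) L = bind_pmf (L x) K" and q: "q \<in> {0..1}"
    and M: "\<And>x. M x = bind_pmf (bernoulli_pmf q) (\<lambda>b. if b then K x else L x)"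
  shows "kpow M m x = bind_pmf (binomial_pmf m q) (\<lambda>j. bind_pmf (kpow K j x) (kpow L (m - j)))"
proof (induction m arbitrary: x)
  case 0
  have "binomial_pmf 0 q = return_pmf 0"
    using set_pmf_binomial_eq[of q 0] q by (intro set_pmf_subset_singleton[THEN iffD1]) (auto split: if_splits)
  then show ?case by (simp add: bind_return_pmf)
next
  case (Suc m)
  have a: "bind_pmf (K x) (kpow M m) =
      bind_pmf (binomial_pmf m q) (\<lambda>j. bind_pmf (kpow K (Suc j) x) (kpow L (Suc m - Suc j)))"
  proof -
    have "bind_pmf (K x) (kpow M m) = bind_pmf (K x) (\<lambda>y. bind_pmf (binomial_pmf m q)
        (\<lambda>j. bind_pmf (kpow K j y) (kpow L (m - j))))"
      by (intro bind_pmf_cong refl Suc)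
    also have "\<dots> = bind_pmf (binomial_pmf m q) (\<lambda>j. bind_pmf (K x)
        (\<lambda>y. bind_pmf (kpow K j y) (kpow L (m - j))))"
      by (rule bind_commute_pmf)
    finally show ?thesis
      by (simp add: kpow_Suc' bind_assoc_pmf)
  qed
  have b: "bind_pmf (L x) (kpow M m) =
      bind_pmf (binomial_pmf m q) (\<lambda>j. bind_pmf (kpow K j x) (kpow L (Suc m - j)))"
  proof -
    have "bind_pmf (L x) (kpow M m) = bind_pmf (L x) (\<lambda>y. bind_pmf (binomial_pmf m q)
        (\<lambda>j. bind_pmf (kpow K j y) (kpow L (m - j))))"
      by (intro bind_pmf_cong refl Suc)
    also have "\<dots> = bind_pmf (binomial_pmf m q) (\<lambda>j. bind_pmf (L x)
        (\<lambda>y. bind_pmf (kpow K j y) (kpow L (m - j))))"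
      by (rule bind_commute_pmf)
    also have "\<dots> = bind_pmf (binomial_pmf m q) (\<lambda>j. bind_pmf (kpow K j x)
        (\<lambda>y. bind_pmf (L y) (kpow L (m - j))))"
      by (simp add: kpow_commute[OF comm] flip: bind_assoc_pmf)
    also have "\<dots> = bind_pmf (binomial_pmf m q) (\<lambda>j. bind_pmf (kpow K j x) (kpow L (Suc m - j)))"
    proof (intro bind_pmf_cong refl)
      fix j y assume "j \<in> set_pmf (binomial_pmf m q)"
      hence "j \<le> m" using q by (auto simp: set_pmf_binomial_eq split: if_splits)
      thus "bind_pmf (L y) (kpow L (m - j)) = kpow L (Suc m - j) y"
        by (simp add: Suc_diff_le kpow_Suc')
    qed
    finally show ?thesis .
  qed
  have "kpow M (Suc m) x = bind_pmf (bernoulli_pmf q)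
      (\<lambda>b. if b then bind_pmf (K x) (kpow M m) else bind_pmf (L x) (kpow M m))"
    by (simp add: kpow_Suc' M bind_assoc_pmf if_distrib[of "\<lambda>p. bind_pmf p _"] cong: if_cong)
  also have "\<dots> = bind_pmf (bernoulli_pmf q) (\<lambda>b. bind_pmf (binomial_pmf m q) (\<lambda>j.
      bind_pmf (kpow K ((if b then 1 else 0) + j) x) (kpow L (Suc m - ((if b then 1 else 0) + j)))))"
    by (intro bind_pmf_cong refl) (auto simp: a b)
  also have "\<dots> = bind_pmf (binomial_pmf (Suc m) q) (\<lambda>j. bind_pmf (kpow K j x) (kpow L (Suc m - j)))"
    by (simp add: binomial_pmf_Suc[OF q] bind_assoc_pmf bind_return_pmf)
  finally show ?case .
qed

lemma poisson_thinning:
  assumes t: "t \<ge> 0" and q: "q \<in> {0..1}"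
  shows "bind_pmf (jump_count t) (\<lambda>m. map_pmf (\<lambda>j. (j, m - j)) (binomial_pmf m q)) =
    pair_pmf (jump_count (q * t)) (jump_count ((1 - q) * t))"
proof (rule pmf_eqI)
  fix ab :: "nat \<times> nat"
  obtain a b where ab: "ab = (a, b)" by (cases ab)
  have inner: "pmf (map_pmf (\<lambda>j. (j, m - j)) (binomial_pmf m q)) (a, b) =
      (if m = a + b then pmf (binomial_pmf m q) a else 0)" for m
  proof -
    have "pmf (map_pmf (\<lambda>j. (j, m - j)) (binomial_pmf m q)) (a, b) =
        measure_pmf.prob (binomial_pmf m q) ((\<lambda>j. (j, m - j)) -` {(a, b)})"
      by (simp add: pmf_map)
    \<comment> \<open>Truncated subtraction puts some \<open>j > m\<close> into the preimage as
      well; these have binomial weight 0.\<close>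
    also have "\<dots> = measure_pmf.prob (binomial_pmf m q) (if m = a + b then {a} else {})"
      using q by (intro measure_prob_cong_0)
        (auto simp: binomial_eq_0 split: if_splits intro!: binomial_eq_0)
    finally show ?thesis by (simp add: measure_pmf_single)
  qed
  have "pmf (bind_pmf (jump_count t) (\<lambda>m. map_pmf (\<lambda>j. (j, m - j)) (binomial_pmf m q))) ab =
      (\<integral>m. (if m = a + b then pmf (binomial_pmf m q) a else 0) \<partial>measure_pmf (jump_count t))"
    by (simp add: pmf_bind ab inner)
  also have "\<dots> = pmf (binomial_pmf (a + b) q) a * pmf (jump_count t) (a + b)"
    by (subst integral_measure_pmf_real[of "{a + b}"]) (auto split: if_splits)
  also have "\<dots> = pmf (pair_pmf (jump_count (q * t)) (jump_count ((1 - q) * t))) (a, b)"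
  proof -
    have 1: "real ((a + b) choose a) = fact (a + b) / (fact a * fact b)"
      by (subst binomial_fact) auto
    have 2: "exp (- t) = exp (- (q * t)) * exp (- ((1 - q) * t))"
      by (simp add: algebra_simps flip: exp_add)
    show ?thesis using q t
      by (simp add: pmf_pair pmf_jump_count 1 2 power_add power_mult_distrib)
  qed
  finally show "pmf (bind_pmf (jump_count t) (\<lambda>m. map_pmf (\<lambda>j. (j, m - j)) (binomial_pmf m q))) ab =
    pmf (pair_pmf (jump_count (q * t)) (jump_count ((1 - q) * t))) ab" by (simp add: ab)
qed

text \<open>Thinning splits the clock into two independent Poisson clocks, one for each kernel, so
  the interleaved walk may be run as the two walks in succession.\<close>

lemma rate1_walk_mixture:
  assumes comm: "\<And>x. bind_pmf (K x) L = bind_pmf (L x) K" and q: "q \<in> {0..1}"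
    and M: "\<And>x. M x = bind_pmf (bernoulli_pmf q) (\<lambda>b. if b then K x else L x)" and t: "t \<ge> 0"
  shows "rate1_walk M x t =
    bind_pmf (rate1_walk K x (q * t)) (\<lambda>y. rate1_walk L y ((1 - q) * t))"
proof -
  have "rate1_walk M x t = bind_pmf (bind_pmf (jump_count t) (\<lambda>m. map_pmf (\<lambda>j. (j, m - j)) (binomial_pmf m q)))
     (\<lambda>(a, b). bind_pmf (kpow K a x) (kpow L b))"
    by (simp add: rate1_walk_kpow kpow_mixture[OF comm q M] bind_assoc_pmf bind_map_pmf)
  also have "\<dots> = bind_pmf (jump_count (q * t)) (\<lambda>a. bind_pmf (jump_count ((1 - q) * t))
      (\<lambda>b. bind_pmf (kpow K a x) (kpow L b)))"
    by (simp add: poisson_thinning[OF t q] pair_pmf_def bind_assoc_pmf bind_return_pmf)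
  also have "\<dots> = bind_pmf (jump_count (q * t)) (\<lambda>a. bind_pmf (kpow K a x)
      (\<lambda>y. bind_pmf (jump_count ((1 - q) * t)) (\<lambda>b. kpow L b y)))"
    by (intro bind_pmf_cong refl, subst bind_commute_pmf) simp
  finally show ?thesis by (simp add: rate1_walk_kpow bind_assoc_pmf)
qed

text \<open>The semigroup property is the mixture with both kernels equal:
  \<open>q = t / (t + h)\<close> thins one clock of length \<open>t + h\<close> into clocks of
  lengths \<open>t\<close> and \<open>h\<close>.\<close>

lemma rate1_walk_add:
  assumes "t \<ge> 0" "h \<ge> 0"
  shows "rate1_walk K x (t + h) = bind_pmf (rate1_walk K x t) (\<lambda>y. rate1_walk K y h)"
proof (cases "t + h = 0")
  case True
  then have "t = 0" "h = 0" using assms by auto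
  then show ?thesis by (simp add: bind_return_pmf)
next
  case False
  have "rate1_walk K x (t + h) = bind_pmf (rate1_walk K x (t / (t + h) * (t + h)))
      (\<lambda>y. rate1_walk K y ((1 - t / (t + h)) * (t + h)))"
    using assms False by (intro rate1_walk_mixture) (auto simp: divide_simps)
  moreover have "t / (t + h) * (t + h) = t" "(1 - t / (t + h)) * (t + h) = h"
    using False by (auto simp: field_simps)
  ultimately show ?thesis by simp
qed

section \<open>One coordinate, and splitting the walk on vectors into its coordinates\<close>

definition step1 :: "orientation \<Rightarrow> int \<Rightarrow> int pmf" where
  "step1 dir x = (case dir of Directed \<Rightarrow> return_pmf (x + 1)
     | Undirected \<Rightarrow> map_pmf (\<lambda>b. if b then x + 1 else x - 1) (bernoulli_pmf (1/2)))"

text \<open>Directed: Poisson with parameter \<open>s\<close>. Undirected: the difference of two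
  independent Poisson variables with parameter \<open>s / 2\<close>, whose weights are
  \<open>exp (- s)\<close> times Bessel functions.\<close>

definition xi :: "orientation \<Rightarrow> real \<Rightarrow> int pmf" where
  "xi dir s = rate1_walk (step1 dir) 0 s"

lemma map_step1: "map_pmf (\<lambda>y. y + c) (step1 dir x) = step1 dir (x + c)"
  by (cases dir) (auto simp: step1_def pmf.map_comp o_def intro!: map_pmf_cong)

definition coord_step :: "orientation \<Rightarrow> nat \<Rightarrow> (nat \<Rightarrow> int) \<Rightarrow> (nat \<Rightarrow> int) pmf" where
  "coord_step dir i w = map_pmf (\<lambda>x. w(i := x)) (step1 dir (w i))"

lemma rate1_walk_coord_step:
  "rate1_walk (coord_step dir i) w s = map_pmf (\<lambda>x. w(i := w i + x)) (xi dir s)"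
proof -
  have "map_pmf (\<lambda>x. w(i := w i + x)) (rate1_walk (step1 dir) 0 s) =
      rate1_walk (coord_step dir i) (w(i := w i + 0)) s"
  proof (rule rate1_walk_map)
    fix x show "map_pmf (\<lambda>x. w(i := w i + x)) (step1 dir x) = coord_step dir i (w(i := w i + x))"
      using map_step1[of "w i" dir x, symmetric]
      by (simp add: coord_step_def pmf.map_comp o_def add.commute)
  qed
  thus ?thesis by (simp add: xi_def)
qed

definition set_step :: "orientation \<Rightarrow> nat set \<Rightarrow> (nat \<Rightarrow> int) \<Rightarrow> (nat \<Rightarrow> int) pmf" where
  "set_step dir I w = bind_pmf (pmf_of_set I) (\<lambda>i. coord_step dir i w)"

lemma lattice_step_eq: "lattice_step dir k = set_step dir {..<k}"
  by (cases dir) (auto simp: fun_eq_iff lattice_step_def set_step_def coord_step_def step1_def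
    pmf.map_comp o_def intro!: bind_pmf_cong map_pmf_cong)

text \<open>Peels one coordinate off the uniform choice, with the probability that leaves all
  coordinates the same clock rate in an induction over \<open>I\<close>.\<close>

lemma pmf_of_set_insert_mixture:
  assumes "finite I" "I \<noteq> {}" "i \<notin> I"
  shows "pmf_of_set (insert i I) =
    bind_pmf (bernoulli_pmf (1 / (1 + card I))) (\<lambda>b. if b then return_pmf i else pmf_of_set I)"
proof (rule pmf_eqI)
  fix j
  have c: "card I > 0" using assms by (simp add: card_gt_0_iff)
  hence q: "1 / (1 + real (card I)) \<in> {0..1}" by auto
  show "pmf (pmf_of_set (insert i I)) j =
    pmf (bind_pmf (bernoulli_pmf (1 / (1 + card I))) (\<lambda>b. if b then return_pmf i else pmf_of_set I)) j"
  proof -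
    have "1 - 1 / (1 + real (card I)) = real (card I) / (1 + real (card I))"
      using c by (simp add: divide_simps)
    thus ?thesis using assms c q by (auto simp: pmf_bind indicator_def)
  qed
qed

lemma coord_step_commute:
  assumes "i \<noteq> j"
  shows "bind_pmf (coord_step dir i w) (coord_step dir j) = bind_pmf (coord_step dir j w) (coord_step dir i)"
proof -
  have "bind_pmf (coord_step dir i w) (coord_step dir j) =
     bind_pmf (step1 dir (w i)) (\<lambda>x. bind_pmf (step1 dir (w j)) (\<lambda>y. return_pmf (w(i := x, j := y))))"
    using assms by (simp add: coord_step_def[abs_def] bind_map_pmf map_pmf_def bind_assoc_pmf bind_return_pmf)
  also have "\<dots> = bind_pmf (step1 dir (w j)) (\<lambda>y. bind_pmf (step1 dir (w i)) (\<lambda>x. return_pmf (w(j := y, i := x))))"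
    using assms by (subst bind_commute_pmf) (simp add: fun_upd_twist)
  also have "\<dots> = bind_pmf (coord_step dir j w) (coord_step dir i)"
    using assms by (simp add: coord_step_def[abs_def] bind_map_pmf map_pmf_def bind_assoc_pmf bind_return_pmf)
  finally show ?thesis .
qed

lemma set_step_commute:
  assumes "i \<notin> I" "finite I" "I \<noteq> {}"
  shows "bind_pmf (coord_step dir i w) (set_step dir I) = bind_pmf (set_step dir I w) (coord_step dir i)"
proof -
  have "bind_pmf (coord_step dir i w) (set_step dir I) =
     bind_pmf (pmf_of_set I) (\<lambda>j. bind_pmf (coord_step dir i w) (coord_step dir j))"
    unfolding set_step_def[abs_def] by (rule bind_commute_pmf)
  also have "\<dots> = bind_pmf (pmf_of_set I) (\<lambda>j. bind_pmf (coord_step dir j w) (coord_step dir i))"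
    using assms by (intro bind_pmf_cong refl coord_step_commute) auto
  finally show ?thesis by (simp add: set_step_def bind_assoc_pmf)
qed

text \<open>Poissonisation makes the coordinates of the walk independent.\<close>

lemma rate1_walk_set_step:
  assumes "finite I" "I \<noteq> {}" "t \<ge> 0"
  shows "rate1_walk (set_step dir I) w t =
    map_pmf (\<lambda>f j. w j + f j) (Pi_pmf I 0 (\<lambda>_. xi dir (t / card I)))"
  using assms
proof (induction arbitrary: w t rule: finite_ne_induct)
  case (singleton i)
  have "set_step dir {i} = coord_step dir i"
    by (simp add: fun_eq_iff set_step_def pmf_of_set_singleton bind_return_pmf)
  then show ?case
    by (auto simp: rate1_walk_coord_step Pi_pmf_singleton pmf.map_comp o_def intro!: map_pmf_cong)
next
  case (insert i I)
  define q where "q = 1 / (1 + real (card I))"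
  have c: "card I > 0" using insert by (simp add: card_gt_0_iff)
  have q: "q \<in> {0..1}" and q1: "q * t = t / (1 + card I)" and q2: "(1 - q) * t / card I = t / (1 + card I)"
    using c by (auto simp: q_def divide_simps)
  have "rate1_walk (set_step dir (insert i I)) w t =
    bind_pmf (rate1_walk (coord_step dir i) w (q * t)) (\<lambda>y. rate1_walk (set_step dir I) y ((1 - q) * t))"
  proof (rule rate1_walk_mixture[OF _ q _ \<open>t \<ge> 0\<close>])
    fix x
    show "bind_pmf (coord_step dir i x) (set_step dir I) = bind_pmf (set_step dir I x) (coord_step dir i)"
      using insert by (intro set_step_commute) auto
    show "set_step dir (insert i I) x = bind_pmf (bernoulli_pmf q) (\<lambda>b. if b then coord_step dir i x else set_step dir I x)"
      using insert unfolding set_step_def q_def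
      by (simp add: pmf_of_set_insert_mixture bind_assoc_pmf)
        (intro bind_pmf_cong refl, simp add: bind_return_pmf)
  qed
  also have "\<dots> = bind_pmf (xi dir (t / (1 + card I))) (\<lambda>x. map_pmf (\<lambda>f j. (w(i := w i + x)) j + f j)
      (Pi_pmf I 0 (\<lambda>_. xi dir (t / (1 + card I)))))"
    using q insert by (simp add: rate1_walk_coord_step bind_map_pmf q1 q2)
  also have "\<dots> = bind_pmf (xi dir (t / (1 + card I))) (\<lambda>x. map_pmf (\<lambda>f j. w j + (f(i := x)) j)
      (Pi_pmf I 0 (\<lambda>_. xi dir (t / (1 + card I)))))"
  proof (intro bind_pmf_cong refl map_pmf_cong)
    \<comment> \<open>Outside \<open>I\<close> the vector \<open>f\<close> has the default value 0,
      so adding it leaves coordinate \<open>i\<close> alone.\<close>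
    fix x f assume "f \<in> set_pmf (Pi_pmf I 0 (\<lambda>_. xi dir (t / (1 + card I))))"
    hence "f i = 0" using set_Pi_pmf_subset[OF \<open>finite I\<close>, of 0] \<open>i \<notin> I\<close>
      by (metis (mono_tags, lifting) mem_Collect_eq subsetD)
    thus "(\<lambda>j. (w(i := w i + x)) j + f j) = (\<lambda>j. w j + (f(i := x)) j)"
      by (auto simp: fun_eq_iff)
  qed
  also have "\<dots> = map_pmf (\<lambda>f j. w j + f j) (Pi_pmf (insert i I) 0 (\<lambda>_. xi dir (t / card (insert i I))))"
    using insert by (simp add: Pi_pmf_insert' map_pmf_def bind_assoc_pmf bind_return_pmf fun_upd_def)
  finally show ?case .
qed

lemma lattice_walk_eq_Pi_pmf:
  assumes "k \<ge> 1" "t \<ge> 0"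
  shows "lattice_walk dir k t = Pi_pmf {..<k} 0 (\<lambda>_. xi dir (t / k))"
  using assms by (simp add: lattice_walk_def lattice_step_eq rate1_walk_set_step lessThan_empty_iff)

lemma nu_eq_xi:
  assumes "k \<ge> 1" "s \<ge> 0"
  shows "nu dir k s = xi dir s"
  using assms by (simp add: nu_def lattice_walk_eq_Pi_pmf Pi_pmf_component)

section \<open>The law of a single coordinate\<close>

fun up_prob :: "orientation \<Rightarrow> real" where
  "up_prob Directed = 1" | "up_prob Undirected = 1/2"

definition down_prob :: "orientation \<Rightarrow> real" where
  "down_prob dir = 1 - up_prob dir"

fun walk_support :: "orientation \<Rightarrow> int set" where
  "walk_support Directed = {0..}" | "walk_support Undirected = UNIV"

lemma up_down_simps [simp]:
  "down_prob Directed = 0" "down_prob Undirected = 1/2" "up_prob dir \<ge> 0" "down_prob dir \<ge> 0"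
  "up_prob dir + down_prob dir = 1" "up_prob dir \<ge> 1/2" "up_prob dir \<le> 1" "down_prob dir \<le> 1/2"
  by (cases dir; simp add: down_prob_def)+

section \<open>The embedded walk, its Stein identity, and the law as a power series\<close>

definition srw :: "orientation \<Rightarrow> nat \<Rightarrow> int \<Rightarrow> real" where
  "srw dir m x = pmf (kpow (step1 dir) m 0) x"

lemma pmf_bind_step1:
  "pmf (bind_pmf p (step1 dir)) x = up_prob dir * pmf p (x - 1) + down_prob dir * pmf p (x + 1)"
proof -
  have *: "pmf (step1 dir y) x = up_prob dir * indicator {x - 1} y + down_prob dir * indicator {x + 1} y" for y
  proof (cases dir)
    case Undirected
    have "pmf (map_pmf (\<lambda>b. if b then y + 1 else y - 1) (bernoulli_pmf (1/2))) x =
      pmf (bind_pmf (bernoulli_pmf (1/2)) (\<lambda>b. return_pmf (if b then y + 1 else y - 1))) x"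
      by (simp add: map_pmf_def)
    also have "\<dots> = 1/2 * indicator {x - 1} y + 1/2 * indicator {x + 1} y"
      by (subst pmf_bind) (auto simp: indicator_def)
    finally show ?thesis using Undirected by (simp add: step1_def)
  qed (auto simp: step1_def indicator_def)
  have "(\<integral>y. up_prob dir * indicator {x - 1} y + down_prob dir * indicator {x + 1} y \<partial>measure_pmf p) =
      up_prob dir * pmf p (x - 1) + down_prob dir * pmf p (x + 1)"
    by (subst Bochner_Integration.integral_add)
      (auto simp: measure_pmf_single intro!: measure_pmf.integrable_const_bound[where B = 1])
  thus ?thesis
    by (simp add: pmf_bind *)
qed

lemma srw_0: "srw dir 0 x = (if x = 0 then 1 else 0)"
  by (simp add: srw_def indicator_def)

lemma srw_Suc: "srw dir (Suc m) x = up_prob dir * srw dir m (x - 1) + down_prob dir * srw dir m (x + 1)"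
  by (simp add: srw_def kpow_Suc pmf_bind_step1)

lemma srw_nonneg [simp]: "srw dir m x \<ge> 0" and srw_le_1 [simp]: "srw dir m x \<le> 1"
  by (simp_all add: srw_def pmf_le_1)

lemma srw_eq_0: "\<bar>x\<bar> > int m \<Longrightarrow> srw dir m x = 0"
  by (induction m arbitrary: x) (auto simp: srw_0 srw_Suc)

lemma srw_Directed: "srw Directed m x = (if x = int m then 1 else 0)"
  by (induction m arbitrary: x) (auto simp: srw_0 srw_Suc)

lemma srw_Undirected_minus: "srw Undirected m (- x) = srw Undirected m x"
proof (induction m arbitrary: x)
  case (Suc m)
  show ?case using Suc[of "x + 1"] Suc[of "x - 1"] by (simp add: srw_Suc)
qed (simp add: srw_0)

lemma srw_extreme: "srw dir m (int m) = up_prob dir ^ m"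
  by (induction m) (auto simp: srw_0 srw_Suc srw_eq_0)

text \<open>Counts only the straight path from 0 to \<open>x\<close>, whose steps have probability
  at least 1/2 each; negative \<open>x\<close> is handled by reflection.\<close>

lemma srw_ge:
  assumes "x \<in> walk_support dir"
  shows "srw dir (nat \<bar>x\<bar>) x \<ge> (1/2) ^ nat \<bar>x\<bar>"
proof -
  have *: "srw dir (nat \<bar>x\<bar>) \<bar>x\<bar> \<ge> (1/2) ^ nat \<bar>x\<bar>"
    using srw_extreme[of dir "nat \<bar>x\<bar>"] power_mono[OF up_down_simps(6), of "nat \<bar>x\<bar>" dir]
    by simp
  show ?thesis
  proof (cases dir)
    case Directed
    with assms * show ?thesis by simp
  next
    case Undirected
    with * srw_Undirected_minus[of "nat \<bar>x\<bar>" x] show ?thesis by (cases "x \<ge> 0") auto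
  qed
qed

text \<open>The position is a sum of \<open>m + 1\<close> exchangeable increments, so its
  contribution on the event of ending at \<open>x\<close> is \<open>m + 1\<close> times that of the
  last increment. The induction verifies this from the one-step recursion.\<close>

lemma srw_stein:
  "x * srw dir (Suc m) x = (m + 1) * (up_prob dir * srw dir m (x - 1) - down_prob dir * srw dir m (x + 1))"
proof (induction m arbitrary: x)
  case 0
  have "x = -1 \<or> x = 1 \<or> (x \<noteq> -1 \<and> x \<noteq> 1)" by blast
  then show ?case by (auto simp: srw_Suc srw_0)
next
  case (Suc m)
  let ?u = "up_prob dir" and ?d = "down_prob dir"
  have "x * srw dir (Suc (Suc m)) x = ?u * (of_int (x - 1) * srw dir (Suc m) (x - 1)) + ?d * (of_int (x + 1) * srw dir (Suc m) (x + 1))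
     + (?u * srw dir (Suc m) (x - 1) - ?d * srw dir (Suc m) (x + 1))"
    by (subst srw_Suc) (simp add: algebra_simps)
  also have "\<dots> = (m + 1) * (?u * (?u * srw dir m (x - 1 - 1) + ?d * srw dir m (x - 1 + 1))
       - ?d * (?u * srw dir m (x + 1 - 1) + ?d * srw dir m (x + 1 + 1)))
     + (?u * srw dir (Suc m) (x - 1) - ?d * srw dir (Suc m) (x + 1))"
    unfolding Suc by (simp add: algebra_simps)
  also have "\<dots> = (Suc m + 1) * (?u * srw dir (Suc m) (x - 1) - ?d * srw dir (Suc m) (x + 1))"
    unfolding srw_Suc[symmetric] by (simp add: algebra_simps)
  finally show ?case by simp
qed

text \<open>For \<open>s \<ge> 0\<close> this is \<open>exp s\<close> times the weight at
  \<open>x\<close>: an everywhere convergent power series, which can be differentiated and reindexed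
  termwise.\<close>

definition xi_series :: "orientation \<Rightarrow> int \<Rightarrow> real \<Rightarrow> real" where
  "xi_series dir x s = (\<Sum>m. srw dir m x / fact m * s ^ m)"

lemma summable_bounded_exp_series:
  assumes "\<And>m. \<bar>c m\<bar> \<le> B"
  shows "summable (\<lambda>m. c m / fact m * (s::real) ^ m)"
proof (rule summable_comparison_test')
  show "summable (\<lambda>m. B * (inverse (fact m) * \<bar>s\<bar> ^ m))"
    by (intro summable_mult summable_exp)
  show "norm (c m / fact m * s ^ m) \<le> B * (inverse (fact m) * \<bar>s\<bar> ^ m)" if "m \<ge> 0" for m
    using mult_right_mono[OF assms[of m], of "inverse (fact m) * \<bar>s\<bar> ^ m"]
    by (simp add: abs_mult power_abs field_simps)
qed

lemma summable_xi_series: "summable (\<lambda>m. srw dir m x / fact m * s ^ m)"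
  by (rule summable_bounded_exp_series[of _ 1]) simp

lemma pmf_xi:
  assumes "s \<ge> 0"
  shows "pmf (xi dir s) x = exp (- s) * xi_series dir x s"
proof -
  have "pmf (xi dir s) x = (\<integral>m. srw dir m x \<partial>measure_pmf (jump_count s))"
    by (simp add: xi_def rate1_walk_kpow pmf_bind srw_def)
  also have "\<dots> = (\<integral>m. pmf (jump_count s) m * srw dir m x \<partial>count_space UNIV)"
    by (subst measure_pmf_eq_density, subst integral_density) auto
  also have "\<dots> = (\<Sum>m. pmf (jump_count s) m * srw dir m x)"
  proof (rule integral_count_space_nat)
    have "summable (\<lambda>m. exp (-s) * (srw dir m x / fact m * s ^ m))"
      by (intro summable_mult summable_xi_series)
    thus "integrable (count_space UNIV) (\<lambda>m. pmf (jump_count s) m * srw dir m x)"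
      using assms by (simp add: integrable_count_space_nat_iff pmf_jump_count abs_mult field_simps)
  qed
  also have "\<dots> = (\<Sum>m. exp (- s) * (srw dir m x / fact m * s ^ m))"
    using assms by (intro suminf_cong) (simp add: pmf_jump_count)
  also have "\<dots> = exp (- s) * xi_series dir x s"
    unfolding xi_series_def by (rule suminf_mult[OF summable_xi_series])
  finally show ?thesis .
qed

lemma xi_series_deriv:
  "(xi_series dir x has_field_derivative
     up_prob dir * xi_series dir (x - 1) s + down_prob dir * xi_series dir (x + 1) s) (at s)"
proof -
  have "((\<lambda>s. \<Sum>m. srw dir m x / fact m * s ^ m) has_field_derivative
     (\<Sum>m. diffs (\<lambda>m. srw dir m x / fact m) m * s ^ m)) (at s)"
    by (rule termdiffs_strong_converges_everywhere) (rule summable_xi_series)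
  also have "(\<lambda>m. diffs (\<lambda>m. srw dir m x / fact m) m * s ^ m) =
     (\<lambda>m. up_prob dir * (srw dir m (x - 1) / fact m * s ^ m) + down_prob dir * (srw dir m (x + 1) / fact m * s ^ m))"
    by (simp add: fun_eq_iff diffs_def srw_Suc field_simps del: of_nat_Suc)
  also have "(\<Sum>m. \<dots> m) = up_prob dir * xi_series dir (x - 1) s + down_prob dir * xi_series dir (x + 1) s"
    unfolding xi_series_def
    by (simp only: suminf_add[symmetric] summable_mult summable_xi_series suminf_mult[symmetric])
  finally show ?thesis by (simp add: xi_series_def[abs_def])
qed

text \<open>Kolmogorov's forward equation: the shifted series gives the two gain terms and the
  factor \<open>exp (- s)\<close> the loss.\<close>

lemma xi_deriv:
  assumes "s > 0"
  shows "((\<lambda>s. pmf (xi dir s) x) has_field_derivative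
     up_prob dir * pmf (xi dir s) (x - 1) + down_prob dir * pmf (xi dir s) (x + 1) - pmf (xi dir s) x) (at s)"
proof -
  have "((\<lambda>s. exp (- s) * xi_series dir x s) has_field_derivative
     up_prob dir * pmf (xi dir s) (x - 1) + down_prob dir * pmf (xi dir s) (x + 1) - pmf (xi dir s) x) (at s)"
    using assms by (auto intro!: derivative_eq_intros xi_series_deriv simp: pmf_xi algebra_simps)
  thus ?thesis
    by (rule has_field_derivative_transform_within_open[where S = "{0<..}"]) (use assms in \<open>auto simp: pmf_xi\<close>)
qed

text \<open>For the directed walk this is the recursion of the Poisson weights, for the undirected one the
  three-term recursion of the Bessel functions \<open>I\<^sub>x(s)\<close>. All local estimates below come from it.\<close>

lemma xi_stein:
  assumes "s \<ge> 0"
  shows "x * pmf (xi dir s) x = s * (up_prob dir * pmf (xi dir s) (x - 1) - down_prob dir * pmf (xi dir s) (x + 1))"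
proof -
  let ?f = "\<lambda>m. real_of_int x * (srw dir m x / fact m * s ^ m)"
  have sm: "summable ?f" by (intro summable_mult summable_xi_series)
  have "x * xi_series dir x s = suminf ?f"
    unfolding xi_series_def by (rule suminf_mult[OF summable_xi_series, symmetric])
  also have "\<dots> = (\<Sum>m. ?f (Suc m)) + ?f 0"
    using suminf_split_head[OF sm] by simp
  also have "?f 0 = 0" by (simp add: srw_0)
  also have "(\<lambda>m. ?f (Suc m)) = (\<lambda>m. s * (up_prob dir * (srw dir m (x - 1) / fact m * s ^ m) - down_prob dir * (srw dir m (x + 1) / fact m * s ^ m)))"
  proof
    fix m
    have "?f (Suc m) = (x * srw dir (Suc m) x) / fact (Suc m) * s ^ Suc m" by simp
    also have "\<dots> = s * (up_prob dir * (srw dir m (x - 1) / fact m * s ^ m) - down_prob dir * (srw dir m (x + 1) / fact m * s ^ m))"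
    proof -
      have "(real m + 1) * y / fact (Suc m) = y / fact m" for y
        by (simp add: divide_simps)
      note this[of "up_prob dir * srw dir m (x - 1) - down_prob dir * srw dir m (x + 1)"]
      thus ?thesis unfolding srw_stein by (simp only:) (simp add: diff_divide_distrib algebra_simps)
    qed
    finally show "?f (Suc m) = s * (up_prob dir * (srw dir m (x - 1) / fact m * s ^ m) - down_prob dir * (srw dir m (x + 1) / fact m * s ^ m))" .
  qed
  also have "suminf \<dots> + 0 = s * (up_prob dir * xi_series dir (x - 1) s - down_prob dir * xi_series dir (x + 1) s)"
    unfolding xi_series_def
    by (simp only: add_0_right)
      (rule sums_unique[symmetric], intro sums_mult sums_diff summable_sums summable_xi_series)
  finally have *: "x * xi_series dir x s = s * (up_prob dir * xi_series dir (x - 1) s - down_prob dir * xi_series dir (x + 1) s)" .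
  have "x * pmf (xi dir s) x = exp (- s) * (x * xi_series dir x s)"
    using assms by (simp add: pmf_xi)
  also have "\<dots> = s * (up_prob dir * pmf (xi dir s) (x - 1) - down_prob dir * pmf (xi dir s) (x + 1))"
    unfolding * using assms by (simp add: pmf_xi algebra_simps)
  finally show ?thesis .
qed

text \<open>Keeps the single term of the series with \<open>\<bar>x\<bar>\<close> jumps. This gives
  positivity on the support and, through the logarithm, the growth bound on the surprisal.\<close>

lemma pmf_xi_ge:
  assumes "s \<ge> 0" "x \<in> walk_support dir"
  shows "pmf (xi dir s) x \<ge> exp (- s) * (s / 2) ^ nat \<bar>x\<bar> / fact (nat \<bar>x\<bar>)"
proof -
  let ?n = "nat \<bar>x\<bar>"
  have "(s / 2) ^ ?n / fact ?n \<le> srw dir ?n x / fact ?n * s ^ ?n"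
    using mult_right_mono[OF srw_ge[OF assms(2)], of "s ^ ?n / fact ?n"] assms(1)
    by (simp add: power_divide)
  also have "\<dots> \<le> xi_series dir x s"
    unfolding xi_series_def using assms(1) sum_le_suminf[OF summable_xi_series, of "{?n}"] by auto
  finally show ?thesis
    using assms(1) mult_left_mono[of "(s / 2) ^ ?n / fact ?n" "xi_series dir x s" "exp (- s)"] by (simp add: pmf_xi)
qed

lemma pmf_xi_pos:
  assumes "s > 0" "x \<in> walk_support dir"
  shows "pmf (xi dir s) x > 0"
proof -
  have "0 < exp (- s) * (s / 2) ^ nat \<bar>x\<bar> / fact (nat \<bar>x\<bar>)" using assms by auto
  with pmf_xi_ge[of s x dir] assms show ?thesis by linarith
qed

lemma pmf_xi_Directed:
  assumes "s \<ge> 0"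
  shows "pmf (xi Directed s) x = (if x \<ge> 0 then s ^ nat x / fact (nat x) * exp (- s) else 0)"
proof -
  have "xi_series Directed x s = (if x \<ge> 0 then s ^ nat x / fact (nat x) else 0)"
  proof (cases "x \<ge> 0")
    case True
    hence "xi_series Directed x s = (\<Sum>m\<in>{nat x}. srw Directed m x / fact m * s ^ m)"
      unfolding xi_series_def by (intro suminf_finite) (auto simp: srw_Directed)
    thus ?thesis using True by (simp add: srw_Directed)
  qed (simp add: xi_series_def srw_Directed)
  thus ?thesis using assms by (simp add: pmf_xi)
qed

lemma pmf_xi_eq_0: "s \<ge> 0 \<Longrightarrow> x \<notin> walk_support dir \<Longrightarrow> pmf (xi dir s) x = 0"
  by (cases dir) (auto simp: pmf_xi_Directed)

lemma set_pmf_xi: "s > 0 \<Longrightarrow> set_pmf (xi dir s) = walk_support dir"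
  using pmf_xi_pos[of s _ dir] pmf_xi_eq_0[of s _ dir] by (force simp: set_pmf_iff)

lemma pmf_xi_Undirected_minus: "s \<ge> 0 \<Longrightarrow> pmf (xi Undirected s) (- x) = pmf (xi Undirected s) x"
  by (simp add: pmf_xi xi_series_def srw_Undirected_minus)

section \<open>Exponential moments and integrability\<close>

text \<open>A step multiplies the exponential moment by \<open>\<phi>\<close>, and averaging
  \<open>\<phi> ^ m\<close> over the Poisson clock gives \<open>exp (s * (\<phi> - 1))\<close>.
  Nonnegative integrals deliver integrability together with the value.\<close>

lemma xi_mgf_nn:
  fixes a :: real
  assumes "s \<ge> 0"
  shows "(\<integral>\<^sup>+x. ennreal (exp (a * x)) \<partial>measure_pmf (xi dir s)) =
    ennreal (exp (s * (up_prob dir * (exp a - 1) + down_prob dir * (exp (- a) - 1))))"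
proof -
  define \<phi> where "\<phi> = up_prob dir * exp a + down_prob dir * exp (- a)"
  have \<phi>: "\<phi> \<ge> 0" by (simp add: \<phi>_def)
  have st: "(\<integral>\<^sup>+y. ennreal (exp (a * y)) \<partial>measure_pmf (step1 dir x)) = ennreal (exp (a * x) * \<phi>)" for x
  proof (cases dir)
    case Undirected
    have "(\<integral>\<^sup>+y. ennreal (exp (a * y)) \<partial>measure_pmf (step1 dir x)) =
       (\<integral>\<^sup>+b. ennreal (exp (a * (if b then x + 1 else x - 1))) \<partial>measure_pmf (bernoulli_pmf (1/2)))"
      using Undirected by (simp add: step1_def)
    also have "\<dots> = ennreal (1/2 * exp (a * (x + 1)) + 1/2 * exp (a * (x - 1)))"
      by (subst nn_integral_eq_integral) (auto intro!: integrable_measure_pmf_finite)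
    finally show ?thesis using Undirected by (simp add: \<phi>_def algebra_simps exp_add exp_diff exp_minus field_simps)
  qed (simp add: step1_def \<phi>_def algebra_simps exp_add)
  have k: "(\<integral>\<^sup>+y. ennreal (exp (a * y)) \<partial>measure_pmf (kpow (step1 dir) m 0)) = ennreal (\<phi> ^ m)" for m
  proof (induction m)
    case (Suc m)
    have "(\<integral>\<^sup>+y. ennreal (exp (a * y)) \<partial>measure_pmf (kpow (step1 dir) (Suc m) 0)) =
       (\<integral>\<^sup>+y. ennreal (exp (a * y)) * ennreal \<phi> \<partial>measure_pmf (kpow (step1 dir) m 0))"
      by (simp add: kpow_Suc st ennreal_mult \<phi>)
    also have "\<dots> = ennreal (\<phi> ^ m) * ennreal \<phi>"
      by (subst nn_integral_multc) (auto simp: Suc)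
    finally show ?case using \<phi> by (simp add: ennreal_mult[symmetric] mult.commute)
  qed simp
  have "(\<integral>\<^sup>+x. ennreal (exp (a * x)) \<partial>measure_pmf (xi dir s)) = (\<integral>\<^sup>+m. ennreal (\<phi> ^ m) \<partial>measure_pmf (jump_count s))"
    by (simp add: xi_def rate1_walk_kpow k)
  also have "\<dots> = (\<Sum>m. ennreal (pmf (jump_count s) m * \<phi> ^ m))"
    by (simp add: nn_integral_measure_pmf nn_integral_count_space_nat ennreal_mult[symmetric] \<phi>)
  also have "\<dots> = ennreal (\<Sum>m. pmf (jump_count s) m * \<phi> ^ m)"
  proof (rule suminf_ennreal2)
    have "(\<lambda>m. exp (- s) * ((s * \<phi>) ^ m /\<^sub>R fact m)) sums (exp (- s) * exp (s * \<phi>))"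
      by (intro sums_mult exp_converges)
    thus "summable (\<lambda>m. pmf (jump_count s) m * \<phi> ^ m)"
      using assms by (simp add: pmf_jump_count sums_iff field_simps power_mult_distrib)
  qed (simp add: \<phi>)
  also have "(\<lambda>m. pmf (jump_count s) m * \<phi> ^ m) = (\<lambda>m. exp (- s) * ((s * \<phi>) ^ m /\<^sub>R fact m))"
    using assms by (simp add: fun_eq_iff pmf_jump_count field_simps power_mult_distrib)
  also have "(\<Sum>m. exp (- s) * ((s * \<phi>) ^ m /\<^sub>R fact m)) = exp (- s) * exp (s * \<phi>)"
    using sums_mult[OF exp_converges[of "s * \<phi>"], of "exp (- s)"] by (simp add: sums_iff)
  also have "exp (- s) * exp (s * \<phi>) = exp (s * (up_prob dir * (exp a - 1) + down_prob dir * (exp (- a) - 1)))"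
  proof -
    have "s * \<phi> - s = s * (\<phi> - (up_prob dir + down_prob dir))"
      by (simp only: up_down_simps right_diff_distrib mult_1_right)
    also have "\<dots> = s * (up_prob dir * (exp a - 1) + down_prob dir * (exp (- a) - 1))"
      unfolding \<phi>_def by (simp add: algebra_simps del: up_down_simps)
    finally show ?thesis by (simp flip: exp_add)
  qed
  finally show ?thesis .
qed

lemma xi_mgf:
  fixes a :: real
  assumes "s \<ge> 0"
  shows "integrable (measure_pmf (xi dir s)) (\<lambda>x. exp (a * x))"
    and "measure_pmf.expectation (xi dir s) (\<lambda>x. exp (a * x)) =
      exp (s * (up_prob dir * (exp a - 1) + down_prob dir * (exp (- a) - 1)))"
  using xi_mgf_nn[OF assms, of dir a]
  by (subst (asm) nn_integral_eq_integrable; simp)+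

text \<open>A class closed under sums, products and shifts, so that integrability under every
  \<open>xi dir s\<close> is settled by the shape of the integrand.\<close>

definition poly_growth :: "(int \<Rightarrow> real) \<Rightarrow> bool" where
  "poly_growth f \<longleftrightarrow> (\<exists>C n. \<forall>x. \<bar>f x\<bar> \<le> C * (1 + \<bar>real_of_int x\<bar>) ^ n)"

lemma poly_growthI: "(\<And>x. \<bar>f x\<bar> \<le> C * (1 + \<bar>real_of_int x\<bar>) ^ n) \<Longrightarrow> poly_growth f"
  by (auto simp: poly_growth_def)

lemma poly_growthE:
  assumes "poly_growth f"
  obtains C n where "C \<ge> 0" "\<And>x. \<bar>f x\<bar> \<le> C * (1 + \<bar>real_of_int x\<bar>) ^ n"
proof -
  obtain C n where *: "\<And>x. \<bar>f x\<bar> \<le> C * (1 + \<bar>real_of_int x\<bar>) ^ n"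
    using assms by (auto simp: poly_growth_def)
  have "C \<ge> 0" using *[of 0] by simp
  with * that show ?thesis by blast
qed

lemma poly_growth_const [intro, simp]: "poly_growth (\<lambda>_. c)"
  by (rule poly_growthI[of _ "\<bar>c\<bar>" 0]) simp

lemma poly_growth_id [intro, simp]: "poly_growth (\<lambda>x. real_of_int x)"
  by (rule poly_growthI[of _ 1 1]) simp

lemma poly_growth_abs: "poly_growth f \<Longrightarrow> poly_growth (\<lambda>x. \<bar>f x\<bar>)"
  by (simp add: poly_growth_def)

lemma poly_growth_le: "poly_growth g \<Longrightarrow> (\<And>x. \<bar>f x\<bar> \<le> \<bar>g x\<bar>) \<Longrightarrow> poly_growth f"
  unfolding poly_growth_def by (meson order_trans)

lemma poly_growth_mult [intro]: assumes "poly_growth f" "poly_growth g" shows "poly_growth (\<lambda>x. f x * g x)"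
proof -
  obtain C n where C: "C \<ge> 0" "\<And>x. \<bar>f x\<bar> \<le> C * (1 + \<bar>real_of_int x\<bar>) ^ n" using poly_growthE[OF assms(1)] by blast
  obtain D m where D: "D \<ge> 0" "\<And>x. \<bar>g x\<bar> \<le> D * (1 + \<bar>real_of_int x\<bar>) ^ m" using poly_growthE[OF assms(2)] by blast
  show ?thesis
  proof (rule poly_growthI)
    fix x show "\<bar>f x * g x\<bar> \<le> (C * D) * (1 + \<bar>real_of_int x\<bar>) ^ (n + m)"
      using mult_mono[OF C(2)[of x] D(2)[of x]] C(1) by (simp add: abs_mult power_add mult_ac)
  qed
qed

lemma poly_growth_add [intro]: assumes "poly_growth f" "poly_growth g" shows "poly_growth (\<lambda>x. f x + g x)"
proof -
  obtain C n where C: "C \<ge> 0" "\<And>x. \<bar>f x\<bar> \<le> C * (1 + \<bar>real_of_int x\<bar>) ^ n" using poly_growthE[OF assms(1)] by blast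
  obtain D m where D: "D \<ge> 0" "\<And>x. \<bar>g x\<bar> \<le> D * (1 + \<bar>real_of_int x\<bar>) ^ m" using poly_growthE[OF assms(2)] by blast
  show ?thesis
  proof (rule poly_growthI)
    fix x
    have "C * (1 + \<bar>real_of_int x\<bar>) ^ n \<le> C * (1 + \<bar>real_of_int x\<bar>) ^ (n + m)"
      "D * (1 + \<bar>real_of_int x\<bar>) ^ m \<le> D * (1 + \<bar>real_of_int x\<bar>) ^ (n + m)"
      using C D by (auto intro!: mult_left_mono power_increasing)
    with C(2)[of x] D(2)[of x] abs_triangle_ineq[of "f x" "g x"] show "\<bar>f x + g x\<bar> \<le> (C + D) * (1 + \<bar>real_of_int x\<bar>) ^ (n + m)"
      by (simp add: algebra_simps)
  qed
qed

lemma poly_growth_minus [intro]: "poly_growth f \<Longrightarrow> poly_growth (\<lambda>x. - f x)"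
  by (simp add: poly_growth_def)

lemma poly_growth_diff [intro]: "poly_growth f \<Longrightarrow> poly_growth g \<Longrightarrow> poly_growth (\<lambda>x. f x - g x)"
  using poly_growth_add[of f "\<lambda>x. - g x"] by auto

lemma poly_growth_power [intro]: "poly_growth f \<Longrightarrow> poly_growth (\<lambda>x. f x ^ n)"
  by (induction n) auto

lemma poly_growth_shift [intro]: assumes "poly_growth f" shows "poly_growth (\<lambda>x. f (x + c))"
proof -
  obtain C n where C: "C \<ge> 0" "\<And>x. \<bar>f x\<bar> \<le> C * (1 + \<bar>real_of_int x\<bar>) ^ n" using poly_growthE[OF assms(1)] by blast
  show ?thesis
  proof (rule poly_growthI)
    fix x
    have "1 + \<bar>real_of_int (x + c)\<bar> \<le> (1 + \<bar>real_of_int c\<bar>) * (1 + \<bar>real_of_int x\<bar>)"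
    proof -
      have "\<bar>real_of_int (x + c)\<bar> \<le> \<bar>real_of_int x\<bar> + \<bar>real_of_int c\<bar>" by simp
      moreover have "0 \<le> \<bar>real_of_int c\<bar> * \<bar>real_of_int x\<bar>" by simp
      ultimately show ?thesis unfolding distrib_left distrib_right by linarith
    qed
    hence "C * (1 + \<bar>real_of_int (x + c)\<bar>) ^ n \<le> C * ((1 + \<bar>real_of_int c\<bar>) * (1 + \<bar>real_of_int x\<bar>)) ^ n"
      using C by (intro mult_left_mono power_mono) auto
    with C(2)[of "x + c"]
    show "\<bar>f (x + c)\<bar> \<le> (C * (1 + \<bar>real_of_int c\<bar>) ^ n) * (1 + \<bar>real_of_int x\<bar>) ^ n"
      by (simp add: power_mult_distrib mult_ac)
  qed
qed

lemma power_le_fact_exp: "(y::real) \<ge> 0 \<Longrightarrow> y ^ n \<le> fact n * exp y"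
proof -
  assume y: "y \<ge> 0"
  have "(\<Sum>k\<in>{n}. y ^ k /\<^sub>R fact k) \<le> (\<Sum>k. y ^ k /\<^sub>R fact k)"
    by (rule sum_le_suminf) (use y summable_exp_generic[of y] in auto)
  also have "\<dots> = exp y" by (simp add: exp_def)
  finally show ?thesis by (simp add: field_simps)
qed

lemma poly_growth_exp_bound:
  assumes "poly_growth f"
  obtains C where "C \<ge> 0" "\<And>x. \<bar>f x\<bar> \<le> C * exp \<bar>real_of_int x\<bar>"
proof -
  obtain C n where C: "C \<ge> 0" "\<And>x. \<bar>f x\<bar> \<le> C * (1 + \<bar>real_of_int x\<bar>) ^ n" using poly_growthE[OF assms(1)] by blast
  show thesis
  proof (rule that[of "C * (fact n * exp 1)"])
    fix x
    have "C * (1 + \<bar>real_of_int x\<bar>) ^ n \<le> C * (fact n * exp (1 + \<bar>real_of_int x\<bar>))"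
      using C by (intro mult_left_mono power_le_fact_exp) auto
    with C(2)[of x] show "\<bar>f x\<bar> \<le> C * (fact n * exp 1) * exp \<bar>real_of_int x\<bar>"
      by (simp add: exp_add mult_ac)
  qed (use C in auto)
qed

lemma exp_abs_le: "exp \<bar>y::real\<bar> \<le> exp y + exp (- y)"
  by (cases "y \<ge> 0") auto

lemma integrable_xi_exp_abs:
  fixes a :: real
  assumes "s \<ge> 0" "a \<ge> 0"
  shows "integrable (measure_pmf (xi dir s)) (\<lambda>x. exp (a * \<bar>real_of_int x\<bar>))"
proof (rule Bochner_Integration.integrable_bound)
  show "integrable (measure_pmf (xi dir s)) (\<lambda>x. exp (a * x) + exp (- a * x))"
    using assms xi_mgf(1)[of s dir a] xi_mgf(1)[of s dir "- a"] by (intro Bochner_Integration.integrable_add) auto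
  show "AE x in measure_pmf (xi dir s). norm (exp (a * \<bar>real_of_int x\<bar>)) \<le> norm (exp (a * x) + exp (- a * x))"
    using assms exp_abs_le[of "a * _"] by (auto simp: abs_mult intro!: AE_I2)
qed simp

lemma integrable_xi [intro, simp]:
  assumes "s \<ge> 0" "poly_growth f"
  shows "integrable (measure_pmf (xi dir s)) f"
proof -
  obtain C where C: "C \<ge> 0" "\<And>x. \<bar>f x\<bar> \<le> C * exp \<bar>real_of_int x\<bar>"
    using poly_growth_exp_bound[OF assms(2)] by blast
  show ?thesis
  proof (rule Bochner_Integration.integrable_bound)
    show "integrable (measure_pmf (xi dir s)) (\<lambda>x. C * exp (1 * \<bar>real_of_int x\<bar>))"
      using assms by (intro integrable_mult_right integrable_xi_exp_abs) auto
    show "AE x in measure_pmf (xi dir s). norm (f x) \<le> norm (C * exp (1 * \<bar>real_of_int x\<bar>))"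
      using C by (intro AE_I2) auto
  qed simp
qed

lemma expectation_int_count_space:
  fixes f :: "int \<Rightarrow> real"
  shows "measure_pmf.expectation p f = (\<integral>x. pmf p x * f x \<partial>count_space UNIV)"
    "integrable (measure_pmf p) f \<longleftrightarrow> integrable (count_space UNIV) (\<lambda>x. pmf p x * f x)"
  using integral_density[of f "count_space UNIV" "pmf p"] integrable_density[of f "count_space UNIV" "pmf p"]
  by (simp_all add: measure_pmf_eq_density[symmetric])

lemma integral_shift_int:
  fixes f :: "int \<Rightarrow> real"
  shows "(\<integral>x. f (x + c) \<partial>count_space UNIV) = (\<integral>x. f x \<partial>count_space UNIV)"
    "integrable (count_space UNIV) (\<lambda>x. f (x + c)) \<longleftrightarrow> integrable (count_space UNIV) f"
proof -
  have "bij (\<lambda>x::int. x + c)" by (rule bij_plus_right)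
  thus "(\<integral>x. f (x + c) \<partial>count_space UNIV) = (\<integral>x. f x \<partial>count_space UNIV)"
    "integrable (count_space UNIV) (\<lambda>x. f (x + c)) \<longleftrightarrow> integrable (count_space UNIV) f"
    using integral_bij_count_space[of "\<lambda>x. x + c" UNIV UNIV f] integrable_bij_count_space[of "\<lambda>x. x + c" UNIV UNIV f]
    by simp_all
qed

lemma integrable_xi_count:
  assumes "s \<ge> 0" "poly_growth f"
  shows "integrable (count_space UNIV) (\<lambda>x. pmf (xi dir s) (x + c) * f x)"
proof -
  have "integrable (count_space UNIV) (\<lambda>x. pmf (xi dir s) (x + c) * f (x + c + - c))"
    using assms integral_shift_int(2)[of "\<lambda>x. pmf (xi dir s) x * f (x + - c)" c]
      expectation_int_count_space(2)[of "xi dir s" "\<lambda>x. f (x + - c)"] integrable_xi[OF assms(1) poly_growth_shift[OF assms(2), of "-c"], of dir]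
    by simp
  thus ?thesis by simp
qed

lemma expectation_xi_shift:
  "(\<integral>x. pmf (xi dir s) (x + c) * f x \<partial>count_space UNIV) = measure_pmf.expectation (xi dir s) (\<lambda>x. f (x - c))"
  using integral_shift_int(1)[of "\<lambda>x. pmf (xi dir s) x * f (x - c)" c]
  by (simp add: expectation_int_count_space)

text \<open>The recursion summed against \<open>f\<close>; translating the sum moves the shifts from
  the law to \<open>f\<close>. The central moments are derived from it.\<close>

lemma xi_stein_expectation:
  fixes f :: "int \<Rightarrow> real"
  assumes "s \<ge> 0" "poly_growth f"
  shows "measure_pmf.expectation (xi dir s) (\<lambda>x. real_of_int x * f x) =
    s * (up_prob dir * measure_pmf.expectation (xi dir s) (\<lambda>x. f (x + 1))
      - down_prob dir * measure_pmf.expectation (xi dir s) (\<lambda>x. f (x - 1)))"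
proof -
  note int = integrable_xi_count[OF assms, of dir]
  have "measure_pmf.expectation (xi dir s) (\<lambda>x. real_of_int x * f x) = (\<integral>x. (x * pmf (xi dir s) x) * f x \<partial>count_space UNIV)"
    by (simp add: expectation_int_count_space mult_ac)
  also have "\<dots> = (\<integral>x. s * (up_prob dir * (pmf (xi dir s) (x + -1) * f x) - down_prob dir * (pmf (xi dir s) (x + 1) * f x)) \<partial>count_space UNIV)"
    unfolding xi_stein[OF assms(1)] by (simp add: algebra_simps)
  also have "\<dots> = s * (up_prob dir * (\<integral>x. pmf (xi dir s) (x + -1) * f x \<partial>count_space UNIV) - down_prob dir * (\<integral>x. pmf (xi dir s) (x + 1) * f x \<partial>count_space UNIV))"
    using int[of "-1"] int[of 1] by (subst integral_mult_right_zero, subst Bochner_Integration.integral_diff) (auto)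
  finally show ?thesis
    unfolding expectation_xi_shift by simp
qed

section \<open>Unimodality\<close>

text \<open>If monotonicity failed somewhere, the recursion would propagate jumps larger than \<open>c\<close>
  arbitrarily far out, although \<open>r\<close> tends to 0.\<close>

lemma ratio_recursion_antimono:
  fixes r :: "int \<Rightarrow> real" and c :: real
  assumes c: "c > 0" and pos: "\<And>x. r x > 0" and rec: "\<And>x. 1 / r x = r (x + 1) + c * (x + 1)"
    and x: "x \<ge> -1"
  shows "r (x + 1) \<le> r x"
proof (rule ccontr)
  define \<delta> where "\<delta> y = r y - r (y + 1)" for y
  assume "\<not> r (x + 1) \<le> r x"
  hence neg: "\<delta> x < 0" by (simp add: \<delta>_def)
  have \<delta>: "\<delta> y = r y * r (y + 1) * (c - \<delta> (y + 1))" for y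
  proof -
    have "\<delta> y = r y * r (y + 1) * (1 / r (y + 1) - 1 / r y)"
      using pos[of y] pos[of "y + 1"] by (simp add: \<delta>_def field_simps)
    also have "1 / r (y + 1) - 1 / r y = c - \<delta> (y + 1)"
      unfolding rec by (simp add: \<delta>_def algebra_simps)
    finally show ?thesis .
  qed
  have s1: "\<delta> (y + 1) > c" if "\<delta> y < 0" for y
  proof -
    have "0 < r y * r (y + 1)" using pos by simp
    with that \<delta>[of y] have "c - \<delta> (y + 1) < 0" by (metis mult_pos_pos not_less_iff_gr_or_eq mult_eq_0_iff)
    thus ?thesis by simp
  qed
  \<comment> \<open>The recursion makes \<open>r y * r (y + 1)\<close> less than 1 here, so a
    nonnegative \<open>\<delta> (y + 1)\<close> would give
    \<open>\<delta> y \<le> c\<close>.\<close>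
  have s2: "\<delta> (y + 1) < 0" if "\<delta> y > c" "y \<ge> 0" for y
  proof -
    have "r y * (r (y + 1) + c * (y + 1)) = 1" using rec[of y] pos[of y] by (simp add: field_simps)
    moreover have "r y * (c * (y + 1)) > 0" using c pos that by simp
    ultimately have lt: "r y * r (y + 1) < 1" by (simp add: algebra_simps)
    have gt: "r y * r (y + 1) > 0" using pos by simp
    show ?thesis
    proof (rule ccontr)
      assume "\<not> \<delta> (y + 1) < 0"
      hence "r y * r (y + 1) * (c - \<delta> (y + 1)) \<le> r y * r (y + 1) * c"
        using gt by (intro mult_left_mono) auto
      also have "\<dots> \<le> 1 * c" using lt c by (intro mult_right_mono) auto
      finally show False using \<delta>[of y] that by simp
    qed
  qed
  have iter: "\<delta> (x + 2 * int j) < 0" for j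
  proof (induction j)
    case (Suc j)
    have "\<delta> (x + 2 * int j + 1 + 1) < 0"
      by (rule s2[OF s1[OF Suc]]) (use x in auto)
    thus ?case by (simp add: algebra_simps)
  qed (use neg in simp)
  \<comment> \<open>A jump at \<open>y\<close> gives \<open>c < r y\<close>, while the recursion
    gives \<open>r y * (c * (y + 1)) < 1\<close>. Together \<open>c\<^sup>2 * (y + 1) < 1\<close>,
    which fails once \<open>j > 1 / c\<^sup>2\<close>.\<close>
  obtain j :: nat where j: "real j > 1 / c\<^sup>2" using reals_Archimedean2 by blast
  define y where "y = x + 2 * int j + 1"
  have y: "real_of_int y \<ge> 2 * real j" using x by (simp add: y_def)
  have "c < \<delta> y" unfolding y_def by (rule s1[OF iter])
  also have "\<dots> < r y" using pos[of "y + 1"] by (simp add: \<delta>_def)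
  finally have "c < r y" .
  moreover have "c * (y + 1) < 1 / r y" using rec[of y] pos[of "y + 1"] by simp
  ultimately have "c * (c * (y + 1)) < r y * (1 / r y)"
    using c y by (intro mult_strict_mono) auto
  hence "c\<^sup>2 * (y + 1) < 1" using pos[of y] by (simp add: power2_eq_square mult_ac)
  moreover have "c\<^sup>2 * (y + 1) \<ge> c\<^sup>2 * real j" using y by (intro mult_left_mono) auto
  moreover have "c\<^sup>2 * real j > 1" using j c by (simp add: field_simps)
  ultimately show False by simp
qed

section \<open>Increments of the surprisal\<close>

text \<open>Off the support the value is 0, because \<open>ln 0 = 0\<close>; estimates of its shape
  are therefore confined to the support.\<close>

definition surprisal :: "orientation \<Rightarrow> real \<Rightarrow> int \<Rightarrow> real" where
  "surprisal dir s x = - ln (pmf (xi dir s) x)"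

text \<open>The function \<open>y - 1 / y\<close> is increasing, and at \<open>1 + u\<close> its
  value \<open>u + u / (1 + u)\<close> is at most \<open>2 * u\<close>.\<close>

lemma diff_inverse_ge_imp:
  fixes y u :: real
  assumes "y > 0" "u \<ge> 0" "y - 1 / y \<ge> 2 * u"
  shows "y \<ge> 1 + u"
proof (rule ccontr)
  assume "\<not> y \<ge> 1 + u"
  hence lt: "y < 1 + u" by simp
  hence "1 / (1 + u) < 1 / y" using assms by (simp add: field_simps)
  hence "y - 1 / y < (1 + u) - 1 / (1 + u)" using lt by linarith
  also have "(1 + u) - 1 / (1 + u) = u + u / (1 + u)" using assms by (simp add: field_simps)
  also have "u / (1 + u) \<le> u" using assms by (simp add: divide_le_eq algebra_simps)
  finally show False using assms(3) by simp
qed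

text \<open>With \<open>u = ln y\<close> the hypothesis reads \<open>sinh u \<le> v\<close>, which
  forces \<open>u \<le> v\<close>. The comparison point \<open>w\<close> is the quadratic Taylor
  polynomial of \<open>exp v\<close>, for which \<open>w - 1 / w \<ge> 2 * v\<close> can be checked
  algebraically.\<close>

lemma diff_inverse_le_imp:
  fixes y v :: real
  assumes "y > 0" "v \<ge> 0" "y - 1 / y \<le> 2 * v"
  shows "y \<le> exp v"
proof -
  define w where "w = 1 + v + v\<^sup>2 / 2"
  have w: "w > 0" "w \<ge> 1" using assms by (auto simp: w_def add_pos_nonneg)
  have "w\<^sup>2 - 1 - 2 * v * w = v ^ 4 / 4"
    unfolding w_def by (simp add: field_simps power2_eq_square power4_eq_xxxx)
  moreover have "v ^ 4 / 4 \<ge> 0" by simp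
  ultimately have "w\<^sup>2 - 1 \<ge> 2 * v * w" by linarith
  hence wv: "w - 1 / w \<ge> 2 * v" using w by (simp add: field_simps power2_eq_square)
  have "y \<le> w"
  proof (rule ccontr)
    assume "\<not> y \<le> w"
    hence lt: "w < y" by simp
    hence "1 / y < 1 / w" using w by (simp add: field_simps)
    thus False using lt wv assms(3) by linarith
  qed
  also have "w \<le> exp v"
    unfolding w_def using exp_lower_Taylor_quadratic[OF assms(2)] by simp
  finally show ?thesis .
qed

text \<open>The ratio \<open>r\<close> of consecutive weights obeys
  \<open>1 / r y = r (y + 1) + 2 / s * (y + 1)\<close>. Its monotonicity allows neighbouring ratios
  to be exchanged in this recursion, at \<open>x - 1\<close> for the lower and at \<open>x\<close>
  for the upper bound, which leaves bounds on \<open>1 / r x - r x\<close> alone; these are then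
  inverted.\<close>

lemma surprisal_step_Undirected:
  fixes x :: int
  assumes s: "s > 0" and x: "x \<ge> 0"
  shows "surprisal Undirected s (x + 1) - surprisal Undirected s x \<ge> ln (1 + x / s)"
    and "surprisal Undirected s (x + 1) - surprisal Undirected s x \<le> (x + 1) / s"
proof -
  define p where "p = pmf (xi Undirected s)"
  define r where "r y = p (y + 1) / p y" for y
  have p: "p y > 0" for y using pmf_xi_pos[of s y Undirected] s by (simp add: p_def)
  have r: "r y > 0" for y using p by (simp add: r_def)
  have rec: "1 / r y = r (y + 1) + 2 / s * (y + 1)" for y
  proof -
    have "(y + 1) * p (y + 1) = s / 2 * (p y - p (y + 2))"
      using xi_stein[of s "y + 1" Undirected] s by (simp add: p_def algebra_simps)
    thus ?thesis using s p[of y] p[of "y + 1"] by (simp add: r_def field_simps)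
  qed
  have anti: "r (y + 1) \<le> r y" if "y \<ge> -1" for y
    by (rule ratio_recursion_antimono[of "2 / s"]) (use s r rec that in auto)
  have e: "surprisal Undirected s (x + 1) - surprisal Undirected s x = ln (1 / r x)"
    using p[of x] p[of "x + 1"] by (simp add: surprisal_def r_def ln_div flip: p_def)
  have y: "1 / r x > 0" using r by simp
  have "1 / r x \<ge> 1 / r (x - 1)" using anti[of "x - 1"] x r[of x] r[of "x - 1"]
    by (simp add: frac_le)
  hence "1 / r x - 1 / (1 / r x) \<ge> 2 * (x / s)" using rec[of "x - 1"] by simp
  hence "1 / r x \<ge> 1 + x / s" using y s x by (intro diff_inverse_ge_imp) auto
  thus "surprisal Undirected s (x + 1) - surprisal Undirected s x \<ge> ln (1 + x / s)"
    unfolding e using s x y by (subst ln_le_cancel_iff) (auto intro!: add_pos_nonneg)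
  have "2 / s * (x + 1) = 2 * ((x + 1) / s)" by simp
  hence "1 / r x - r x \<le> 2 * ((x + 1) / s)" using rec[of x] anti[of x] x by linarith
  hence "1 / r x - 1 / (1 / r x) \<le> 2 * ((x + 1) / s)" by simp
  hence "1 / r x \<le> exp ((x + 1) / s)" using y s x by (intro diff_inverse_le_imp) auto
  thus "surprisal Undirected s (x + 1) - surprisal Undirected s x \<le> (x + 1) / s"
    unfolding e using y ln_le_cancel_iff[of "1 / r x" "exp ((x + 1) / s)"] by simp
qed

lemma surprisal_Undirected_minus: "s \<ge> 0 \<Longrightarrow> surprisal Undirected s (- x) = surprisal Undirected s x"
  by (simp add: surprisal_def pmf_xi_Undirected_minus)

lemma surprisal_step_Directed:
  fixes x :: int
  assumes s: "s > 0" and x: "x \<ge> 0"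
  shows "surprisal Directed s (x + 1) - surprisal Directed s x = ln ((x + 1) / s)"
proof -
  obtain n where n: "x = int n" using x nonneg_int_cases by blast
  have n': "nat (int n + 1) = Suc n" "nat (1 + int n) = Suc n" by simp_all
  have "pmf (xi Directed s) (x + 1) * ((x + 1) / s) = pmf (xi Directed s) x"
    using s by (simp add: pmf_xi_Directed n n' add_nonneg_nonneg) (simp add: divide_simps)
  moreover have "pmf (xi Directed s) (x + 1) > 0" "(x + 1) / s > 0"
    using pmf_xi_pos[of s _ Directed] s x by simp_all
  ultimately have "ln (pmf (xi Directed s) x) = ln (pmf (xi Directed s) (x + 1)) + ln ((x + 1) / s)"
    by (subst ln_mult_pos[symmetric]) simp_all
  thus ?thesis by (simp add: surprisal_def)
qed

definition mode :: "orientation \<Rightarrow> real \<Rightarrow> int" where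
  "mode dir s = (case dir of Directed \<Rightarrow> \<lfloor>s\<rfloor> | Undirected \<Rightarrow> 0)"

definition drift :: "orientation \<Rightarrow> real \<Rightarrow> real" where
  "drift dir s = s * (up_prob dir - down_prob dir)"

lemma drift_simps [simp]: "drift Directed s = s" "drift Undirected s = 0"
  by (simp_all add: drift_def)

lemma mode_in_support: "s \<ge> 0 \<Longrightarrow> mode dir s \<in> walk_support dir"
  by (cases dir) (auto simp: mode_def)

lemma mode_drift: "s \<ge> 0 \<Longrightarrow> \<bar>mode dir s - drift dir s\<bar> \<le> 1"
  by (cases dir) (auto simp: mode_def, linarith)

text \<open>One form of bound for both orientations: the Poisson ratio is exact and only the floor
  in the mode has to be absorbed, while the undirected case is the ratio recursion.\<close>

lemma surprisal_step_right_aux: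
  assumes s: "s > 0"
  shows "surprisal dir s (mode dir s + int j + 1) - surprisal dir s (mode dir s + int j) \<ge> ln (1 + j / s) \<and>
     surprisal dir s (mode dir s + int j + 1) - surprisal dir s (mode dir s + int j) \<le> (j + 1) / s"
proof -
  have ?thesis if "dir = Directed"
  proof -
    have e: "surprisal dir s (mode dir s + int j + 1) - surprisal dir s (mode dir s + int j) = ln ((\<lfloor>s\<rfloor> + j + 1) / s)"
      using surprisal_step_Directed[of s "\<lfloor>s\<rfloor> + int j"] s that by (simp add: mode_def)
    have b: "\<lfloor>s\<rfloor> + j + 1 > s + j" "\<lfloor>s\<rfloor> + j + 1 \<le> s + j + 1" by linarith+
    have a: "(\<lfloor>s\<rfloor> + j + 1) / s \<ge> 1 + j / s" "(\<lfloor>s\<rfloor> + j + 1) / s \<le> 1 + (real j + 1) / s"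
    proof -
      have e: "1 + j / s = (s + j) / s" "1 + (real j + 1) / s = (s + j + 1) / s"
        using s by (simp_all add: add_divide_distrib)
      from b show "(\<lfloor>s\<rfloor> + j + 1) / s \<ge> 1 + j / s" "(\<lfloor>s\<rfloor> + j + 1) / s \<le> 1 + (real j + 1) / s"
        unfolding e using s by (intro divide_right_mono; simp)+
    qed
    have "1 + j / s > 0" using s by (intro add_pos_nonneg) auto
    with a have "ln (1 + j / s) \<le> ln ((\<lfloor>s\<rfloor> + j + 1) / s)" by (subst ln_le_cancel_iff) linarith+
    moreover have "ln ((\<lfloor>s\<rfloor> + j + 1) / s) \<le> (\<lfloor>s\<rfloor> + j + 1) / s - 1"
      using a \<open>1 + j / s > 0\<close> by (intro ln_le_minus_one) linarith
    ultimately show ?thesis unfolding e using a by auto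
  qed
  moreover have ?thesis if "dir = Undirected"
    using surprisal_step_Undirected[of s "int j"] s that by (simp add: mode_def)
  ultimately show ?thesis by (cases dir; simp)
qed

lemmas surprisal_step_right = surprisal_step_right_aux[THEN conjunct1] surprisal_step_right_aux[THEN conjunct2]

text \<open>Poisson weights fall at least as fast to the left as to the right, since
  \<open>- ln (1 - v) \<ge> v \<ge> ln (1 + v)\<close>; the undirected case is a reflection.\<close>

lemma surprisal_step_left_ge:
  assumes s: "s > 0" and j: "mode dir s - int j - 1 \<in> walk_support dir"
  shows "surprisal dir s (mode dir s - int j - 1) - surprisal dir s (mode dir s - int j) \<ge> ln (1 + j / s)"
proof (cases dir)
  case Directed
  have e: "surprisal dir s (mode dir s - int j - 1) - surprisal dir s (mode dir s - int j) = - ln ((\<lfloor>s\<rfloor> - j) / s)"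
    using surprisal_step_Directed[of s "\<lfloor>s\<rfloor> - int j - 1"] s j Directed by (simp add: mode_def)
  have pos: "(\<lfloor>s\<rfloor> - j) / s > 0" using s j Directed by (simp add: mode_def)
  have "ln ((\<lfloor>s\<rfloor> - j) / s) \<le> (\<lfloor>s\<rfloor> - j) / s - 1" using pos by (rule ln_le_minus_one)
  also have "\<dots> \<le> - (j / s)" using s by (simp add: field_simps)
  also have "\<dots> \<le> - ln (1 + j / s)" using s ln_add_one_self_le_self[of "j / s"] by simp
  finally show ?thesis unfolding e by simp
next
  case Undirected
  have "surprisal dir s (mode dir s - int j - 1) = surprisal dir s (int j + 1)"
    "surprisal dir s (mode dir s - int j) = surprisal dir s (int j)"
    using surprisal_Undirected_minus[of s "int j + 1"] surprisal_Undirected_minus[of s "int j"] s Undirected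
    by (simp_all add: mode_def)
  with surprisal_step_right(1)[OF s, of j dir] Undirected show ?thesis by (simp add: mode_def)
qed

lemma pmf_xi_right_antimono:
  assumes s: "s > 0"
  shows "pmf (xi dir s) (mode dir s + int j + 1) \<le> pmf (xi dir s) (mode dir s + int j)"
proof -
  have "mode dir s + int i \<in> walk_support dir" for i
    using mode_in_support[of s dir] s by (cases dir) auto
  from this[of j] this[of "j + 1"] have "pmf (xi dir s) (mode dir s + int j) > 0" "pmf (xi dir s) (mode dir s + int j + 1) > 0"
    using pmf_xi_pos[OF s, of _ dir] by (auto simp: add_ac)
  moreover have "surprisal dir s (mode dir s + int j + 1) - surprisal dir s (mode dir s + int j) \<ge> 0"
    using surprisal_step_right(1)[OF s, of j dir] s by (smt (verit) ln_ge_zero divide_nonneg_pos of_nat_0_le_iff)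
  ultimately show ?thesis by (simp add: surprisal_def)
qed

lemma pmf_xi_left_antimono:
  assumes s: "s > 0"
  shows "pmf (xi dir s) (mode dir s - int j - 1) \<le> pmf (xi dir s) (mode dir s - int j)"
proof (cases "mode dir s - int j - 1 \<in> walk_support dir")
  case True
  hence "mode dir s - int j \<in> walk_support dir" by (cases dir) auto
  with True have "pmf (xi dir s) (mode dir s - int j) > 0" "pmf (xi dir s) (mode dir s - int j - 1) > 0"
    using pmf_xi_pos[OF s, of _ dir] by auto
  moreover have "surprisal dir s (mode dir s - int j - 1) - surprisal dir s (mode dir s - int j) \<ge> 0"
    using surprisal_step_left_ge[OF s True] s by (smt (verit) ln_ge_zero divide_nonneg_pos of_nat_0_le_iff)
  ultimately show ?thesis by (simp add: surprisal_def)
qed (use s in \<open>simp add: pmf_xi_eq_0\<close>)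

lemma pmf_xi_antimono:
  assumes s: "s > 0" and xy: "mode dir s \<le> x" "x \<le> y"
  shows "pmf (xi dir s) y \<le> pmf (xi dir s) x"
proof -
  have "pmf (xi dir s) (mode dir s + int (i + n)) \<le> pmf (xi dir s) (mode dir s + int i)" for i n
  proof (induction n)
    case (Suc n)
    with pmf_xi_right_antimono[OF s, of dir "i + n"] show ?case by (simp add: add_ac)
  qed simp
  from this[of "nat (x - mode dir s)" "nat (y - x)"] xy show ?thesis by simp
qed

lemma pmf_xi_mono:
  assumes s: "s > 0" and xy: "x \<le> y" "y \<le> mode dir s"
  shows "pmf (xi dir s) x \<le> pmf (xi dir s) y"
proof -
  have "pmf (xi dir s) (mode dir s - int (i + n)) \<le> pmf (xi dir s) (mode dir s - int i)" for i n
  proof (induction n)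
    case (Suc n)
    with pmf_xi_left_antimono[OF s, of dir "i + n"] show ?case by (simp add: algebra_simps)
  qed simp
  from this[of "nat (mode dir s - y)" "nat (y - x)"] xy show ?thesis by simp
qed

lemma pmf_xi_le_mode:
  assumes s: "s > 0"
  shows "pmf (xi dir s) x \<le> pmf (xi dir s) (mode dir s)"
  using pmf_xi_antimono[OF s, of dir "mode dir s" x] pmf_xi_mono[OF s, of x "mode dir s" dir] by linarith

lemma surprisal_right_le:
  assumes s: "s > 0"
  shows "surprisal dir s (mode dir s + int j) - surprisal dir s (mode dir s) \<le> real j * (real j + 1) / (2 * s)"
proof (induction j)
  case (Suc j)
  have "real (Suc j) * (real (Suc j) + 1) / (2 * s) = real j * (real j + 1) / (2 * s) + (j + 1) / s"
    using s by (simp add: field_simps)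
  with Suc surprisal_step_right(2)[OF s, of dir j] show ?case by (simp add: add_ac)
qed simp

text \<open>Over about \<open>sqrt s\<close> points to the right of the mode the surprisal grows by
  at most \<open>11/20 < ln 2\<close>, so each of these points has at least half the weight of the
  mode, and their total weight is at most 1.\<close>

lemma pmf_xi_mode_le:
  assumes s: "s \<ge> 100"
  shows "pmf (xi dir s) (mode dir s) \<le> 2 / sqrt s"
proof -
  define J where "J = nat \<lfloor>sqrt s\<rfloor>"
  define p where "p = pmf (xi dir s)"
  define M where "M = mode dir s"
  have s0: "s > 0" and s10: "sqrt s \<ge> 10" using s real_sqrt_le_mono[of 100 s] by auto
  have J: "real J \<le> sqrt s" "real J + 1 > sqrt s" using s10 by (auto simp: J_def) linarith+
  have sup: "M + int i \<in> walk_support dir" for i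
    using mode_in_support[of s dir] s by (cases dir) (auto simp: M_def)
  have pos: "p (M + int i) > 0" for i using pmf_xi_pos[OF s0 sup] by (simp add: p_def)
  have low: "p (M + int j) \<ge> p M / 2" if "j \<le> J" for j
  proof -
    have "real j * (real j + 1) / (2 * s) \<le> sqrt s * (sqrt s + 1) / (2 * s)"
      using J that s0 by (intro divide_right_mono mult_mono) auto
    also have "sqrt s * (sqrt s + 1) = s + sqrt s" using s0 by (simp add: algebra_simps)
    also have "(s + sqrt s) / (2 * s) = 1/2 + 1 / (2 * sqrt s)"
      using s0 by (simp add: field_simps)
    also have "1 / (2 * sqrt s) \<le> 1 / 20" using s10 s0 by (intro divide_left_mono) auto
    finally have a: "real j * (real j + 1) / (2 * s) \<le> 11/20" by simp
    \<comment> \<open>Verifies \<open>11/20 < ln 2\<close> by squaring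
      \<open>exp (- y) \<ge> 1 - y\<close> at \<open>y = 11/40\<close>.\<close>
    have "(1/2::real) \<le> (1 - 11/40)^2" by (simp add: power2_eq_square)
    also have "\<dots> \<le> (exp (- (11/40)))^2" using exp_ge_add_one_self[of "- (11/40)"] by (intro power_mono) auto
    also have "\<dots> = exp (- (11/20::real))" by (simp flip: exp_of_nat_mult)
    finally have half: "(1/2::real) \<le> exp (- (11/20))" .
    have "ln (p M) - ln (p (M + int j)) \<le> 11/20"
      using surprisal_right_le[OF s0, of dir j] a by (simp add: surprisal_def p_def M_def)
    hence "ln (p M) - 11/20 \<le> ln (p (M + int j))" by simp
    hence "exp (ln (p M) - 11/20) \<le> p (M + int j)" using pos[of j] by (metis exp_le_cancel_iff exp_ln)
    also have "exp (ln (p M) - 11/20) = p M * exp (- (11/20))"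
      unfolding diff_conv_add_uminus exp_add using pos[of 0] by simp
    finally have "p M * exp (- (11/20)) \<le> p (M + int j)" .
    moreover have "p M * (1/2) \<le> p M * exp (- (11/20))"
      using half pos[of 0] by (intro mult_left_mono) auto
    ultimately show ?thesis by linarith
  qed
  have "(J + 1) * (p M / 2) = (\<Sum>j\<le>J. p M / 2)" by simp
  also have "\<dots> \<le> (\<Sum>j\<le>J. p (M + int j))" using low by (intro sum_mono) auto
  also have "\<dots> = (\<Sum>x\<in>(\<lambda>j. M + int j) ` {..J}. p x)"
    by (subst sum.reindex) (auto simp: inj_on_def)
  also have "\<dots> = measure_pmf.prob (xi dir s) ((\<lambda>j. M + int j) ` {..J})"
    by (simp add: measure_measure_pmf_finite p_def)
  also have "\<dots> \<le> 1" by simp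
  finally have "(J + 1) * (p M / 2) \<le> 1" .
  moreover have "sqrt s * (p M / 2) \<le> (J + 1) * (p M / 2)"
    using J pos[of 0] by (intro mult_right_mono) auto
  ultimately have "sqrt s * (p M / 2) \<le> 1" by linarith
  moreover have "sqrt s > 0" using s10 by linarith
  ultimately show ?thesis by (simp add: pos_le_divide_eq mult.commute p_def M_def)
qed

lemma pmf_xi_le:
  assumes s: "s \<ge> 100"
  shows "pmf (xi dir s) x \<le> 2 / sqrt s"
  using pmf_xi_le_mode[of s dir x] pmf_xi_mode_le[OF s, of dir] s by linarith

text \<open>A unimodal law is nearly equidistributed over residue classes: two classes differ in mass by at
  most the height of the mode, since the differences telescope on either side of it.\<close>

lemma prob_xi_cong_shift_le:
  fixes g i :: int
  assumes s: "s > 0" and g: "g > 0" and i: "0 \<le> i" "i < g"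
  shows "measure_pmf.prob (xi dir s) {x. g dvd x - c} \<le>
    measure_pmf.prob (xi dir s) {x. g dvd x - (c + i)} + pmf (xi dir s) (mode dir s)"
proof -
  define p where "p = pmf (xi dir s)"
  define M where "M = mode dir s"
  \<comment> \<open>The least antitone majorant of \<open>p\<close>: constant at the height of the
    mode on the left, equal to \<open>p\<close> on the right.\<close>
  define F where "F y = p (max y M)" for y
  define y where "y J n = c + (int n - int J) * g" for J n :: nat
  have Fanti: "F b \<le> F a" if "a \<le> b" for a b
    unfolding F_def p_def using that s by (intro pmf_xi_antimono) (auto simp: M_def)
  have Fge: "p a \<le> F a" for a
    unfolding F_def p_def using s pmf_xi_mono[OF s, of a M dir] by (cases "a \<le> M") (auto simp: M_def max_def)
  have Fle: "F a \<le> p M" and F0: "F a \<ge> 0" for a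
    unfolding F_def p_def M_def using pmf_xi_le_mode[OF s] by auto
  \<comment> \<open>If \<open>a + i\<close> is not past the mode, the left side is nonpositive by
    monotonicity. Otherwise \<open>a + i < a + g\<close> puts \<open>F (a + g)\<close> below
    \<open>p (a + i)\<close>.\<close>
  have key: "p a - p (a + i) \<le> F a - F (a + g)" for a
  proof (cases "a + i \<le> M")
    case True
    hence "p a \<le> p (a + i)" unfolding p_def using i s by (intro pmf_xi_mono) (auto simp: M_def)
    thus ?thesis using Fanti[of a "a + g"] g by simp
  next
    case False
    hence "F (a + g) \<le> p (a + i)" unfolding F_def p_def using i s by (intro pmf_xi_antimono) (auto simp: M_def)
    thus ?thesis using Fge[of a] by simp
  qed
  define A where "A J = y J ` {..<2 * J}" for J
  have inj: "inj_on (y J) {..<2 * J}" for J using g by (auto simp: inj_on_def y_def)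
  have bound: "measure_pmf.prob (xi dir s) (A J) \<le> measure_pmf.prob (xi dir s) {x. g dvd x - (c + i)} + p M" for J
  proof -
    have "(\<Sum>n<2*J. p (y J n) - p (y J n + i)) \<le> (\<Sum>n<2*J. F (y J n) - F (y J (Suc n)))"
    proof (intro sum_mono)
      fix n
      have "y J (Suc n) = y J n + g" by (simp add: y_def algebra_simps)
      thus "p (y J n) - p (y J n + i) \<le> F (y J n) - F (y J (Suc n))" using key by simp
    qed
    also have "\<dots> = F (y J 0) - F (y J (2 * J))" by (rule sum_lessThan_telescope')
    also have "\<dots> \<le> p M" using Fle[of "y J 0"] F0[of "y J (2 * J)"] by linarith
    finally have "(\<Sum>n<2*J. p (y J n)) \<le> (\<Sum>n<2*J. p (y J n + i)) + p M" by (simp add: sum_subtractf)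
    moreover have "(\<Sum>n<2*J. p (y J n)) = measure_pmf.prob (xi dir s) (A J)"
      unfolding A_def by (subst measure_measure_pmf_finite) (auto simp: sum.reindex[OF inj] p_def)
    moreover have "(\<Sum>n<2*J. p (y J n + i)) = measure_pmf.prob (xi dir s) ((\<lambda>n. y J n + i) ` {..<2 * J})"
    proof (subst measure_measure_pmf_finite)
      have "inj_on (\<lambda>n. y J n + i) {..<2 * J}" using inj[of J] by (auto simp: inj_on_def)
      thus "(\<Sum>n<2*J. p (y J n + i)) = sum (pmf (xi dir s)) ((\<lambda>n. y J n + i) ` {..<2 * J})"
        by (simp add: sum.reindex p_def)
    qed simp
    moreover have "\<dots> \<le> measure_pmf.prob (xi dir s) {x. g dvd x - (c + i)}"
      by (intro measure_pmf.finite_measure_mono) (auto simp: y_def)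
    ultimately show ?thesis by linarith
  qed
  have "incseq A"
  proof (rule incseq_SucI, rule subsetI)
    fix J x assume "x \<in> A J"
    then obtain n where "n < 2 * J" "x = y J n" by (auto simp: A_def)
    \<comment> \<open>Enlarging the window moves its left end down by one multiple of
      \<open>g\<close>, hence the shifted index.\<close>
    hence "x = y (Suc J) (Suc n)" "Suc n < 2 * Suc J" by (auto simp: y_def)
    thus "x \<in> A (Suc J)" by (auto simp: A_def)
  qed
  hence "(\<lambda>J. measure_pmf.prob (xi dir s) (A J)) \<longlonglongrightarrow> measure_pmf.prob (xi dir s) (\<Union>J. A J)"
    by (intro measure_pmf.finite_Lim_measure_incseq) auto
  also have "(\<Union>J. A J) = {x. g dvd x - c}"
  proof (intro equalityI subsetI)
    fix x assume "x \<in> {x. g dvd x - c}"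
    then obtain m where m: "x = c + m * g" by (auto simp: dvd_def algebra_simps)
    define J where "J = nat (\<bar>m\<bar> + 1)"
    have "x = y J (nat (m + int J))" "nat (m + int J) < 2 * J" by (auto simp: y_def m J_def)
    thus "x \<in> (\<Union>J. A J)" by (auto simp: A_def)
  qed (auto simp: A_def y_def)
  finally show ?thesis
    using bound by (intro LIMSEQ_le_const2[of _ _ "measure_pmf.prob (xi dir s) {x. g dvd x - (c + i)} + pmf (xi dir s) (mode dir s)"])
     (auto simp: p_def M_def)
qed

text \<open>Averages the comparison over the \<open>g\<close> residue classes, which are disjoint
  and so have total mass at most 1.\<close>

lemma prob_xi_cong_le:
  fixes g :: nat
  assumes s: "s > 0" and g: "g > 0"
  shows "measure_pmf.prob (xi dir s) {x. int g dvd x - c} \<le> 1 / g + pmf (xi dir s) (mode dir s)"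
proof -
  let ?P = "measure_pmf.prob (xi dir s)"
  have "g * ?P {x. int g dvd x - c} = (\<Sum>i<g. ?P {x. int g dvd x - c})" by simp
  also have "\<dots> \<le> (\<Sum>i<g. ?P {x. int g dvd x - (c + int i)} + pmf (xi dir s) (mode dir s))"
    using s g by (intro sum_mono prob_xi_cong_shift_le) auto
  also have "\<dots> = ?P (\<Union>i<g. {x. int g dvd x - (c + int i)}) + g * pmf (xi dir s) (mode dir s)"
  proof -
    have "disjoint_family_on (\<lambda>i. {x. int g dvd x - (c + int i)}) {..<g}"
      unfolding disjoint_family_on_def
    proof (intro ballI impI)
      fix i j assume ij: "i \<in> {..<g}" "j \<in> {..<g}" "i \<noteq> j"
      show "{x. int g dvd x - (c + int i)} \<inter> {x. int g dvd x - (c + int j)} = {}"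
      proof (rule ccontr)
        assume "\<not> ?thesis"
        then obtain x where "int g dvd x - (c + int i)" "int g dvd x - (c + int j)" by auto
        from dvd_diff[OF this] have "int g dvd int j - int i" by (simp add: algebra_simps)
        with ij show False using zdvd_imp_le[of "int g" "int j - int i"] zdvd_imp_le[of "int g" "int i - int j"]
          by (cases "i < j") (auto simp: dvd_diff_commute)
      qed
    qed
    thus ?thesis by (subst measure_pmf.finite_measure_finite_Union) (auto simp: sum.distrib)
  qed
  also have "\<dots> \<le> 1 + g * pmf (xi dir s) (mode dir s)" by simp
  finally show ?thesis using g by (simp add: field_simps)
qed

section \<open>Uniform bounds that permit termwise differentiation\<close>

lemma ln_fact_le_square: "ln (fact n :: real) \<le> real n ^ 2"
proof (cases "n = 0")
  case False
  have "(fact n :: real) \<le> real n ^ n" using fact_le_power[of n, where 'a = real] by simp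
  hence "ln (fact n :: real) \<le> ln (real n ^ n)" using False by (subst ln_le_cancel_iff) auto
  also have "\<dots> = real n * ln (real n)" using False by (simp add: ln_realpow)
  also have "\<dots> \<le> real n * real n" using False ln_le_minus_one[of "real n"] by (intro mult_left_mono) auto
  finally show ?thesis by (simp add: power2_eq_square)
qed simp

lemma surprisal_nonneg [simp]: "surprisal dir s x \<ge> 0"
  by (cases "pmf (xi dir s) x = 0") (auto simp: surprisal_def pmf_le_1 ln_le_zero_iff order_less_le)

text \<open>A crude quadratic bound, but uniform for \<open>s\<close> in a compact interval away
  from 0; it dominates the differentiated series.\<close>

lemma surprisal_le:
  assumes "0 < a" "a \<le> s" "s \<le> b"
  shows "surprisal dir s x \<le> (b + \<bar>ln (2 / a)\<bar> + 1) * (1 + \<bar>real_of_int x\<bar>) ^ 2"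
proof (cases "x \<in> walk_support dir")
  case False
  hence "surprisal dir s x = 0" using assms by (simp add: surprisal_def pmf_xi_eq_0)
  thus ?thesis using assms by simp
next
  case True
  define n where "n = nat \<bar>x\<bar>"
  have nx: "real n = \<bar>real_of_int x\<bar>" by (simp add: n_def)
  have s: "s > 0" using assms by simp
  have low: "exp (- s) * (s / 2) ^ n / fact n \<le> pmf (xi dir s) x"
    using pmf_xi_ge[of s x dir] True s by (simp add: n_def)
  have "0 < exp (- s) * (s / 2) ^ n / fact n" using s by simp
  hence "ln (exp (- s) * (s / 2) ^ n / fact n) \<le> ln (pmf (xi dir s) x)"
    using low by (subst ln_le_cancel_iff) linarith+
  moreover have "ln (exp (- s) * (s / 2) ^ n / fact n) = - s + real n * ln (s / 2) - ln (fact n)"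
    using s by (simp add: ln_mult_pos ln_div ln_realpow)
  ultimately have "surprisal dir s x \<le> s + real n * ln (2 / s) + ln (fact n)"
    using s by (simp add: surprisal_def ln_div algebra_simps)
  also have "ln (2 / s) \<le> ln (2 / a)" using assms by (subst ln_le_cancel_iff) (auto intro!: divide_left_mono)
  also have "ln (2 / a) \<le> \<bar>ln (2 / a)\<bar>" by simp
  finally have "surprisal dir s x \<le> b + real n * \<bar>ln (2 / a)\<bar> + real n ^ 2"
    using ln_fact_le_square[of n] assms mult_left_mono by (fastforce intro: add_mono)
  also have "\<dots> \<le> b * (1 + real n) ^ 2 + (1 + real n) ^ 2 * \<bar>ln (2 / a)\<bar> + (1 + real n) ^ 2"
  proof -
    have 1: "1 \<le> (1 + real n) ^ 2" by simp
    have 2: "real n \<le> (1 + real n) ^ 2" by (simp add: power2_eq_square algebra_simps)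
    have "b * 1 \<le> b * (1 + real n) ^ 2" using 1 assms by (intro mult_left_mono) auto
    moreover have "real n * \<bar>ln (2 / a)\<bar> \<le> (1 + real n) ^ 2 * \<bar>ln (2 / a)\<bar>" using 2 by (intro mult_right_mono) auto
    moreover have "real n ^ 2 \<le> (1 + real n) ^ 2" by (intro power_mono) auto
    ultimately show ?thesis by linarith
  qed
  finally show ?thesis unfolding nx by (simp add: algebra_simps)
qed

lemma poly_growth_surprisal [intro, simp]: "s > 0 \<Longrightarrow> poly_growth (surprisal dir s)"
  by (rule poly_growthI[of _ "s + \<bar>ln (2 / s)\<bar> + 1" 2]) (use surprisal_le[of s s s dir] in simp)

text \<open>Chernoff's bound at exponents 2 and -2. Rate 2 leaves a summable
  \<open>exp (- \<bar>x\<bar>)\<close> after the polynomial factors have been absorbed into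
  \<open>exp \<bar>x\<bar>\<close>.\<close>

lemma pmf_xi_exp_le:
  assumes "0 \<le> s" "s \<le> b"
  shows "pmf (xi dir s) x \<le> exp (b * exp 2) * exp (- 2 * \<bar>real_of_int x\<bar>)"
proof -
  have "pmf (xi dir s) x * exp (a * x) \<le> exp (b * exp 2)" if a: "a = 2 \<or> a = -2" for a :: real
  proof -
    have "pmf (xi dir s) x * exp (a * x) = (\<integral>y. exp (a * y) * indicator {x} y \<partial>measure_pmf (xi dir s))"
      by (subst integral_measure_pmf_real[of "{x}"]) (auto simp: indicator_def)
    also have "\<dots> \<le> (\<integral>y. exp (a * y) \<partial>measure_pmf (xi dir s))"
      using assms xi_mgf(1)[of s dir a]
      by (intro integral_mono integrable_real_mult_indicator) (auto simp: indicator_def)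
    also have "\<dots> = exp (s * (up_prob dir * (exp a - 1) + down_prob dir * (exp (- a) - 1)))"
      using assms by (intro xi_mgf(2))
    also have "\<dots> \<le> exp (b * exp 2)"
    proof -
      have e: "exp a - 1 \<le> exp 2" "exp (- a) - 1 \<le> exp 2"
      proof -
        have "exp (-2) - 1 \<le> exp (2::real)" by (rule order_trans[of _ "exp (-2)"]) simp_all
        thus "exp a - 1 \<le> exp 2" "exp (- a) - 1 \<le> exp 2" using a by auto
      qed
      have "up_prob dir * (exp a - 1) + down_prob dir * (exp (- a) - 1) \<le> up_prob dir * exp 2 + down_prob dir * exp 2"
        using e by (intro add_mono mult_left_mono) auto
      also have "\<dots> = (up_prob dir + down_prob dir) * exp 2" by (simp only: distrib_right)
      finally have "up_prob dir * (exp a - 1) + down_prob dir * (exp (- a) - 1) \<le> exp 2" by simp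
      hence "s * (up_prob dir * (exp a - 1) + down_prob dir * (exp (- a) - 1)) \<le> s * exp 2"
        using assms by (intro mult_left_mono)
      also have "\<dots> \<le> b * exp 2" using assms by (intro mult_right_mono) auto
      finally show ?thesis by simp
    qed
    finally show ?thesis .
  qed
  from this[of 2] this[of "-2"]
  have "pmf (xi dir s) x * exp (2 * \<bar>real_of_int x\<bar>) \<le> exp (b * exp 2)" by (cases "x \<ge> 0") auto
  thus ?thesis by (simp add: exp_minus field_simps)
qed

lemma abs_int_decode_ge: "\<bar>int_decode n\<bar> \<ge> int n div 2"
  by (auto simp: int_decode_def sum_decode_def split: sum.splits if_splits)

lemma summable_exp_int_decode: "summable (\<lambda>n. exp (- \<bar>real_of_int (int_decode n)\<bar>))"
proof (rule summable_comparison_test')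
  show "summable (\<lambda>n. exp 1 * exp (- (1/2::real)) ^ n)"
    by (intro summable_mult summable_geometric) auto
  fix n :: nat
  have "real_of_int (int n div 2) \<le> \<bar>real_of_int (int_decode n)\<bar>"
    using abs_int_decode_ge[of n] by linarith
  moreover have "real_of_int (int n div 2) \<ge> real n / 2 - 1" by linarith
  ultimately have "exp (- \<bar>real_of_int (int_decode n)\<bar>) \<le> exp (1 + real n * (- (1/2)))" by simp
  also have "\<dots> = exp 1 * exp (- (1/2::real)) ^ n" by (simp only: exp_add exp_of_nat_mult)
  finally show "norm (exp (- \<bar>real_of_int (int_decode n)\<bar>)) \<le> exp 1 * exp (- (1/2::real)) ^ n" by simp
qed

text \<open>Enumerating the integers by \<open>int_decode\<close> makes the theorems on series over
  the naturals applicable.\<close>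

lemma count_space_int_sums:
  fixes g :: "int \<Rightarrow> real"
  assumes "integrable (count_space UNIV) g"
  shows "(\<lambda>n. g (int_decode n)) sums (\<integral>x. g x \<partial>count_space UNIV)"
proof -
  have "integrable (count_space UNIV) (\<lambda>n. g (int_decode n))"
    using integrable_bij_count_space[OF bij_int_decode, of g] assms by simp
  from sums_integral_count_space_nat[OF this] integral_bij_count_space[OF bij_int_decode, of g]
  show ?thesis by simp
qed

section \<open>Entropy of a coordinate\<close>

text \<open>The right-hand side of the forward equation for the law \<open>xi\<close>.\<close>

definition xi_flow :: "orientation \<Rightarrow> real \<Rightarrow> int \<Rightarrow> real" where
  "xi_flow dir s x = up_prob dir * pmf (xi dir s) (x - 1) + down_prob dir * pmf (xi dir s) (x + 1) - pmf (xi dir s) x"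

lemma xi_flow_abs_le:
  assumes "0 \<le> s" "s \<le> b"
  shows "\<bar>xi_flow dir s x\<bar> \<le> exp (b * exp 2) * exp 2 * exp (- 2 * \<bar>real_of_int x\<bar>)"
proof -
  define B where "B = exp (b * exp 2) * exp 2 * exp (- 2 * \<bar>real_of_int x\<bar>)"
  have le: "pmf (xi dir s) y \<le> B" if "\<bar>y - x\<bar> \<le> 1" for y
  proof -
    have "\<bar>real_of_int y\<bar> \<ge> \<bar>real_of_int x\<bar> - 1" using that by linarith
    hence "exp (- 2 * \<bar>real_of_int y\<bar>) \<le> exp (2 + - 2 * \<bar>real_of_int x\<bar>)" by simp
    also have "\<dots> = exp 2 * exp (- 2 * \<bar>real_of_int x\<bar>)" by (rule exp_add)
    finally have "exp (b * exp 2) * exp (- 2 * \<bar>real_of_int y\<bar>) \<le> B" by (simp add: B_def)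
    with pmf_xi_exp_le[OF assms, of dir y] show ?thesis by linarith
  qed
  have "up_prob dir * pmf (xi dir s) (x - 1) + down_prob dir * pmf (xi dir s) (x + 1) \<le> up_prob dir * B + down_prob dir * B"
    by (intro add_mono mult_left_mono le) auto
  also have "\<dots> = B" by (simp only: distrib_right[symmetric] up_down_simps mult_1)
  finally have upper: "xi_flow dir s x \<le> B" using pmf_nonneg[of "xi dir s" x] unfolding xi_flow_def by linarith
  have "0 \<le> up_prob dir * pmf (xi dir s) (x - 1) + down_prob dir * pmf (xi dir s) (x + 1)" by simp
  moreover have "pmf (xi dir s) x \<le> B" by (rule le) simp
  ultimately have "- B \<le> xi_flow dir s x" unfolding xi_flow_def by linarith
  with upper show ?thesis unfolding B_def[symmetric] by (simp add: abs_le_iff)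
qed

lemma xi_flow_integral:
  assumes "s \<ge> 0" "poly_growth f"
  shows "integrable (count_space UNIV) (\<lambda>x. xi_flow dir s x * f x)"
    and "(\<integral>x. xi_flow dir s x * f x \<partial>count_space UNIV) =
      measure_pmf.expectation (xi dir s) (\<lambda>x. up_prob dir * f (x + 1) + down_prob dir * f (x - 1) - f x)"
proof -
  note int = integrable_xi_count[OF assms, of dir]
  have e: "(\<lambda>x. xi_flow dir s x * f x) = (\<lambda>x. up_prob dir * (pmf (xi dir s) (x + -1) * f x) +
      down_prob dir * (pmf (xi dir s) (x + 1) * f x) - pmf (xi dir s) (x + 0) * f x)"
    by (simp add: fun_eq_iff xi_flow_def algebra_simps)
  show "integrable (count_space UNIV) (\<lambda>x. xi_flow dir s x * f x)"
    unfolding e by (intro Bochner_Integration.integrable_add Bochner_Integration.integrable_diff integrable_mult_right int)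
  have i: "integrable (xi dir s) (\<lambda>x. f (x + c))" for c using assms by auto
  from i[of 1] i[of "-1"] i[of 0] have i': "integrable (xi dir s) (\<lambda>x. f (x + 1))" "integrable (xi dir s) (\<lambda>x. f (x - 1))" "integrable (xi dir s) f"
    by simp_all
  have "(\<integral>x. xi_flow dir s x * f x \<partial>count_space UNIV) =
     up_prob dir * (\<integral>x. pmf (xi dir s) (x + -1) * f x \<partial>count_space UNIV) +
     down_prob dir * (\<integral>x. pmf (xi dir s) (x + 1) * f x \<partial>count_space UNIV) - (\<integral>x. pmf (xi dir s) (x + 0) * f x \<partial>count_space UNIV)"
    unfolding e
    by (subst Bochner_Integration.integral_diff, intro Bochner_Integration.integrable_add integrable_mult_right int, rule int,
        subst Bochner_Integration.integral_add, (intro integrable_mult_right int)+, simp)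
  also have "\<dots> = measure_pmf.expectation (xi dir s) (\<lambda>x. up_prob dir * f (x + 1) + down_prob dir * f (x - 1) - f x)"
    unfolding expectation_xi_shift using i' by simp
  finally show "(\<integral>x. xi_flow dir s x * f x \<partial>count_space UNIV) =
      measure_pmf.expectation (xi dir s) (\<lambda>x. up_prob dir * f (x + 1) + down_prob dir * f (x - 1) - f x)" .
qed

text \<open>The expectation is differentiated termwise: \<open>p * (- ln p) ^ k\<close> has
  derivative \<open>(- ln p) ^ k - k * (- ln p) ^ (k - 1)\<close> in \<open>p\<close>, and the
  forward equation supplies the derivative of \<open>p\<close>. The case \<open>k = 1\<close> gives
  the entropy rate, \<open>k = 2\<close> continuity of the variance.\<close>

lemma surprisal_moment_deriv:
  assumes s: "s > 0"
  shows "((\<lambda>s. measure_pmf.expectation (xi dir s) (\<lambda>x. surprisal dir s x ^ k)) has_field_derivative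
    (\<integral>x. xi_flow dir s x * (surprisal dir s x ^ k - k * surprisal dir s x ^ (k - 1)) \<partial>count_space UNIV)) (at s)"
proof -
  define a b where "a = s / 2" and "b = s + 1"
  define S where "S = {a<..<b}"
  have ab: "0 < a" "a < s" "s < b" using s by (auto simp: a_def b_def)
  define f where "f n s = pmf (xi dir s) (int_decode n) * surprisal dir s (int_decode n) ^ k" for n s
  define f' where "f' n s = xi_flow dir s (int_decode n) *
    (surprisal dir s (int_decode n) ^ k - k * surprisal dir s (int_decode n) ^ (k - 1))" for n s
  have S: "r > 0" "a \<le> r" "r \<le> b" if "r \<in> S" for r using that ab by (auto simp: S_def)
  have pg: "poly_growth (\<lambda>x. surprisal dir r x ^ i)" if "r > 0" for r i using that by auto
  have sums: "(\<lambda>n. f n r) sums measure_pmf.expectation (xi dir r) (\<lambda>x. surprisal dir r x ^ k)" if "r > 0" for r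
    unfolding f_def expectation_int_count_space(1)
    by (rule count_space_int_sums) (use that pg in \<open>simp flip: expectation_int_count_space(2)\<close>)
  have sums': "(\<lambda>n. f' n r) sums (\<integral>x. xi_flow dir r x * (surprisal dir r x ^ k - k * surprisal dir r x ^ (k - 1)) \<partial>count_space UNIV)"
    if "r > 0" for r
    unfolding f'_def using that pg
    by (intro count_space_int_sums xi_flow_integral(1) poly_growth_diff poly_growth_mult pg poly_growth_const) auto
  have deriv: "(f n has_field_derivative f' n r) (at r within S)" if r: "r \<in> S" for n r
  proof (cases "int_decode n \<in> walk_support dir")
    case True
    define x where "x = int_decode n"
    have p: "pmf (xi dir r) x > 0" using pmf_xi_pos[OF S(1)[OF r] True] by (simp add: x_def)
    have d: "((\<lambda>r. pmf (xi dir r) x) has_field_derivative xi_flow dir r x) (at r)"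
      unfolding xi_flow_def using S(1)[OF r] by (rule xi_deriv)
    have "((\<lambda>r. pmf (xi dir r) x * (- ln (pmf (xi dir r) x)) ^ k) has_field_derivative f' n r) (at r)"
      using p by (auto intro!: derivative_eq_intros d simp: f'_def surprisal_def field_simps simp flip: x_def)
    moreover have "f n = (\<lambda>r. pmf (xi dir r) x * (- ln (pmf (xi dir r) x)) ^ k)"
      by (simp add: fun_eq_iff f_def surprisal_def x_def)
    ultimately show ?thesis by (simp add: has_field_derivative_at_within)
  next
    case False
    hence z: "pmf (xi dir r) (int_decode n) = 0" if "r \<in> S" for r
      using S(1)[OF that] by (simp add: pmf_xi_eq_0)
    \<comment> \<open>A negative point can be entered by the directed walk only from its left
      neighbour, which is off the support as well.\<close>
    have "xi_flow dir r (int_decode n) = 0"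
      using False S(1)[OF r] by (cases dir) (auto simp: xi_flow_def pmf_xi_eq_0)
    hence z': "f' n r = 0" by (simp add: f'_def)
    have "((\<lambda>_. 0) has_field_derivative f' n r) (at r within S)" unfolding z' by simp
    thus ?thesis by (rule has_field_derivative_transform_within[where d = 1]) (use r in \<open>auto simp: f_def z\<close>)
  qed
  define K where "K = b + \<bar>ln (2 / a)\<bar> + 1"
  have K: "K \<ge> 1" using ab by (simp add: K_def)
  \<comment> \<open>The product of the bounds in \<open>xi_flow_abs_le\<close> and
    \<open>surprisal_le\<close>, with the power of \<open>1 + y\<close> absorbed into an
    exponential; of the decay rate 2 of the flow, rate 1 is left.\<close>
  define C where "C = exp (b * exp 2) * exp 2 * (real (k + 1) * K ^ k * (fact (2 * k) * exp 1))"
  have bound: "norm (f' n r) \<le> C * exp (- \<bar>real_of_int (int_decode n)\<bar>)" if r: "r \<in> S" for n r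
  proof -
    define y where "y = \<bar>real_of_int (int_decode n)\<bar>"
    define q where "q = surprisal dir r (int_decode n)"
    define B where "B = K * (1 + y) ^ 2"
    have y: "y \<ge> 0" by (simp add: y_def)
    have B: "B \<ge> 1" unfolding B_def using K y mult_mono[of 1 K 1 "(1 + y) ^ 2"] by simp
    have q: "0 \<le> q" "q \<le> B"
      using surprisal_le[OF ab(1) S(2)[OF r] S(3)[OF r], of dir "int_decode n"] by (auto simp: q_def B_def K_def y_def)
    have "q ^ k \<le> B ^ k" using q by (intro power_mono) auto
    moreover have "q ^ (k - 1) \<le> B ^ k"
      using power_mono[of q B "k - 1"] power_increasing[of "k - 1" k B] q B by (meson diff_le_self order_trans)
    hence "k * q ^ (k - 1) \<le> k * B ^ k" by (intro mult_left_mono) auto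
    moreover have "0 \<le> q ^ k" "0 \<le> k * q ^ (k - 1)" using q by auto
    ultimately have "\<bar>q ^ k - k * q ^ (k - 1)\<bar> \<le> B ^ k + k * B ^ k" by linarith
    also have "\<dots> = real (k + 1) * K ^ k * (1 + y) ^ (2 * k)"
      unfolding B_def power_mult_distrib power_mult[symmetric] by (simp add: algebra_simps)
    also have "\<dots> \<le> real (k + 1) * K ^ k * (fact (2 * k) * exp (1 + y))"
      using K y by (intro mult_left_mono power_le_fact_exp) auto
    finally have 1: "\<bar>q ^ k - k * q ^ (k - 1)\<bar> \<le> real (k + 1) * K ^ k * (fact (2 * k) * exp (1 + y))" .
    have 2: "\<bar>xi_flow dir r (int_decode n)\<bar> \<le> exp (b * exp 2) * exp 2 * exp (- 2 * y)"
      unfolding y_def by (rule xi_flow_abs_le) (use S[OF r] in auto)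
    have "norm (f' n r) = \<bar>xi_flow dir r (int_decode n)\<bar> * \<bar>q ^ k - k * q ^ (k - 1)\<bar>"
      by (simp add: f'_def q_def abs_mult)
    also have "\<dots> \<le> (exp (b * exp 2) * exp 2 * exp (- 2 * y)) * (real (k + 1) * K ^ k * (fact (2 * k) * exp (1 + y)))"
      by (intro mult_mono 1 2) auto
    also have "\<dots> = C * (exp (- 2 * y) * exp y)" by (simp add: C_def exp_add mult_ac)
    also have "exp (- 2 * y) * exp y = exp (- y)" by (simp flip: exp_add)
    finally show ?thesis by (simp add: y_def)
  qed
  have "uniformly_convergent_on S (\<lambda>n r. \<Sum>i<n. f' i r)"
    by (rule Weierstrass_m_test'[OF bound]) (auto intro!: summable_mult summable_exp_int_decode)
  hence "((\<lambda>r. \<Sum>n. f n r) has_field_derivative (\<Sum>n. f' n s)) (at s)"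
    using ab sums[OF s] deriv
    by (intro has_field_derivative_series'(2)[of S _ _ s]) (auto simp: S_def sums_iff)
  hence "((\<lambda>r. \<Sum>n. f n r) has_field_derivative (\<integral>x. xi_flow dir s x * (surprisal dir s x ^ k - k * surprisal dir s x ^ (k - 1)) \<partial>count_space UNIV)) (at s)"
    using sums'[OF s] by (simp add: sums_iff)
  thus ?thesis
    by (rule has_field_derivative_transform_within_open[of _ _ _ "{0<..}"])
      (use s sums in \<open>auto simp: sums_iff\<close>)
qed

lemma xi_stein_central:
  fixes f :: "int \<Rightarrow> real"
  assumes "s \<ge> 0" "poly_growth f"
  shows "measure_pmf.expectation (xi dir s) (\<lambda>x. (real_of_int x - drift dir s) * f x) =
    s * measure_pmf.expectation (xi dir s) (\<lambda>x. up_prob dir * (f (x + 1) - f x) - down_prob dir * (f (x - 1) - f x))"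
proof -
  have int: "integrable (xi dir s) (\<lambda>x. f (x + 1))" "integrable (xi dir s) (\<lambda>x. f (x - 1))" "integrable (xi dir s) f"
    "integrable (xi dir s) (\<lambda>x. real_of_int x * f x)"
    using assms poly_growth_shift[OF assms(2), of 1] poly_growth_shift[OF assms(2), of "-1"] by auto
  have "measure_pmf.expectation (xi dir s) (\<lambda>x. (real_of_int x - drift dir s) * f x) =
     measure_pmf.expectation (xi dir s) (\<lambda>x. real_of_int x * f x) - drift dir s * measure_pmf.expectation (xi dir s) f"
    using int by (simp add: left_diff_distrib)
  also have "\<dots> = s * measure_pmf.expectation (xi dir s) (\<lambda>x. up_prob dir * (f (x + 1) - f x) - down_prob dir * (f (x - 1) - f x))"
    using int xi_stein_expectation[OF assms, of dir] by (simp add: drift_def algebra_simps)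
  finally show ?thesis .
qed

text \<open>Stein's identity with the test function \<open>y ^ n\<close> expresses the central
  moment of order \<open>n + 1\<close> through those of lower order.\<close>

lemma xi_central_moments:
  fixes dir :: orientation and s :: real
  assumes s: "s \<ge> 0"
  defines "m \<equiv> \<lambda>n. measure_pmf.expectation (xi dir s) (\<lambda>x. (x - drift dir s) ^ n)"
  shows "m 1 = 0" "m 2 = s" "m 3 = s * (up_prob dir - down_prob dir)" "m 4 = 3 * s\<^sup>2 + s"
proof -
  let ?E = "measure_pmf.expectation (xi dir s)"
  let ?u = "up_prob dir" and ?d = "down_prob dir"
  have ud: "?d = 1 - ?u" by (simp add: down_prob_def)
  define y where "y x = real_of_int x - drift dir s" for x
  have pg: "poly_growth (\<lambda>x. y x ^ n)" for n
    unfolding y_def by (intro poly_growth_power poly_growth_diff poly_growth_id poly_growth_const)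
  have int: "integrable (xi dir s) (\<lambda>x. y x ^ n)" for n using pg s by auto
  have int1: "integrable (xi dir s) y" using int[of 1] by simp
  have step: "y (x + 1) = y x + 1" "y (x - 1) = y x - 1" for x by (simp_all add: y_def)
  have st: "m (Suc n) = s * ?E (\<lambda>x. ?u * ((y x + 1) ^ n - y x ^ n) - ?d * ((y x - 1) ^ n - y x ^ n))" for n
    using xi_stein_central[OF s pg[of n], of dir] by (simp add: m_def step flip: y_def)
  have m: "m n = ?E (\<lambda>x. y x ^ n)" for n by (simp add: m_def y_def)
  show m1: "m 1 = 0" using st[of 0] by simp
  have "(\<lambda>x. ?u * ((y x + 1) ^ 1 - y x ^ 1) - ?d * ((y x - 1) ^ 1 - y x ^ 1)) = (\<lambda>_. 1)"
    by (simp add: fun_eq_iff)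
  thus m2: "m 2 = s" using st[of 1] by (simp add: numeral_2_eq_2)
  have "(\<lambda>x. ?u * ((y x + 1) ^ 2 - y x ^ 2) - ?d * ((y x - 1) ^ 2 - y x ^ 2)) = (\<lambda>x. 2 * y x ^ 1 + (?u - ?d))"
    by (simp add: fun_eq_iff ud power2_eq_square algebra_simps)
  thus m3: "m 3 = s * (?u - ?d)" using st[of 2] m1 m[of 1] int1 by (simp add: numeral_3_eq_3)
  have "(\<lambda>x. ?u * ((y x + 1) ^ 3 - y x ^ 3) - ?d * ((y x - 1) ^ 3 - y x ^ 3)) = (\<lambda>x. 3 * y x ^ 2 + 3 * (?u - ?d) * y x ^ 1 + 1)"
    by (simp add: fun_eq_iff ud power2_eq_square power3_eq_cube algebra_simps)
  moreover have "?E (\<lambda>x. 3 * y x ^ 2 + 3 * (?u - ?d) * y x ^ 1 + 1) = 3 * m 2 + 3 * (?u - ?d) * m 1 + 1"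
    using int[of 2] int1 by (simp add: m)
  ultimately show "m 4 = 3 * s\<^sup>2 + s" using st[of 3] m1 m2
    by (simp add: numeral_eq_Suc power2_eq_square algebra_simps)
qed

section \<open>The entropy and its rate of growth\<close>

definition entropy1 :: "orientation \<Rightarrow> real \<Rightarrow> real" where
  "entropy1 dir s = measure_pmf.expectation (xi dir s) (surprisal dir s)"

definition entropy_rate :: "orientation \<Rightarrow> real \<Rightarrow> real" where
  "entropy_rate dir s = measure_pmf.expectation (xi dir s)
     (\<lambda>x. up_prob dir * surprisal dir s (x + 1) + down_prob dir * surprisal dir s (x - 1) - surprisal dir s x)"

text \<open>The rate is the mean of the generator applied to the surprisal. The extra term
  \<open>- 1\<close> from differentiating the logarithm is constant, and the generator annihilates
  constants.\<close>

lemma entropy1_deriv: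
  assumes s: "s > 0"
  shows "(entropy1 dir has_field_derivative entropy_rate dir s) (at s)"
proof -
  have "((\<lambda>s. measure_pmf.expectation (xi dir s) (\<lambda>x. surprisal dir s x ^ 1)) has_field_derivative
    (\<integral>x. xi_flow dir s x * (surprisal dir s x ^ 1 - 1 * surprisal dir s x ^ (1 - 1)) \<partial>count_space UNIV)) (at s)"
    using surprisal_moment_deriv[OF s, of dir 1] by simp
  also have "(\<integral>x. xi_flow dir s x * (surprisal dir s x ^ 1 - 1 * surprisal dir s x ^ (1 - 1)) \<partial>count_space UNIV) =
    measure_pmf.expectation (xi dir s) (\<lambda>x. up_prob dir * (surprisal dir s (x + 1) - 1) + down_prob dir * (surprisal dir s (x - 1) - 1) - (surprisal dir s x - 1))"
    using xi_flow_integral(2)[of s "\<lambda>x. surprisal dir s x - 1" dir] s by (simp add: poly_growth_diff)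
  also have "(\<lambda>x. up_prob dir * (surprisal dir s (x + 1) - 1) + down_prob dir * (surprisal dir s (x - 1) - 1) - (surprisal dir s x - 1)) =
    (\<lambda>x. up_prob dir * surprisal dir s (x + 1) + down_prob dir * surprisal dir s (x - 1) - surprisal dir s x)"
    by (simp add: fun_eq_iff down_prob_def algebra_simps)
  finally show ?thesis unfolding entropy_rate_def by (simp add: entropy1_def[abs_def])
qed

lemma entropy1_nonneg: "entropy1 dir s \<ge> 0"
  unfolding entropy1_def by (rule Bochner_Integration.integral_nonneg) simp

lemma entropy1_0 [simp]: "entropy1 dir 0 = 0"
  by (simp add: entropy1_def xi_def surprisal_def)

text \<open>Adds a quadratic gain to \<open>ln w \<ge> 1 - 1 / w\<close>. The difference of the two
  sides has derivative \<open>(w - 1) * (1 / w\<^sup>2 - 1 / 4)\<close>, so up to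
  \<open>w = 2\<close> its minimum is at 1.\<close>

lemma ln_ge_quadratic:
  fixes w :: real
  assumes "0 < w" "w \<le> 2"
  shows "ln w \<ge> 1 - 1 / w + (w - 1)\<^sup>2 / 8"
proof -
  define h where "h w = ln w - 1 + 1 / w - (w - 1)\<^sup>2 / 8" for w :: real
  have d: "(h has_real_derivative (x - 1) * (1 / x\<^sup>2 - 1 / 4)) (at x)" if "x > 0" for x
    unfolding h_def[abs_def] using that
    by (auto intro!: derivative_eq_intros simp: field_simps power2_eq_square)
  have sq: "1 / x\<^sup>2 - 1 / 4 \<ge> 0" if "0 < x" "x \<le> 2" for x :: real
  proof -
    have "x\<^sup>2 \<le> 2\<^sup>2" using that by (intro power_mono) auto
    thus ?thesis using that by (simp add: field_simps)
  qed
  have h1: "h 1 = 0" by (simp add: h_def)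
  have "h w \<ge> 0"
  proof (cases "w \<ge> 1")
    case True
    have "h 1 \<le> h w"
    proof (rule DERIV_nonneg_imp_nondecreasing[OF True])
      fix x assume "1 \<le> x" "x \<le> w"
      thus "\<exists>y. DERIV h x :> y \<and> y \<ge> 0" using d[of x] sq[of x] assms by (intro exI conjI) (auto intro!: mult_nonneg_nonneg)
    qed
    thus ?thesis using h1 by simp
  next
    case False
    have "h 1 \<le> h w"
    proof (rule DERIV_nonpos_imp_nonincreasing[of w 1])
      fix x assume "w \<le> x" "x \<le> 1"
      thus "\<exists>y. DERIV h x :> y \<and> y \<le> 0" using d[of x] sq[of x] assms by (intro exI conjI) (auto intro!: mult_nonpos_nonneg)
    qed (use False in auto)
    thus ?thesis using h1 by simp
  qed
  thus ?thesis by (simp add: h_def)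
qed

lemma entropy_rate_Directed:
  assumes s: "s > 0"
  shows "entropy_rate Directed s = measure_pmf.expectation (xi Directed s) (\<lambda>x. ln ((real_of_int x + 1) / s))"
  unfolding entropy_rate_def
proof (rule integral_cong_AE)
  show "AE x in measure_pmf (xi Directed s). up_prob Directed * surprisal Directed s (x + 1) +
      down_prob Directed * surprisal Directed s (x - 1) - surprisal Directed s x = ln ((real_of_int x + 1) / s)"
    using surprisal_step_Directed[OF s] by (auto simp: AE_measure_pmf_iff set_pmf_xi[OF s])
qed simp_all

lemma integrable_ln_Directed:
  assumes s: "s > 0"
  shows "integrable (xi Directed s) (\<lambda>x. ln ((real_of_int x + 1) / s))"
proof (rule Bochner_Integration.integrable_cong_AE[THEN iffD1])
  show "integrable (xi Directed s) (\<lambda>x. surprisal Directed s (x + 1) - surprisal Directed s x)"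
    using s by (intro integrable_xi poly_growth_diff poly_growth_shift) auto
  show "AE x in measure_pmf (xi Directed s). surprisal Directed s (x + 1) - surprisal Directed s x = ln ((real_of_int x + 1) / s)"
    using surprisal_step_Directed[OF s] by (auto simp: AE_measure_pmf_iff set_pmf_xi[OF s])
qed simp_all

lemma poly_growth_inverse_Suc: "poly_growth (\<lambda>x. c / (real_of_int x + 1))"
proof (rule poly_growthI[of _ "\<bar>c\<bar>" 0])
  fix x :: int
  have "x = -1 \<or> \<bar>real_of_int x + 1\<bar> \<ge> 1" by linarith
  thus "\<bar>c / (real_of_int x + 1)\<bar> \<le> \<bar>c\<bar> * (1 + \<bar>real_of_int x\<bar>) ^ 0"
    by (auto simp: divide_le_eq mult_le_cancel_left1 abs_divide intro: order_trans[OF _ mult_left_mono[of 1 _ "\<bar>c\<bar>"]])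
qed

text \<open>The factor \<open>s / (x + 1)\<close> shifts the Poisson weights by one, so all mass is
  recovered except that at 0.\<close>

lemma expectation_inverse_Directed:
  assumes s: "s > 0"
  shows "measure_pmf.expectation (xi Directed s) (\<lambda>x. s / (real_of_int x + 1)) = 1 - pmf (xi Directed s) 0"
proof -
  have "measure_pmf.expectation (xi Directed s) (\<lambda>x. s / (real_of_int x + 1)) =
     (\<integral>x. pmf (xi Directed s) (x + 1) * (if x \<ge> 0 then 1 else 0) \<partial>count_space UNIV)"
    unfolding expectation_int_count_space
  proof (intro Bochner_Integration.integral_cong refl)
    fix x :: int
    show "pmf (xi Directed s) x * (s / (real_of_int x + 1)) = pmf (xi Directed s) (x + 1) * (if x \<ge> 0 then 1 else 0)"
    proof (cases "x \<ge> 0")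
      case True
      have "(x + 1) * pmf (xi Directed s) (x + 1) = s * pmf (xi Directed s) x"
        using xi_stein[of s "x + 1" Directed] s by simp
      thus ?thesis using True by (simp add: field_simps)
    qed (use s in \<open>simp add: pmf_xi_Directed\<close>)
  qed
  also have "\<dots> = measure_pmf.expectation (xi Directed s) (\<lambda>x. if x - 1 \<ge> 0 then 1 else 0)"
    by (rule expectation_xi_shift)
  also have "\<dots> = measure_pmf.expectation (xi Directed s) (\<lambda>x. 1 - indicator {0} x)"
    by (intro integral_cong_AE) (auto simp: AE_measure_pmf_iff set_pmf_xi[OF s] indicator_def)
  also have "\<dots> = 1 - pmf (xi Directed s) 0"
    by (subst Bochner_Integration.integral_diff)
      (auto simp: measure_pmf_single intro!: measure_pmf.integrable_const_bound[where B = 1])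
  finally show ?thesis .
qed

text \<open>The rate is the mean of \<open>ln w\<close> with \<open>w = (x + 1) / s\<close>. From
  \<open>ln w \<le> w - 1\<close> comes the upper bound, and \<open>ln w \<ge> 1 - 1 / w\<close>
  yields the positive but exponentially small value \<open>p0\<close>. The lower bound of order
  \<open>1 / s\<close> needs the quadratic refinement.\<close>

lemma entropy_rate_Directed_bounds:
  assumes s: "s > 0"
  shows "entropy_rate Directed s > 0" "entropy_rate Directed s \<le> 1 / s"
    "s \<ge> 8 \<Longrightarrow> entropy_rate Directed s \<ge> 1 / (16 * s)"
proof -
  let ?E = "measure_pmf.expectation (xi Directed s)"
  define p0 where "p0 = pmf (xi Directed s) 0"
  have p0: "p0 > 0" using pmf_xi_pos[of s 0 Directed] s by (simp add: p0_def)
  have iinv: "integrable (xi Directed s) (\<lambda>x. s / (real_of_int x + 1))"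
    using s by (intro integrable_xi poly_growth_inverse_Suc) auto
  have Einv: "?E (\<lambda>x. 1 - s / (real_of_int x + 1)) = p0"
    using iinv expectation_inverse_Directed[OF s] by (simp add: p0_def)
  have iln: "integrable (xi Directed s) (\<lambda>x. ln ((real_of_int x + 1) / s))" by (rule integrable_ln_Directed[OF s])
  note H = entropy_rate_Directed[OF s]
  have ge1: "ln ((real_of_int x + 1) / s) \<ge> 1 - s / (real_of_int x + 1)" if "x \<ge> 0" for x :: int
  proof -
    have "- ln ((real_of_int x + 1) / s) = ln (s / (real_of_int x + 1))" using s that by (simp add: ln_div)
    also have "\<dots> \<le> s / (real_of_int x + 1) - 1" using s that by (intro ln_le_minus_one) auto
    finally show ?thesis by simp
  qed
  have "?E (\<lambda>x. 1 - s / (real_of_int x + 1)) \<le> ?E (\<lambda>x. ln ((real_of_int x + 1) / s))"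
    by (rule integral_mono_AE) (use iinv iln ge1 in \<open>auto simp: AE_measure_pmf_iff set_pmf_xi[OF s]\<close>)
  thus "entropy_rate Directed s > 0" using Einv p0 H by simp
  have m1: "?E (\<lambda>x. real_of_int x) = s"
    using xi_central_moments(1)[of s Directed] s integrable_xi[of s "\<lambda>x. real_of_int x" Directed] by simp
  have "?E (\<lambda>x. ln ((real_of_int x + 1) / s)) \<le> ?E (\<lambda>x. (real_of_int x + 1) / s - 1)"
  proof (rule integral_mono_AE[OF iln])
    show "integrable (xi Directed s) (\<lambda>x. (real_of_int x + 1) / s - 1)" using s by (auto simp: divide_inverse intro!: integrable_xi)
    show "AE x in measure_pmf (xi Directed s). ln ((real_of_int x + 1) / s) \<le> (real_of_int x + 1) / s - 1"
      using s by (auto simp: AE_measure_pmf_iff set_pmf_xi[OF s] intro!: ln_le_minus_one)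
  qed
  also have "?E (\<lambda>x. (real_of_int x + 1) / s - 1) = 1 / s"
    using s m1 by (simp add: add_divide_distrib integrable_xi)
  finally show "entropy_rate Directed s \<le> 1 / s" using H by simp
  assume s8: "s \<ge> 8"
  define f where "f x = 1 - s / (real_of_int x + 1) + ((real_of_int x + 1 - s)\<^sup>2 - (real_of_int x + 1 - s) ^ 4 / s\<^sup>2) / (8 * s\<^sup>2)" for x :: int
  have ge: "ln ((real_of_int x + 1) / s) \<ge> f x" if x: "x \<ge> 0" for x
  proof -
    define v where "v = real_of_int x + 1 - s"
    have quad: "(v\<^sup>2 - v ^ 4 / s\<^sup>2) / (8 * s\<^sup>2) = v\<^sup>2 * (1 - (v / s)\<^sup>2) / (8 * s\<^sup>2)"
      by (simp add: power_divide algebra_simps power4_eq_xxxx power2_eq_square)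
    show ?thesis
    proof (cases "(real_of_int x + 1) / s \<le> 2")
      case True
      have "ln ((real_of_int x + 1) / s) \<ge> 1 - 1 / ((real_of_int x + 1) / s) + ((real_of_int x + 1) / s - 1)\<^sup>2 / 8"
        using True x s by (intro ln_ge_quadratic) auto
      also have "(real_of_int x + 1) / s - 1 = v / s" using s by (simp add: v_def field_simps)
      also have "(v / s)\<^sup>2 / 8 = v\<^sup>2 * 1 / (8 * s\<^sup>2)" by (simp add: power_divide)
      finally have "ln ((real_of_int x + 1) / s) \<ge> 1 - s / (real_of_int x + 1) + v\<^sup>2 * 1 / (8 * s\<^sup>2)" by simp
      moreover have "v\<^sup>2 * (1 - (v / s)\<^sup>2) / (8 * s\<^sup>2) \<le> v\<^sup>2 * 1 / (8 * s\<^sup>2)"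
        by (intro divide_right_mono mult_left_mono) auto
      ultimately show ?thesis unfolding f_def v_def[symmetric] quad by linarith
    next
      case False
      hence "v / s \<ge> 1" using s by (simp add: v_def field_simps)
      hence "v\<^sup>2 * (1 - (v / s)\<^sup>2) / (8 * s\<^sup>2) \<le> 0"
        by (intro divide_nonpos_nonneg mult_nonneg_nonpos) (auto simp: one_le_power)
      thus ?thesis using ge1[OF x] unfolding f_def v_def[symmetric] quad by linarith
    qed
  qed
  define y where "y x = real_of_int x - s" for x :: int
  have iy: "integrable (xi Directed s) (\<lambda>x. y x ^ n)" for n
    unfolding y_def using s by (intro integrable_xi poly_growth_power poly_growth_diff poly_growth_id poly_growth_const) auto
  have iy1: "integrable (xi Directed s) y" using iy[of 1] by simp
  have my: "?E y = 0" "?E (\<lambda>x. y x ^ 2) = s" "?E (\<lambda>x. y x ^ 3) = s" "?E (\<lambda>x. y x ^ 4) = 3 * s\<^sup>2 + s"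
    using xi_central_moments[of s Directed] s by (simp_all add: y_def[abs_def])
  \<comment> \<open>For the centred variable \<open>y\<close>, the variable \<open>y + 1\<close> has
    second moment \<open>s + 1\<close> and fourth moment
    \<open>3 * s\<^sup>2 + 11 * s + 1\<close>.\<close>
  define R where "R = (s + 1 - (3 * s\<^sup>2 + 11 * s + 1) / s\<^sup>2) / (8 * s\<^sup>2)"
  have yy: "f = (\<lambda>x. (1 - s / (real_of_int x + 1)) + ((y x ^ 2 + 2 * y x + 1) - (y x ^ 4 + 4 * y x ^ 3 + 6 * y x ^ 2 + 4 * y x + 1) / s\<^sup>2) / (8 * s\<^sup>2))"
  proof
    fix x
    have e: "real_of_int x + 1 - s = y x + 1" by (simp add: y_def)
    have "(y x + 1)\<^sup>2 = y x ^ 2 + 2 * y x + 1" "(y x + 1) ^ 4 = y x ^ 4 + 4 * y x ^ 3 + 6 * y x ^ 2 + 4 * y x + 1"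
      by (simp_all add: power2_eq_square power3_eq_cube power4_eq_xxxx algebra_simps)
    thus "f x = (1 - s / (real_of_int x + 1)) + ((y x ^ 2 + 2 * y x + 1) - (y x ^ 4 + 4 * y x ^ 3 + 6 * y x ^ 2 + 4 * y x + 1) / s\<^sup>2) / (8 * s\<^sup>2)"
      unfolding f_def e by (simp only:)
  qed
  have if': "integrable (xi Directed s) f" unfolding yy
    using iinv iy iy1 by (intro Bochner_Integration.integrable_add Bochner_Integration.integrable_diff integrable_divide integrable_mult_right) auto
  have "?E f = ?E (\<lambda>x. 1 - s / (real_of_int x + 1)) + ((?E (\<lambda>x. y x ^ 2) + 2 * ?E y + 1) - (?E (\<lambda>x. y x ^ 4) + 4 * ?E (\<lambda>x. y x ^ 3) + 6 * ?E (\<lambda>x. y x ^ 2) + 4 * ?E y + 1) / s\<^sup>2) / (8 * s\<^sup>2)"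
    unfolding yy using iinv iy iy1 by simp
  hence Ef: "?E f = p0 + R" unfolding Einv my R_def by simp
  have "?E f \<le> entropy_rate Directed s" unfolding H
    by (rule integral_mono_AE[OF if' iln]) (use ge in \<open>auto simp: AE_measure_pmf_iff set_pmf_xi[OF s]\<close>)
  moreover have "R \<ge> 1 / (16 * s)"
  proof -
    have "(3 * s\<^sup>2 + 11 * s + 1) / s\<^sup>2 = 3 + 11 / s + 1 / s\<^sup>2" using s by (simp add: field_simps power2_eq_square)
    also have "\<dots> \<le> 3 + 11 / 8 + 1 / 8\<^sup>2" using s8 by (intro add_mono divide_left_mono power_mono) auto
    also have "\<dots> \<le> s / 2 + 1" using s8 by simp
    finally have "s + 1 - (3 * s\<^sup>2 + 11 * s + 1) / s\<^sup>2 \<ge> s / 2" by linarith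
    hence "R \<ge> (s / 2) / (8 * s\<^sup>2)" unfolding R_def by (intro divide_right_mono) auto
    thus ?thesis using s by (simp add: power2_eq_square)
  qed
  ultimately show "entropy_rate Directed s \<ge> 1 / (16 * s)" using Ef p0 by linarith
qed

text \<open>Summation by parts: for the symmetric walk the rate is half the Dirichlet form of the
  law and its surprisal, whose terms are nonnegative.\<close>

lemma entropy_rate_Undirected:
  fixes s :: real
  defines "g \<equiv> \<lambda>x. (pmf (xi Undirected s) x - pmf (xi Undirected s) (x + 1)) *
    (surprisal Undirected s (x + 1) - surprisal Undirected s x)"
  assumes s: "s > 0"
  shows "integrable (count_space UNIV) g" "entropy_rate Undirected s = (\<integral>x. g x \<partial>count_space UNIV) / 2"
proof -
  let ?p = "pmf (xi Undirected s)" and ?Q = "surprisal Undirected s" and ?E = "measure_pmf.expectation (xi Undirected s)"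
  define h where "h x = ?Q (x + 1) - ?Q x" for x
  have pg: "poly_growth h" unfolding h_def using s by (intro poly_growth_diff poly_growth_shift) auto
  have pgm: "poly_growth (\<lambda>x. - h (x - 1))"
    using poly_growth_shift[OF pg, of "-1"] by (auto intro: poly_growth_minus)
  have i0: "integrable (count_space UNIV) (\<lambda>x. ?p x * h x)" and i1: "integrable (count_space UNIV) (\<lambda>x. ?p (x + 1) * h x)"
    using integrable_xi_count[OF _ pg, of s Undirected 0] integrable_xi_count[OF _ pg, of s Undirected 1] s by simp_all
  have g: "g = (\<lambda>x. ?p x * h x - ?p (x + 1) * h x)" by (simp add: g_def h_def fun_eq_iff algebra_simps)
  show "integrable (count_space UNIV) g" unfolding g using i0 i1 by simp
  have "(\<integral>x. g x \<partial>count_space UNIV) = ?E h - ?E (\<lambda>x. h (x - 1))"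
    unfolding g using i0 i1 expectation_xi_shift[of Undirected s 1 h] by (simp add: expectation_int_count_space(1))
  also have "\<dots> = ?E (\<lambda>x. h x + - h (x - 1))"
    using integrable_xi[OF _ pg, of s Undirected] integrable_xi[OF _ pgm, of s Undirected] s
    by (subst Bochner_Integration.integral_add) auto
  also have "\<dots> = ?E (\<lambda>x. 2 * (up_prob Undirected * ?Q (x + 1) + down_prob Undirected * ?Q (x - 1) - ?Q x))"
    by (simp add: h_def algebra_simps)
  also have "\<dots> = 2 * entropy_rate Undirected s"
    unfolding entropy_rate_def by (rule integral_mult_right_zero)
  finally show "entropy_rate Undirected s = (\<integral>x. g x \<partial>count_space UNIV) / 2" by simp
qed

text \<open>With \<open>l\<close> the increment of the surprisal, a term is
  \<open>p x * (1 - exp (- l)) * l\<close>, essentially \<open>p x * l\<^sup>2\<close>; the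
  two-sided bounds on \<open>l\<close> apply for \<open>x \<ge> 0\<close>.\<close>

lemma dirichlet_term_bounds:
  fixes s :: real
  defines "g \<equiv> \<lambda>x. (pmf (xi Undirected s) x - pmf (xi Undirected s) (x + 1)) *
    (surprisal Undirected s (x + 1) - surprisal Undirected s x)"
  assumes s: "s > 0"
  shows "x \<ge> 0 \<Longrightarrow> g x \<ge> pmf (xi Undirected s) x * (x / (s + x))\<^sup>2"
    and "g x \<ge> 0"
    and "g x \<le> (pmf (xi Undirected s) x + pmf (xi Undirected s) (x + 1)) * ((\<bar>real_of_int x\<bar> + 1) / s)\<^sup>2"
proof -
  let ?p = "pmf (xi Undirected s)" and ?Q = "surprisal Undirected s"
  have p: "?p y > 0" for y using pmf_xi_pos[of s y Undirected] s by simp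
  define l where "l y = ?Q (y + 1) - ?Q y" for y
  have pe: "?p (y + 1) = ?p y * exp (- l y)" for y
    using p[of y] p[of "y + 1"] by (simp add: l_def surprisal_def exp_diff)
  have ge: "g y = ?p y * ((1 - exp (- l y)) * l y)" for y
    by (simp add: g_def pe l_def[symmetric] algebra_simps)
  have lower: "g y \<ge> ?p y * (y / (s + y))\<^sup>2" if "y \<ge> 0" for y
  proof -
    \<comment> \<open>Chosen so that \<open>1 / (1 - u) = 1 + y / s\<close>; then \<open>u\<close>
      is a lower bound both for the increment \<open>l y\<close> and for
      \<open>1 - exp (- l y)\<close>.\<close>
    define u where "u = y / (s + y)"
    have u: "0 \<le> u" "u < 1" using s that by (auto simp: u_def)
    have e: "1 - u = s / (s + y)" using s that by (simp add: u_def field_simps)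
    have inv: "1 / (1 - u) = 1 + y / s" unfolding e using s that by (simp add: field_simps)
    have "ln (1 / (1 - u)) \<le> l y" using surprisal_step_Undirected(1)[OF s that] by (simp add: l_def inv)
    hence a: "- l y \<le> ln (1 - u)" using u by (simp add: ln_div)
    hence "exp (- l y) \<le> 1 - u" using u by (metis exp_le_cancel_iff exp_ln diff_gt_0_iff_gt)
    hence "u \<le> 1 - exp (- l y)" by simp
    moreover have "u \<le> l y" using a u ln_le_minus_one[of "1 - u"] by simp
    ultimately have "u * u \<le> (1 - exp (- l y)) * l y" using u by (intro mult_mono) auto
    thus ?thesis unfolding ge using p[of y] by (simp add: u_def[symmetric] power2_eq_square)
  qed
  have upper: "g y \<le> ?p y * ((real_of_int y + 1) / s)\<^sup>2" if "y \<ge> 0" for y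
  proof -
    have l: "l y \<le> (real_of_int y + 1) / s" using surprisal_step_Undirected(2)[OF s that] by (simp add: l_def)
    have l0: "l y \<ge> 0" using surprisal_step_Undirected(1)[OF s that] s that
      by (smt (verit) l_def divide_nonneg_pos ln_ge_zero of_int_0_le_iff)
    have "1 - exp (- l y) \<le> l y" using exp_ge_add_one_self[of "- l y"] by simp
    hence "(1 - exp (- l y)) * l y \<le> l y * l y" using l0 by (intro mult_right_mono)
    also have "\<dots> \<le> ((real_of_int y + 1) / s) * ((real_of_int y + 1) / s)" using l l0 by (intro mult_mono) auto
    finally have "?p y * ((1 - exp (- l y)) * l y) \<le> ?p y * (((real_of_int y + 1) / s) * ((real_of_int y + 1) / s))"
      using p[of y] by (intro mult_left_mono) auto
    thus ?thesis unfolding ge power2_eq_square .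
  qed
  \<comment> \<open>Reflection sends the edge from \<open>y\<close> to \<open>y + 1\<close> to the
    edge from \<open>- 1 - y\<close> to \<open>- y\<close>.\<close>
  have sym: "g y = g (- 1 - y)" for y
  proof -
    have "- 1 - y = - (y + 1)" "- 1 - y + 1 = - y" by simp_all
    hence "?p (- 1 - y) = ?p (y + 1)" "?p (- 1 - y + 1) = ?p y"
      using pmf_xi_Undirected_minus[of s "y + 1"] pmf_xi_Undirected_minus[of s y] s by (simp_all only: less_imp_le)
    moreover from this have "?Q (- 1 - y) = ?Q (y + 1)" "?Q (- 1 - y + 1) = ?Q y" by (simp_all add: surprisal_def)
    ultimately show ?thesis unfolding g_def by (simp only:) (simp add: algebra_simps)
  qed
  show "g x \<ge> ?p x * (x / (s + x))\<^sup>2" if "x \<ge> 0" using lower[OF that] .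
  have nn: "g y \<ge> 0" if "y \<ge> 0" for y using lower[OF that] p[of y] by (smt (verit) mult_nonneg_nonneg zero_le_power2)
  show "g x \<ge> 0" using nn[of x] nn[of "-1 - x"] sym[of x] by (cases "x \<ge> 0") auto
  show "g x \<le> (?p x + ?p (x + 1)) * ((\<bar>real_of_int x\<bar> + 1) / s)\<^sup>2"
  proof (cases "x \<ge> 0")
    case True
    have "?p x * ((real_of_int x + 1) / s)\<^sup>2 \<le> (?p x + ?p (x + 1)) * ((\<bar>real_of_int x\<bar> + 1) / s)\<^sup>2"
      using True p by (intro mult_mono) (auto intro: less_imp_le)
    with upper[OF True] show ?thesis by linarith
  next
    case False
    have "-1 - x = - (x + 1)" by simp
    hence e: "?p (-1 - x) = ?p (x + 1)" using pmf_xi_Undirected_minus[of s "x + 1"] s by (simp only: less_imp_le)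
    have f: "real_of_int (-1 - x) + 1 = \<bar>real_of_int x\<bar>" using False by simp
    have "?p (-1 - x) * ((real_of_int (-1 - x) + 1) / s)\<^sup>2 \<le> (?p x + ?p (x + 1)) * ((\<bar>real_of_int x\<bar> + 1) / s)\<^sup>2"
      unfolding e f using p s by (intro mult_mono power_mono divide_right_mono) (auto intro: less_imp_le)
    moreover have "g x \<le> ?p (-1 - x) * ((real_of_int (-1 - x) + 1) / s)\<^sup>2"
      unfolding sym[of x] using False by (intro upper) simp
    ultimately show ?thesis by linarith
  qed
qed

text \<open>Both bounds of order \<open>1 / s\<close> are second moments divided by
  \<open>s\<^sup>2\<close>: a full one for the upper bound, a truncated one for the lower.\<close>

lemma entropy_rate_Undirected_bounds:
  assumes s: "s > 0"
  shows "entropy_rate Undirected s > 0" "s \<ge> 8 \<Longrightarrow> entropy_rate Undirected s \<le> 3 / s"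
    "s \<ge> 8 \<Longrightarrow> entropy_rate Undirected s \<ge> 1 / (32 * s)"
proof -
  let ?p = "pmf (xi Undirected s)" and ?Q = "surprisal Undirected s" and ?E = "measure_pmf.expectation (xi Undirected s)"
  define g where "g x = (?p x - ?p (x + 1)) * (?Q (x + 1) - ?Q x)" for x
  have ig: "integrable (count_space UNIV) g" and H: "entropy_rate Undirected s = (\<integral>x. g x \<partial>count_space UNIV) / 2"
    using entropy_rate_Undirected[OF s] by (simp_all add: g_def[abs_def])
  note gb = dirichlet_term_bounds[OF s, folded g_def]
  have p: "?p y > 0" for y using pmf_xi_pos[of s y Undirected] s by simp
  have "g 1 > 0"
  proof -
    have "?p 1 * (1 / (s + 1))\<^sup>2 > 0" using p[of 1] s by simp
    thus ?thesis using gb(1)[of 1] by simp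
  qed
  hence "(\<integral>x. g x \<partial>count_space UNIV) \<noteq> 0"
    using integral_nonneg_eq_0_iff_AE[OF ig] gb(2) by (auto simp: AE_count_space)
  moreover have "(\<integral>x. g x \<partial>count_space UNIV) \<ge> 0"
    using gb(2) by (intro Bochner_Integration.integral_nonneg) auto
  ultimately show "entropy_rate Undirected s > 0" using H by simp
  assume s8: "s \<ge> 8"
  have pgy: "poly_growth (\<lambda>x. (real_of_int x) ^ n)" for n by (intro poly_growth_power poly_growth_id)
  have iy: "integrable (xi Undirected s) (\<lambda>x. (real_of_int x) ^ n)" for n using pgy s by auto
  have m2: "?E (\<lambda>x. (real_of_int x)\<^sup>2) = s" "?E (\<lambda>x. (real_of_int x) ^ 4) = 3 * s\<^sup>2 + s"
    using xi_central_moments[of s Undirected] s by simp_all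
  show "entropy_rate Undirected s \<le> 3 / s"
  proof -
    define f where "f x = ((\<bar>real_of_int x\<bar> + 1) / s)\<^sup>2" for x
    have pg: "poly_growth f" unfolding f_def[abs_def] divide_inverse
      by (intro poly_growth_power poly_growth_mult poly_growth_add poly_growth_abs poly_growth_id poly_growth_const)
    note i = integrable_xi_count[OF less_imp_le[OF s] pg, of Undirected 0, simplified] integrable_xi_count[OF less_imp_le[OF s] pg, of Undirected 1]
    have "(\<integral>x. g x \<partial>count_space UNIV) \<le> (\<integral>x. ?p x * f x + ?p (x + 1) * f x \<partial>count_space UNIV)"
      using ig i gb(3) by (intro integral_mono Bochner_Integration.integrable_add) (auto simp: f_def algebra_simps)
    also have "\<dots> = ?E f + ?E (\<lambda>x. f (x - 1))"
      using i expectation_xi_shift[of Undirected s 1 f] by (simp add: expectation_int_count_space(1))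
    also have "?E f + ?E (\<lambda>x. f (x - 1)) \<le> ?E (\<lambda>x. (4 * (real_of_int x)\<^sup>2 + 16) / s\<^sup>2)"
    proof -
      have int: "integrable (xi Undirected s) f" "integrable (xi Undirected s) (\<lambda>x. f (x - 1))"
        using pg poly_growth_shift[OF pg, of "-1"] s by auto
      have "f x + f (x - 1) \<le> (4 * (real_of_int x)\<^sup>2 + 16) / s\<^sup>2" for x
      proof -
        define a where "a = \<bar>real_of_int x\<bar>"
        have "f x \<le> ((a + 2) / s)\<^sup>2" unfolding f_def a_def using s by (intro power_mono divide_right_mono) auto
        moreover have "f (x - 1) \<le> ((a + 2) / s)\<^sup>2" unfolding f_def a_def using s by (intro power_mono divide_right_mono) auto
        ultimately have "f x + f (x - 1) \<le> 2 * (a + 2)\<^sup>2 / s\<^sup>2" by (simp add: power_divide)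
        also have "2 * (a + 2)\<^sup>2 \<le> 4 * a\<^sup>2 + 16"
          using sum_squares_bound[of a 2] by (simp add: power2_eq_square algebra_simps)
        hence "2 * (a + 2)\<^sup>2 / s\<^sup>2 \<le> (4 * a\<^sup>2 + 16) / s\<^sup>2" by (intro divide_right_mono) auto
        finally show ?thesis by (simp add: a_def)
      qed
      hence "?E (\<lambda>x. f x + f (x - 1)) \<le> ?E (\<lambda>x. (4 * (real_of_int x)\<^sup>2 + 16) / s\<^sup>2)"
        using int iy[of 2] by (intro integral_mono) auto
      thus ?thesis using int by simp
    qed
    also have "\<dots> = (4 * s + 16) / s\<^sup>2" using iy[of 2] m2 by simp
    also have "\<dots> \<le> (6 * s) / s\<^sup>2" using s8 by (intro divide_right_mono) auto
    also have "\<dots> = 6 / s" by (simp add: power2_eq_square)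
    finally show ?thesis unfolding H by simp
  qed
  show "entropy_rate Undirected s \<ge> 1 / (32 * s)"
  proof -
    \<comment> \<open>Only \<open>0 \<le> x \<le> s\<close> is kept, where
      \<open>x / (s + x) \<ge> x / (2 * s)\<close>; by symmetry this half carries at least half of
      the truncated second moment.\<close>
    define k where "k x = (if \<bar>x\<bar> \<le> s then x\<^sup>2 else 0)" for x :: real
    define k1 where "k1 x = (if 0 \<le> x \<and> x \<le> s then x\<^sup>2 else 0)" for x :: real
    have pgk: "poly_growth (\<lambda>x. k x)" "poly_growth (\<lambda>x. k1 x)" "poly_growth (\<lambda>x. k1 (- x))"
      by (rule poly_growth_le[OF pgy[of 2]], simp add: k_def k1_def)+
    have ik: "integrable (xi Undirected s) (\<lambda>x. k x)" "integrable (xi Undirected s) (\<lambda>x. k1 x)" "integrable (xi Undirected s) (\<lambda>x. k1 (- x))"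
      using pgk s by auto
    have msym: "map_pmf uminus (xi Undirected s) = xi Undirected s"
    proof (rule pmf_eqI)
      fix i
      have "pmf (map_pmf uminus (xi Undirected s)) (- (- i)) = pmf (xi Undirected s) (- i)"
        by (rule pmf_map_inj') (auto simp: inj_def)
      thus "pmf (map_pmf uminus (xi Undirected s)) i = pmf (xi Undirected s) i"
        using s pmf_xi_Undirected_minus[of s i] by simp
    qed
    have "?E (\<lambda>x. k1 (real_of_int x)) = ?E (\<lambda>x. k1 (- real_of_int x))"
      by (subst msym[symmetric], subst integral_map_pmf) simp
    moreover have "?E (\<lambda>x. k x) \<le> ?E (\<lambda>x. k1 (real_of_int x) + k1 (- real_of_int x))"
      using ik by (intro integral_mono) (auto simp: k_def k1_def)
    ultimately have k1: "?E (\<lambda>x. k1 x) \<ge> ?E (\<lambda>x. k x) / 2" using ik by simp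
    \<comment> \<open>The function \<open>x\<^sup>2 - x ^ 4 / s\<^sup>2\<close> is nonpositive
      beyond \<open>s\<close>, hence lies below the truncated square, and its mean is known
      exactly.\<close>
    have "?E (\<lambda>x. k x) \<ge> ?E (\<lambda>x. (real_of_int x)\<^sup>2 - (real_of_int x) ^ 4 / s\<^sup>2)"
    proof (rule integral_mono)
      fix x
      show "(real_of_int x)\<^sup>2 - real_of_int x ^ 4 / s\<^sup>2 \<le> k (real_of_int x)"
      proof (cases "\<bar>real_of_int x\<bar> \<le> s")
        case False
        have "s\<^sup>2 \<le> \<bar>real_of_int x\<bar>\<^sup>2" using False s by (intro power_mono) auto
        hence "(real_of_int x)\<^sup>2 * s\<^sup>2 \<le> (real_of_int x)\<^sup>2 * (real_of_int x)\<^sup>2" by (intro mult_left_mono) auto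
        hence "(real_of_int x)\<^sup>2 \<le> real_of_int x ^ 4 / s\<^sup>2" using s by (simp add: field_simps flip: power_add)
        thus ?thesis using False by (simp add: k_def)
      qed (simp add: k_def)
    qed (use iy ik in auto)
    also have "?E (\<lambda>x. (real_of_int x)\<^sup>2 - (real_of_int x) ^ 4 / s\<^sup>2) = s - (3 * s\<^sup>2 + s) / s\<^sup>2"
      using iy[of 2] iy[of 4] m2 by simp
    finally have k2: "?E (\<lambda>x. k x) \<ge> s - (3 * s\<^sup>2 + s) / s\<^sup>2" .
    have "(3 * s\<^sup>2 + s) / s\<^sup>2 = 3 + 1 / s" using s by (simp add: field_simps power2_eq_square)
    also have "\<dots> \<le> 3 + 1 / 8" using s8 by (intro add_mono divide_left_mono) auto
    finally have "(3 * s\<^sup>2 + s) / s\<^sup>2 \<le> 3 + 1 / 8" .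
    hence k3: "?E (\<lambda>x. k1 x) \<ge> s / 4" using k1 k2 s8 by linarith
    have "?E (\<lambda>x. k1 x / (4 * s\<^sup>2)) = (\<integral>x. ?p x * (k1 x / (4 * s\<^sup>2)) \<partial>count_space UNIV)"
      by (rule expectation_int_count_space(1))
    also have "\<dots> \<le> (\<integral>x. g x \<partial>count_space UNIV)"
    proof (rule integral_mono[OF _ ig])
      show "integrable (count_space UNIV) (\<lambda>x. ?p x * (k1 x / (4 * s\<^sup>2)))"
        using ik(2) by (simp flip: expectation_int_count_space(2))
      fix x
      show "?p x * (k1 x / (4 * s\<^sup>2)) \<le> g x"
      proof (cases "0 \<le> real_of_int x \<and> real_of_int x \<le> s")
        case True
        have "k1 x / (4 * s\<^sup>2) = (x / (2 * s))\<^sup>2" using True by (simp add: k1_def power_divide power_mult_distrib)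
        also have "\<dots> \<le> (x / (s + x))\<^sup>2" using True s by (intro power_mono divide_left_mono) auto
        finally have "?p x * (k1 x / (4 * s\<^sup>2)) \<le> ?p x * (x / (s + x))\<^sup>2" by (intro mult_left_mono) auto
        with gb(1)[of x] True show ?thesis by simp
      qed (use gb(2)[of x] in \<open>auto simp: k1_def\<close>)
    qed
    finally have "(s / 4) / (4 * s\<^sup>2) \<le> (\<integral>x. g x \<partial>count_space UNIV)"
      using k3 divide_right_mono[OF k3, of "4 * s\<^sup>2"] by simp
    thus ?thesis unfolding H using s by (simp add: power2_eq_square)
  qed
qed

lemma entropy_rate_pos: "s > 0 \<Longrightarrow> entropy_rate dir s > 0"
  using entropy_rate_Directed_bounds(1)[of s] entropy_rate_Undirected_bounds(1)[of s] by (cases dir) auto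

lemma entropy_rate_bounds:
  assumes "s \<ge> 8"
  shows "1 / (32 * s) \<le> entropy_rate dir s" "entropy_rate dir s \<le> 3 / s"
proof -
  have "1 / (32 * s) \<le> 1 / (16 * s)" "1 / s \<le> 3 / s" using assms by (auto intro!: divide_left_mono divide_right_mono)
  thus "1 / (32 * s) \<le> entropy_rate dir s" "entropy_rate dir s \<le> 3 / s"
    using entropy_rate_Directed_bounds(2,3)[of s] entropy_rate_Undirected_bounds(2,3)[of s] assms
    by (cases dir; simp)+
qed

lemma entropy1_strict_mono:
  assumes "0 \<le> s" "s < s'"
  shows "entropy1 dir s < entropy1 dir s'"
proof -
  have pos: "entropy1 dir a < entropy1 dir b" if "0 < a" "a < b" for a b
  proof (rule DERIV_pos_imp_increasing[OF that(2)])
    fix x assume "a \<le> x" "x \<le> b"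
    thus "\<exists>y. (entropy1 dir has_real_derivative y) (at x) \<and> 0 < y"
      using entropy1_deriv[of x dir] entropy_rate_pos[of x dir] that by auto
  qed
  show ?thesis
  proof (cases "s = 0")
    case True
    with pos[of "s' / 2" s'] entropy1_nonneg[of dir "s' / 2"] assms show ?thesis by simp
  qed (use pos assms in auto)
qed

text \<open>Integrates the bounds on the rate by comparing the entropy with multiples of
  \<open>ln s\<close>.\<close>

lemma entropy1_bilipschitz:
  assumes "8 \<le> s" "s \<le> s'"
  shows "ln (s' / s) / 32 \<le> entropy1 dir s' - entropy1 dir s" "entropy1 dir s' - entropy1 dir s \<le> 3 * ln (s' / s)"
proof -
  have "entropy1 dir s - ln s / 32 \<le> entropy1 dir s' - ln s' / 32"
  proof (rule DERIV_nonneg_imp_nondecreasing[OF assms(2)])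
    fix x assume x: "s \<le> x" "x \<le> s'"
    have "((\<lambda>x. entropy1 dir x - ln x / 32) has_field_derivative (entropy_rate dir x - 1 / x / 32)) (at x)"
      using x assms by (auto intro!: derivative_eq_intros entropy1_deriv)
    moreover have "entropy_rate dir x - 1 / x / 32 \<ge> 0" using entropy_rate_bounds(1)[of x dir] x assms by simp
    ultimately show "\<exists>y. ((\<lambda>x. entropy1 dir x - ln x / 32) has_real_derivative y) (at x) \<and> 0 \<le> y" by blast
  qed
  thus "ln (s' / s) / 32 \<le> entropy1 dir s' - entropy1 dir s" using assms by (simp add: ln_div field_simps)
  have "3 * ln s - entropy1 dir s \<le> 3 * ln s' - entropy1 dir s'"
  proof (rule DERIV_nonneg_imp_nondecreasing[OF assms(2)])
    fix x assume x: "s \<le> x" "x \<le> s'"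
    have "((\<lambda>x. 3 * ln x - entropy1 dir x) has_field_derivative (3 * (1 / x) - entropy_rate dir x)) (at x)"
      using x assms by (auto intro!: derivative_eq_intros entropy1_deriv)
    moreover have "3 * (1 / x) - entropy_rate dir x \<ge> 0" using entropy_rate_bounds(2)[of x dir] x assms by simp
    ultimately show "\<exists>y. ((\<lambda>x. 3 * ln x - entropy1 dir x) has_real_derivative y) (at x) \<and> 0 \<le> y" by blast
  qed
  thus "entropy1 dir s' - entropy1 dir s \<le> 3 * ln (s' / s)" using assms by (simp add: ln_div algebra_simps)
qed

lemma isCont_entropy1: "s > 0 \<Longrightarrow> isCont (entropy1 dir) s"
  using entropy1_deriv DERIV_isCont by blast

section \<open>Explicit size of the entropy\<close>

text \<open>No weight exceeds \<open>2 / sqrt s\<close>, so the bound already holds pointwise for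
  the surprisal.\<close>

lemma entropy1_ge:
  assumes s: "s \<ge> 100"
  shows "entropy1 dir s \<ge> ln s / 2 - ln 2"
proof -
  have s0: "s > 0" using s by simp
  have "ln s / 2 - ln 2 = measure_pmf.expectation (xi dir s) (\<lambda>_. ln s / 2 - ln 2)" by simp
  also have "\<dots> \<le> entropy1 dir s"
    unfolding entropy1_def
  proof (rule integral_mono_AE)
    show "AE x in measure_pmf (xi dir s). ln s / 2 - ln 2 \<le> surprisal dir s x"
      unfolding AE_measure_pmf_iff set_pmf_xi[OF s0]
    proof
      fix x assume "x \<in> walk_support dir"
      hence p: "pmf (xi dir s) x > 0" using pmf_xi_pos[OF s0] by blast
      hence "ln (pmf (xi dir s) x) \<le> ln (2 / sqrt s)" using pmf_xi_le[OF s, of dir x] s0 by (subst ln_le_cancel_iff) auto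
      also have "\<dots> = ln 2 - ln s / 2" using s0 by (simp add: ln_div ln_sqrt)
      finally show "ln s / 2 - ln 2 \<le> surprisal dir s x" by (simp add: surprisal_def)
    qed
  qed (use s0 in auto)
  finally show ?thesis .
qed

lemma sum_geometric_int_le:
  fixes q :: real
  assumes q: "0 < q" "q < 1" and A: "finite A"
  shows "(\<Sum>x\<in>A. q ^ nat \<bar>x\<bar>) \<le> (1 + q) / (1 - q)"
proof -
  obtain K :: nat where K: "A \<subseteq> {- int K..int K}"
  proof (rule that[of "nat (Max ((\<lambda>x. \<bar>x\<bar>) ` insert 0 A))"], rule subsetI)
    fix x assume "x \<in> A"
    hence "\<bar>x\<bar> \<le> Max ((\<lambda>x. \<bar>x\<bar>) ` insert 0 A)" using A by (intro Max_ge) auto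
    thus "x \<in> {- int (nat (Max ((\<lambda>x. \<bar>x\<bar>) ` insert 0 A)))..int (nat (Max ((\<lambda>x. \<bar>x\<bar>) ` insert 0 A)))}" by auto
  qed
  have geo: "(\<Sum>k\<le>K. q ^ k) \<le> 1 / (1 - q)"
    using q sum_le_suminf[OF summable_geometric, of q "{..K}"] by (simp add: suminf_geometric)
  have "(\<Sum>x\<in>A. q ^ nat \<bar>x\<bar>) \<le> (\<Sum>x\<in>{- int K..int K}. q ^ nat \<bar>x\<bar>)"
    using q K by (intro sum_mono2) auto
  also have "\<dots> \<le> (\<Sum>x\<in>int ` {..K} \<union> (\<lambda>k. - int k - 1) ` {..K}. q ^ nat \<bar>x\<bar>)"
  proof (rule sum_mono2)
    show "{- int K..int K} \<subseteq> int ` {..K} \<union> (\<lambda>k. - int k - 1) ` {..K}"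
    proof
      fix x assume x: "x \<in> {- int K..int K}"
      show "x \<in> int ` {..K} \<union> (\<lambda>k. - int k - 1) ` {..K}"
      proof (cases "x \<ge> 0")
        case True
        thus ?thesis using x by (intro UnI1 image_eqI[of _ _ "nat x"]) auto
      next
        case False
        thus ?thesis using x by (intro UnI2 image_eqI[of _ _ "nat (- x - 1)"]) auto
      qed
    qed
  qed (use q in auto)
  also have "\<dots> = (\<Sum>k\<le>K. q ^ k) + (\<Sum>k\<le>K. q * q ^ k)"
    by (subst sum.union_disjoint) (auto simp: sum.reindex inj_on_def nat_add_distrib intro!: sum.cong arg_cong2[of _ _ _ _ "(+)"])
  also have "\<dots> \<le> 1 / (1 - q) + q * (1 / (1 - q))"
    unfolding sum_distrib_left[symmetric] using geo q by (intro add_mono mult_left_mono) auto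
  finally show ?thesis by (simp add: add_divide_distrib)
qed

lemma integrable_geometric_int:
  fixes q :: real
  assumes q: "0 < q" "q < 1"
  shows "integrable (count_space UNIV) (\<lambda>x::int. q ^ nat \<bar>x - c\<bar>)"
    "(\<integral>x. q ^ nat \<bar>x - c\<bar> \<partial>count_space UNIV) \<le> (1 + q) / (1 - q)"
proof -
  define f where "f n = q ^ nat \<bar>int_decode n\<bar>" for n
  have le: "(\<Sum>i<n. f i) \<le> (1 + q) / (1 - q)" for n
    using sum_geometric_int_le[OF q, of "int_decode ` {..<n}"] by (simp add: sum.reindex inj_int_decode f_def)
  have sm: "summable f" by (rule summableI_nonneg_bounded[OF _ le]) (use q in \<open>simp add: f_def\<close>)
  have "integrable (count_space UNIV) f"
    unfolding integrable_count_space_nat_iff using sm q by (simp add: f_def[abs_def])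
  hence i: "integrable (count_space UNIV) (\<lambda>x::int. q ^ nat \<bar>x\<bar>)"
    using integrable_bij_count_space[OF bij_int_decode, of "\<lambda>x. q ^ nat \<bar>x\<bar>"]
    unfolding f_def[abs_def] by simp
  have "(\<integral>x. q ^ nat \<bar>x\<bar> \<partial>count_space (UNIV :: int set)) = suminf f"
    using count_space_int_sums[OF i] by (simp add: f_def[abs_def] sums_iff)
  also have "\<dots> \<le> (1 + q) / (1 - q)" by (rule suminf_le_const[OF sm le])
  finally have b: "(\<integral>x. q ^ nat \<bar>x\<bar> \<partial>count_space (UNIV :: int set)) \<le> (1 + q) / (1 - q)" .
  show "integrable (count_space UNIV) (\<lambda>x::int. q ^ nat \<bar>x - c\<bar>)"
    "(\<integral>x. q ^ nat \<bar>x - c\<bar> \<partial>count_space UNIV) \<le> (1 + q) / (1 - q)"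
    using i b integral_shift_int[of "\<lambda>x. q ^ nat \<bar>x\<bar>" "- c"] by simp_all
qed

text \<open>Gibbs' inequality against a two-sided geometric law of width \<open>sqrt s\<close>.\<close>

lemma entropy1_le:
  assumes s: "s \<ge> 100"
  shows "entropy1 dir s \<le> ln s / 2 + 37/20"
proof -
  let ?E = "measure_pmf.expectation (xi dir s)"
  define M where "M = mode dir s"
  \<comment> \<open>This decay per step gives the reference law the width \<open>sqrt s\<close>; its
    total mass before normalisation is then at most \<open>W\<close>.\<close>
  define q where "q = exp (- 1 / sqrt s)"
  define w where "w x = q ^ nat \<bar>x - M\<bar>" for x
  define W where "W = 1 + 2 * sqrt s"
  have s0: "s > 0" and s10: "sqrt s \<ge> 10" using s real_sqrt_le_mono[of 100 s] by auto
  have q: "0 < q" "q < 1" using s0 by (auto simp: q_def)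
  have lnw: "ln (w x) = - (\<bar>real_of_int x - M\<bar> / sqrt s)" for x
    using q by (simp add: w_def ln_realpow) (simp add: q_def)
  have w0: "w x > 0" for x using q by (simp add: w_def)
  have W0: "W > 0" using s10 by (simp add: W_def)
  note iw = integrable_geometric_int[OF q, of M, folded w_def]
  have "(1 + q) / (1 - q) \<le> W"
  proof -
    have "1 + 1 / sqrt s \<le> exp (1 / sqrt s)" by (rule exp_ge_add_one_self)
    hence "q * (1 + 1 / sqrt s) \<le> q * exp (1 / sqrt s)" using q by (intro mult_left_mono) auto
    also have "\<dots> = 1" by (simp add: q_def flip: exp_add)
    finally have "q * (1 + 1 / sqrt s) * sqrt s \<le> 1 * sqrt s" using s0 by (intro mult_right_mono) auto
    moreover have "q * (1 + 1 / sqrt s) * sqrt s = q * (sqrt s + 1)" using s0 by (simp add: algebra_simps)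
    ultimately have "q * (sqrt s + 1) \<le> sqrt s" by simp
    hence "1 + q \<le> W * (1 - q)" by (simp add: W_def algebra_simps)
    thus ?thesis using q by (simp add: divide_le_eq)
  qed
  hence sw: "(\<integral>x. w x \<partial>count_space UNIV) \<le> W" using iw(2) by simp
  \<comment> \<open>The ratio of the normalised reference weights to the law. Its mean is at most 1,
    so \<open>ln (h x) \<le> h x - 1\<close> contributes nothing positive in the mean.\<close>
  define h where "h x = w x / (W * pmf (xi dir s) x)" for x
  have ph: "pmf (xi dir s) x * h x = (if x \<in> walk_support dir then w x / W else 0)" for x
    using pmf_xi_pos[OF s0, of x dir] pmf_xi_eq_0[of s x dir] s0 by (auto simp: h_def)
  have iph: "integrable (count_space UNIV) (\<lambda>x. pmf (xi dir s) x * h x)"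
    by (rule Bochner_Integration.integrable_bound[of _ "\<lambda>x. w x / W"]) (use iw(1) w0 W0 in \<open>auto simp: ph less_imp_le\<close>)
  have ih: "integrable (xi dir s) h" using iph by (simp add: expectation_int_count_space(2))
  have "?E h = (\<integral>x. pmf (xi dir s) x * h x \<partial>count_space UNIV)" by (rule expectation_int_count_space(1))
  also have "\<dots> \<le> (\<integral>x. w x / W \<partial>count_space UNIV)"
    using iph iw(1) w0 W0 by (intro integral_mono) (auto simp: ph less_imp_le)
  also have "\<dots> \<le> 1" using sw W0 by simp
  finally have Eh: "?E h \<le> 1" .
  define y where "y x = real_of_int x - drift dir s" for x
  have iy: "integrable (xi dir s) (\<lambda>x. (y x)\<^sup>2)"
    unfolding y_def using s0 by (intro integrable_xi poly_growth_power poly_growth_diff) auto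
  have Ey: "?E (\<lambda>x. (y x)\<^sup>2) = s" using xi_central_moments(2)[of s dir] s0 by (simp add: y_def)
  \<comment> \<open>The inequality between arithmetic and geometric means bounds
    \<open>\<bar>y x\<bar>\<close> by a polynomial of known mean; the summand 1 pays for the
    distance from the mode to the mean.\<close>
  define u where "u x = ((y x)\<^sup>2 / sqrt s + sqrt s) / 2 + 1" for x
  have iu: "integrable (xi dir s) u" unfolding u_def[abs_def] using iy by auto
  have "?E u = (s / sqrt s + sqrt s) / 2 + 1" unfolding u_def[abs_def] using iy Ey by simp
  hence Eu: "?E u = sqrt s + 1" using s0 by (simp add: real_div_sqrt)
  have u: "\<bar>real_of_int x - M\<bar> \<le> u x" for x
  proof -
    have "\<bar>y x\<bar> * sqrt s \<le> ((y x)\<^sup>2 + s) / 2"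
      using sum_squares_bound[of "\<bar>y x\<bar>" "sqrt s"] s0 by simp
    hence "\<bar>y x\<bar> \<le> ((y x)\<^sup>2 + s) / 2 / sqrt s" using s10 s0 by (subst pos_le_divide_eq) auto
    also have "\<dots> = ((y x)\<^sup>2 / sqrt s + s / sqrt s) / 2" by (simp add: add_divide_distrib mult.commute)
    also have "s / sqrt s = sqrt s" using s0 by (simp add: real_div_sqrt)
    finally have "\<bar>y x\<bar> + 1 \<le> u x" by (simp add: u_def)
    moreover have "\<bar>real_of_int x - M\<bar> \<le> \<bar>y x\<bar> + 1" using mode_drift[of s dir] s0 by (simp add: y_def M_def)
    ultimately show ?thesis by linarith
  qed
  have "?E (\<lambda>x. surprisal dir s x) \<le> ?E (\<lambda>x. u x / sqrt s + ln W + (h x - 1))"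
  proof (rule integral_mono_AE)
    show "AE x in measure_pmf (xi dir s). surprisal dir s x \<le> u x / sqrt s + ln W + (h x - 1)"
      unfolding AE_measure_pmf_iff set_pmf_xi[OF s0]
    proof
      fix x assume "x \<in> walk_support dir"
      hence p: "pmf (xi dir s) x > 0" by (rule pmf_xi_pos[OF s0])
      have "ln (h x) = ln (w x) - ln W + surprisal dir s x"
        using p w0[of x] W0 by (simp add: h_def ln_div ln_mult_pos surprisal_def)
      moreover have "ln (h x) \<le> h x - 1" using p w0[of x] W0 by (intro ln_le_minus_one) (simp add: h_def)
      moreover have "\<bar>real_of_int x - M\<bar> / sqrt s \<le> u x / sqrt s" using u s0 by (intro divide_right_mono) auto
      ultimately show "surprisal dir s x \<le> u x / sqrt s + ln W + (h x - 1)" using lnw[of x] by linarith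
    qed
  qed (use s0 iu ih in auto)
  also have "\<dots> = ?E u / sqrt s + ln W + (?E h - 1)" using iu ih by simp
  also have "\<dots> \<le> (sqrt s + 1) / sqrt s + ln W" using Eh Eu by simp
  also have "(sqrt s + 1) / sqrt s = 1 + 1 / sqrt s" using s0 by (simp add: add_divide_distrib)
  also have "\<dots> \<le> 11/10" using s10 s0 by (simp add: divide_le_eq)
  also have "ln W = ln (2 * sqrt s) + ln (1 + 1 / (2 * sqrt s))"
    using s10 s0 by (subst ln_mult_pos[symmetric]) (auto simp: W_def field_simps add_pos_pos)
  also have "\<dots> \<le> (25/36 + ln s / 2) + 1 / 20"
  proof (intro add_mono)
    have "ln (2 * sqrt s) = ln 2 + ln s / 2" using s0 by (simp add: ln_mult_pos ln_sqrt)
    thus "ln (2 * sqrt s) \<le> 25/36 + ln s / 2" using ln2_le_25_over_36 by simp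
    have "ln (1 + 1 / (2 * sqrt s)) \<le> 1 / (2 * sqrt s)" using s0 by (intro ln_add_one_self_le_self) auto
    also have "\<dots> \<le> 1 / 20" using s10 s0 by (intro divide_left_mono) auto
    finally show "ln (1 + 1 / (2 * sqrt s)) \<le> 1 / 20" .
  qed
  \<comment> \<open>The constant is \<open>11/10 + 25/36 + 1/20 < 37/20\<close>.\<close>
  finally show ?thesis by (simp add: entropy1_def)
qed

lemma exp_le_quadratic:
  fixes x :: real
  assumes "\<bar>x\<bar> \<le> 1"
  shows "exp x \<le> 1 + x + x\<^sup>2"
proof (cases "x \<ge> 0")
  case True
  thus ?thesis using exp_bound[of x] assms by simp
next
  case False
  define t where "t = - x"
  have t: "0 < t" "t \<le> 1" using False assms by (auto simp: t_def)
  have a: "1 + t + t\<^sup>2 / 2 \<le> exp t" using exp_lower_Taylor_quadratic[of t] t by simp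
  have b: "1 - t + t\<^sup>2 > 0" using t by (smt (verit) zero_less_power2)
  have "(1 - t + t\<^sup>2) * (1 + t + t\<^sup>2 / 2) = 1 + t\<^sup>2 / 2 * (1 + t + t\<^sup>2)"
    by (simp add: power2_eq_square field_simps)
  also have "\<dots> \<ge> 1" using t by simp
  finally have "1 \<le> (1 - t + t\<^sup>2) * (1 + t + t\<^sup>2 / 2)" .
  also have "\<dots> \<le> (1 - t + t\<^sup>2) * exp t" using a b by (intro mult_left_mono) auto
  finally have "exp (- t) \<le> 1 - t + t\<^sup>2" by (simp add: exp_minus field_simps)
  thus ?thesis by (simp add: t_def)
qed

section \<open>Fluctuations of the surprisal\<close>

definition zscore :: "orientation \<Rightarrow> real \<Rightarrow> int \<Rightarrow> real" where
  "zscore dir s x = (x - drift dir s) / sqrt s"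

lemma poly_growth_zscore [simp]: "poly_growth (zscore dir s)"
  unfolding zscore_def[abs_def] divide_inverse by (intro poly_growth_mult poly_growth_diff) auto

text \<open>A sub-Gaussian bound from
  \<open>exp \<theta> \<le> 1 + \<theta> + \<theta>\<^sup>2\<close>. This needs
  \<open>\<bar>\<theta>\<bar> \<le> 1\<close>, hence the restriction
  \<open>a \<le> sqrt s\<close>.\<close>

lemma xi_exp_abs_zscore:
  assumes s: "s > 0" and a: "0 \<le> a" "a \<le> sqrt s"
  shows "integrable (xi dir s) (\<lambda>x. exp (a * \<bar>zscore dir s x\<bar>))"
    "measure_pmf.expectation (xi dir s) (\<lambda>x. exp (a * \<bar>zscore dir s x\<bar>)) \<le> 2 * exp (a\<^sup>2)"
proof -
  let ?E = "measure_pmf.expectation (xi dir s)"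
  have one: "integrable (xi dir s) (\<lambda>x. exp (b * zscore dir s x)) \<and> ?E (\<lambda>x. exp (b * zscore dir s x)) \<le> exp (a\<^sup>2)"
    if b: "b = a \<or> b = - a" for b
  proof -
    define \<theta> where "\<theta> = b / sqrt s"
    have \<theta>: "\<bar>\<theta>\<bar> \<le> 1" "s * \<theta>\<^sup>2 = a\<^sup>2" using b a s by (auto simp: \<theta>_def power_divide)
    have e: "(\<lambda>x. exp (b * zscore dir s x)) = (\<lambda>x. exp (- \<theta> * drift dir s) * exp (\<theta> * x))"
      using s by (simp add: fun_eq_iff zscore_def \<theta>_def field_simps flip: exp_add)
    have i: "integrable (xi dir s) (\<lambda>x. exp (b * zscore dir s x))"
      unfolding e using xi_mgf(1)[of s dir \<theta>] s by simp
    have "?E (\<lambda>x. exp (b * zscore dir s x)) = exp (- \<theta> * drift dir s) * exp (s * (up_prob dir * (exp \<theta> - 1) + down_prob dir * (exp (- \<theta>) - 1)))"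
      unfolding e using xi_mgf(2)[of s dir \<theta>] s by simp
    also have "\<dots> = exp (s * (up_prob dir * (exp \<theta> - 1 - \<theta>) + down_prob dir * (exp (- \<theta>) - 1 + \<theta>)))"
      by (simp add: drift_def algebra_simps flip: exp_add)
    also have "\<dots> \<le> exp (s * (up_prob dir * \<theta>\<^sup>2 + down_prob dir * \<theta>\<^sup>2))"
      using exp_le_quadratic[of \<theta>] exp_le_quadratic[of "- \<theta>"] \<theta> s
      by (auto intro!: mult_left_mono add_mono)
    also have "up_prob dir * \<theta>\<^sup>2 + down_prob dir * \<theta>\<^sup>2 = \<theta>\<^sup>2" by (simp only: distrib_right[symmetric] up_down_simps mult_1)
    finally show ?thesis using i \<theta>(2) by simp
  qed
  note i = one[of a] one[of "- a"]
  have le: "exp (a * \<bar>zscore dir s x\<bar>) \<le> exp (a * zscore dir s x) + exp (- a * zscore dir s x)" for x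
    using exp_abs_le[of "a * zscore dir s x"] a by (simp add: abs_mult)
  show int: "integrable (xi dir s) (\<lambda>x. exp (a * \<bar>zscore dir s x\<bar>))"
    by (rule Bochner_Integration.integrable_bound[of _ "\<lambda>x. exp (a * zscore dir s x) + exp (- a * zscore dir s x)"])
      (use i le in \<open>auto intro!: AE_I2\<close>)
  have "?E (\<lambda>x. exp (a * \<bar>zscore dir s x\<bar>)) \<le> ?E (\<lambda>x. exp (a * zscore dir s x) + exp (- a * zscore dir s x))"
    using i int le by (intro integral_mono) auto
  also have "\<dots> \<le> 2 * exp (a\<^sup>2)" using i by simp
  finally show "?E (\<lambda>x. exp (a * \<bar>zscore dir s x\<bar>)) \<le> 2 * exp (a\<^sup>2)" .
qed

text \<open>Markov's inequality at exponent 2. Any exponent above 1 lets a union bound over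
  \<open>k\<close> coordinates at \<open>r = ln k\<close> tend to 0.\<close>

lemma prob_zscore_gt_le:
  assumes s: "s \<ge> 4"
  shows "measure_pmf.prob (xi dir s) {x. \<bar>zscore dir s x\<bar> > r} \<le> 2 * exp 4 * exp (- 2 * r)"
proof -
  have "sqrt s \<ge> 2" using s real_sqrt_le_mono[of 4 s] by simp
  hence b: "integrable (xi dir s) (\<lambda>x. exp (2 * \<bar>zscore dir s x\<bar>))"
    "measure_pmf.expectation (xi dir s) (\<lambda>x. exp (2 * \<bar>zscore dir s x\<bar>)) \<le> 2 * exp (2\<^sup>2)"
    using xi_exp_abs_zscore[of s 2 dir] s by auto
  have "measure_pmf.prob (xi dir s) {x. \<bar>zscore dir s x\<bar> > r} = (\<integral>x. indicator {x. \<bar>zscore dir s x\<bar> > r} x \<partial>measure_pmf (xi dir s))"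
    by simp
  also have "\<dots> \<le> (\<integral>x. exp (- 2 * r) * exp (2 * \<bar>zscore dir s x\<bar>) \<partial>measure_pmf (xi dir s))"
  proof (rule integral_mono)
    fix x
    show "indicator {x. \<bar>zscore dir s x\<bar> > r} x \<le> exp (- 2 * r) * exp (2 * \<bar>zscore dir s x\<bar>)"
      unfolding exp_add[symmetric] by (auto simp: indicator_def)
    show "integrable (xi dir s) (indicator {x. \<bar>zscore dir s x\<bar> > r} :: int \<Rightarrow> real)"
      by (rule measure_pmf.integrable_const_bound[where B = 1]) (auto simp: indicator_def)
  qed (use b(1) in auto)
  also have "\<dots> \<le> exp (- 2 * r) * (2 * exp (2\<^sup>2))" using b by (simp)
  finally show ?thesis by (simp add: mult_ac)
qed

text \<open>Comes from \<open>(1 + z) ^ n \<le> fact n * exp (1 + z)\<close> and the exponential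
  moment at \<open>a = 1\<close>; it does not depend on \<open>s\<close>.\<close>

definition zmoment_bound :: "nat \<Rightarrow> real" where
  "zmoment_bound n = 2 * fact n * exp 2"

lemma expectation_zscore_power_le:
  assumes s: "s \<ge> 1"
  shows "measure_pmf.expectation (xi dir s) (\<lambda>x. (1 + \<bar>zscore dir s x\<bar>) ^ n) \<le> zmoment_bound n"
proof -
  have b: "integrable (xi dir s) (\<lambda>x. exp (1 * \<bar>zscore dir s x\<bar>))"
    "measure_pmf.expectation (xi dir s) (\<lambda>x. exp (1 * \<bar>zscore dir s x\<bar>)) \<le> 2 * exp (1\<^sup>2)"
    using xi_exp_abs_zscore[of s 1 dir] s by simp_all
  have "measure_pmf.expectation (xi dir s) (\<lambda>x. (1 + \<bar>zscore dir s x\<bar>) ^ n) \<le>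
     measure_pmf.expectation (xi dir s) (\<lambda>x. (fact n * exp 1) * exp (1 * \<bar>zscore dir s x\<bar>))"
  proof (rule integral_mono)
    show "integrable (xi dir s) (\<lambda>x. (1 + \<bar>zscore dir s x\<bar>) ^ n)"
      using s by (intro integrable_xi poly_growth_power poly_growth_add poly_growth_abs) auto
    show "integrable (xi dir s) (\<lambda>x. (fact n * exp 1) * exp (1 * \<bar>zscore dir s x\<bar>))" using b(1) by simp
    fix x show "(1 + \<bar>zscore dir s x\<bar>) ^ n \<le> (fact n * exp 1) * exp (1 * \<bar>zscore dir s x\<bar>)"
      using power_le_fact_exp[of "1 + \<bar>zscore dir s x\<bar>" n] by (simp add: exp_add mult_ac)
  qed
  also have "\<dots> \<le> (fact n * exp 1) * (2 * exp 1)" using b by (simp add: mult_left_mono)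
  also have "\<dots> = zmoment_bound n"
  proof -
    have "exp 1 * exp 1 = exp (2::real)" by (simp flip: exp_add)
    thus ?thesis by (simp add: zmoment_bound_def mult_ac)
  qed
  finally show ?thesis .
qed

section \<open>Quadratic expansion of the surprisal\<close>

text \<open>Increments close to \<open>i / s\<close> sum to \<open>n\<^sup>2 / (2 * s)\<close>. The
  linear error is due to \<open>i\<close> against \<open>i + 1\<close>, the cubic and quintic errors
  to the sums of the squares and fourth powers in the one-step bounds.\<close>

lemma quadratic_of_steps:
  fixes D :: "nat \<Rightarrow> real" and s :: real
  assumes s: "s > 0" and D0: "D 0 = 0"
    and lo: "\<And>i. i < n \<Longrightarrow> D (Suc i) - D i \<ge> ln (1 + real i / s)"
    and hi: "\<And>i. i < n \<Longrightarrow> D (Suc i) - D i \<le> (real i + 1) / s + 2 * (real i + 1)^2 / s^2 + 16 * (real i + 1)^4 / s^3"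
  shows "\<bar>D n - real n^2 / (2 * s)\<bar> \<le> real n / (2 * s) + 2 * real n^3 / s^2 + 16 * real n^5 / s^3"
proof -
  have "D j \<ge> real j^2 / (2 * s) - real j / (2 * s) - 2 * real j^3 / s^2 \<and>
    D j \<le> real j^2 / (2 * s) + real j / (2 * s) + 2 * real j^3 / s^2 + 16 * real j^5 / s^3" if "j \<le> n" for j
    using that
  proof (induction j)
    case (Suc j)
    have u: "real j / s \<ge> 0" using s by simp
    have "ln (1 + real j / s) \<ge> real j / s - (real j / s)^2"
    proof (cases "real j / s \<le> 1")
      case True
      thus ?thesis using ln_one_plus_pos_lower_bound[OF u] by simp
    next
      case False
      hence "real j / s * 1 \<le> real j / s * (real j / s)" using u by (intro mult_left_mono) auto
      moreover have "ln (1 + real j / s) \<ge> 0" using u by (intro ln_ge_zero) simp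
      ultimately show ?thesis by (simp add: power2_eq_square)
    qed
    moreover have "(real j / s)^2 = real j^2 / s^2" by (simp add: power_divide)
    ultimately have l: "D (Suc j) \<ge> D j + real j / s - real j^2 / s^2" using lo[of j] Suc.prems by simp
    define x where "x = real j"
    have x: "x \<ge> 0" and Sx: "real (Suc j) = x + 1" by (simp_all add: x_def)
    \<comment> \<open>These inequalities absorb the error of one step when the cubic and quintic
      bounds pass from \<open>j\<close> to \<open>j + 1\<close>.\<close>
    have 3: "(x + 1)^3 \<ge> x^3 + x^2" "(x + 1)^3 \<ge> x^3 + (x + 1)^2"
      using x by (simp_all add: power3_eq_cube power2_eq_square algebra_simps)
    have 5: "(x + 1)^5 \<ge> x^5 + (x + 1)^4"
    proof -
      have "x^5 \<le> x * (x + 1)^4" using x power_mono[of x "x + 1" 4] by (simp add: eval_nat_numeral mult_left_mono)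
      moreover have "(x + 1)^5 = x * (x + 1)^4 + (x + 1)^4" by (simp add: eval_nat_numeral algebra_simps)
      ultimately show ?thesis by simp
    qed
    have q: "(x + 1)^2 / (2 * s) = x^2 / (2 * s) + x / (2 * s) + x / (2 * s) + 1 / (2 * s)"
      "(x + 1) / (2 * s) = x / (2 * s) + 1 / (2 * s)" "x / s = x / (2 * s) + x / (2 * s)" "(x + 1) / s = x / (2 * s) + x / (2 * s) + 1 / (2 * s) + 1 / (2 * s)"
      using s by (simp_all add: field_simps power2_eq_square)
    have "2 * x^3 + x^2 \<le> 2 * (x + 1)^3" "2 * x^3 + 2 * (x + 1)^2 \<le> 2 * (x + 1)^3"
      using 3 zero_le_power2[of x] by linarith+
    hence d3: "2 * (x + 1)^3 / s^2 \<ge> 2 * x^3 / s^2 + x^2 / s^2" "2 * (x + 1)^3 / s^2 \<ge> 2 * x^3 / s^2 + 2 * (x + 1)^2 / s^2"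
      unfolding add_divide_distrib[symmetric] by (simp_all only: divide_right_mono zero_le_power2)
    have d5: "16 * (x + 1)^5 / s^3 \<ge> 16 * x^5 / s^3 + 16 * (x + 1)^4 / s^3"
      unfolding add_divide_distrib[symmetric] using 5 s by (intro divide_right_mono) auto
    have h: "D (Suc j) \<le> D j + (x + 1) / s + 2 * (x + 1)^2 / s^2 + 16 * (x + 1)^4 / s^3"
      using hi[of j] Suc.prems by (simp add: x_def)
    have IH: "D j \<ge> x^2 / (2 * s) - x / (2 * s) - 2 * x^3 / s^2" "D j \<le> x^2 / (2 * s) + x / (2 * s) + 2 * x^3 / s^2 + 16 * x^5 / s^3"
      using Suc by (simp_all add: x_def)
    have l': "D (Suc j) \<ge> D j + x / s - x^2 / s^2" using l by (simp add: x_def)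
    have "1 / (2 * s) \<ge> 0" using s by simp
    thus ?case unfolding Sx using l' h IH q d3 d5 by linarith
  qed (simp add: D0)
  from this[of n] have "D n - real n^2 / (2 * s) \<ge> - (real n / (2 * s)) - 2 * real n^3 / s^2"
    "D n - real n^2 / (2 * s) \<le> real n / (2 * s) + 2 * real n^3 / s^2 + 16 * real n^5 / s^3" by auto
  moreover have "0 \<le> 16 * real n^5 / s^3" using s by simp
  ultimately show ?thesis unfolding abs_le_iff by linarith
qed

text \<open>In the directed case the increment is \<open>- ln w\<close>, and near the origin
  \<open>w\<close> can be as small as \<open>1 / s\<close>, beyond the reach of a Taylor bound.
  There \<open>w < 1/2\<close> forces \<open>v = (j + 1) / s > 1/2\<close>, so
  \<open>- ln w \<le> ln s \<le> s \<le> 16 * s * v ^ 4\<close>; this is the origin of the quartic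
  term.\<close>

lemma surprisal_step_left_le:
  assumes s: "s \<ge> 1" and j: "mode dir s - int j - 1 \<in> walk_support dir"
  shows "surprisal dir s (mode dir s - int j - 1) - surprisal dir s (mode dir s - int j) \<le>
    (real j + 1) / s + 2 * (real j + 1)^2 / s^2 + 16 * (real j + 1)^4 / s^3"
proof (cases dir)
  case Undirected
  have "surprisal dir s (mode dir s - int j - 1) = surprisal dir s (int j + 1)"
    "surprisal dir s (mode dir s - int j) = surprisal dir s (int j)"
    using surprisal_Undirected_minus[of s "int j + 1"] surprisal_Undirected_minus[of s "int j"] s Undirected
    by (simp_all add: mode_def)
  with surprisal_step_right(2)[of s dir j] Undirected s
  have "surprisal dir s (mode dir s - int j - 1) - surprisal dir s (mode dir s - int j) \<le> (real j + 1) / s"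
    by (simp add: mode_def add.commute)
  moreover have "0 \<le> 2 * (real j + 1)^2 / s^2" "0 \<le> 16 * (real j + 1)^4 / s^3" using s by auto
  ultimately show ?thesis by linarith
next
  case Directed
  have e: "surprisal dir s (mode dir s - int j - 1) - surprisal dir s (mode dir s - int j) = - ln ((\<lfloor>s\<rfloor> - j) / s)"
    using surprisal_step_Directed[of s "\<lfloor>s\<rfloor> - int j - 1"] s j Directed by (simp add: mode_def)
  define w where "w = (\<lfloor>s\<rfloor> - j) / s"
  define v where "v = (real j + 1) / s"
  have M: "\<lfloor>s\<rfloor> - j \<ge> (1::real)"
  proof -
    have "\<lfloor>s\<rfloor> - int j \<ge> 1" using j Directed by (simp add: mode_def)
    thus ?thesis by linarith
  qed
  have w: "w > 0" "w \<ge> 1 / s" using M s by (auto simp: w_def intro!: divide_right_mono)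
  have "real_of_int \<lfloor>s\<rfloor> \<le> s" "s < \<lfloor>s\<rfloor> + 1" by linarith+
  moreover have "1 - w = (s - (\<lfloor>s\<rfloor> - j)) / s" using s by (simp add: w_def diff_divide_distrib)
  ultimately have "1 - w \<le> v" using s unfolding v_def by (simp only:) (intro divide_right_mono; linarith)
  have "w \<le> 1" using s by (simp add: w_def divide_le_eq) linarith
  have v: "v > 0" using s by (simp add: v_def add_nonneg_pos)
  have "- ln w \<le> v + 2 * v^2 + 16 * s * v^4"
  proof (cases "w \<ge> 1/2")
    case True
    have "- ln w = ln (1 / w)" using w by (simp add: ln_div)
    also have "\<dots> \<le> 1 / w - 1" using w by (intro ln_le_minus_one) simp
    also have "\<dots> = (1 - w) + (1 - w)^2 / w" using w by (simp add: field_simps power2_eq_square)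
    also have "(1 - w)^2 / w \<le> 2 * (1 - w)^2"
    proof -
      have "(1 - w)^2 * 1 \<le> (1 - w)^2 * (2 * w)" using True by (intro mult_left_mono) auto
      thus ?thesis using w by (simp add: divide_le_eq mult_ac)
    qed
    also have "(1 - w) + 2 * (1 - w)^2 \<le> v + 2 * v^2"
      using \<open>w \<le> 1\<close> \<open>1 - w \<le> v\<close> by (intro add_mono mult_left_mono power_mono) auto
    finally have "- ln w \<le> v + 2 * v^2" by simp
    moreover have "0 \<le> 16 * s * v^4" using s by simp
    ultimately show ?thesis by linarith
  next
    case False
    have "ln (1 / s) \<le> ln w" using w s by (subst ln_le_cancel_iff) auto
    hence "- ln w \<le> ln s" using s by (simp add: ln_div)
    also have "\<dots> \<le> s" using s ln_le_minus_one[of s] by simp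
    also have "\<dots> \<le> 16 * s * v^4"
    proof -
      have "(1/2)^4 \<le> v^4" using False \<open>1 - w \<le> v\<close> by (intro power_mono) auto
      thus ?thesis using s by (simp add: power_divide)
    qed
    finally have "- ln w \<le> 16 * s * v^4" .
    moreover have "0 \<le> v + 2 * v^2" using v by simp
    ultimately show ?thesis by linarith
  qed
  also have "v + 2 * v^2 + 16 * s * v^4 = (real j + 1) / s + 2 * (real j + 1)^2 / s^2 + 16 * (real j + 1)^4 / s^3"
    using s by (simp add: v_def power_divide eval_nat_numeral field_simps)
  finally show ?thesis unfolding e w_def .
qed

text \<open>At distance \<open>n = t * sqrt s\<close> the three errors of
  \<open>quadratic_of_steps\<close> all scale as \<open>1 / sqrt s\<close>, with the powers 1, 3 and
  5 of \<open>t\<close>. The constant is \<open>19 = 1 + 2 + 16\<close>.\<close>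

lemma surprisal_expansion_mode:
  assumes s: "s \<ge> 1" and x: "x \<in> walk_support dir"
  defines "t \<equiv> \<bar>real_of_int (x - mode dir s)\<bar> / sqrt s"
  shows "\<bar>surprisal dir s x - surprisal dir s (mode dir s) - t^2 / 2\<bar> \<le> 19 * (1 + t)^5 / sqrt s"
proof -
  define n where "n = nat \<bar>x - mode dir s\<bar>"
  define M where "M = mode dir s"
  have s0: "s > 0" using s by simp
  have bd: "\<bar>surprisal dir s x - surprisal dir s M - real n^2 / (2 * s)\<bar> \<le> real n / (2 * s) + 2 * real n^3 / s^2 + 16 * real n^5 / s^3"
  proof (cases "x \<ge> M")
    case True
    define D where "D j = surprisal dir s (M + int j) - surprisal dir s M" for j :: nat
    have "\<bar>D n - real n^2 / (2 * s)\<bar> \<le> real n / (2 * s) + 2 * real n^3 / s^2 + 16 * real n^5 / s^3"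
    proof (rule quadratic_of_steps[OF s0])
      fix i
      have e: "D (Suc i) - D i = surprisal dir s (M + int i + 1) - surprisal dir s (M + int i)"
        by (simp add: D_def add_ac)
      show "ln (1 + real i / s) \<le> D (Suc i) - D i"
        unfolding e M_def by (rule surprisal_step_right(1)[OF s0])
      have "D (Suc i) - D i \<le> (real i + 1) / s"
        unfolding e M_def using surprisal_step_right(2)[OF s0, of dir i] by (simp add: add.commute)
      moreover have "0 \<le> 2 * (real i + 1)^2 / s^2" "0 \<le> 16 * (real i + 1)^4 / s^3" using s0 by auto
      ultimately show "D (Suc i) - D i \<le> (real i + 1) / s + 2 * (real i + 1)^2 / s^2 + 16 * (real i + 1)^4 / s^3" by linarith
    qed (simp add: D_def)
    moreover have "M + int n = x" using True by (simp add: n_def M_def)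
    ultimately show ?thesis by (simp add: D_def)
  next
    case False
    define D where "D j = surprisal dir s (M - int j) - surprisal dir s M" for j :: nat
    have "\<bar>D n - real n^2 / (2 * s)\<bar> \<le> real n / (2 * s) + 2 * real n^3 / s^2 + 16 * real n^5 / s^3"
    proof (rule quadratic_of_steps[OF s0])
      fix i assume i: "i < n"
      have e: "D (Suc i) - D i = surprisal dir s (M - int i - 1) - surprisal dir s (M - int i)"
        by (simp add: D_def algebra_simps)
      have sup: "mode dir s - int i - 1 \<in> walk_support dir"
        using x i False by (cases dir) (auto simp: n_def M_def)
      show "ln (1 + real i / s) \<le> D (Suc i) - D i"
        unfolding e M_def by (rule surprisal_step_left_ge[OF s0 sup])
      show "D (Suc i) - D i \<le> (real i + 1) / s + 2 * (real i + 1)^2 / s^2 + 16 * (real i + 1)^4 / s^3"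
        unfolding e M_def using surprisal_step_left_le[OF s sup] by simp
    qed (simp add: D_def)
    moreover have "M - int n = x" using False by (simp add: n_def M_def)
    ultimately show ?thesis by (simp add: D_def)
  qed
  have t: "t = n / sqrt s" "t \<ge> 0" using s by (auto simp: t_def n_def)
  have sq: "sqrt s * sqrt s = s" "sqrt s > 0" using s by auto
  define r where "r = sqrt s"
  have r: "s = r * r" "r > 0" using sq by (simp_all add: r_def)
  have "real n^2 / (2 * s) = t^2 / 2" unfolding t r_def[symmetric] r(1) using r(2) by (simp add: field_simps power2_eq_square)
  moreover have "real n / (2 * s) + 2 * real n^3 / s^2 + 16 * real n^5 / s^3 = (t / 2 + 2 * t^3 + 16 * t^5) / sqrt s"
    unfolding t r_def[symmetric] r(1) using r(2) by (simp add: field_simps eval_nat_numeral)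
  moreover have "(t / 2 + 2 * t^3 + 16 * t^5) / sqrt s \<le> 19 * (1 + t)^5 / sqrt s"
  proof (intro divide_right_mono)
    have "t \<le> (1 + t)^1" by simp
    also have "\<dots> \<le> (1 + t)^5" using t by (intro power_increasing) auto
    finally have 1: "t \<le> (1 + t)^5" .
    have "t^3 \<le> (1 + t)^3" using t by (intro power_mono) auto
    also have "\<dots> \<le> (1 + t)^5" using t by (intro power_increasing) auto
    finally have 3: "t^3 \<le> (1 + t)^5" .
    have 5: "t^5 \<le> (1 + t)^5" using t by (intro power_mono) auto
    have "t / 2 \<le> (1 + t)^5" using 1 t by linarith
    thus "t / 2 + 2 * t^3 + 16 * t^5 \<le> 19 * (1 + t)^5" using 3 5 by linarith
  qed (use s in simp)
  ultimately show ?thesis using bd unfolding M_def by linarith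
qed

text \<open>Passes from distance to the mode to distance to the mean, which differ by at most
  \<open>1 / sqrt s\<close> after scaling. In \<open>609 = 19 * 32 + 1\<close> the factor 32 is from
  \<open>1 + t \<le> 2 * (1 + \<bar>z\<bar>)\<close> and the 1 from the change in the
  square.\<close>

lemma surprisal_expansion:
  assumes s: "s \<ge> 1" and x: "x \<in> walk_support dir"
  defines "z \<equiv> zscore dir s x"
  shows "\<bar>surprisal dir s x - surprisal dir s (mode dir s) - z^2 / 2\<bar> \<le> 609 * (1 + \<bar>z\<bar>)^5 / sqrt s"
proof -
  define t where "t = \<bar>real_of_int (x - mode dir s)\<bar> / sqrt s"
  have r: "sqrt s \<ge> 1" using s by simp
  have tz: "\<bar>t - \<bar>z\<bar>\<bar> \<le> 1 / sqrt s"
  proof -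
    have "t - \<bar>z\<bar> = (\<bar>real_of_int (x - mode dir s)\<bar> - \<bar>x - drift dir s\<bar>) / sqrt s"
    proof -
      have "\<bar>z\<bar> = \<bar>x - drift dir s\<bar> / sqrt s"
        unfolding z_def zscore_def using s by (intro abs_div_pos[symmetric]) simp
      thus ?thesis by (simp add: t_def diff_divide_distrib)
    qed
    moreover have "\<bar>\<bar>real_of_int (x - mode dir s)\<bar> - \<bar>x - drift dir s\<bar>\<bar> \<le> 1"
      using mode_drift[of s dir] s by auto
    ultimately show ?thesis using r by (simp add: abs_divide divide_right_mono)
  qed
  moreover have "1 / sqrt s \<le> 1" using r by simp
  ultimately have t1: "t \<le> 1 + \<bar>z\<bar>" by linarith
  have t0: "t \<ge> 0" using s by (simp add: t_def)
  have "\<bar>t^2 - z^2\<bar> = \<bar>t - \<bar>z\<bar>\<bar> * (t + \<bar>z\<bar>)"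
  proof -
    have "t^2 - z^2 = (t - \<bar>z\<bar>) * (t + \<bar>z\<bar>)" by (simp add: power2_eq_square algebra_simps flip: abs_mult)
    thus ?thesis using t0 by (simp add: abs_mult)
  qed
  also have "\<dots> \<le> 1 / sqrt s * (2 * (1 + \<bar>z\<bar>))" using tz t1 t0 s by (intro mult_mono) auto
  finally have a: "\<bar>t^2 - z^2\<bar> \<le> 2 * (1 + \<bar>z\<bar>) / sqrt s" by simp
  have "(1 + t)^5 \<le> (2 * (1 + \<bar>z\<bar>))^5" using t1 t0 by (intro power_mono) auto
  also have "\<dots> = 32 * (1 + \<bar>z\<bar>)^5" unfolding power_mult_distrib by simp
  finally have "19 * (1 + t)^5 / sqrt s \<le> 608 * (1 + \<bar>z\<bar>)^5 / sqrt s" using s by (intro divide_right_mono) auto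
  moreover have "\<bar>surprisal dir s x - surprisal dir s (mode dir s) - t^2 / 2\<bar> \<le> 19 * (1 + t)^5 / sqrt s"
    unfolding t_def by (rule surprisal_expansion_mode[OF s x])
  moreover have "(1 + \<bar>z\<bar>) / sqrt s \<le> (1 + \<bar>z\<bar>)^5 / sqrt s"
    using s power_increasing[of 1 5 "1 + \<bar>z\<bar>"] by (intro divide_right_mono) auto
  ultimately show ?thesis using a by (simp add: abs_le_iff add_divide_distrib)
qed

section \<open>Variance and third moment of the surprisal\<close>

definition surprisal_var :: "orientation \<Rightarrow> real \<Rightarrow> real" where
  "surprisal_var dir s = measure_pmf.variance (xi dir s) (surprisal dir s)"

lemma surprisal_var_eq:
  assumes "s > 0"
  shows "surprisal_var dir s = measure_pmf.expectation (xi dir s) (\<lambda>x. surprisal dir s x ^ 2) - (entropy1 dir s)\<^sup>2"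
  unfolding surprisal_var_def entropy1_def
  using assms by (intro measure_pmf.variance_eq integrable_xi poly_growth_power) auto

lemma isCont_surprisal_var:
  assumes s: "s > 0"
  shows "isCont (surprisal_var dir) s"
proof -
  have "isCont (\<lambda>s. measure_pmf.expectation (xi dir s) (\<lambda>x. surprisal dir s x ^ 2) - (entropy1 dir s)\<^sup>2) s"
    using DERIV_isCont[OF surprisal_moment_deriv[OF s, of dir 2]] isCont_entropy1[OF s, of dir] by (intro continuous_intros)
  moreover have "eventually (\<lambda>s. measure_pmf.expectation (xi dir s) (\<lambda>x. surprisal dir s x ^ 2) - (entropy1 dir s)\<^sup>2 = surprisal_var dir s) (nhds s)"
    using eventually_nhds_in_open[of "{0<..}" s] s by (auto elim!: eventually_mono simp: surprisal_var_eq)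
  ultimately show ?thesis by (subst (asm) isCont_cong)
qed

text \<open>Zero variance would make the surprisal constant on the support, but it increases
  strictly from the first to the second point right of the mode. The step from the mode itself is no
  use, as its lower bound is \<open>ln 1\<close>.\<close>

lemma surprisal_var_pos:
  assumes s: "s > 0"
  shows "surprisal_var dir s > 0"
proof (rule ccontr)
  define H where "H = entropy1 dir s"
  assume "\<not> surprisal_var dir s > 0"
  moreover have "surprisal_var dir s \<ge> 0" unfolding surprisal_var_def by (rule Bochner_Integration.integral_nonneg) simp
  ultimately have "(\<integral>x. (surprisal dir s x - H)\<^sup>2 \<partial>measure_pmf (xi dir s)) = 0"
    unfolding surprisal_var_def H_def entropy1_def by linarith
  moreover have "integrable (xi dir s) (\<lambda>x. (surprisal dir s x - H)\<^sup>2)"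
    using s by (intro integrable_xi poly_growth_power poly_growth_diff) auto
  ultimately have "AE x in measure_pmf (xi dir s). (surprisal dir s x - H)\<^sup>2 = 0"
    by (subst (asm) integral_nonneg_eq_0_iff_AE) auto
  hence "surprisal dir s x = H" if "x \<in> walk_support dir" for x
    using that by (simp add: AE_measure_pmf_iff set_pmf_xi[OF s])
  moreover have "mode dir s + int i \<in> walk_support dir" for i
    using mode_in_support[of s dir] s by (cases dir) auto
  from this[of 1] this[of 2] have "mode dir s + int 1 \<in> walk_support dir" "mode dir s + int 1 + 1 \<in> walk_support dir"
    by (simp_all add: add.assoc)
  ultimately have "surprisal dir s (mode dir s + int 1 + 1) = surprisal dir s (mode dir s + int 1)" by simp
  moreover have "ln (1 + real 1 / s) > 0" using s by (intro ln_gt_zero) simp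
  ultimately show False using surprisal_step_right(1)[OF s, of 1 dir] by simp
qed

lemma zscore_moments:
  assumes s: "s > 0"
  shows "measure_pmf.expectation (xi dir s) (\<lambda>x. zscore dir s x ^ 2) = 1"
    "measure_pmf.expectation (xi dir s) (\<lambda>x. zscore dir s x ^ 4) = 3 + 1 / s"
proof -
  have "sqrt s ^ 4 = s\<^sup>2" using s by (simp add: power4_eq_xxxx power2_eq_square)
  thus "measure_pmf.expectation (xi dir s) (\<lambda>x. zscore dir s x ^ 2) = 1"
    "measure_pmf.expectation (xi dir s) (\<lambda>x. zscore dir s x ^ 4) = 3 + 1 / s"
    unfolding zscore_def power_divide using s xi_central_moments[of s dir]
    by (simp_all add: add_divide_distrib power2_eq_square)
qed

text \<open>Up to a constant the surprisal is \<open>A + R\<close> with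
  \<open>A = (z\<^sup>2 - 1) / 2\<close>. The fourth moment gives \<open>A\<close> the variance
  \<open>1/2 + 1 / (4 * s)\<close>, and \<open>R\<close> and
  \<open>B\<^sup>2 - A\<^sup>2 = R * (2 * A + R)\<close> have means of order
  \<open>1 / sqrt s\<close>.\<close>

lemma surprisal_var_asymp:
  obtains K where "\<And>s. s \<ge> 1 \<Longrightarrow> \<bar>surprisal_var dir s - 1/2\<bar> \<le> K / sqrt s"
proof
  define C :: real where "C = 609"
  fix s :: real assume s: "s \<ge> 1"
  let ?E = "measure_pmf.expectation (xi dir s)"
  have s0: "s > 0" and r: "sqrt s \<ge> 1" using s by auto
  define z where "z = zscore dir s"
  define w where "w x = 1 + \<bar>z x\<bar>" for x
  define A where "A x = (z x)\<^sup>2 / 2 - 1 / 2" for x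
  define B where "B x = surprisal dir s x - surprisal dir s (mode dir s) - 1/2" for x
  define R where "R x = B x - A x" for x
  have pgz: "poly_growth z" by (simp add: z_def)
  have pgA: "poly_growth A" unfolding A_def[abs_def] divide_inverse
    by (intro poly_growth_diff poly_growth_mult poly_growth_power pgz poly_growth_const)
  have pgB: "poly_growth B" unfolding B_def[abs_def] using s0 by (intro poly_growth_diff poly_growth_const) auto
  have pgR: "poly_growth R" unfolding R_def[abs_def] using pgA pgB by (rule poly_growth_diff[rotated])
  have pgw: "poly_growth w" unfolding w_def[abs_def] using pgz by (intro poly_growth_add poly_growth_abs) auto
  have iz: "integrable (xi dir s) (\<lambda>x. z x ^ n)" for n using pgz s0 by (intro integrable_xi poly_growth_power) auto
  have iw: "integrable (xi dir s) (\<lambda>x. w x ^ n)" for n using pgw s0 by (intro integrable_xi poly_growth_power) auto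
  have iA: "integrable (xi dir s) A" and iB: "integrable (xi dir s) B" and iR: "integrable (xi dir s) R"
    using pgA pgB pgR s0 by auto
  have iA2: "integrable (xi dir s) (\<lambda>x. (A x)\<^sup>2)" and iB2: "integrable (xi dir s) (\<lambda>x. (B x)\<^sup>2)"
    using pgA pgB s0 by (auto intro!: integrable_xi poly_growth_power)
  have w1: "w x \<ge> 1" for x by (simp add: w_def)
  have Rb: "\<bar>R x\<bar> \<le> C * w x ^ 5 / sqrt s" if "x \<in> walk_support dir" for x
  proof -
    have "R x = surprisal dir s x - surprisal dir s (mode dir s) - (z x)\<^sup>2 / 2" by (simp add: R_def A_def B_def)
    thus ?thesis using surprisal_expansion[OF s that] by (simp add: z_def w_def C_def)
  qed
  have Mw: "?E (\<lambda>x. w x ^ n) \<le> zmoment_bound n" for n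
    using expectation_zscore_power_le[OF s, of dir n] by (simp add: w_def z_def)
  have EA: "?E A = 0" and EA2: "?E (\<lambda>x. (A x)\<^sup>2) = 1/2 + 1 / (4 * s)"
  proof -
    have A2: "(A x)\<^sup>2 = z x ^ 4 / 4 - z x ^ 2 / 2 + 1 / 4" for x
      by (simp add: A_def power2_eq_square power4_eq_xxxx algebra_simps)
    show "?E A = 0" unfolding A_def[abs_def] using iz[of 2] zscore_moments(1)[OF s0, of dir] by (simp add: z_def)
    show "?E (\<lambda>x. (A x)\<^sup>2) = 1/2 + 1 / (4 * s)"
      unfolding A2 using iz[of 2] iz[of 4] zscore_moments[OF s0, of dir] by (simp add: z_def field_simps)
  qed
  have V: "surprisal_var dir s = ?E (\<lambda>x. (B x)\<^sup>2) - (?E B)\<^sup>2"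
  proof -
    have "surprisal_var dir s = measure_pmf.variance (xi dir s) B"
      unfolding surprisal_var_def B_def using s0 by simp
    also have "\<dots> = ?E (\<lambda>x. (B x)\<^sup>2) - (?E B)\<^sup>2" using iB iB2 by (intro measure_pmf.variance_eq)
    finally show ?thesis .
  qed
  have mono_supp: "?E f \<le> ?E g" if "integrable (xi dir s) f" "integrable (xi dir s) g" "\<And>x. x \<in> walk_support dir \<Longrightarrow> f x \<le> g x" for f g :: "int \<Rightarrow> real"
    by (rule integral_mono_AE[OF that(1,2)]) (use that(3) in \<open>auto simp: AE_measure_pmf_iff set_pmf_xi[OF s0]\<close>)
  have "\<bar>?E R\<bar> \<le> ?E (\<lambda>x. \<bar>R x\<bar>)" by (rule integral_abs_bound)
  also have "\<dots> \<le> ?E (\<lambda>x. C / sqrt s * w x ^ 5)" using iR iw[of 5] Rb by (intro mono_supp) auto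
  also have "\<dots> \<le> C / sqrt s * zmoment_bound 5" using mult_left_mono[OF Mw[of 5], of "C / sqrt s"] s by (simp add: C_def)
  finally have ER: "\<bar>?E R\<bar> \<le> C * zmoment_bound 5 / sqrt s" by simp
  have EB: "?E B = ?E R" using iA iB EA by (simp add: R_def[abs_def])
  have "(?E B)\<^sup>2 \<le> (C * zmoment_bound 5 / sqrt s)\<^sup>2"
    unfolding EB using ER by (metis abs_ge_zero power2_abs power_mono)
  also have "\<dots> = (C * zmoment_bound 5)\<^sup>2 / s" using s0 by (simp add: power_divide)
  also have "\<dots> \<le> (C * zmoment_bound 5)\<^sup>2 / sqrt s"
    using r s0 mult_right_mono[of 1 "sqrt s" "sqrt s"] by (intro divide_left_mono) auto
  finally have 1: "(?E B)\<^sup>2 \<le> (C * zmoment_bound 5)\<^sup>2 / sqrt s" .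
  have le: "\<bar>(B x)\<^sup>2 - (A x)\<^sup>2\<bar> \<le> (C + C\<^sup>2) / sqrt s * w x ^ 10" if "x \<in> walk_support dir" for x
  proof -
    have "\<bar>A x\<bar> \<le> w x ^ 2 / 2"
    proof -
      have "(z x)\<^sup>2 \<le> (w x)\<^sup>2" using power_mono[of "\<bar>z x\<bar>" "w x" 2] by (simp add: w_def)
      moreover have "(w x)\<^sup>2 \<ge> 1" using w1[of x] by (simp add: one_le_power)
      moreover have "(z x)\<^sup>2 \<ge> 0" by simp
      ultimately show ?thesis unfolding A_def abs_le_iff by linarith
    qed
    also have "\<dots> \<le> w x ^ 5 / 2" using w1[of x] by (intro divide_right_mono power_increasing) auto
    finally have A: "\<bar>A x\<bar> \<le> w x ^ 5 / 2" .
    have w5: "w x ^ 5 \<ge> 0" using w1[of x] by simp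
    have "\<bar>R x\<bar> * (2 * \<bar>A x\<bar> + \<bar>R x\<bar>) \<le> (C * w x ^ 5 / sqrt s) * (w x ^ 5 + C * w x ^ 5)"
    proof (intro mult_mono add_mono)
      show "\<bar>R x\<bar> \<le> C * w x ^ 5"
        using Rb[OF that] r w5 divide_left_mono[of 1 "sqrt s" "C * w x ^ 5"] by (simp add: C_def)
    qed (use Rb[OF that] A w5 r in \<open>auto simp: C_def\<close>)
    also have "\<dots> = (C + C\<^sup>2) / sqrt s * (w x ^ 5 * w x ^ 5)" by (simp add: power2_eq_square algebra_simps add_divide_distrib)
    also have "w x ^ 5 * w x ^ 5 = w x ^ 10" by (simp flip: power_add)
    finally have "\<bar>R x\<bar> * (2 * \<bar>A x\<bar> + \<bar>R x\<bar>) \<le> (C + C\<^sup>2) / sqrt s * w x ^ 10" .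
    moreover have "\<bar>(B x)\<^sup>2 - (A x)\<^sup>2\<bar> \<le> \<bar>R x\<bar> * (2 * \<bar>A x\<bar> + \<bar>R x\<bar>)"
    proof -
      have "(B x)\<^sup>2 - (A x)\<^sup>2 = R x * (2 * A x + R x)" by (simp add: R_def power2_eq_square algebra_simps)
      moreover have "\<bar>2 * A x + R x\<bar> \<le> 2 * \<bar>A x\<bar> + \<bar>R x\<bar>" by linarith
      ultimately show ?thesis by (simp add: abs_mult mult_left_mono)
    qed
    ultimately show ?thesis by linarith
  qed
  have "\<bar>?E (\<lambda>x. (B x)\<^sup>2) - ?E (\<lambda>x. (A x)\<^sup>2)\<bar> = \<bar>?E (\<lambda>x. (B x)\<^sup>2 - (A x)\<^sup>2)\<bar>" using iA2 iB2 by simp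
  also have "\<dots> \<le> ?E (\<lambda>x. \<bar>(B x)\<^sup>2 - (A x)\<^sup>2\<bar>)" by (rule integral_abs_bound)
  also have "\<dots> \<le> ?E (\<lambda>x. (C + C\<^sup>2) / sqrt s * w x ^ 10)" using iA2 iB2 iw[of 10] le by (intro mono_supp) auto
  also have "\<dots> \<le> (C + C\<^sup>2) / sqrt s * zmoment_bound 10"
    using mult_left_mono[OF Mw[of 10], of "(C + C\<^sup>2) / sqrt s"] s by (simp add: C_def)
  finally have 2: "\<bar>?E (\<lambda>x. (B x)\<^sup>2) - ?E (\<lambda>x. (A x)\<^sup>2)\<bar> \<le> (C + C\<^sup>2) * zmoment_bound 10 / sqrt s" by simp
  have 3: "1 / (4 * s) \<le> (1/4) / sqrt s" "1 / (4 * s) \<ge> 0"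
    using r s0 mult_right_mono[of 1 "sqrt s" "sqrt s"] by (auto simp: field_simps)
  have 4: "(?E B)\<^sup>2 \<ge> 0" by simp
  show "\<bar>surprisal_var dir s - 1/2\<bar> \<le> (1/4 + (C + C\<^sup>2) * zmoment_bound 10 + (C * zmoment_bound 5)\<^sup>2) / sqrt s"
    unfolding add_divide_distrib using 1 2 3 4 V EA2 unfolding abs_le_iff by linarith
qed

lemma surprisal_var_tendsto_half:
  assumes "e > 0"
  obtains S where "S \<ge> 100" "\<And>s. s \<ge> S \<Longrightarrow> \<bar>surprisal_var dir s - 1/2\<bar> < e"
proof -
  obtain K where K: "\<And>s. s \<ge> 1 \<Longrightarrow> \<bar>surprisal_var dir s - 1/2\<bar> \<le> K / sqrt s"
    using surprisal_var_asymp[of dir] by blast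
  define S where "S = max 100 ((\<bar>K\<bar> / e + 1)\<^sup>2)"
  show thesis
  proof (rule that[of S])
    fix s assume s: "s \<ge> S"
    hence r: "sqrt s \<ge> \<bar>K\<bar> / e + 1" by (intro real_le_rsqrt) (simp add: S_def)
    have "\<bar>K\<bar> / e \<ge> 0" using assms by simp
    hence r0: "sqrt s > 0" using r by linarith
    have "\<bar>K\<bar> / e * e < sqrt s * e" using r assms by (intro mult_strict_right_mono) auto
    hence "\<bar>K\<bar> < e * sqrt s" using assms by (simp add: mult.commute)
    hence "K / sqrt s < e" using r0 by (simp add: divide_less_eq)
    thus "\<bar>surprisal_var dir s - 1/2\<bar> < e" using K[of s] s by (simp add: S_def)
  qed (simp add: S_def)
qed

text \<open>The limit controls large \<open>s\<close>; on the remaining compact interval continuity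
  and positivity suffice.\<close>

lemma surprisal_var_bounds:
  obtains lo hi where "0 < lo" "\<And>s. s \<ge> 100 \<Longrightarrow> lo \<le> surprisal_var dir s" "\<And>s. s \<ge> 100 \<Longrightarrow> surprisal_var dir s \<le> hi"
proof -
  obtain S where S: "S \<ge> 100" "\<And>s. s \<ge> S \<Longrightarrow> \<bar>surprisal_var dir s - 1/2\<bar> < 1/4"
    using surprisal_var_tendsto_half[of "1/4"] by auto
  have cont: "continuous_on {100..S} (surprisal_var dir)"
    by (intro continuous_at_imp_continuous_on ballI isCont_surprisal_var) auto
  obtain a where a: "a \<in> {100..S}" "\<And>s. s \<in> {100..S} \<Longrightarrow> surprisal_var dir a \<le> surprisal_var dir s"
    using continuous_attains_inf[OF _ _ cont] S(1) by auto
  obtain b where b: "b \<in> {100..S}" "\<And>s. s \<in> {100..S} \<Longrightarrow> surprisal_var dir s \<le> surprisal_var dir b"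
    using continuous_attains_sup[OF _ _ cont] S(1) by auto
  show thesis
  proof (rule that[of "min (1/4) (surprisal_var dir a)" "max (3/4) (surprisal_var dir b)"])
    show "0 < min (1/4) (surprisal_var dir a)" using a(1) by (auto intro!: surprisal_var_pos)
    fix s :: real assume s: "s \<ge> 100"
    show "min (1/4) (surprisal_var dir a) \<le> surprisal_var dir s"
    proof (cases "s \<ge> S")
      case True
      hence "1/4 \<le> surprisal_var dir s" using S(2)[of s] by linarith
      thus ?thesis by simp
    qed (use a(2)[of s] s in auto)
    show "surprisal_var dir s \<le> max (3/4) (surprisal_var dir b)"
    proof (cases "s \<ge> S")
      case True
      hence "surprisal_var dir s \<le> 3/4" using S(2)[of s] by linarith
      thus ?thesis by simp
    qed (use b(2)[of s] s in auto)
  qed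
qed

text \<open>Needed because the arguments may drift without converging. Beyond \<open>S\<close> both
  values are near 1/2; otherwise both arguments lie in a compact interval.\<close>

lemma surprisal_var_uniform:
  assumes e: "e > 0"
  obtains d where "d > 0" "\<And>s s'. s \<ge> 100 \<Longrightarrow> s' \<ge> 100 \<Longrightarrow> \<bar>ln s' - ln s\<bar> < d \<Longrightarrow> \<bar>surprisal_var dir s' - surprisal_var dir s\<bar> < e"
proof -
  obtain S where S: "S \<ge> 100" "\<And>s. s \<ge> S \<Longrightarrow> \<bar>surprisal_var dir s - 1/2\<bar> < e / 2"
    using surprisal_var_tendsto_half[of "e / 2"] e by auto
  \<comment> \<open>The margin 1 keeps both points inside when only one of them is known to lie
    below \<open>ln S\<close>.\<close>
  define I where "I = {ln 100..ln S + 1}"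
  have "continuous_on I (\<lambda>u. surprisal_var dir (exp u))"
  proof (intro continuous_at_imp_continuous_on ballI)
    fix u show "isCont (\<lambda>u. surprisal_var dir (exp u)) u"
      using isCont_o2[of u exp "surprisal_var dir"] isCont_surprisal_var[of "exp u" dir] by simp
  qed
  hence "uniformly_continuous_on I (\<lambda>u. surprisal_var dir (exp u))"
    by (rule compact_uniformly_continuous) (simp add: I_def)
  then obtain d where d: "d > 0" "\<And>u u'. u \<in> I \<Longrightarrow> u' \<in> I \<Longrightarrow> dist u' u < d \<Longrightarrow>
      dist (surprisal_var dir (exp u')) (surprisal_var dir (exp u)) < e"
    using e unfolding uniformly_continuous_on_def by metis
  show thesis
  proof (rule that[of "min d 1"])
    fix s s' :: real assume s: "s \<ge> 100" "s' \<ge> 100" "\<bar>ln s' - ln s\<bar> < min d 1"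
    show "\<bar>surprisal_var dir s' - surprisal_var dir s\<bar> < e"
    proof (cases "s \<ge> S \<and> s' \<ge> S")
      case True
      thus ?thesis using S(2)[of s] S(2)[of s'] by linarith
    next
      case False
      have l: "ln 100 \<le> ln s" "ln 100 \<le> ln s'" using s by auto
      have "ln s < ln S \<or> ln s' < ln S" using False s S(1) by auto
      hence "ln s \<in> I" "ln s' \<in> I" using l s(3) by (auto simp: I_def)
      from d(2)[OF this] s show ?thesis by (simp add: dist_real_def)
    qed
  qed (use d in auto)
qed

text \<open>Provides the Lyapunov condition of the central limit theorem. By the expansion the
  surprisal deviates from its value at the mode by at most \<open>610 * w ^ 5\<close>, and all
  moments of \<open>w\<close> are bounded uniformly in \<open>s\<close>.\<close>

lemma surprisal_third_moment:
  obtains K where "\<And>s. s \<ge> 1 \<Longrightarrow> measure_pmf.expectation (xi dir s) (\<lambda>x. \<bar>surprisal dir s x - entropy1 dir s\<bar> ^ 3) \<le> K"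
proof
  define C where "C = 610 + 610 * zmoment_bound 5"
  fix s :: real assume s: "s \<ge> 1"
  let ?E = "measure_pmf.expectation (xi dir s)"
  have s0: "s > 0" and r: "sqrt s \<ge> 1" using s by auto
  define w where "w x = 1 + \<bar>zscore dir s x\<bar>" for x
  define c where "c = surprisal dir s (mode dir s)"
  have w1: "w x \<ge> 1" for x by (simp add: w_def)
  have pgw: "poly_growth (\<lambda>x. w x ^ n)" for n
    unfolding w_def by (intro poly_growth_power poly_growth_add poly_growth_abs) auto
  have iw: "integrable (xi dir s) (\<lambda>x. w x ^ n)" for n using pgw s0 by (intro integrable_xi) auto
  have Mw: "?E (\<lambda>x. w x ^ n) \<le> zmoment_bound n" for n
    unfolding w_def by (rule expectation_zscore_power_le[OF s])
  have le: "\<bar>surprisal dir s x - c\<bar> \<le> 610 * w x ^ 5" if "x \<in> walk_support dir" for x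
  proof -
    define z where "z = zscore dir s x"
    have z: "w x = 1 + \<bar>z\<bar>" by (simp add: w_def z_def)
    have "\<bar>surprisal dir s x - c - z\<^sup>2 / 2\<bar> \<le> 609 * w x ^ 5 / sqrt s"
      using surprisal_expansion[OF s that] by (simp add: c_def z_def w_def)
    also have "\<dots> \<le> 609 * w x ^ 5 / 1" using r w1[of x] by (intro divide_left_mono) auto
    finally have "\<bar>surprisal dir s x - c\<bar> \<le> 609 * w x ^ 5 + z\<^sup>2 / 2"
      using zero_le_power2[of z] unfolding abs_le_iff div_by_1 by linarith
    moreover have "z\<^sup>2 \<le> (w x)\<^sup>2" using power_mono[of "\<bar>z\<bar>" "w x" 2] by (simp add: z)
    moreover have "(w x)\<^sup>2 \<le> w x ^ 5" using w1[of x] by (intro power_increasing) auto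
    moreover have "z\<^sup>2 \<ge> 0" by simp
    ultimately show ?thesis by linarith
  qed
  have iQ: "integrable (xi dir s) (\<lambda>x. surprisal dir s x - c)" using s0 by (intro integrable_xi poly_growth_diff) auto
  have "\<bar>entropy1 dir s - c\<bar> = \<bar>?E (\<lambda>x. surprisal dir s x - c)\<bar>" using s0 by (simp add: entropy1_def)
  also have "\<dots> \<le> ?E (\<lambda>x. \<bar>surprisal dir s x - c\<bar>)" by (rule integral_abs_bound)
  also have "\<dots> \<le> ?E (\<lambda>x. 610 * w x ^ 5)"
    by (rule integral_mono_AE) (use iQ iw[of 5] le in \<open>auto simp: AE_measure_pmf_iff set_pmf_xi[OF s0]\<close>)
  also have "\<dots> \<le> 610 * zmoment_bound 5" using Mw[of 5] by simp
  finally have H: "\<bar>entropy1 dir s - c\<bar> \<le> 610 * zmoment_bound 5" .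
  have z0: "zmoment_bound 5 \<ge> 0" by (simp add: zmoment_bound_def)
  have le3: "\<bar>surprisal dir s x - entropy1 dir s\<bar> ^ 3 \<le> C ^ 3 * w x ^ 15" if "x \<in> walk_support dir" for x
  proof -
    have "610 * zmoment_bound 5 * 1 \<le> 610 * zmoment_bound 5 * w x ^ 5"
      using z0 w1[of x] by (intro mult_left_mono) (auto simp: one_le_power)
    hence "\<bar>surprisal dir s x - entropy1 dir s\<bar> \<le> C * w x ^ 5"
      using le[OF that] H unfolding C_def distrib_right by linarith
    hence "\<bar>surprisal dir s x - entropy1 dir s\<bar> ^ 3 \<le> (C * w x ^ 5) ^ 3" by (intro power_mono) auto
    also have "\<dots> = C ^ 3 * w x ^ 15" by (simp add: power_mult_distrib flip: power_mult)
    finally show ?thesis .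
  qed
  have "?E (\<lambda>x. \<bar>surprisal dir s x - entropy1 dir s\<bar> ^ 3) \<le> ?E (\<lambda>x. C ^ 3 * w x ^ 15)"
  proof (rule integral_mono_AE)
    show "integrable (xi dir s) (\<lambda>x. \<bar>surprisal dir s x - entropy1 dir s\<bar> ^ 3)"
      using s0 by (intro integrable_xi poly_growth_power poly_growth_abs poly_growth_diff) auto
  qed (use iw[of 15] le3 in \<open>auto simp: AE_measure_pmf_iff set_pmf_xi[OF s0]\<close>)
  also have "\<dots> \<le> C ^ 3 * zmoment_bound 15"
    using mult_left_mono[OF Mw[of 15], of "C ^ 3"] z0 by (simp add: C_def)
  finally show "?E (\<lambda>x. \<bar>surprisal dir s x - entropy1 dir s\<bar> ^ 3) \<le> C ^ 3 * zmoment_bound 15" .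
qed

section \<open>Central limit theorem for rows of independent variables with varying law\<close>

text \<open>The common law changes with the row, so characteristic functions are compared
  quantitatively with \<open>(1 - t\<^sup>2 / (2 * k)) ^ k\<close>, using the third moment, before
  Levy's theorem is applied.\<close>

lemma row_iid_central_limit:
  fixes P :: "nat \<Rightarrow> int pmf" and f :: "nat \<Rightarrow> int \<Rightarrow> real" and k :: "nat \<Rightarrow> nat" and v a :: "nat \<Rightarrow> real"
  assumes k: "filterlim k at_top sequentially" and lo: "lo > 0"
    and ev: "\<forall>\<^sub>F N in sequentially. integrable (P N) (\<lambda>x. \<bar>f N x\<bar> ^ 3) \<and> measure_pmf.expectation (P N) (f N) = 0 \<and>
      measure_pmf.expectation (P N) (\<lambda>x. (f N x)\<^sup>2) = v N \<and> lo \<le> v N \<and> measure_pmf.expectation (P N) (\<lambda>x. \<bar>f N x\<bar> ^ 3) \<le> K"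
    and a: "a \<longlonglongrightarrow> \<alpha>"
  shows "(\<lambda>N. measure_pmf.prob (Pi_pmf {..<k N} 0 (\<lambda>_. P N)) {w. (\<Sum>i<k N. f N (w i)) \<le> a N * sqrt (v N * k N)})
    \<longlonglongrightarrow> cdf std_normal_distribution \<alpha>"
proof -
  define W where "W N = Pi_pmf {..<k N} 0 (\<lambda>_. P N)" for N
  define c where "c N = sqrt (v N * k N)" for N
  define S where "S N w = (\<Sum>i<k N. f N (w i) / c N)" for N and w :: "nat \<Rightarrow> int"
  define \<mu> where "\<mu> N = distr (W N) borel (S N)" for N
  define \<phi> where "\<phi> N t = char (distr (P N) borel (f N)) t" for N t
  have rd: "real_distribution (\<mu> N)" for N
    unfolding \<mu>_def by (intro prob_space.real_distribution_distr[OF measure_pmf.prob_space_axioms]) simp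
  have char\<mu>: "char (\<mu> N) t = \<phi> N (t / c N) ^ k N" for N t
  proof -
    have ind: "prob_space.indep_vars (measure_pmf (W N)) (\<lambda>_. borel) (\<lambda>i w. f N (w i) / c N) {..<k N}"
      using prob_space.indep_vars_compose2[OF measure_pmf.prob_space_axioms indep_vars_Pi_pmf[of "{..<k N}" 0 "\<lambda>_. P N"], of "\<lambda>_ x. f N x / c N" "\<lambda>_. borel"]
      by (simp add: W_def)
    have single: "char (distr (W N) borel (\<lambda>w. f N (w i) / c N)) t = \<phi> N (t / c N)" if "i < k N" for i
    proof -
      have "char (distr (W N) borel (\<lambda>w. f N (w i) / c N)) t = (\<integral>w. iexp (t * (f N (w i) / c N)) \<partial>W N)"
        unfolding char_def by (subst integral_distr) auto
      also have "\<dots> = (\<integral>x. iexp (t * (f N x / c N)) \<partial>map_pmf (\<lambda>w. w i) (W N))" by simp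
      also have "map_pmf (\<lambda>w. w i) (W N) = P N" using that by (simp add: W_def Pi_pmf_component)
      also have "(\<integral>x. iexp (t * (f N x / c N)) \<partial>P N) = \<phi> N (t / c N)"
        unfolding \<phi>_def char_def by (subst integral_distr) (auto simp: mult_ac)
      finally show ?thesis .
    qed
    have "char (\<mu> N) t = (\<Prod>i<k N. char (distr (W N) borel (\<lambda>w. f N (w i) / c N)) t)"
      unfolding \<mu>_def S_def by (rule prob_space.char_distr_sum[OF measure_pmf.prob_space_axioms ind])
    thus ?thesis using single by simp
  qed
  have kr: "filterlim (\<lambda>N. real (k N)) at_top sequentially"
    by (rule filterlim_compose[OF filterlim_real_sequentially k])
  have conv: "(\<lambda>N. char (\<mu> N) t) \<longlonglongrightarrow> char std_normal_distribution t" for t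
  proof -
    have e: "(\<lambda>N. complex_of_real ((1 + (- (t\<^sup>2) / 2) / real (k N)) ^ k N)) \<longlonglongrightarrow> complex_of_real (exp (- (t\<^sup>2) / 2))"
      by (intro tendsto_of_real filterlim_compose[OF tendsto_exp_limit_sequentially k])
    \<comment> \<open>Stems from \<open>k N\<close> times the Taylor error
      \<open>\<bar>t / c N\<bar> ^ 3 * K / 6\<close> of one factor multiplied by its variance scale,
      with \<open>c N \<ge> sqrt (lo * k N)\<close>.\<close>
    define B where "B N = \<bar>t\<bar> ^ 3 * K / (6 * (lo * sqrt lo)) / sqrt (real (k N))" for N
    have B: "B \<longlonglongrightarrow> 0"
      unfolding B_def by (intro tendsto_divide_0[OF tendsto_const] filterlim_at_top_imp_at_infinity filterlim_compose[OF sqrt_at_top kr])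
    have "\<forall>\<^sub>F N in sequentially. cmod (char (\<mu> N) t - complex_of_real ((1 + (- (t\<^sup>2) / 2) / real (k N)) ^ k N)) \<le> B N"
      using ev filterlim_at_top[THEN iffD1, OF kr, rule_format, of "max 1 (t\<^sup>2)"]
    proof eventually_elim
      case (elim N)
      hence kN: "real (k N) \<ge> 1" "t\<^sup>2 \<le> real (k N)" and i3: "integrable (P N) (\<lambda>x. \<bar>f N x\<bar> ^ 3)"
        and m1: "measure_pmf.expectation (P N) (f N) = 0" and m2: "measure_pmf.expectation (P N) (\<lambda>x. (f N x)\<^sup>2) = v N"
        and vlo: "lo \<le> v N" and m3: "measure_pmf.expectation (P N) (\<lambda>x. \<bar>f N x\<bar> ^ 3) \<le> K" by auto
      have pow: "\<bar>y\<bar> \<le> 1 + \<bar>y\<bar> ^ 3" "y\<^sup>2 \<le> 1 + \<bar>y\<bar> ^ 3" for y :: real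
      proof -
        have "\<bar>y\<bar> ^ n \<le> 1 + \<bar>y\<bar> ^ 3" if "n \<le> 3" for n
          using power_increasing[OF that, of "\<bar>y\<bar>"] power_le_one[of "\<bar>y\<bar>" n] by (cases "\<bar>y\<bar> \<ge> 1") (auto intro: order_trans add_increasing2)
        from this[of 1] this[of 2] show "\<bar>y\<bar> \<le> 1 + \<bar>y\<bar> ^ 3" "y\<^sup>2 \<le> 1 + \<bar>y\<bar> ^ 3" by simp_all
      qed
      have i1: "integrable (P N) (f N)" and i2: "integrable (P N) (\<lambda>x. (f N x)\<^sup>2)"
        by (rule Bochner_Integration.integrable_bound[of _ "\<lambda>x. 1 + \<bar>f N x\<bar> ^ 3"]; use i3 pow in \<open>auto intro!: AE_I2\<close>)+
      define \<tau> where "\<tau> = t / c N"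
      have vk: "v N * k N > 0" using vlo lo kN by (intro mult_pos_pos) auto
      have c0: "c N > 0" using vk by (simp add: c_def)
      have c2: "(c N)\<^sup>2 = v N * k N" using vk by (simp add: c_def)
      have "cmod (\<phi> N \<tau> - (1 - \<tau>\<^sup>2 * v N / 2)) \<le> \<tau>\<^sup>2 / 6 * measure_pmf.expectation (P N) (\<lambda>x. min (6 * (f N x)\<^sup>2) (\<bar>\<tau>\<bar> * \<bar>f N x\<bar> ^ 3))"
        unfolding \<phi>_def using i1 i2 m1 m2
        by (intro prob_space.char_approx3'[OF measure_pmf.prob_space_axioms]) auto
      also have "measure_pmf.expectation (P N) (\<lambda>x. min (6 * (f N x)\<^sup>2) (\<bar>\<tau>\<bar> * \<bar>f N x\<bar> ^ 3)) \<le> measure_pmf.expectation (P N) (\<lambda>x. \<bar>\<tau>\<bar> * \<bar>f N x\<bar> ^ 3)"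
        using i2 i3 by (intro integral_mono integrable_min) auto
      also have "\<dots> \<le> \<bar>\<tau>\<bar> * K" using m3 by (simp add: mult_left_mono)
      finally have 1: "cmod (\<phi> N \<tau> - (1 - \<tau>\<^sup>2 * v N / 2)) \<le> \<tau>\<^sup>2 / 6 * (\<bar>\<tau>\<bar> * K)" by (simp add: mult_left_mono)
      have \<tau>2: "\<tau>\<^sup>2 * v N / 2 = t\<^sup>2 / 2 / k N"
        unfolding \<tau>_def power_divide c2 using vlo lo kN by (simp add: field_simps)
      define w where "w = complex_of_real (1 + (- (t\<^sup>2) / 2) / real (k N))"
      have w: "w = 1 - \<tau>\<^sup>2 * v N / 2" unfolding w_def \<tau>2[unfolded of_real_divide] by (simp flip: \<tau>2)
      \<comment> \<open>The bound \<open>t\<^sup>2 \<le> k N\<close> keeps the comparison factor in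
        the unit disc, as the estimate for a difference of powers requires.\<close>
      have "t\<^sup>2 / 2 / k N \<le> 1" using kN by (simp add: divide_le_eq)
      moreover have "t\<^sup>2 / 2 / k N \<ge> 0" by simp
      ultimately have "\<bar>1 + (- (t\<^sup>2) / 2) / real (k N)\<bar> \<le> 1" by simp
      hence nw: "norm w \<le> 1" by (simp only: w_def norm_of_real)
      have n\<phi>: "norm (\<phi> N \<tau>) \<le> 1"
        unfolding \<phi>_def by (intro real_distribution.cmod_char_le_1 prob_space.real_distribution_distr[OF measure_pmf.prob_space_axioms]) simp
      have "cmod (char (\<mu> N) t - w ^ k N) \<le> k N * cmod (\<phi> N \<tau> - w)"
        unfolding char\<mu> \<tau>_def[symmetric] by (rule norm_power_diff[OF n\<phi> nw])
      also have "\<dots> \<le> k N * (\<tau>\<^sup>2 / 6 * (\<bar>\<tau>\<bar> * K))" using 1 by (intro mult_left_mono) (auto simp: w)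
      also have "\<dots> = \<bar>t\<bar> ^ 3 * K / 6 * (k N / (v N * k N * (sqrt (v N) * sqrt (k N))))"
        using c0 c2 by (simp add: \<tau>_def power_divide abs_divide power3_eq_cube power2_eq_square c_def real_sqrt_mult abs_mult_self_eq)
      also have "k N / (v N * k N * (sqrt (v N) * sqrt (k N))) = 1 / (v N * sqrt (v N)) / sqrt (k N)"
        using kN by (simp add: field_simps)
      also have "\<bar>t\<bar> ^ 3 * K / 6 * (1 / (v N * sqrt (v N)) / sqrt (k N)) \<le> \<bar>t\<bar> ^ 3 * K / 6 * (1 / (lo * sqrt lo) / sqrt (k N))"
      proof -
        have "0 \<le> measure_pmf.expectation (P N) (\<lambda>x. \<bar>f N x\<bar> ^ 3)" by (rule Bochner_Integration.integral_nonneg) simp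
        hence "K \<ge> 0" using m3 by linarith
        moreover have "lo * sqrt lo \<le> v N * sqrt (v N)" using lo vlo by (intro mult_mono) auto
        ultimately show ?thesis using lo vlo by (intro mult_left_mono divide_right_mono divide_left_mono) auto
      qed
      also have "\<dots> = B N" by (simp add: B_def)
      finally show ?case by (simp add: w_def)
    qed
    hence "(\<lambda>N. char (\<mu> N) t - complex_of_real ((1 + (- (t\<^sup>2) / 2) / real (k N)) ^ k N)) \<longlonglongrightarrow> 0"
      by (rule Lim_null_comparison[OF _ B])
    from tendsto_add[OF this e] show ?thesis by (simp add: char_std_normal_distribution)
  qed
  have "weak_conv_m \<mu> std_normal_distribution"
    by (rule levy_continuity[OF rd _ conv]) (simp add: real_dist_normal_dist)
  moreover interpret sn: real_distribution std_normal_distribution by (rule real_dist_normal_dist)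
  have cont: "isCont (cdf std_normal_distribution) x" for x
  proof -
    have "emeasure std_normal_distribution {x} = 0"
      by (subst emeasure_density) (auto simp: nn_integral_indicator_singleton[of _ _ "\<lambda>_. _", simplified] nn_integral_null_set)
    thus ?thesis by (simp add: sn.isCont_cdf measure_def)
  qed
  ultimately have wc: "(\<lambda>N. cdf (\<mu> N) x) \<longlonglongrightarrow> cdf std_normal_distribution x" for x
    unfolding weak_conv_m_def weak_conv_def by blast
  \<comment> \<open>The threshold moves with \<open>N\<close>. Monotone distribution functions
    squeeze it between the values at \<open>\<alpha> - d / 2\<close> and
    \<open>\<alpha> + d / 2\<close>, and the limit is continuous.\<close>
  have ac: "(\<lambda>N. cdf (\<mu> N) (a N)) \<longlonglongrightarrow> cdf std_normal_distribution \<alpha>"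
  proof (rule LIMSEQ_I)
    fix r :: real assume r: "r > 0"
    obtain d where d: "d > 0" "\<And>x. \<bar>x - \<alpha>\<bar> < d \<Longrightarrow> \<bar>cdf std_normal_distribution x - cdf std_normal_distribution \<alpha>\<bar> < r / 2"
      using cont[of \<alpha>] r unfolding isCont_def LIM_eq by (metis abs_0 diff_self half_gt_zero real_norm_def)
    define x y where "x = \<alpha> - d / 2" and "y = \<alpha> + d / 2"
    have "\<forall>\<^sub>F N in sequentially. \<bar>cdf (\<mu> N) x - cdf std_normal_distribution x\<bar> < r / 2 \<and>
        \<bar>cdf (\<mu> N) y - cdf std_normal_distribution y\<bar> < r / 2 \<and> \<bar>a N - \<alpha>\<bar> < d / 2"
      using tendstoD[OF wc[of x], of "r / 2"] tendstoD[OF wc[of y], of "r / 2"] tendstoD[OF a, of "d / 2"] r d(1)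
      by (simp add: dist_real_def eventually_conj)
    hence "\<forall>\<^sub>F N in sequentially. norm (cdf (\<mu> N) (a N) - cdf std_normal_distribution \<alpha>) < r"
    proof eventually_elim
      case (elim N)
      interpret r: real_distribution "\<mu> N" by (rule rd)
      have "cdf (\<mu> N) x \<le> cdf (\<mu> N) (a N)" "cdf (\<mu> N) (a N) \<le> cdf (\<mu> N) y"
        using elim by (auto intro!: r.cdf_nondecreasing simp: x_def y_def abs_if split: if_splits)
      moreover have "\<bar>cdf std_normal_distribution x - cdf std_normal_distribution \<alpha>\<bar> < r / 2"
        "\<bar>cdf std_normal_distribution y - cdf std_normal_distribution \<alpha>\<bar> < r / 2"
        using d by (auto simp: x_def y_def)
      ultimately show ?case using elim unfolding real_norm_def by linarith
    qed
    thus "\<exists>no. \<forall>N\<ge>no. norm (cdf (\<mu> N) (a N) - cdf std_normal_distribution \<alpha>) < r"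
      by (simp add: eventually_sequentially)
  qed
  have "\<forall>\<^sub>F N in sequentially. cdf (\<mu> N) (a N) = measure_pmf.prob (Pi_pmf {..<k N} 0 (\<lambda>_. P N)) {w. (\<Sum>i<k N. f N (w i)) \<le> a N * sqrt (v N * k N)}"
    using ev filterlim_at_top[THEN iffD1, OF kr, rule_format, of 1]
  proof eventually_elim
    case (elim N)
    have "v N * k N > 0" using elim lo by (intro mult_pos_pos) auto
    hence c0: "c N > 0" by (simp add: c_def)
    have "cdf (\<mu> N) (a N) = measure_pmf.prob (W N) {w. S N w \<le> a N}"
      unfolding \<mu>_def cdf_def by (subst measure_distr) (auto simp: vimage_def)
    also have "{w. S N w \<le> a N} = {w. (\<Sum>i<k N. f N (w i)) \<le> a N * sqrt (v N * k N)}"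
      using c0 by (simp add: S_def divide_le_eq flip: sum_divide_distrib c_def)
    finally show ?case by (simp add: W_def)
  qed
  thus ?thesis using ac by (rule Lim_transform_eventually[rotated])
qed

section \<open>Words in uniform generators\<close>

definition word :: "('a, 'b) monoid_scheme \<Rightarrow> 'i set \<Rightarrow> ('i \<Rightarrow> 'a) \<Rightarrow> ('i \<Rightarrow> int) \<Rightarrow> 'a" where
  "word G I z w = finprod G (\<lambda>i. z i [^]\<^bsub>G\<^esub> w i) I"

lemma (in comm_group) word_closed [simp]: "z \<in> I \<rightarrow> carrier G \<Longrightarrow> word G I z w \<in> carrier G"
  unfolding word_def by (intro finprod_closed) auto

lemma (in comm_group) word_mult_gens:
  assumes "z \<in> I \<rightarrow> carrier G" "y \<in> I \<rightarrow> carrier G"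
  shows "word G I (\<lambda>i. z i \<otimes> y i) w = word G I z w \<otimes> word G I y w"
proof -
  have "word G I (\<lambda>i. z i \<otimes> y i) w = finprod G (\<lambda>i. z i [^] w i \<otimes> y i [^] w i) I"
    unfolding word_def using assms by (intro finprod_cong' refl) (auto intro!: int_pow_mult_distrib m_comm)
  thus ?thesis unfolding word_def using assms by (subst (asm) finprod_multf) auto
qed

lemma (in comm_group) word_add:
  assumes "z \<in> I \<rightarrow> carrier G"
  shows "word G I z (\<lambda>i. u i + w i) = word G I z u \<otimes> word G I z w"
proof -
  have "word G I z (\<lambda>i. u i + w i) = finprod G (\<lambda>i. z i [^] u i \<otimes> z i [^] w i) I"
    unfolding word_def using assms by (intro finprod_cong' refl) (auto simp: int_pow_mult Pi_iff)
  thus ?thesis unfolding word_def using assms by (subst (asm) finprod_multf) auto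
qed

lemma (in comm_group) word_scale:
  assumes "finite I" "z \<in> I \<rightarrow> carrier G"
  shows "word G I z (\<lambda>i. w i * c) = word G I z w [^] c"
  using assms
proof (induction I rule: finite_induct)
  case (insert j I)
  hence z: "z \<in> I \<rightarrow> carrier G" "z j \<in> carrier G" by auto
  have "z j [^] (w j * c) = (z j [^] w j) [^] c" using z by (simp add: int_pow_pow)
  moreover have "word G I z w \<in> carrier G" using z by simp
  ultimately show ?case using insert z
    by (simp add: word_def Pi_iff int_pow_mult_distrib m_comm)
qed (simp add: word_def)

lemma (in comm_group) finprod_int_pow_sum:
  assumes "finite I" "y \<in> carrier G"
  shows "finprod G (\<lambda>i. y [^] (e i :: int)) I = y [^] (\<Sum>i\<in>I. e i)"
  using assms by (induction I rule: finite_induct) (auto simp: int_pow_mult Pi_iff)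

lemma (in comm_group) word_diff_eq_one_iff:
  assumes "z \<in> I \<rightarrow> carrier G"
  shows "word G I z (\<lambda>i. u i - w i) = \<one> \<longleftrightarrow> word G I z u = word G I z w"
proof -
  have "word G I z u = word G I z (\<lambda>i. u i - w i) \<otimes> word G I z w"
    using word_add[OF assms, of "\<lambda>i. u i - w i" w] by simp
  moreover have "word G I z u \<in> carrier G" "word G I z w \<in> carrier G" "word G I z (\<lambda>i. u i - w i) \<in> carrier G"
    using assms by auto
  ultimately show ?thesis by (metis l_one r_cancel_one')
qed

lemma (in comm_group) word_update:
  assumes "finite I" "i \<in> I" "z \<in> I \<rightarrow> carrier G"
  shows "word G I z (w(i := w i + c)) = word G I z w \<otimes> z i [^] c"
proof -
  have "(w(i := w i + c)) = (\<lambda>j. w j + (if j = i then c else 0))" by auto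
  hence "word G I z (w(i := w i + c)) = word G I z w \<otimes> word G I z (\<lambda>j. if j = i then c else 0)"
    using word_add[OF assms(3)] by simp
  also have "word G I z (\<lambda>j. if j = i then c else 0) = z i [^] c"
  proof -
    have zc: "z j [^] c \<in> carrier G" if "j \<in> I" for j using assms that by auto
    have "word G I z (\<lambda>j. if j = i then c else 0) = finprod G (\<lambda>j. if i = j then z j [^] c else \<one>) I"
      unfolding word_def using assms(2) zc by (intro finprod_cong' refl) (auto simp del: Pi_I')
    also have "\<dots> = z i [^] c" using assms(1,2) zc by (intro finprod_singleton) auto
    finally show ?thesis .
  qed
  finally show ?thesis .
qed

lemma (in comm_group) generate_imp_word:
  assumes A: "finite A" "A \<subseteq> carrier G" and x: "x \<in> generate G A"
  shows "\<exists>e. x = word G A (\<lambda>a. a) e"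
proof -
  have AP: "(\<lambda>a. a) \<in> A \<rightarrow> carrier G" using A by auto
  show ?thesis using x
proof (induction rule: generate.induct)
  case one
  have "word G A (\<lambda>a. a) (\<lambda>_. 0) = \<one>" unfolding word_def by simp
  thus ?case by metis
next
  case (incl h)
  have "word G A (\<lambda>a. a) (\<lambda>_. 0) = \<one>" unfolding word_def by simp
  hence "word G A (\<lambda>a. a) ((\<lambda>_. 0)(h := 0 + 1)) = h"
    using word_update[of A h "\<lambda>a. a" "\<lambda>_. 0" 1] A AP incl by (auto simp: subset_iff)
  thus ?case by metis
next
  case (inv h)
  have "word G A (\<lambda>a. a) (\<lambda>_. 0) = \<one>" unfolding word_def by simp
  hence "word G A (\<lambda>a. a) ((\<lambda>_. 0)(h := 0 + -1)) = inv h"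
    using word_update[of A h "\<lambda>a. a" "\<lambda>_. 0" "-1"] A AP inv by (auto simp: int_pow_neg subset_iff)
  thus ?case by metis
next
  case (eng h1 h2)
  then obtain e1 e2 where "h1 = word G A (\<lambda>a. a) e1" "h2 = word G A (\<lambda>a. a) e2" by blast
  moreover have "word G A (\<lambda>a. a) (\<lambda>i. e1 i + e2 i) = word G A (\<lambda>a. a) e1 \<otimes> word G A (\<lambda>a. a) e2"
    using A by (intro word_add) auto
  ultimately show ?case by metis
qed
qed

section \<open>Subgroups of powers and collisions of words\<close>

definition powers :: "('a, 'b) monoid_scheme \<Rightarrow> nat \<Rightarrow> 'a set" where
  "powers G g = (\<lambda>x. x [^]\<^bsub>G\<^esub> int g) ` carrier G"

text \<open>Division with remainder in the exponents over a minimal generating set: every element is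
  one of \<open>g ^ min_gens G\<close> words with exponents below \<open>g\<close>, times a
  \<open>g\<close>-th power.\<close>

lemma (in comm_group) order_le_power:
  assumes fin: "finite (carrier G)" and g: "g > 0"
  shows "order G \<le> g ^ min_gens G * card (powers G g)"
proof -
  have "\<exists>m. \<exists>A \<subseteq> carrier G. finite A \<and> card A = m \<and> generate G A = carrier G"
    using fin generate_incl[of "carrier G"] generate.incl[of _ "carrier G" G] by blast
  from LeastI_ex[OF this] obtain A where A: "A \<subseteq> carrier G" "finite A" "card A = min_gens G" "generate G A = carrier G"
    unfolding min_gens_def by blast
  have AP: "(\<lambda>a. a) \<in> A \<rightarrow> carrier G" using A by auto
  have "carrier G \<subseteq> (\<lambda>(f, y). word G A (\<lambda>a. a) (\<lambda>a. int (f a)) \<otimes> y) ` (PiE A (\<lambda>_. {..<g}) \<times> powers G g)"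
  proof
    fix x assume "x \<in> carrier G"
    then obtain e where e: "x = word G A (\<lambda>a. a) e" using generate_imp_word[OF A(2,1)] A(4) by blast
    define f where "f = restrict (\<lambda>a. nat (e a mod int g)) A"
    define y where "y = word G A (\<lambda>a. a) (\<lambda>a. e a div int g) [^] int g"
    have "x = word G A (\<lambda>a. a) (\<lambda>a. e a mod int g + e a div int g * int g)" using e by simp
    also have "\<dots> = word G A (\<lambda>a. a) (\<lambda>a. e a mod int g) \<otimes> y"
      unfolding y_def using word_add[OF AP, of "\<lambda>a. e a mod int g" "\<lambda>a. e a div int g * int g"]
        word_scale[OF A(2) AP, of "\<lambda>a. e a div int g" "int g"] by (simp only:)
    also have "word G A (\<lambda>a. a) (\<lambda>a. e a mod int g) = word G A (\<lambda>a. a) (\<lambda>a. int (f a))"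
      unfolding word_def using A g by (intro finprod_cong' refl) (auto simp: f_def)
    finally have "x = word G A (\<lambda>a. a) (\<lambda>a. int (f a)) \<otimes> y" .
    moreover have "f \<in> PiE A (\<lambda>_. {..<g})" using g by (auto simp: f_def nat_less_iff)
    moreover have "y \<in> powers G g" unfolding y_def powers_def using AP by (intro imageI word_closed)
    ultimately show "x \<in> (\<lambda>(f, y). word G A (\<lambda>a. a) (\<lambda>a. int (f a)) \<otimes> y) ` (PiE A (\<lambda>_. {..<g}) \<times> powers G g)"
      by (intro image_eqI[of _ _ "(f, y)"]) auto
  qed
  hence "card (carrier G) \<le> card (PiE A (\<lambda>_. {..<g}) \<times> powers G g)"
    using A fin by (intro surj_card_le) (auto intro!: finite_PiE simp: powers_def)
  also have "\<dots> = g ^ min_gens G * card (powers G g)"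
    using A by (simp add: card_cartesian_product card_PiE)
  finally show ?thesis by (simp add: order_def)
qed

text \<open>Folds the two-term identity over the entries; the witness is their gcd, which is 0 for
  the zero vector.\<close>

lemma bezout_sum:
  fixes v :: "nat \<Rightarrow> int"
  shows "\<exists>g b. (\<forall>i<k. int g dvd v i) \<and> (\<Sum>i<k. b i * v i) = int g"
proof (induction k)
  case (Suc k)
  then obtain g b where g: "\<And>i. i < k \<Longrightarrow> int g dvd v i" "(\<Sum>i<k. b i * v i) = int g" by blast
  obtain x y where xy: "x * int g + y * v k = gcd (int g) (v k)" using bezout_int by blast
  have "(\<Sum>i<k. (x * b i) * v i) = x * int g" using g(2) by (simp add: mult.assoc flip: sum_distrib_left)
  hence sum: "(\<Sum>i<Suc k. (if i = k then y else x * b i) * v i) = int (nat (gcd (int g) (v k)))"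
    using xy by simp
  have "int (nat (gcd (int g) (v k))) dvd v i" if "i < Suc k" for i
  proof (cases "i = k")
    case False
    have "gcd (int g) (v k) dvd int g" by (rule gcd_dvd1)
    also have "int g dvd v i" using g(1) that False by simp
    finally show ?thesis by simp
  qed simp
  with sum show ?case by meson
qed auto

text \<open>The law of a word in uniform letters is invariant under translation by \<open>g\<close>-th powers, by
  Bezout applied to its exponents; hence it puts mass at most \<open>1 / card (powers G g)\<close> on the identity.\<close>

lemma (in comm_group) prob_word_eq_one_le:
  fixes v b :: "nat \<Rightarrow> int"
  assumes fin: "finite (carrier G)" and b: "(\<Sum>i<k. b i * v i) = int g" and g: "g > 0"
  shows "real (order G) * measure_pmf.prob (Pi_pmf {..<k} \<one> (\<lambda>_. pmf_of_set (carrier G))) {z. word G {..<k} z v = \<one>} \<le> real g ^ min_gens G"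
proof -
  define X where "X = PiE_dflt {..<k} \<one> (\<lambda>_. carrier G)"
  have X: "finite X" "X \<noteq> {}" "\<And>z. z \<in> X \<Longrightarrow> z \<in> {..<k} \<rightarrow> carrier G"
  proof -
    show "finite X" unfolding X_def using fin by (intro finite_PiE_dflt) auto
    have "carrier G \<noteq> {}" using one_closed by blast
    thus "X \<noteq> {}" unfolding X_def by simp
    show "z \<in> {..<k} \<rightarrow> carrier G" if "z \<in> X" for z using that by (auto simp: X_def PiE_dflt_def)
  qed
  have Z: "Pi_pmf {..<k} \<one> (\<lambda>_. pmf_of_set (carrier G)) = pmf_of_set X"
    unfolding X_def using fin by (intro Pi_pmf_of_set) auto
  define F where "F c = {z \<in> X. word G {..<k} z v = c}" for c
  have le: "card (F \<one>) \<le> card (F c)" if c: "c \<in> powers G g" for c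
  proof -
    obtain y where y: "y \<in> carrier G" "c = y [^] int g" using c by (auto simp: powers_def)
    \<comment> \<open>Multiplying letter \<open>i\<close> by \<open>y [^] b i\<close> is injective
      and multiplies the word by \<open>y [^] int g\<close>; from \<open>k\<close> on, the identity
      is the default value of \<open>Pi_pmf\<close>.\<close>
    define s where "s z = (\<lambda>i. if i < k then z i \<otimes> y [^] b i else \<one>)" for z :: "nat \<Rightarrow> 'a"
    have "inj_on s X"
    proof (rule inj_onI, rule ext)
      fix z z' i assume z: "z \<in> X" "z' \<in> X" "s z = s z'"
      show "z i = z' i"
      proof (cases "i < k")
        case True
        have "z i \<otimes> y [^] b i = z' i \<otimes> y [^] b i" using fun_cong[OF z(3), of i] True by (simp add: s_def)
        thus ?thesis using X(3)[OF z(1)] X(3)[OF z(2)] True y by (auto simp: Pi_iff)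
      qed (use z in \<open>auto simp: X_def PiE_dflt_def\<close>)
    qed
    moreover have "s ` F \<one> \<subseteq> F c"
    proof
      fix z' assume "z' \<in> s ` F \<one>"
      then obtain z where z: "z \<in> X" "word G {..<k} z v = \<one>" "z' = s z" by (auto simp: F_def)
      have zc: "z \<in> {..<k} \<rightarrow> carrier G" using X(3)[OF z(1)] .
      have "word G {..<k} (s z) v = word G {..<k} (\<lambda>i. z i \<otimes> y [^] b i) v"
        unfolding word_def using zc y by (intro finprod_cong' refl) (auto simp: s_def Pi_iff)
      also have "\<dots> = word G {..<k} (\<lambda>i. y [^] b i) v"
        using word_mult_gens[OF zc, of "\<lambda>i. y [^] b i" v] y z by simp
      also have "\<dots> = finprod G (\<lambda>i. y [^] (b i * v i)) {..<k}"
        unfolding word_def using y by (intro finprod_cong' refl) (auto simp: int_pow_pow)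
      also have "\<dots> = c" using y b by (simp add: finprod_int_pow_sum)
      finally have "word G {..<k} (s z) v = c" .
      moreover have "s z \<in> X" using zc y by (auto simp: X_def PiE_dflt_def s_def Pi_iff)
      ultimately show "z' \<in> F c" using z by (simp add: F_def)
    qed
    ultimately show ?thesis
      using X(1) by (intro card_inj_on_le[of s]) (auto simp: F_def intro: inj_on_subset)
  qed
  \<comment> \<open>The fibres over \<open>powers G g\<close> are disjoint, and none is smaller than
    the fibre over the identity.\<close>
  have "card (powers G g) * card (F \<one>) = (\<Sum>c\<in>powers G g. card (F \<one>))" by simp
  also have "\<dots> \<le> (\<Sum>c\<in>powers G g. card (F c))" using le by (intro sum_mono)
  also have "\<dots> = card (\<Union>c\<in>powers G g. F c)"
    using X(1) fin by (intro card_UN_disjoint[symmetric]) (auto simp: F_def powers_def)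
  also have "\<dots> \<le> card X" using X(1) by (intro card_mono) (auto simp: F_def)
  finally have 1: "real (card (powers G g)) * real (card (F \<one>)) \<le> real (card X)"
    by (simp flip: of_nat_mult)
  have "measure_pmf.prob (pmf_of_set X) {z. word G {..<k} z v = \<one>} = card (F \<one>) / card X"
    using X by (simp add: measure_pmf_of_set F_def Int_def conj_commute)
  moreover have "real (order G) * real (card (F \<one>)) \<le> real g ^ min_gens G * real (card X)"
  proof -
    have "real (order G) \<le> real g ^ min_gens G * real (card (powers G g))"
      using order_le_power[OF fin g] by (simp flip: of_nat_mult of_nat_power)
    hence "real (order G) * real (card (F \<one>)) \<le> real g ^ min_gens G * real (card (powers G g)) * real (card (F \<one>))"
      by (intro mult_right_mono) auto
    also have "\<dots> \<le> real g ^ min_gens G * real (card X)"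
      using 1 mult_left_mono[OF 1, of "real g ^ min_gens G"] by (simp add: mult.assoc)
    finally show ?thesis .
  qed
  ultimately show ?thesis unfolding Z using X by (simp add: divide_le_eq card_gt_0_iff)
qed

text \<open>By commutativity, changing a coordinate of the exponent vector by one multiplies the
  word on the right by the letter or its inverse, so the word map carries one step kernel to the
  other.\<close>

lemma (in comm_group) cayley_walk_eq_map_word:
  fixes k :: nat
  assumes k: "k \<ge> 1" and z: "z \<in> {..<k} \<rightarrow> carrier G" and t: "t \<ge> 0"
  shows "cayley_walk dir G (image_mset z (mset_set {..<k})) t =
    map_pmf (word G {..<k} z) (Pi_pmf {..<k} 0 (\<lambda>_. xi dir (t / k)))"
proof -
  have "0 \<in> {..<k}" using k by simp
  hence ne: "{..<k} \<noteq> {}" by blast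
  have Z: "pmf_of_multiset (image_mset z (mset_set {..<k})) = map_pmf z (pmf_of_set {..<k})"
    by (rule map_pmf_of_set[symmetric]) (use ne in auto)
  have "map_pmf (word G {..<k} z) (lattice_step dir k w) =
    cayley_step dir G (image_mset z (mset_set {..<k})) (word G {..<k} z w)" for w
  proof -
    have *: "word G {..<k} z (w(i := w i + 1)) = word G {..<k} z w \<otimes> z i"
      "word G {..<k} z (w(i := w i - 1)) = word G {..<k} z w \<otimes> inv (z i)" if "i < k" for i
      using word_update[of "{..<k}" i z w 1] word_update[of "{..<k}" i z w "-1"] that z
      by (auto simp: int_pow_neg Pi_iff)
    have "word G {..<k} z (if b then w(i := w i + 1) else w(i := w i - 1)) =
      (if b then word G {..<k} z w \<otimes> z i else word G {..<k} z w \<otimes> inv (z i))" if "i < k" for i b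
      using *[OF that] by simp
    thus ?thesis unfolding lattice_step_def cayley_step_def Z map_bind_pmf bind_map_pmf
      by (intro bind_pmf_cong refl) (use ne * in \<open>auto simp: pmf.map_comp o_def split: orientation.split intro!: map_pmf_cong\<close>)
  qed
  hence "map_pmf (word G {..<k} z) (rate1_walk (lattice_step dir k) (\<lambda>_. 0) t) =
    rate1_walk (cayley_step dir G (image_mset z (mset_set {..<k}))) (word G {..<k} z (\<lambda>_. 0)) t"
    by (intro rate1_walk_map)
  moreover have "word G {..<k} z (\<lambda>_. 0) = \<one>" by (simp add: word_def)
  ultimately show ?thesis
    using lattice_walk_eq_Pi_pmf[OF k t, of dir] by (simp add: cayley_walk_def lattice_walk_def)
qed

section \<open>Bounds on the distance to uniformity\<close>

lemma tv_dist_ge: "\<bar>measure_pmf.prob p A - measure_pmf.prob q A\<bar> \<le> tv_dist p q"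
  unfolding tv_dist_def
proof (rule cSUP_upper)
  show "bdd_above (range (\<lambda>A. \<bar>measure_pmf.prob p A - measure_pmf.prob q A\<bar>))"
  proof (rule bdd_aboveI2)
    fix A
    have "0 \<le> measure_pmf.prob p A" "measure_pmf.prob p A \<le> 1" "0 \<le> measure_pmf.prob q A" "measure_pmf.prob q A \<le> 1" by simp_all
    thus "\<bar>measure_pmf.prob p A - measure_pmf.prob q A\<bar> \<le> 1" by linarith
  qed
qed simp

lemma tv_dist_le: "(\<And>A. \<bar>measure_pmf.prob p A - measure_pmf.prob q A\<bar> \<le> c) \<Longrightarrow> tv_dist p q \<le> c"
  unfolding tv_dist_def by (rule cSUP_least) auto

lemma tv_dist_bounds: "0 \<le> tv_dist p q" "tv_dist p q \<le> 1"
proof -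
  show "0 \<le> tv_dist p q" using tv_dist_ge[of p "{}" q] by simp
  have "\<bar>measure_pmf.prob p A - measure_pmf.prob q A\<bar> \<le> 1" for A
  proof -
    have "0 \<le> measure_pmf.prob p A" "measure_pmf.prob p A \<le> 1" "0 \<le> measure_pmf.prob q A" "measure_pmf.prob q A \<le> 1" by simp_all
    thus ?thesis by linarith
  qed
  thus "tv_dist p q \<le> 1" by (rule tv_dist_le)
qed

lemma prob_pmf_of_set: "finite C \<Longrightarrow> C \<noteq> {} \<Longrightarrow> measure_pmf.prob (pmf_of_set C) A = card (C \<inter> A) / card C"
  by (rule measure_pmf_of_set)

text \<open>Cauchy-Schwarz, applied to the image of the restriction of \<open>\<mu>\<close> to the likely set \<open>T\<close>.\<close>

lemma tv_dist_map_uniform_le: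
  fixes \<mu> :: "'w pmf" and \<Psi> :: "'w \<Rightarrow> 'a"
  assumes C: "finite C" "C \<noteq> {}" and T: "finite T" "\<Psi> ` T \<subseteq> C"
  defines "\<tau> \<equiv> measure_pmf.prob \<mu> T"
  defines "D \<equiv> card C * (\<Sum>w\<in>T. \<Sum>w'\<in>T. pmf \<mu> w * pmf \<mu> w' * of_bool (\<Psi> w = \<Psi> w')) - \<tau>\<^sup>2"
  shows "D \<ge> 0" "tv_dist (map_pmf \<Psi> \<mu>) (pmf_of_set C) \<le> (1 - \<tau>) + sqrt D"
proof -
  define n where "n = real (card C)"
  have n: "n > 0" using C by (simp add: n_def card_gt_0_iff)
  define f where "f c = (\<Sum>w\<in>T. pmf \<mu> w * of_bool (\<Psi> w = c))" for c
  have \<tau>: "\<tau> = (\<Sum>w\<in>T. pmf \<mu> w)" unfolding \<tau>_def using T(1) by (rule measure_measure_pmf_finite)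
  have sumA: "(\<Sum>c\<in>C \<inter> A. f c) = measure_pmf.prob \<mu> (\<Psi> -` A \<inter> T)" for A
  proof -
    have "(\<Sum>c\<in>C \<inter> A. f c) = (\<Sum>w\<in>T. \<Sum>c\<in>C \<inter> A. pmf \<mu> w * of_bool (\<Psi> w = c))"
      unfolding f_def by (rule sum.swap)
    also have "\<dots> = (\<Sum>w\<in>T. if \<Psi> w \<in> A then pmf \<mu> w else 0)"
    proof (intro sum.cong refl)
      fix w assume w: "w \<in> T"
      have "(\<Sum>c\<in>C \<inter> A. pmf \<mu> w * of_bool (\<Psi> w = c)) = (\<Sum>c\<in>C \<inter> A. if \<Psi> w = c then pmf \<mu> w else 0)"
        by (intro sum.cong) auto
      also have "\<dots> = (if \<Psi> w \<in> A then pmf \<mu> w else 0)" using C T w by (subst sum.delta') auto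
      finally show "(\<Sum>c\<in>C \<inter> A. pmf \<mu> w * of_bool (\<Psi> w = c)) = (if \<Psi> w \<in> A then pmf \<mu> w else 0)" .
    qed
    also have "\<dots> = (\<Sum>w\<in>\<Psi> -` A \<inter> T. pmf \<mu> w)"
      using T(1) by (simp add: sum.If_cases Int_def vimage_def conj_commute)
    also have "\<dots> = measure_pmf.prob \<mu> (\<Psi> -` A \<inter> T)" using T(1) by (simp add: measure_measure_pmf_finite)
    finally show ?thesis .
  qed
  have sf: "(\<Sum>c\<in>C. f c) = \<tau>" using sumA[of UNIV] by (simp add: \<tau>_def)
  have sf2: "(\<Sum>c\<in>C. (f c)\<^sup>2) = (\<Sum>w\<in>T. \<Sum>w'\<in>T. pmf \<mu> w * pmf \<mu> w' * of_bool (\<Psi> w = \<Psi> w'))"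
  proof -
    have "(\<Sum>c\<in>C. (f c)\<^sup>2) = (\<Sum>c\<in>C. \<Sum>w\<in>T. \<Sum>w'\<in>T. (pmf \<mu> w * of_bool (\<Psi> w = c)) * (pmf \<mu> w' * of_bool (\<Psi> w' = c)))"
      unfolding f_def power2_eq_square sum_product ..
    also have "\<dots> = (\<Sum>w\<in>T. \<Sum>c\<in>C. \<Sum>w'\<in>T. (pmf \<mu> w * of_bool (\<Psi> w = c)) * (pmf \<mu> w' * of_bool (\<Psi> w' = c)))"
      by (rule sum.swap)
    also have "\<dots> = (\<Sum>w\<in>T. \<Sum>w'\<in>T. \<Sum>c\<in>C. (pmf \<mu> w * of_bool (\<Psi> w = c)) * (pmf \<mu> w' * of_bool (\<Psi> w' = c)))"
      by (intro sum.cong refl sum.swap)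
    also have "\<dots> = (\<Sum>w\<in>T. \<Sum>w'\<in>T. pmf \<mu> w * pmf \<mu> w' * of_bool (\<Psi> w = \<Psi> w'))"
    proof (intro sum.cong refl)
      fix w w' assume w: "w \<in> T" "w' \<in> T"
      have "(\<Sum>c\<in>C. (pmf \<mu> w * of_bool (\<Psi> w = c)) * (pmf \<mu> w' * of_bool (\<Psi> w' = c))) =
        (\<Sum>c\<in>C. if \<Psi> w = c then pmf \<mu> w * pmf \<mu> w' * of_bool (\<Psi> w = \<Psi> w') else 0)"
        by (intro sum.cong) auto
      also have "\<dots> = pmf \<mu> w * pmf \<mu> w' * of_bool (\<Psi> w = \<Psi> w')" using C T w by (subst sum.delta') auto
      finally show "(\<Sum>c\<in>C. (pmf \<mu> w * of_bool (\<Psi> w = c)) * (pmf \<mu> w' * of_bool (\<Psi> w' = c))) =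
        pmf \<mu> w * pmf \<mu> w' * of_bool (\<Psi> w = \<Psi> w')" .
    qed
    finally show ?thesis .
  qed
  \<comment> \<open>Identifies \<open>D\<close> as \<open>n\<close> times the squared Euclidean
    distance from \<open>f\<close> to the constant \<open>\<tau> / n\<close>.\<close>
  have D: "D = n * (\<Sum>c\<in>C. (f c - \<tau> / n)\<^sup>2)"
  proof -
    have "(\<Sum>c\<in>C. (f c - \<tau> / n)\<^sup>2) = (\<Sum>c\<in>C. (f c)\<^sup>2 - 2 * \<tau> / n * f c + (\<tau> / n)\<^sup>2)"
      by (intro sum.cong refl) (simp add: power2_eq_square algebra_simps)
    also have "\<dots> = (\<Sum>c\<in>C. (f c)\<^sup>2) - 2 * \<tau> / n * \<tau> + n * (\<tau> / n)\<^sup>2"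
    proof -
      have "(\<Sum>c\<in>C. 2 * \<tau> / n * f c) = 2 * \<tau> / n * \<tau>" by (simp only: sf sum_distrib_left[symmetric])
      thus ?thesis by (simp add: sum.distrib sum_subtractf n_def)
    qed
    finally show ?thesis unfolding D_def sf2[symmetric] n_def[symmetric] using n
      by (simp add: power2_eq_square field_simps)
  qed
  thus "D \<ge> 0" using n by (simp add: sum_nonneg)
  have L1: "(\<Sum>c\<in>C. \<bar>f c - \<tau> / n\<bar>) \<le> sqrt D"
  proof (rule real_le_rsqrt)
    show "(\<Sum>c\<in>C. \<bar>f c - \<tau> / n\<bar>)\<^sup>2 \<le> D"
      using sum_squared_le_sum_of_squares[of "\<lambda>c. \<bar>f c - \<tau> / n\<bar>" C] by (simp add: D n_def mult.commute)
  qed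
  show "tv_dist (map_pmf \<Psi> \<mu>) (pmf_of_set C) \<le> (1 - \<tau>) + sqrt D"
  proof (rule tv_dist_le)
    fix A
    define PA where "PA = measure_pmf.prob \<mu> (\<Psi> -` A \<inter> T)"
    define U where "U = measure_pmf.prob (pmf_of_set C) A"
    define Q where "Q = measure_pmf.prob (map_pmf \<Psi> \<mu>) A"
    have U: "U = card (C \<inter> A) / n" unfolding U_def n_def using C by (rule prob_pmf_of_set)
    have U01: "0 \<le> U" "U \<le> 1" by (simp_all add: U_def)
    have \<tau>01: "0 \<le> \<tau>" "\<tau> \<le> 1" by (simp_all add: \<tau>_def)
    have Q: "PA \<le> Q" "Q \<le> PA + (1 - \<tau>)"
    proof -
      show "PA \<le> Q" unfolding PA_def Q_def measure_map_pmf by (intro measure_pmf.finite_measure_mono) auto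
      have "Q \<le> measure_pmf.prob \<mu> ((\<Psi> -` A \<inter> T) \<union> (- T))"
        unfolding Q_def measure_map_pmf by (intro measure_pmf.finite_measure_mono) auto
      also have "\<dots> \<le> PA + measure_pmf.prob \<mu> (- T)"
        unfolding PA_def by (rule measure_Un_le) auto
      also have "measure_pmf.prob \<mu> (- T) = 1 - \<tau>"
        unfolding \<tau>_def using measure_pmf.prob_compl[of T \<mu>] by (simp add: Compl_eq_Diff_UNIV)
      finally show "Q \<le> PA + (1 - \<tau>)" .
    qed
    \<comment> \<open>The image is compared with \<open>\<tau>\<close> times the uniform law. The
      discarded mass and the deficit of that comparison law are each at most
      \<open>1 - \<tau>\<close> and act in opposite directions, so \<open>1 - \<tau>\<close> is paid
      only once.\<close>
    have "PA - \<tau> * U = (\<Sum>c\<in>C \<inter> A. f c - \<tau> / n)"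
      unfolding PA_def sumA[symmetric] U by (simp add: sum_subtractf)
    also have "\<bar>\<dots>\<bar> \<le> (\<Sum>c\<in>C \<inter> A. \<bar>f c - \<tau> / n\<bar>)" by (rule sum_abs)
    also have "\<dots> \<le> (\<Sum>c\<in>C. \<bar>f c - \<tau> / n\<bar>)" using C by (intro sum_mono2) auto
    finally have "\<bar>PA - \<tau> * U\<bar> \<le> sqrt D" using L1 by linarith
    moreover have "\<tau> * U \<le> U" using \<tau>01 U01 mult_right_mono[of \<tau> 1 U] by simp
    moreover have "(1 - \<tau>) * U \<le> (1 - \<tau>) * 1" using \<tau>01 U01 by (intro mult_left_mono) auto
    hence "U - \<tau> * U \<le> 1 - \<tau>" by (simp add: algebra_simps)
    ultimately have "\<bar>Q - U\<bar> \<le> (1 - \<tau>) + sqrt D" using Q unfolding abs_le_iff by linarith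
    thus "\<bar>measure_pmf.prob (map_pmf \<Psi> \<mu>) A - measure_pmf.prob (pmf_of_set C) A\<bar> \<le> (1 - \<tau>) + sqrt D"
      by (simp add: Q_def U_def)
  qed
qed

text \<open>Split according to the gcd \<open>g\<close> of the entries of \<open>w - w'\<close>: the diagonal \<open>g = 0\<close> gives \<open>e\<close>, the value
  \<open>g = 1\<close> gives the square, and \<open>w \<equiv> w' (mod g)\<close> costs a factor \<open>1 / g + \<beta>\<close> per coordinate.\<close>

lemma (in comm_group) expected_collisions_le:
  fixes p :: "int pmf" and k :: nat and T :: "(nat \<Rightarrow> int) set"
  defines "\<mu> \<equiv> Pi_pmf {..<k} 0 (\<lambda>_. p)" and "Zp \<equiv> Pi_pmf {..<k} \<one> (\<lambda>_. pmf_of_set (carrier G))"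
  assumes fin: "finite (carrier G)" and T: "finite T" "\<And>w i. w \<in> T \<Longrightarrow> i \<ge> k \<Longrightarrow> w i = 0"
    and L: "\<And>w w' i. w \<in> T \<Longrightarrow> w' \<in> T \<Longrightarrow> \<bar>w i - w' i\<bar> \<le> int L"
    and e: "0 \<le> e" "\<And>w. w \<in> T \<Longrightarrow> real (order G) * pmf \<mu> w \<le> e"
    and \<beta>: "\<And>g c. g > 0 \<Longrightarrow> measure_pmf.prob p {x. int g dvd x - c} \<le> 1 / real g + \<beta>"
  shows "real (order G) * (\<Sum>w\<in>T. \<Sum>w'\<in>T. pmf \<mu> w * pmf \<mu> w' * measure_pmf.prob Zp {z. word G {..<k} z w = word G {..<k} z w'})
    \<le> e + (measure_pmf.prob \<mu> T)\<^sup>2 + (\<Sum>g=2..L. real g ^ min_gens G * (1 / real g + \<beta>) ^ k)"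
proof -
  define n d where "n = real (order G)" and "d = min_gens G"
  have sT: "(\<Sum>w\<in>T. pmf \<mu> w) = measure_pmf.prob \<mu> T" using T(1) by (simp add: measure_measure_pmf_finite)
  define dv where "dv g w w' \<longleftrightarrow> (\<forall>i<k. int g dvd w i - w' i)" for g and w w' :: "nat \<Rightarrow> int"
  have supp: "z \<in> {..<k} \<rightarrow> carrier G" if "z \<in> set_pmf Zp" for z
    using that fin carrier_not_empty unfolding Zp_def by (auto simp: set_Pi_pmf PiE_dflt_def)
  have pt: "n * measure_pmf.prob Zp {z. word G {..<k} z w = word G {..<k} z w'} \<le>
      (if w = w' then n else 1 + (\<Sum>g=2..L. real g ^ d * of_bool (dv g w w')))" if w: "w \<in> T" "w' \<in> T" for w w'
  proof (cases "w = w'")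
    case True
    have "n * measure_pmf.prob Zp {z. word G {..<k} z w = word G {..<k} z w'} \<le> n * 1"
      by (intro mult_left_mono) (auto simp: n_def)
    thus ?thesis using True by simp
  next
    case False
    obtain g b where g: "\<And>i. i < k \<Longrightarrow> int g dvd w i - w' i" "(\<Sum>i<k. b i * (w i - w' i)) = int g"
      using bezout_sum[of k "\<lambda>i. w i - w' i"] by blast
    obtain i where i: "w i \<noteq> w' i" using False by blast
    hence ik: "i < k" using T(2)[OF w(1), of i] T(2)[OF w(2), of i] by (cases "i < k") auto
    have g0: "g > 0" using g(1)[OF ik] i by (cases "g = 0") auto
    have "int g \<le> \<bar>w i - w' i\<bar>" using g(1)[OF ik] i by (intro zdvd_imp_le) auto
    hence gL: "g \<le> L" using L[OF w, of i] by linarith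
    have "measure_pmf.prob Zp {z. word G {..<k} z w = word G {..<k} z w'} = measure_pmf.prob Zp {z. word G {..<k} z (\<lambda>i. w i - w' i) = \<one>}"
      by (intro measure_pmf.finite_measure_eq_AE AE_pmfI) (simp_all add: word_diff_eq_one_iff[OF supp])
    hence "n * measure_pmf.prob Zp {z. word G {..<k} z w = word G {..<k} z w'} \<le> real g ^ d"
      using prob_word_eq_one_le[OF fin g(2) g0] by (simp add: n_def d_def Zp_def)
    also have "real g ^ d \<le> 1 + (\<Sum>g=2..L. real g ^ d * of_bool (dv g w w'))"
    proof (cases "g = 1")
      case True
      thus ?thesis by (simp add: sum_nonneg)
    next
      case False
      \<comment> \<open>The gcd is itself one of the indices \<open>2..L\<close>, so its term is
        dominated by the whole sum.\<close>
      have "real g ^ d = (\<Sum>h\<in>{g}. real h ^ d * of_bool (dv h w w'))" using g(1) by (simp add: dv_def)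
      also have "\<dots> \<le> (\<Sum>h=2..L. real h ^ d * of_bool (dv h w w'))"
        using False g0 gL by (intro sum_mono2) auto
      finally show ?thesis by simp
    qed
    finally show ?thesis using False by simp
  qed
  have "n * (\<Sum>w\<in>T. \<Sum>w'\<in>T. pmf \<mu> w * pmf \<mu> w' * measure_pmf.prob Zp {z. word G {..<k} z w = word G {..<k} z w'}) =
     (\<Sum>w\<in>T. \<Sum>w'\<in>T. (pmf \<mu> w * pmf \<mu> w') * (n * measure_pmf.prob Zp {z. word G {..<k} z w = word G {..<k} z w'}))"
    by (simp add: sum_distrib_left mult_ac)
  also have "\<dots> \<le> (\<Sum>w\<in>T. \<Sum>w'\<in>T. (pmf \<mu> w * pmf \<mu> w') *
      ((if w = w' then n else 0) + 1 + (\<Sum>g=2..L. real g ^ d * of_bool (dv g w w'))))"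
  proof (intro sum_mono mult_left_mono)
    fix w w' assume w: "w \<in> T" "w' \<in> T"
    have "0 \<le> (\<Sum>g=2..L. real g ^ d * of_bool (dv g w w'))" by (intro sum_nonneg) auto
    thus "n * measure_pmf.prob Zp {z. word G {..<k} z w = word G {..<k} z w'} \<le>
      (if w = w' then n else 0) + 1 + (\<Sum>g=2..L. real g ^ d * of_bool (dv g w w'))"
      using pt[OF w] by (auto split: if_splits)
  qed auto
  also have "\<dots> = (\<Sum>w\<in>T. \<Sum>w'\<in>T. (pmf \<mu> w * pmf \<mu> w') * (if w = w' then n else 0)) +
      (\<Sum>w\<in>T. \<Sum>w'\<in>T. pmf \<mu> w * pmf \<mu> w') +
      (\<Sum>w\<in>T. \<Sum>w'\<in>T. \<Sum>g=2..L. real g ^ d * (pmf \<mu> w * (pmf \<mu> w' * of_bool (dv g w w'))))"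
    by (simp only: distrib_left sum.distrib sum_distrib_left mult_1_right mult_1_left mult_ac)
  also have "(\<Sum>w\<in>T. \<Sum>w'\<in>T. (pmf \<mu> w * pmf \<mu> w') * (if w = w' then n else 0)) \<le> e"
  proof -
    have "(\<Sum>w\<in>T. \<Sum>w'\<in>T. (pmf \<mu> w * pmf \<mu> w') * (if w = w' then n else 0)) = (\<Sum>w\<in>T. pmf \<mu> w * (n * pmf \<mu> w))"
    proof (intro sum.cong refl)
      fix w assume w: "w \<in> T"
      have "(\<Sum>w'\<in>T. (pmf \<mu> w * pmf \<mu> w') * (if w = w' then n else 0)) = (\<Sum>w'\<in>T. if w = w' then pmf \<mu> w * (n * pmf \<mu> w) else 0)"
        by (intro sum.cong) auto
      thus "(\<Sum>w'\<in>T. (pmf \<mu> w * pmf \<mu> w') * (if w = w' then n else 0)) = pmf \<mu> w * (n * pmf \<mu> w)"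
        using T(1) w by simp
    qed
    also have "\<dots> \<le> (\<Sum>w\<in>T. pmf \<mu> w * e)" using e(2) by (intro sum_mono mult_left_mono) (auto simp: n_def)
    also have "\<dots> = measure_pmf.prob \<mu> T * e" by (simp add: sT flip: sum_distrib_right)
    also have "\<dots> \<le> e" using e(1) mult_right_mono[of "measure_pmf.prob \<mu> T" 1 e] by simp
    finally show ?thesis .
  qed
  also have "(\<Sum>w\<in>T. \<Sum>w'\<in>T. pmf \<mu> w * pmf \<mu> w') = (measure_pmf.prob \<mu> T)\<^sup>2"
    by (simp add: sT power2_eq_square flip: sum_product)
  also have "(\<Sum>w\<in>T. \<Sum>w'\<in>T. \<Sum>g=2..L. real g ^ d * (pmf \<mu> w * (pmf \<mu> w' * of_bool (dv g w w')))) \<le>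
     (\<Sum>g=2..L. real g ^ d * (1 / real g + \<beta>) ^ k)"
  proof -
    have inner: "(\<Sum>w'\<in>T. \<Sum>w\<in>T. pmf \<mu> w' * (pmf \<mu> w * of_bool (dv g w w'))) \<le> (1 / real g + \<beta>) ^ k" if g: "g > 0" for g
    proof -
      have pr: "(\<Sum>w\<in>T. pmf \<mu> w * of_bool (dv g w w')) \<le> (1 / real g + \<beta>) ^ k" for w'
      proof -
        have "(\<Sum>w\<in>T. pmf \<mu> w * of_bool (dv g w w')) = (\<Sum>w\<in>{w\<in>T. dv g w w'}. pmf \<mu> w)"
          using T(1) by (intro sum.mono_neutral_cong_right) auto
        also have "\<dots> = measure_pmf.prob \<mu> {w\<in>T. dv g w w'}" using T(1) by (simp add: measure_measure_pmf_finite)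
        also have "\<dots> \<le> measure_pmf.prob \<mu> (Pi {..<k} (\<lambda>i. {x. int g dvd x - w' i}))"
          by (intro measure_pmf.finite_measure_mono) (auto simp: dv_def)
        also have "\<dots> = (\<Prod>i<k. measure_pmf.prob p {x. int g dvd x - w' i})"
          unfolding \<mu>_def by (rule measure_Pi_pmf_Pi) simp
        also have "\<dots> \<le> (\<Prod>i<k. 1 / real g + \<beta>)" using \<beta>[OF g] by (intro prod_mono) auto
        finally show ?thesis by simp
      qed
      \<comment> \<open>Nonnegativity is read off from \<open>pr\<close> at an arbitrary
        vector.\<close>
      have nn: "0 \<le> (1 / real g + \<beta>) ^ k" using sum_nonneg[of T "\<lambda>w. pmf \<mu> w * of_bool (dv g w undefined)"] pr[of undefined] by force
      have "(\<Sum>w'\<in>T. \<Sum>w\<in>T. pmf \<mu> w' * (pmf \<mu> w * of_bool (dv g w w'))) \<le> (\<Sum>w'\<in>T. pmf \<mu> w' * (1 / real g + \<beta>) ^ k)"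
        unfolding sum_distrib_left[symmetric] using pr by (intro sum_mono mult_left_mono) auto
      also have "\<dots> = measure_pmf.prob \<mu> T * (1 / real g + \<beta>) ^ k" by (simp add: sT flip: sum_distrib_right)
      also have "\<dots> \<le> 1 * (1 / real g + \<beta>) ^ k" using nn by (intro mult_right_mono) auto
      finally show ?thesis by simp
    qed
    have "(\<Sum>w\<in>T. \<Sum>w'\<in>T. \<Sum>g=2..L. real g ^ d * (pmf \<mu> w * (pmf \<mu> w' * of_bool (dv g w w')))) =
      (\<Sum>g=2..L. \<Sum>w'\<in>T. \<Sum>w\<in>T. real g ^ d * (pmf \<mu> w' * (pmf \<mu> w * of_bool (dv g w w'))))"
      by (subst sum.swap, subst (2) sum.swap, subst sum.swap) (simp add: mult_ac)
    also have "\<dots> = (\<Sum>g=2..L. real g ^ d * (\<Sum>w'\<in>T. \<Sum>w\<in>T. pmf \<mu> w' * (pmf \<mu> w * of_bool (dv g w w'))))"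
      by (simp add: sum_distrib_left)
    also have "\<dots> \<le> (\<Sum>g=2..L. real g ^ d * (1 / real g + \<beta>) ^ k)"
      using inner by (intro sum_mono mult_left_mono) auto
    finally show ?thesis .
  qed
  finally show ?thesis unfolding n_def d_def by (simp add: add_mono)
qed

section \<open>The sum over common divisors\<close>

text \<open>With \<open>m = k - d\<close>, for \<open>g \<le> B\<close> the main part is
  \<open>1 / g ^ m\<close>, and the perturbation costs
  \<open>(1 + g / B) ^ k \<le> exp (k * g / B)\<close>, at most \<open>g powr (m / 2)\<close> by the
  hypothesis on \<open>ln B\<close>. For \<open>g > B\<close> each factor is at most
  \<open>2 / B\<close> and \<open>g\<close> is simply bounded by \<open>L\<close>.\<close>

lemma sum_gcd_terms_le:
  fixes B :: real and d k L :: nat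
  assumes B: "B \<ge> 4" and d: "d + 4 \<le> k" and kB: "real k \<le> real (k - d) / 2 * ln B"
  shows "(\<Sum>g=2..L. real g ^ d * (1 / real g + 1 / B) ^ k) \<le> 4 * 2 powr (- (real (k - d) / 2)) + real L ^ (d + 1) * (2 / B) ^ k"
proof -
  define m where "m = k - d"
  have m: "m \<ge> 4" "k = m + d" using d by (auto simp: m_def)
  \<comment> \<open>This rests on the decrease of \<open>ln x / x\<close> from 3 on, and at
    \<open>g = 2\<close> on \<open>ln 2 / 2 = ln 4 / 4\<close>, which is where
    \<open>B \<ge> 4\<close> enters.\<close>
  have lnB: "ln B \<le> B / g * ln g" if g: "2 \<le> g" "real g \<le> B" for g :: nat
  proof (cases "g = 2")
    case True
    have "ln B = ln 4 + ln (B / 4)" using B by (simp add: ln_div)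
    also have "ln (B / 4) \<le> B / 4 - 1" using B by (intro ln_le_minus_one) auto
    also have "ln (4::real) = 2 * ln 2" using ln_realpow[of 2 2] by simp
    also have "B / 4 - 1 \<le> (B / 4 - 1) * (2 * ln 2)" using B ln2_ge_two_thirds by (simp add: mult_le_cancel_left1)
    finally show ?thesis using True by (simp add: algebra_simps)
  next
    case False
    hence g3: "real g \<ge> 3" using g by simp
    have "ln B = ln g + ln (B / g)" using B g by (simp add: ln_div)
    also have "ln (B / g) \<le> B / g - 1" using B g by (intro ln_le_minus_one) auto
    also have "B / g - 1 \<le> (B / g - 1) * ln g"
    proof -
      have "ln (real g) \<ge> 1"
      proof -
        have "exp 1 \<le> real g" using exp_le g3 by linarith
        thus ?thesis using g3 by (subst ln_ge_iff) auto
      qed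
      moreover have "B / g - 1 \<ge> 0" using g by simp
      ultimately show ?thesis using mult_left_mono[of 1 "ln (real g)" "B / g - 1"] by simp
    qed
    finally show ?thesis by (simp add: algebra_simps)
  qed
  have small: "real g ^ d * (1 / real g + 1 / B) ^ k \<le> 4 * 2 powr (- (m / 2)) * (1 / (real g - 1) - 1 / real g)"
    if g: "2 \<le> g" "real g \<le> B" for g :: nat
  proof -
    have g0: "real g > 0" using g by simp
    have "real g ^ d * (1 / real g + 1 / B) ^ k = real g ^ d * ((1 / g) * (1 + g / B)) ^ k"
      using g0 B by (simp add: field_simps)
    also have "\<dots> = (1 / real g ^ m) * (1 + g / B) ^ k"
      using g0 unfolding m(2) power_mult_distrib by (simp add: power_add power_divide)
    also have "(1 + g / B) ^ k \<le> exp (g / B) ^ k" using g0 B by (intro power_mono exp_ge_add_one_self) auto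
    also have "exp (g / B) ^ k = exp (k * (g / B))" by (rule exp_of_nat_mult[symmetric])
    also have "real k * (g / B) \<le> m / 2 * ln g"
    proof -
      have "real k * (g / B) \<le> (m / 2 * ln B) * (g / B)" using kB g0 B by (intro mult_right_mono) (auto simp: m_def)
      also have "\<dots> \<le> (m / 2 * (B / g * ln g)) * (g / B)" using lnB[OF g] g0 B by (intro mult_right_mono mult_left_mono) auto
      also have "\<dots> = m / 2 * ln g" using g0 B by simp
      finally show ?thesis .
    qed
    finally have "real g ^ d * (1 / real g + 1 / B) ^ k \<le> 1 / real g ^ m * exp (m / 2 * ln g)"
      using g0 by (simp add: mult_left_mono divide_right_mono)
    also have "\<dots> = real g powr (- (m / 2))"
    proof -
      have "exp (m / 2 * ln g) = real g powr (m / 2)" using g0 by (simp add: powr_def)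
      moreover have "real g ^ m = real g powr (m / 2) * real g powr (m / 2)"
        using g0 by (simp flip: powr_add powr_realpow)
      ultimately show ?thesis using g0 by (simp add: powr_minus field_simps)
    qed
    \<comment> \<open>The exponent -2 is kept for summability over \<open>g\<close> and the rest is
      bounded at \<open>g = 2\<close>; this uses \<open>m \<ge> 4\<close>.\<close>
    also have "\<dots> = real g powr (-2) * real g powr (- (m / 2 - 2))" using g0 by (simp flip: powr_add)
    also have "\<dots> \<le> real g powr (-2) * 2 powr (- (m / 2 - 2))"
      using g m(1) by (intro mult_left_mono powr_mono2') auto
    also have "(2::real) powr (- (m / 2 - 2)) = 4 * 2 powr (- (m / 2))"
      using powr_add[of 2 2 "- (m / 2)"] by simp
    also have "real g powr (-2) \<le> 1 / (real g - 1) - 1 / real g"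
    proof -
      have "real g powr (-2) = 1 / (real g * real g)" using g0 by (simp add: powr_minus powr_numeral power2_eq_square inverse_eq_divide)
      also have "\<dots> \<le> 1 / ((real g - 1) * real g)" using g by (intro divide_left_mono mult_right_mono mult_pos_pos) auto
      also have "\<dots> = 1 / (real g - 1) - 1 / real g" using g by (simp add: field_simps)
      finally show ?thesis .
    qed
    finally show ?thesis by (simp add: mult_ac mult_right_mono)
  qed
  have large: "real g ^ d * (1 / real g + 1 / B) ^ k \<le> real L ^ d * (2 / B) ^ k"
    if g: "2 \<le> g" "g \<le> L" "real g > B" for g :: nat
  proof -
    have "1 / real g \<le> 1 / B" using g B by (intro divide_left_mono mult_pos_pos) auto
    hence "(1 / real g + 1 / B) ^ k \<le> (2 / B) ^ k" using B by (intro power_mono) auto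
    moreover have "real g ^ d \<le> real L ^ d" using g by (intro power_mono) auto
    ultimately show ?thesis using B by (intro mult_mono) auto
  qed
  have tel: "(\<Sum>g=2..L. 1 / (real g - 1) - 1 / real g) \<le> 1"
  proof (cases "L \<ge> 2")
    case True
    have "(\<Sum>g=2..L. 1 / (real g - 1) - 1 / real g) = 1 - 1 / real L"
      using True by (induction L rule: dec_induct) auto
    thus ?thesis by simp
  qed simp
  have "(\<Sum>g=2..L. real g ^ d * (1 / real g + 1 / B) ^ k) \<le>
    (\<Sum>g=2..L. 4 * 2 powr (- (m / 2)) * (1 / (real g - 1) - 1 / real g) + real L ^ d * (2 / B) ^ k)"
  proof (intro sum_mono)
    fix g assume g: "g \<in> {2..L}"
    have "0 \<le> 1 / (real g - 1) - 1 / real g" using g by (simp add: field_simps)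
    hence "0 \<le> 4 * 2 powr (- (m / 2)) * (1 / (real g - 1) - 1 / real g)" by simp
    moreover have "0 \<le> real L ^ d * (2 / B) ^ k" using B by simp
    ultimately
    show "real g ^ d * (1 / real g + 1 / B) ^ k \<le> 4 * 2 powr (- (m / 2)) * (1 / (real g - 1) - 1 / real g) + real L ^ d * (2 / B) ^ k"
    proof (cases "real g \<le> B")
      case True
      hence "real g ^ d * (1 / real g + 1 / B) ^ k \<le> 4 * 2 powr (- (m / 2)) * (1 / (real g - 1) - 1 / real g)"
        using g by (intro small) auto
      thus ?thesis using \<open>0 \<le> real L ^ d * (2 / B) ^ k\<close> by linarith
    next
      case False
      hence "real g ^ d * (1 / real g + 1 / B) ^ k \<le> real L ^ d * (2 / B) ^ k"
        using g by (intro large) auto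
      thus ?thesis using \<open>0 \<le> 4 * 2 powr (- (m / 2)) * (1 / (real g - 1) - 1 / real g)\<close> by linarith
    qed
  qed
  also have "\<dots> = 4 * 2 powr (- (m / 2)) * (\<Sum>g=2..L. 1 / (real g - 1) - 1 / real g) + real (card {2..L}) * (real L ^ d * (2 / B) ^ k)"
    by (simp add: sum.distrib sum_distrib_left)
  also have "\<dots> \<le> 4 * 2 powr (- (m / 2)) * 1 + real L * (real L ^ d * (2 / B) ^ k)"
    using tel B by (intro add_mono mult_left_mono mult_right_mono) auto
  finally show ?thesis by (simp add: m_def mult_ac)
qed

text \<open>The distance is at most \<open>1 - \<tau> + sqrt (D z)\<close>, where only
  \<open>D\<close> depends on the generators. The collision bound controls the mean of the
  nonnegative \<open>D\<close>, and Markov's inequality at level \<open>\<eta>\<^sup>2\<close>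
  concludes.\<close>

lemma (in comm_group) mix_dist_concentrated:
  fixes k L :: nat and e r t \<eta> :: real and dir :: orientation
  defines "\<mu> \<equiv> Pi_pmf {..<k} 0 (\<lambda>_. xi dir (t / k))"
  defines "T \<equiv> {w \<in> PiE_dflt {..<k} 0 (\<lambda>_. {x. \<bar>zscore dir (t / k) x\<bar> \<le> r}). real (order G) * pmf \<mu> w \<le> e}"
  assumes fin: "finite (carrier G)" and k: "k \<ge> 1" and t: "t > 0" and e: "e \<ge> 0" and \<eta>: "\<eta> > 0"
    and L: "2 * r * sqrt (t / k) \<le> real L"
    and \<beta>: "pmf (xi dir (t / k)) (mode dir (t / k)) \<le> \<beta>"
  shows "measure_pmf.prob (random_gens k G) {Z. mix_dist dir G Z t > (1 - measure_pmf.prob \<mu> T) + \<eta>} \<le>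
    (e + (\<Sum>g=2..L. real g ^ min_gens G * (1 / real g + \<beta>) ^ k)) / \<eta>\<^sup>2"
proof -
  define s where "s = t / k"
  have s: "s > 0" using t k by (simp add: s_def)
  define Zp where "Zp = Pi_pmf {..<k} \<one> (\<lambda>_. pmf_of_set (carrier G))"
  define n where "n = real (order G)"
  define \<tau> where "\<tau> = measure_pmf.prob \<mu> T"
  define D where "D z = n * (\<Sum>w\<in>T. \<Sum>w'\<in>T. pmf \<mu> w * pmf \<mu> w' * of_bool (word G {..<k} z w = word G {..<k} z w')) - \<tau>\<^sup>2" for z
  have supp: "z \<in> {..<k} \<rightarrow> carrier G" if "z \<in> set_pmf Zp" for z
    using that fin carrier_not_empty unfolding Zp_def by (auto simp: set_Pi_pmf PiE_dflt_def)
  have "finite {x. \<bar>zscore dir s x\<bar> \<le> r}"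
  proof (rule finite_subset)
    show "{x. \<bar>zscore dir s x\<bar> \<le> r} \<subseteq> {\<lfloor>drift dir s - r * sqrt s\<rfloor>..\<lceil>drift dir s + r * sqrt s\<rceil>}"
    proof
      fix x assume "x \<in> {x. \<bar>zscore dir s x\<bar> \<le> r}"
      hence "\<bar>x - drift dir s\<bar> \<le> r * sqrt s" using s by (simp add: zscore_def abs_divide divide_le_eq)
      hence "drift dir s - r * sqrt s \<le> x" "x \<le> drift dir s + r * sqrt s" by linarith+
      thus "x \<in> {\<lfloor>drift dir s - r * sqrt s\<rfloor>..\<lceil>drift dir s + r * sqrt s\<rceil>}" by (auto simp: floor_le_iff le_ceiling_iff)
    qed
  qed simp
  hence T: "finite T" unfolding T_def s_def[symmetric] by (intro finite_subset[OF _ finite_PiE_dflt]) auto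
  have T0: "w i = 0" if "w \<in> T" "i \<ge> k" for w i using that by (auto simp: T_def PiE_dflt_def)
  have TL: "\<bar>w i - w' i\<bar> \<le> int L" if w: "w \<in> T" "w' \<in> T" for w w' i
  proof (cases "i < k")
    case True
    have "\<bar>u i - drift dir s\<bar> \<le> r * sqrt s" if "u \<in> T" for u
    proof -
      have "\<bar>zscore dir s (u i)\<bar> \<le> r" using that True by (auto simp: T_def PiE_dflt_def s_def)
      thus ?thesis using s by (simp add: zscore_def abs_divide divide_le_eq)
    qed
    from this[OF w(1)] this[OF w(2)] have "\<bar>real_of_int (w i - w' i)\<bar> \<le> 2 * r * sqrt s" by simp
    also have "\<dots> \<le> L" using L by (simp add: s_def)
    finally show ?thesis by linarith
  qed (use T0[OF w(1), of i] T0[OF w(2), of i] in simp)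
  have mix: "D z \<ge> 0" "mix_dist dir G (image_mset z (mset_set {..<k})) t \<le> (1 - \<tau>) + sqrt (D z)" if "z \<in> set_pmf Zp" for z
  proof -
    have z: "z \<in> {..<k} \<rightarrow> carrier G" using supp[OF that] .
    have "cayley_walk dir G (image_mset z (mset_set {..<k})) t = map_pmf (word G {..<k} z) \<mu>"
      unfolding \<mu>_def using z k t by (intro cayley_walk_eq_map_word) auto
    moreover have "word G {..<k} z ` T \<subseteq> carrier G" using z by auto
    ultimately show "D z \<ge> 0" "mix_dist dir G (image_mset z (mset_set {..<k})) t \<le> (1 - \<tau>) + sqrt (D z)"
      using tv_dist_map_uniform_le[OF fin carrier_not_empty T, of "word G {..<k} z" \<mu>]
      unfolding mix_dist_def D_def n_def \<tau>_def order_def by simp_all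
  qed
  have ind: "measure_pmf.expectation Zp (\<lambda>z. of_bool (word G {..<k} z w = word G {..<k} z w')) =
      measure_pmf.prob Zp {z. word G {..<k} z w = word G {..<k} z w'}" for w w'
  proof -
    have "(\<lambda>z. of_bool (word G {..<k} z w = word G {..<k} z w') :: real) = indicator {z. word G {..<k} z w = word G {..<k} z w'}"
      by (auto simp: fun_eq_iff indicator_def)
    thus ?thesis by simp
  qed
  have intb: "integrable Zp (\<lambda>z. of_bool (word G {..<k} z w = word G {..<k} z w') :: real)" for w w'
    by (rule measure_pmf.integrable_const_bound[where B = 1]) auto
  have iD: "integrable Zp D" unfolding D_def[abs_def] using intb by auto
  have "measure_pmf.expectation Zp D = n * (\<Sum>w\<in>T. \<Sum>w'\<in>T. pmf \<mu> w * pmf \<mu> w' *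
      measure_pmf.prob Zp {z. word G {..<k} z w = word G {..<k} z w'}) - \<tau>\<^sup>2"
    unfolding D_def[abs_def] using intb by (simp add: ind)
  also have "\<dots> \<le> e + (\<Sum>g=2..L. real g ^ min_gens G * (1 / real g + \<beta>) ^ k)"
  proof -
    have b: "measure_pmf.prob (xi dir (t / k)) {x. int g dvd x - c} \<le> 1 / real g + \<beta>" if "g > 0" for g c
      using prob_xi_cong_le[OF s that, of dir c] \<beta> by (simp add: s_def)
    have Te: "real (order G) * pmf \<mu> w \<le> e" if "w \<in> T" for w using that by (simp add: T_def)
    have "n * (\<Sum>w\<in>T. \<Sum>w'\<in>T. pmf \<mu> w * pmf \<mu> w' * measure_pmf.prob Zp {z. word G {..<k} z w = word G {..<k} z w'})
      \<le> e + \<tau>\<^sup>2 + (\<Sum>g=2..L. real g ^ min_gens G * (1 / real g + \<beta>) ^ k)"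
      unfolding n_def \<tau>_def Zp_def \<mu>_def
      by (rule expected_collisions_le[OF fin T]) (fact T0 TL e b Te[unfolded \<mu>_def])+
    thus ?thesis by simp
  qed
  finally have ED: "measure_pmf.expectation Zp D \<le> e + (\<Sum>g=2..L. real g ^ min_gens G * (1 / real g + \<beta>) ^ k)" .
  have "measure_pmf.prob (random_gens k G) {Z. mix_dist dir G Z t > (1 - \<tau>) + \<eta>} =
    measure_pmf.prob Zp {z. mix_dist dir G (image_mset z (mset_set {..<k})) t > (1 - \<tau>) + \<eta>}"
    unfolding random_gens_def Zp_def[symmetric] by (simp add: vimage_def)
  also have "\<dots> \<le> measure_pmf.prob Zp {z. D z \<ge> \<eta>\<^sup>2}"
  proof (rule measure_pmf.finite_measure_mono_AE)
    show "AE z in Zp. z \<in> {z. mix_dist dir G (image_mset z (mset_set {..<k})) t > (1 - \<tau>) + \<eta>} \<longrightarrow> z \<in> {z. D z \<ge> \<eta>\<^sup>2}"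
    proof (rule AE_pmfI, rule impI, rule CollectI)
      fix z assume z: "z \<in> set_pmf Zp" "z \<in> {z. mix_dist dir G (image_mset z (mset_set {..<k})) t > (1 - \<tau>) + \<eta>}"
      hence "\<eta> \<le> sqrt (D z)" using mix(2)[OF z(1)] by simp
      hence "\<eta>\<^sup>2 \<le> (sqrt (D z))\<^sup>2" using \<eta> by (intro power_mono) auto
      thus "\<eta>\<^sup>2 \<le> D z" using mix(1)[OF z(1)] by simp
    qed
  qed simp
  also have "\<dots> \<le> measure_pmf.expectation Zp D / \<eta>\<^sup>2"
    using integral_Markov_inequality_measure[OF iD, of "{}" "\<eta>\<^sup>2"] mix(1) \<eta> by (simp add: AE_measure_pmf_iff)
  also have "\<dots> \<le> (e + (\<Sum>g=2..L. real g ^ min_gens G * (1 / real g + \<beta>) ^ k)) / \<eta>\<^sup>2"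
    using ED by (intro divide_right_mono) auto
  finally show ?thesis by (simp add: \<tau>_def)
qed

lemma prob_typical_ge:
  fixes k :: nat and e r s n :: real and dir :: orientation
  defines "\<mu> \<equiv> Pi_pmf {..<k} 0 (\<lambda>_. xi dir s)"
  assumes s: "s \<ge> 4"
  shows "1 - measure_pmf.prob \<mu> {w \<in> PiE_dflt {..<k} 0 (\<lambda>_. {x. \<bar>zscore dir s x\<bar> \<le> r}). n * pmf \<mu> w \<le> e} \<le>
    measure_pmf.prob \<mu> {w. n * pmf \<mu> w > e} + k * (2 * exp 4 * exp (- 2 * r))"
proof -
  define T where "T = {w \<in> PiE_dflt {..<k} 0 (\<lambda>_. {x. \<bar>zscore dir s x\<bar> \<le> r}). n * pmf \<mu> w \<le> e}"
  define B where "B i = {w. \<bar>zscore dir s (w i)\<bar> > r}" for i :: nat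
  have "1 - measure_pmf.prob \<mu> T = measure_pmf.prob \<mu> (- T)"
    using measure_pmf.prob_compl[of T \<mu>] by (simp add: Compl_eq_Diff_UNIV)
  also have "\<dots> \<le> measure_pmf.prob \<mu> ({w. n * pmf \<mu> w > e} \<union> (\<Union>i<k. B i))"
  proof (rule measure_pmf.finite_measure_mono_AE)
    show "AE w in \<mu>. w \<in> - T \<longrightarrow> w \<in> {w. n * pmf \<mu> w > e} \<union> (\<Union>i<k. B i)"
    proof (rule AE_pmfI)
      fix w assume "w \<in> set_pmf \<mu>"
      hence "\<forall>i. i \<notin> {..<k} \<longrightarrow> w i = 0" using set_Pi_pmf_subset[of "{..<k}" 0 "\<lambda>_. xi dir s"] by (auto simp: \<mu>_def)
      thus "w \<in> - T \<longrightarrow> w \<in> {w. n * pmf \<mu> w > e} \<union> (\<Union>i<k. B i)"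
        by (auto simp: T_def B_def PiE_dflt_def not_le)
    qed
  qed simp
  also have "\<dots> \<le> measure_pmf.prob \<mu> {w. n * pmf \<mu> w > e} + measure_pmf.prob \<mu> (\<Union>i<k. B i)"
    by (rule measure_Un_le) auto
  also have "measure_pmf.prob \<mu> (\<Union>i<k. B i) \<le> (\<Sum>i<k. measure_pmf.prob \<mu> (B i))"
    by (rule measure_pmf.finite_measure_subadditive_finite) auto
  also have "\<dots> \<le> (\<Sum>i<k. 2 * exp 4 * exp (- 2 * r))"
  proof (rule sum_mono)
    fix i assume "i \<in> {..<k}"
    hence c: "map_pmf (\<lambda>w. w i) \<mu> = xi dir s" by (simp add: \<mu>_def Pi_pmf_component)
    have "measure_pmf.prob \<mu> (B i) = measure_pmf.prob (map_pmf (\<lambda>w. w i) \<mu>) {x. \<bar>zscore dir s x\<bar> > r}"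
      by (simp add: B_def vimage_def)
    thus "measure_pmf.prob \<mu> (B i) \<le> 2 * exp 4 * exp (- 2 * r)" using prob_zscore_gt_le[OF s, of dir r] by (simp add: c)
  qed
  finally show ?thesis by (simp add: T_def)
qed

section \<open>Bounds for arbitrary generators\<close>

lemma mset_eq_image_upt:
  assumes "size Z = k"
  obtains z where "Z = image_mset z (mset_set {..<k})"
proof -
  obtain xs where xs: "mset xs = Z" using ex_mset by blast
  hence len: "length xs = k" using assms by auto
  have "image_mset (\<lambda>i. xs ! i) (mset_set {..<k}) = mset (map (\<lambda>i. xs ! i) [0..<k])"
    by (simp add: atLeast0LessThan)
  also have "map (\<lambda>i. xs ! i) [0..<k] = xs" using len map_nth[of xs] by simp
  finally show thesis using that[of "\<lambda>i. xs ! i"] xs by simp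
qed

lemma (in comm_group) mix_dist_ge:
  fixes k :: nat and t e :: real and dir :: orientation
  defines "\<mu> \<equiv> Pi_pmf {..<k} 0 (\<lambda>_. xi dir (t / k))"
  assumes fin: "finite (carrier G)" and k: "k \<ge> 1" and t: "t \<ge> 0" and e: "e > 0"
    and Z: "size Z = k" "set_mset Z \<subseteq> carrier G"
  shows "mix_dist dir G Z t \<ge> measure_pmf.prob \<mu> {w. real (order G) * pmf \<mu> w \<ge> e} - 1 / e"
proof -
  obtain z where z: "Z = image_mset z (mset_set {..<k})" using mset_eq_image_upt[OF Z(1)] .
  have zc: "z \<in> {..<k} \<rightarrow> carrier G" using Z(2) by (auto simp: z)
  define n where "n = real (order G)"
  have n: "n > 0" using fin order_gt_0_iff_finite by (simp add: n_def)
  define B where "B = {w. n * pmf \<mu> w \<ge> e}"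
  have card_le: "finite F \<Longrightarrow> F \<subseteq> B \<Longrightarrow> card F * (e / n) \<le> 1" for F
  proof -
    assume F: "finite F" "F \<subseteq> B"
    have "card F * (e / n) = (\<Sum>w\<in>F. e / n)" by simp
    also have "\<dots> \<le> (\<Sum>w\<in>F. pmf \<mu> w)" using F n by (intro sum_mono) (auto simp: B_def divide_le_eq mult.commute)
    also have "\<dots> = measure_pmf.prob \<mu> F" using F by (simp add: measure_measure_pmf_finite)
    also have "\<dots> \<le> 1" by simp
    finally show ?thesis .
  qed
  have B: "finite B"
  proof (rule ccontr)
    assume "infinite B"
    then obtain F where F: "F \<subseteq> B" "finite F" "card F = nat \<lceil>n / e\<rceil> + 1"
      using infinite_arbitrarily_large by metis
    have "n / e < card F" using F(3) by linarith
    hence "1 < card F * (e / n)" using n e by (simp add: field_simps)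
    thus False using card_le[OF F(2,1)] by simp
  qed
  define A where "A = word G {..<k} z ` B"
  have A: "finite A" "A \<subseteq> carrier G" using B zc by (auto simp: A_def)
  have "card A \<le> card B" unfolding A_def using B by (rule card_image_le)
  moreover have "card B \<le> n / e" using card_le[OF B] n e by (simp add: field_simps)
  ultimately have cA: "card A \<le> n / e" by linarith
  have walk: "cayley_walk dir G Z t = map_pmf (word G {..<k} z) \<mu>"
    unfolding z \<mu>_def using zc k t by (intro cayley_walk_eq_map_word)
  have "measure_pmf.prob \<mu> B \<le> measure_pmf.prob (cayley_walk dir G Z t) A"
    unfolding walk measure_map_pmf by (intro measure_pmf.finite_measure_mono) (auto simp: A_def)
  moreover have "measure_pmf.prob (pmf_of_set (carrier G)) A = card A / n"
    using A fin carrier_not_empty by (simp add: prob_pmf_of_set n_def order_def Int_absorb1)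
  moreover have "card A / n \<le> 1 / e"
  proof -
    have "card A / n \<le> n / e / n" using cA n by (intro divide_right_mono) auto
    thus ?thesis using n by simp
  qed
  ultimately have "measure_pmf.prob \<mu> B - 1 / e \<le> measure_pmf.prob (cayley_walk dir G Z t) A - measure_pmf.prob (pmf_of_set (carrier G)) A"
    by linarith
  also have "\<dots> \<le> mix_dist dir G Z t"
    unfolding mix_dist_def using tv_dist_ge[of "cayley_walk dir G Z t" A "pmf_of_set (carrier G)"] by linarith
  finally show ?thesis by (simp add: B_def n_def)
qed

text \<open>The walk at the later time is the earlier one multiplied by an independent word.
  Translations preserve the uniform law, so the later distance is an average of quantities bounded
  by the earlier distance.\<close>

lemma (in comm_group) mix_dist_antimono:
  assumes fin: "finite (carrier G)" and Z: "Z \<noteq> {#}" "set_mset Z \<subseteq> carrier G" and t: "0 \<le> t" "t \<le> t'"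
  shows "mix_dist dir G Z t' \<le> mix_dist dir G Z t"
proof -
  define k where "k = size Z"
  have k: "k \<ge> 1" using Z by (simp add: k_def Suc_le_eq nonempty_has_size)
  obtain z where z: "Z = image_mset z (mset_set {..<k})" using mset_eq_image_upt[of Z k] by (auto simp: k_def)
  have zc: "z \<in> {..<k} \<rightarrow> carrier G" using Z(2) by (auto simp: z)
  define h where "h = t' - t"
  have h: "h \<ge> 0" "t' = t + h" using t by (auto simp: h_def)
  define \<mu> where "\<mu> t = Pi_pmf {..<k} 0 (\<lambda>_. xi dir (t / k))" for t
  have "0 \<in> {..<k}" using k by simp
  hence ne: "{..<k} \<noteq> {}" by blast
  have walk: "cayley_walk dir G Z t = map_pmf (word G {..<k} z) (\<mu> t)" if "t \<ge> 0" for t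
    unfolding z \<mu>_def using zc k that by (intro cayley_walk_eq_map_word)
  have \<mu>: "\<mu> t' = bind_pmf (\<mu> t) (\<lambda>w. map_pmf (\<lambda>f j. w j + f j) (\<mu> h))"
  proof -
    have "lattice_walk dir k t' = bind_pmf (lattice_walk dir k t) (\<lambda>w. rate1_walk (lattice_step dir k) w h)"
      unfolding lattice_walk_def h(2) using t h by (intro rate1_walk_add) auto
    also have "(\<lambda>w. rate1_walk (lattice_step dir k) w h) = (\<lambda>w. map_pmf (\<lambda>f j. w j + f j) (\<mu> h))"
      using ne h by (simp add: fun_eq_iff lattice_step_eq rate1_walk_set_step \<mu>_def)
    finally show ?thesis using k t h lattice_walk_eq_Pi_pmf[of k _ dir] by (simp add: \<mu>_def)
  qed
  have "cayley_walk dir G Z t' = bind_pmf (\<mu> t) (\<lambda>w. bind_pmf (\<mu> h) (\<lambda>f. return_pmf (word G {..<k} z w \<otimes> word G {..<k} z f)))"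
    unfolding walk[OF order_trans[OF t]] \<mu> map_bind_pmf pmf.map_comp o_def word_add[OF zc] by (simp add: map_pmf_def)
  also have "\<dots> = bind_pmf (\<mu> h) (\<lambda>f. bind_pmf (\<mu> t) (\<lambda>w. return_pmf (word G {..<k} z w \<otimes> word G {..<k} z f)))"
    by (rule bind_commute_pmf)
  also have "\<dots> = bind_pmf (\<mu> h) (\<lambda>f. map_pmf (\<lambda>x. x \<otimes> word G {..<k} z f) (cayley_walk dir G Z t))"
    by (simp only: walk[OF t(1)] pmf.map_comp o_def) (simp only: map_pmf_def)
  finally have bind: "cayley_walk dir G Z t' = bind_pmf (\<mu> h) (\<lambda>f. map_pmf (\<lambda>x. x \<otimes> word G {..<k} z f) (cayley_walk dir G Z t))" .
  show ?thesis unfolding mix_dist_def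
  proof (rule tv_dist_le)
    fix A
    define U where "U = pmf_of_set (carrier G)"
    define p where "p = cayley_walk dir G Z t"
    define Sh where "Sh f = (\<lambda>x. x \<otimes> word G {..<k} z f) -` A" for f
    have inv: "measure_pmf.prob U (Sh f) = measure_pmf.prob U A" for f
    proof -
      define c where "c = word G {..<k} z f"
      have c: "c \<in> carrier G" using zc by (simp add: c_def)
      have "card (carrier G \<inter> Sh f) = card (carrier G \<inter> A)"
      proof (rule bij_betw_same_card[of "\<lambda>x. x \<otimes> c"], rule bij_betw_imageI)
        show "inj_on (\<lambda>x. x \<otimes> c) (carrier G \<inter> Sh f)" using c by (auto intro!: inj_onI)
        show "(\<lambda>x. x \<otimes> c) ` (carrier G \<inter> Sh f) = carrier G \<inter> A"
        proof (intro equalityI subsetI)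
          fix y assume y: "y \<in> carrier G \<inter> A"
          hence "y \<otimes> inv c \<otimes> c = y" using c by (simp add: m_assoc)
          thus "y \<in> (\<lambda>x. x \<otimes> c) ` (carrier G \<inter> Sh f)" using y c
            by (intro image_eqI[of _ _ "y \<otimes> inv c"]) (auto simp: Sh_def c_def[symmetric])
        qed (use c in \<open>auto simp: Sh_def c_def\<close>)
      qed
      thus ?thesis using fin carrier_not_empty by (simp add: U_def prob_pmf_of_set)
    qed
    have "measure_pmf.prob (cayley_walk dir G Z t') A = (\<integral>f. measure_pmf.prob p (Sh f) \<partial>\<mu> h)"
    proof -
      have "ennreal (measure_pmf.prob (cayley_walk dir G Z t') A) = emeasure (measure_pmf (cayley_walk dir G Z t')) A"
        by (simp add: measure_pmf.emeasure_eq_measure)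
      also have "\<dots> = (\<integral>\<^sup>+f. emeasure (measure_pmf (map_pmf (\<lambda>x. x \<otimes> word G {..<k} z f) p)) A \<partial>\<mu> h)"
        unfolding bind p_def by (simp only: emeasure_bind_pmf)
      also have "\<dots> = (\<integral>\<^sup>+f. ennreal (measure_pmf.prob p (Sh f)) \<partial>\<mu> h)"
        by (simp add: measure_pmf.emeasure_eq_measure Sh_def)
      also have "\<dots> = ennreal (\<integral>f. measure_pmf.prob p (Sh f) \<partial>\<mu> h)"
        by (intro nn_integral_eq_integral measure_pmf.integrable_const_bound[where B = 1]) auto
      finally show ?thesis by (simp add: Bochner_Integration.integral_nonneg)
    qed
    hence "measure_pmf.prob (cayley_walk dir G Z t') A - measure_pmf.prob U A = (\<integral>f. measure_pmf.prob p (Sh f) - measure_pmf.prob U (Sh f) \<partial>\<mu> h)"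
      by (subst Bochner_Integration.integral_diff) (auto simp: inv intro!: measure_pmf.integrable_const_bound[where B = 1])
    also have "\<bar>\<dots>\<bar> \<le> (\<integral>f. \<bar>measure_pmf.prob p (Sh f) - measure_pmf.prob U (Sh f)\<bar> \<partial>\<mu> h)"
      by (rule integral_abs_bound)
    also have "\<dots> \<le> (\<integral>f. tv_dist p U \<partial>\<mu> h)"
    proof (rule integral_mono)
      show "integrable (\<mu> h) (\<lambda>f. \<bar>measure_pmf.prob p (Sh f) - measure_pmf.prob U (Sh f)\<bar>)"
        using tv_dist_ge[of p _ U] tv_dist_bounds(2)[of p U]
        by (intro measure_pmf.integrable_const_bound[where B = 1]) (auto intro: order_trans)
    qed (auto simp: tv_dist_ge)
    finally show "\<bar>measure_pmf.prob (cayley_walk dir G Z t') A - measure_pmf.prob (pmf_of_set (carrier G)) A\<bar> \<le>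
      tv_dist (cayley_walk dir G Z t) (pmf_of_set (carrier G))" by (simp add: U_def p_def)
  qed
qed

section \<open>The Gaussian tail and the entropic times\<close>

lemma std_normal_singleton: "measure std_normal_distribution {x} = 0"
proof -
  have "emeasure std_normal_distribution {x} = (\<integral>\<^sup>+y. ennreal (std_normal_density y) * indicator {x} y \<partial>lborel)"
    by (subst emeasure_density) auto
  also have "\<dots> = 0"
    by (subst nn_integral_0_iff_AE) (auto intro!: AE_I[where N = "{x}"] simp: indicator_def)
  finally show ?thesis by (simp add: measure_def)
qed

lemma std_normal_symmetric: "measure std_normal_distribution {..- x} = measure std_normal_distribution {x..}"
proof -
  have "emeasure std_normal_distribution {..- x} = (\<integral>\<^sup>+y. ennreal (std_normal_density y) * indicator {..- x} y \<partial>distr lborel borel uminus)"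
    by (subst emeasure_density) (auto simp: lborel_distr_uminus)
  also have "\<dots> = (\<integral>\<^sup>+y. ennreal (std_normal_density (- y)) * indicator {..- x} (- y) \<partial>lborel)"
    by (subst nn_integral_distr) auto
  also have "\<dots> = (\<integral>\<^sup>+y. ennreal (std_normal_density y) * indicator {x..} y \<partial>lborel)"
    by (intro nn_integral_cong) (auto simp: std_normal_density_def indicator_def)
  also have "\<dots> = emeasure std_normal_distribution {x..}"
    by (subst emeasure_density) auto
  finally show ?thesis by (simp add: measure_def)
qed

lemma Gauss_tail_eq_cdf: "Gauss_tail x = cdf std_normal_distribution (- x)"
  by (simp add: Gauss_tail_def cdf_def std_normal_symmetric)

lemma Gauss_tail_eq_1_minus: "Gauss_tail x = 1 - cdf std_normal_distribution x"
proof -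
  interpret real_distribution std_normal_distribution by (rule real_dist_normal_dist)
  have "Gauss_tail x = measure std_normal_distribution ({x<..} \<union> {x})"
    unfolding Gauss_tail_def by (intro arg_cong[where f = "measure std_normal_distribution"]) auto
  also have "\<dots> = measure std_normal_distribution {x<..}"
    using finite_measure_Union[of "{x<..}" "{x}"] std_normal_singleton[of x] by simp
  also have "{x<..} = space std_normal_distribution - {..x}" by auto
  also have "measure std_normal_distribution \<dots> = 1 - cdf std_normal_distribution x"
    unfolding cdf_def by (rule prob_compl) simp
  finally show ?thesis .
qed

lemma Gauss_tail_minus: "Gauss_tail (- x) = 1 - Gauss_tail x"
  using Gauss_tail_eq_cdf[of x] Gauss_tail_eq_1_minus[of "- x"] by simp

lemma Gauss_tail_0: "Gauss_tail 0 = 1/2"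
  using Gauss_tail_minus[of 0] by simp

lemma isCont_Gauss_tail: "isCont Gauss_tail x"
proof -
  interpret real_distribution std_normal_distribution by (rule real_dist_normal_dist)
  have "isCont (\<lambda>x. 1 - cdf std_normal_distribution x) x"
    using isCont_cdf[of x] std_normal_singleton[of x] by (intro continuous_intros) auto
  thus ?thesis by (simp add: Gauss_tail_eq_1_minus[abs_def])
qed

lemma Gauss_tail_strict_antimono:
  assumes "a < b"
  shows "Gauss_tail b < Gauss_tail a"
proof -
  interpret real_distribution std_normal_distribution by (rule real_dist_normal_dist)
  define M where "M = max \<bar>a\<bar> \<bar>b\<bar>"
  have dens: "std_normal_density y \<ge> std_normal_density M" if "y \<in> {a..<b}" for y
  proof -
    have "\<bar>y\<bar> \<le> M" using that by (auto simp: M_def)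
    hence "\<bar>y\<bar>\<^sup>2 \<le> M\<^sup>2" by (intro power_mono) auto
    thus ?thesis by (simp add: std_normal_density_def divide_right_mono)
  qed
  have "ennreal (std_normal_density M) * ennreal (b - a) = (\<integral>\<^sup>+y. ennreal (std_normal_density M) * indicator {a..<b} y \<partial>lborel)"
    using assms by (subst nn_integral_cmult_indicator) auto
  also have "\<dots> \<le> (\<integral>\<^sup>+y. ennreal (std_normal_density y) * indicator {a..<b} y \<partial>lborel)"
    using dens by (intro nn_integral_mono) (auto simp: indicator_def intro!: ennreal_leI)
  also have "\<dots> = emeasure std_normal_distribution {a..<b}" by (subst emeasure_density) auto
  also have "\<dots> = ennreal (measure std_normal_distribution {a..<b})" by (simp add: emeasure_eq_measure)
  finally have "std_normal_density M * (b - a) \<le> measure std_normal_distribution {a..<b}"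
    using assms by (simp add: ennreal_mult[symmetric])
  moreover have "std_normal_density M * (b - a) > 0" using assms normal_density_pos[of 1 0 M] by simp
  moreover have "Gauss_tail a = measure std_normal_distribution ({a..<b} \<union> {b..})"
    unfolding Gauss_tail_def using assms by (intro arg_cong[where f = "measure std_normal_distribution"]) auto
  hence "Gauss_tail a = measure std_normal_distribution {a..<b} + Gauss_tail b"
    unfolding Gauss_tail_def by (subst (asm) finite_measure_Union) auto
  ultimately show ?thesis by linarith
qed

lemma Gauss_tail_01: "0 \<le> Gauss_tail x" "Gauss_tail x \<le> 1"
proof -
  interpret real_distribution std_normal_distribution by (rule real_dist_normal_dist)
  show "0 \<le> Gauss_tail x" "Gauss_tail x \<le> 1" by (simp_all add: Gauss_tail_def)
qed

lemma inj_Gauss_tail: "inj Gauss_tail"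
proof (rule injI)
  fix a b assume "Gauss_tail a = Gauss_tail b"
  thus "a = b" using Gauss_tail_strict_antimono[of a b] Gauss_tail_strict_antimono[of b a] by linarith
qed

text \<open>The value of \<open>the_inv\<close> is unspecified off the range, so the intermediate
  value theorem must first show that \<open>e\<close> is attained.\<close>

lemma Gauss_tail_the_inv:
  assumes "0 < e" "e < 1"
  shows "Gauss_tail (the_inv Gauss_tail e) = e"
proof -
  interpret real_distribution std_normal_distribution by (rule real_dist_normal_dist)
  have cdf: "cdf std_normal_distribution x = 1 - Gauss_tail x" for x by (simp add: Gauss_tail_eq_1_minus)
  have "eventually (\<lambda>x. cdf std_normal_distribution x > 1 - e) at_top"
    by (rule order_tendstoD(1)[OF cdf_lim_at_top_prob]) (use assms in simp)
  then obtain b where b: "Gauss_tail b < e" unfolding cdf by (auto simp: eventually_at_top_linorder)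
  have "eventually (\<lambda>x. cdf std_normal_distribution x < 1 - e) at_bot"
    by (rule order_tendstoD(2)[OF cdf_lim_at_bot]) (use assms in simp)
  then obtain a where a: "Gauss_tail a > e" unfolding cdf by (auto simp: eventually_at_bot_linorder)
  have "a \<le> b" using a b Gauss_tail_strict_antimono[of b a] by linarith
  hence "\<exists>x. a \<le> x \<and> x \<le> b \<and> Gauss_tail x = e"
    using a b isCont_Gauss_tail by (intro IVT2) auto
  hence "e \<in> range Gauss_tail" by auto
  thus ?thesis by (rule f_the_inv_into_f[OF inj_Gauss_tail])
qed

section \<open>Solving for the entropic times\<close>

lemma lattice_walk_coord:
  assumes "k \<ge> 1" "t \<ge> 0"
  shows "map_pmf (\<lambda>w. w 0) (lattice_walk dir k t) = xi dir (t / k)"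
  using assms by (simp add: lattice_walk_eq_Pi_pmf Pi_pmf_component)

lemma Q1_eq:
  assumes "k \<ge> 1" "t \<ge> 0"
  shows "Q1 dir k t w = surprisal dir (t / k) (w 0)"
  using assms by (simp add: Q1_def surprisal_def nu_eq_xi)

lemma Q1_mean_eq:
  assumes "k \<ge> 1" "t \<ge> 0"
  shows "Q1_mean dir k t = entropy1 dir (t / k)"
  unfolding Q1_mean_def entropy1_def Q1_eq[OF assms] lattice_walk_coord[OF assms, symmetric] by simp

lemma Q1_var_eq:
  assumes "k \<ge> 1" "t \<ge> 0"
  shows "Q1_var dir k t = surprisal_var dir (t / k)"
  unfolding Q1_var_def surprisal_var_def Q1_eq[OF assms] lattice_walk_coord[OF assms, symmetric] by simp

text \<open>At \<open>s = 100\<close> the entropy is at most \<open>175/72 + 37/20 < 47/10\<close>,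
  so every value from 47/10 on is attained at some \<open>s \<ge> 100\<close>, where the local
  estimates hold. Strict monotonicity makes the solution unique.\<close>

lemma entropy1_solution:
  fixes k :: nat
  assumes k: "k \<ge> 1" and y: "y \<ge> 47/10"
  obtains s where "s \<ge> 100" "entropy1 dir s = y" "(THE t. t \<ge> 0 \<and> Q1_mean dir k t = y) = s * k"
proof -
  \<comment> \<open>The second term makes \<open>ln S / 2 - ln 2\<close> at least \<open>y\<close>,
    so the entropy has passed \<open>y\<close> by then.\<close>
  define S where "S = max 100 (exp (2 * (y + 1)))"
  have "ln 100 \<le> ln ((2::real) ^ 7)" by (subst ln_le_cancel_iff) auto
  also have "\<dots> = 7 * ln 2" by (subst ln_realpow) auto
  also have "\<dots> \<le> 7 * (25/36)" using ln2_le_25_over_36 by simp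
  finally have l100: "ln (100::real) \<le> 175/36" by simp
  have "entropy1 dir 100 \<le> ln 100 / 2 + 37/20" by (rule entropy1_le) simp
  hence lo: "entropy1 dir 100 \<le> y" using l100 y by simp
  have "ln S \<ge> ln (exp (2 * (y + 1)))" by (subst ln_le_cancel_iff) (auto simp: S_def)
  hence "ln S / 2 - ln 2 \<ge> y" using ln2_le_25_over_36 by simp
  moreover have "entropy1 dir S \<ge> ln S / 2 - ln 2" by (rule entropy1_ge) (simp add: S_def)
  ultimately have hi: "y \<le> entropy1 dir S" by linarith
  have "\<exists>s. 100 \<le> s \<and> s \<le> S \<and> entropy1 dir s = y"
    using lo hi isCont_entropy1[of _ dir] by (intro IVT) (auto simp: S_def)
  then obtain s where s: "s \<ge> 100" "entropy1 dir s = y" by blast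
  have "(THE t. t \<ge> 0 \<and> Q1_mean dir k t = y) = s * k"
  proof (rule the_equality)
    show "s * k \<ge> 0 \<and> Q1_mean dir k (s * k) = y" using s k by (simp add: Q1_mean_eq)
    fix t assume t: "t \<ge> 0 \<and> Q1_mean dir k t = y"
    hence "entropy1 dir (t / k) = entropy1 dir s" using s Q1_mean_eq[OF k, of t dir] by simp
    hence "t / k = s"
      using entropy1_strict_mono[of "t / k" s dir] entropy1_strict_mono[of s "t / k" dir] t s k
      by (cases "t / k" s rule: linorder_cases) auto
    thus "t = s * k" using k by (auto simp: field_simps)
  qed
  with s that show thesis by blast
qed

lemma set_random_gens:
  fixes G :: "('a, 'b) monoid_scheme"
  assumes "finite (carrier G)" "carrier G \<noteq> {}" "Z \<in> set_pmf (random_gens k G)"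
  shows "size Z = k \<and> set_mset Z \<subseteq> carrier G"
  using assms by (auto simp: random_gens_def set_Pi_pmf PiE_dflt_def)

section \<open>Cutoff\<close>

locale cutoff_sequence =
  fixes dir :: orientation and k :: "nat \<Rightarrow> nat" and G :: "nat \<Rightarrow> ('a, 'b) monoid_scheme"
  assumes k_pos: "\<And>N. k N \<ge> 1"
    and grp: "\<And>N. comm_group (G N)"
    and fin: "\<And>N. finite (carrier (G N))"
    and order_lim: "filterlim (\<lambda>N. order (G N)) at_top sequentially"
    and gap_lim: "filterlim (\<lambda>N. real (k N) - real (min_gens (G N))) at_top sequentially"
    and cond: "\<And>N. (real (k N) - real (min_gens (G N)) - 1) / real (k N)
        \<ge> 5 * (real (k N) / ln (real (order (G N))))
          + 2 * (real (min_gens (G N)) * ln (ln (real (k N))) / ln (real (order (G N))))"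
begin

definition "tau N \<alpha> = ent_time dir (k N) (order (G N)) \<alpha>"
definition "S N \<alpha> = tau N \<alpha> / k N"
definition "H0 N = ln (real (order (G N))) / k N"
definition "v0 N = surprisal_var dir (S N 0)"
text \<open>The window on the scale of entropy per coordinate: the entropy prescribed at
  \<open>\<alpha>\<close> is \<open>H0 N + \<alpha> * \<rho> N\<close>.\<close>

definition "\<rho> N = sqrt (v0 N / k N)"
text \<open>Any scale between \<open>1\<close> and \<open>sqrt (k N)\<close> would do for \<open>\<omega>\<close>.\<close>

definition "\<omega> N = sqrt (sqrt (real (k N)))"
definition "\<mu> N \<alpha> = Pi_pmf {..<k N} 0 (\<lambda>_. xi dir (S N \<alpha>))"

section \<open>Asymptotics of the entropic times\<close>

lemma kr_at_top: "filterlim (\<lambda>N. real (k N)) at_top sequentially"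
  by (rule filterlim_at_top_mono[OF gap_lim]) simp

lemma k_at_top: "filterlim k at_top sequentially"
  using kr_at_top by (simp add: filterlim_sequentially_iff_filterlim_real)

lemma eventually_k:
  "eventually P at_top \<Longrightarrow> \<forall>\<^sub>F N in sequentially. P (real (k N))"
  by (rule eventually_compose_filterlim[OF _ kr_at_top])

text \<open>The hypothesis multiplied by \<open>ln (order (G N))\<close>, which is positive for
  large \<open>N\<close>. Since \<open>ln (ln (k N))\<close> is eventually nonnegative and
  \<open>k N - d - 1 \<le> k N\<close>, with \<open>d\<close> the minimal number of generators, it
  also forces \<open>H0 N \<ge> 5\<close>.\<close>

lemma eventually_basic:
  "\<forall>\<^sub>F N in sequentially. real (k N) \<ge> 100 \<and> min_gens (G N) + 4 \<le> k N \<and> 0 \<le> ln (ln (real (k N))) \<and> ln (ln (real (k N))) \<le> k N / 10 \<and>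
     H0 N \<ge> 5 \<and> (real (k N) - min_gens (G N) - 1) * H0 N \<ge> 5 * k N + 2 * min_gens (G N) * ln (ln (real (k N)))"
proof -
  have "eventually (\<lambda>x::real. x \<ge> 100 \<and> 0 \<le> ln (ln x) \<and> ln (ln x) \<le> x / 10) at_top"
    by (intro eventually_conj; real_asymp)
  hence "\<forall>\<^sub>F N in sequentially. real (k N) \<ge> 100 \<and> 0 \<le> ln (ln (real (k N))) \<and> ln (ln (real (k N))) \<le> k N / 10"
    by (rule eventually_k)
  moreover have "\<forall>\<^sub>F N in sequentially. order (G N) \<ge> 2"
    using order_lim by (simp add: filterlim_at_top)
  moreover have "\<forall>\<^sub>F N in sequentially. real (k N) - real (min_gens (G N)) \<ge> 4"
    using gap_lim by (simp add: filterlim_at_top)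
  ultimately show ?thesis
  proof eventually_elim
    case (elim N)
    define a where "a = real (k N) - min_gens (G N) - 1"
    define l where "l = ln (real (order (G N)))"
    define c where "c = ln (ln (real (k N)))"
    have l: "l > 0" using elim by (simp add: l_def)
    have k0: "real (k N) > 0" using elim by simp
    have "a / k N \<ge> 5 * (k N / l) + 2 * (min_gens (G N) * c / l)" using cond[of N] by (simp add: a_def l_def c_def)
    hence "a / k N * l \<ge> (5 * (k N / l) + 2 * (min_gens (G N) * c / l)) * l" using l by (intro mult_right_mono) auto
    also have "(5 * (k N / l) + 2 * (min_gens (G N) * c / l)) * l = 5 * k N + 2 * min_gens (G N) * c" using l by (simp add: algebra_simps)
    also have "a / k N * l = a * H0 N" by (simp add: H0_def l_def)
    finally have aH: "a * H0 N \<ge> 5 * k N + 2 * min_gens (G N) * c" .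
    have H: "H0 N > 0" using l k0 by (simp add: H0_def l_def)
    have "5 * k N \<le> a * H0 N"
    proof -
      have "0 \<le> 2 * real (min_gens (G N)) * c" using elim by (intro mult_nonneg_nonneg) (auto simp: c_def)
      with aH show ?thesis by linarith
    qed
    also have "\<dots> \<le> k N * H0 N" using H by (intro mult_right_mono) (auto simp: a_def)
    finally have "H0 N \<ge> 5" using k0 by (simp add: mult.commute)
    thus ?case using aH elim by (simp add: a_def c_def)
  qed
qed

lemma tau_0: "tau N 0 = (THE t. t \<ge> 0 \<and> Q1_mean dir (k N) t = H0 N)"
  by (simp add: tau_def ent_time_0 ent_time0_def H0_def)

lemma eventually_S_0: "\<forall>\<^sub>F N in sequentially. S N 0 \<ge> 100 \<and> entropy1 dir (S N 0) = H0 N"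
  using eventually_basic
proof eventually_elim
  case (elim N)
  have "H0 N \<ge> 47/10" using elim by simp
  then obtain s where s: "s \<ge> 100" "entropy1 dir s = H0 N" "(THE t. t \<ge> 0 \<and> Q1_mean dir (k N) t = H0 N) = s * k N"
    by (rule entropy1_solution[OF k_pos])
  hence "S N 0 = s" using k_pos[of N] unfolding S_def tau_0 by simp
  with s show ?case by simp
qed

lemma v0_bounds:
  obtains lo hi where "0 < lo" "\<forall>\<^sub>F N in sequentially. lo \<le> v0 N \<and> v0 N \<le> hi"
proof -
  obtain lo hi where b: "0 < lo" "\<And>s. s \<ge> 100 \<Longrightarrow> lo \<le> surprisal_var dir s" "\<And>s. s \<ge> 100 \<Longrightarrow> surprisal_var dir s \<le> hi"
    using surprisal_var_bounds[of dir] by blast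
  show thesis
    using b by (intro that[of lo hi] eventually_mono[OF eventually_S_0]) (auto simp: v0_def)
qed

lemma eventually_rho_pos: "\<forall>\<^sub>F N in sequentially. \<rho> N > 0"
proof -
  obtain lo hi where b: "0 < lo" "\<forall>\<^sub>F N in sequentially. lo \<le> v0 N \<and> v0 N \<le> hi" using v0_bounds .
  from b(2) show ?thesis
  proof eventually_elim
    case (elim N)
    thus ?case using b(1) k_pos[of N] by (simp add: \<rho>_def)
  qed
qed

lemma rho_tendsto_0: "\<rho> \<longlonglongrightarrow> 0"
proof -
  obtain lo hi where b: "0 < lo" "\<forall>\<^sub>F N in sequentially. lo \<le> v0 N \<and> v0 N \<le> hi" using v0_bounds .
  have "(\<lambda>N. hi / real (k N)) \<longlonglongrightarrow> 0"
    by (intro tendsto_divide_0[OF tendsto_const] filterlim_at_top_imp_at_infinity kr_at_top)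
  hence u: "(\<lambda>N. sqrt (hi / real (k N))) \<longlonglongrightarrow> 0" using tendsto_real_sqrt by force
  show ?thesis
  proof (rule tendsto_sandwich[OF _ _ tendsto_const u])
    show "\<forall>\<^sub>F N in sequentially. 0 \<le> \<rho> N" using eventually_rho_pos by eventually_elim simp
    show "\<forall>\<^sub>F N in sequentially. \<rho> N \<le> sqrt (hi / real (k N))"
      using b(2) by eventually_elim (auto simp: \<rho>_def divide_right_mono)
  qed
qed

lemma eventually_rho_le: "c > 0 \<Longrightarrow> \<forall>\<^sub>F N in sequentially. \<bar>\<alpha>\<bar> * \<rho> N < c"
  using tendsto_mult_right_zero[OF rho_tendsto_0, of "\<bar>\<alpha>\<bar>"] by (rule order_tendstoD(2))

lemma k_rho: "v0 N \<ge> 0 \<Longrightarrow> real (k N) * \<rho> N = sqrt (v0 N * k N)"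
  using k_pos[of N] by (simp add: \<rho>_def real_sqrt_divide real_sqrt_mult field_simps)

text \<open>With \<open>H0 N \<ge> 5\<close> and
  \<open>\<bar>\<alpha>\<bar> * \<rho> N < 1/10\<close> the prescribed entropy stays above 47/10, in
  the range of \<open>entropy1_solution\<close>.\<close>

lemma eventually_S:
  "\<forall>\<^sub>F N in sequentially. S N \<alpha> \<ge> 100 \<and> entropy1 dir (S N \<alpha>) = H0 N + \<alpha> * \<rho> N"
proof -
  obtain lo hi where b: "0 < lo" "\<forall>\<^sub>F N in sequentially. lo \<le> v0 N \<and> v0 N \<le> hi" using v0_bounds .
  show ?thesis
    using eventually_basic eventually_S_0 b(2) eventually_rho_le[of "1/10" \<alpha>, simplified]
  proof eventually_elim
    case (elim N)
    have k0: "real (k N) > 0" using k_pos[of N] by simp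
    have "tau N 0 = S N 0 * k N" using k0 by (simp add: S_def)
    hence t0: "tau N 0 \<ge> 0" using elim by simp
    have "Q1_var dir (k N) (ent_time0 dir (k N) (order (G N))) = v0 N"
      using Q1_var_eq[OF k_pos t0, of dir] by (simp add: tau_def ent_time_0 v0_def S_def)
    moreover have "sqrt (v0 N * k N) = k N * \<rho> N" using k_rho[of N] elim b(1) by simp
    ultimately have y: "(ln (real (order (G N))) + \<alpha> * sqrt (Q1_var dir (k N) (ent_time0 dir (k N) (order (G N))) * k N)) / k N = H0 N + \<alpha> * \<rho> N"
      using k0 by (simp add: H0_def add_divide_distrib)
    have "\<rho> N \<ge> 0" using elim b(1) by (simp add: \<rho>_def)
    hence "\<bar>\<alpha> * \<rho> N\<bar> < 1/10" using elim by (simp add: abs_mult)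
    hence "H0 N + \<alpha> * \<rho> N \<ge> 47/10" using elim by linarith
    then obtain s where s: "s \<ge> 100" "entropy1 dir s = H0 N + \<alpha> * \<rho> N"
        "(THE t. t \<ge> 0 \<and> Q1_mean dir (k N) t = H0 N + \<alpha> * \<rho> N) = s * k N"
      by (rule entropy1_solution[OF k_pos])
    have "tau N \<alpha> = s * k N" unfolding tau_def ent_time_def y by (rule s(3))
    hence "S N \<alpha> = s" using k0 by (simp add: S_def)
    with s show ?case by simp
  qed
qed

text \<open>The entropies differ by exactly \<open>(\<beta> - \<alpha>) * \<rho> N\<close>; the
  factors 1/3 and 32 invert the constants of \<open>entropy1_bilipschitz\<close>.\<close>

lemma eventually_S_ratio:
  assumes "\<alpha> \<le> \<beta>"
  shows "\<forall>\<^sub>F N in sequentially. S N \<alpha> \<le> S N \<beta> \<and> (\<beta> - \<alpha>) * \<rho> N / 3 \<le> ln (S N \<beta> / S N \<alpha>) \<and> ln (S N \<beta> / S N \<alpha>) \<le> 32 * (\<beta> - \<alpha>) * \<rho> N"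
  using eventually_S[of \<alpha>] eventually_S[of \<beta>] eventually_rho_pos
proof eventually_elim
  case (elim N)
  have d: "entropy1 dir (S N \<beta>) - entropy1 dir (S N \<alpha>) = (\<beta> - \<alpha>) * \<rho> N" using elim by (simp add: algebra_simps)
  have "(\<beta> - \<alpha>) * \<rho> N \<ge> 0" using elim assms by (intro mult_nonneg_nonneg) auto
  have le: "S N \<alpha> \<le> S N \<beta>"
  proof (rule ccontr)
    assume "\<not> S N \<alpha> \<le> S N \<beta>"
    hence "entropy1 dir (S N \<beta>) < entropy1 dir (S N \<alpha>)" using elim by (intro entropy1_strict_mono) auto
    with d \<open>(\<beta> - \<alpha>) * \<rho> N \<ge> 0\<close> show False by linarith
  qed
  have "ln (S N \<beta> / S N \<alpha>) / 32 \<le> (\<beta> - \<alpha>) * \<rho> N" "(\<beta> - \<alpha>) * \<rho> N \<le> 3 * ln (S N \<beta> / S N \<alpha>)"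
    using entropy1_bilipschitz[of "S N \<alpha>" "S N \<beta>" dir] le elim d by auto
  thus ?case using le unfolding mult.assoc by linarith
qed

lemma ln_S_diff_tendsto_0: "(\<lambda>N. ln (S N \<alpha>) - ln (S N \<beta>)) \<longlonglongrightarrow> 0"
proof -
  have *: "(\<lambda>N. ln (S N b) - ln (S N a)) \<longlonglongrightarrow> 0" if "a \<le> b" for a b
  proof (rule tendsto_sandwich[OF _ _ tendsto_const])
    have u: "\<forall>\<^sub>F N in sequentially. 0 \<le> ln (S N b) - ln (S N a) \<and> ln (S N b) - ln (S N a) \<le> 32 * (b - a) * \<rho> N"
      using eventually_S_ratio[OF that] eventually_S[of a] eventually_S[of b]
      by eventually_elim (auto simp: ln_div)
    show "\<forall>\<^sub>F N in sequentially. 0 \<le> ln (S N b) - ln (S N a)" using u by eventually_elim simp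
    show "\<forall>\<^sub>F N in sequentially. ln (S N b) - ln (S N a) \<le> 32 * (b - a) * \<rho> N" using u by eventually_elim simp
    show "(\<lambda>N. 32 * (b - a) * \<rho> N) \<longlonglongrightarrow> 0" by (rule tendsto_mult_right_zero[OF rho_tendsto_0])
  qed
  show ?thesis
  proof (cases "\<beta> \<le> \<alpha>")
    case False
    thus ?thesis using tendsto_minus[OF *[of \<alpha> \<beta>]] by simp
  qed (use * in auto)
qed

lemma S_ratio_tendsto_1: "(\<lambda>N. S N \<alpha> / S N \<beta>) \<longlonglongrightarrow> 1"
proof -
  have "(\<lambda>N. exp (ln (S N \<alpha>) - ln (S N \<beta>))) \<longlonglongrightarrow> exp 0" by (intro tendsto_exp ln_S_diff_tendsto_0)
  moreover have "\<forall>\<^sub>F N in sequentially. exp (ln (S N \<alpha>) - ln (S N \<beta>)) = S N \<alpha> / S N \<beta>"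
    using eventually_S[of \<alpha>] eventually_S[of \<beta>] by eventually_elim (simp add: exp_diff)
  ultimately show ?thesis by (simp add: Lim_transform_eventually)
qed

lemma tau_ratio: "tau N \<alpha> / tau N \<beta> = S N \<alpha> / S N \<beta>"
  using k_pos[of N] by (simp add: S_def)

section \<open>Limit law of the likelihood and bounds on the distance\<close>

text \<open>The entropic times are defined with the variance at t_0, whereas the limit theorem at
  t_\<alpha> involves the variance there. As \<open>S\<close> need not converge, uniform continuity
  in \<open>ln s\<close> is used.\<close>

lemma var_diff_tendsto_0: "(\<lambda>N. surprisal_var dir (S N \<alpha>) - v0 N) \<longlonglongrightarrow> 0"
proof (rule tendstoI)
  fix e :: real assume "e > 0"
  then obtain d where d: "d > 0" "\<And>s s'. s \<ge> 100 \<Longrightarrow> s' \<ge> 100 \<Longrightarrow> \<bar>ln s' - ln s\<bar> < d \<Longrightarrow> \<bar>surprisal_var dir s' - surprisal_var dir s\<bar> < e"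
    using surprisal_var_uniform[of e dir] by blast
  show "\<forall>\<^sub>F N in sequentially. dist (surprisal_var dir (S N \<alpha>) - v0 N) 0 < e"
    using eventually_S[of \<alpha>] eventually_S_0 tendstoD[OF ln_S_diff_tendsto_0[of \<alpha> 0] d(1)]
    by eventually_elim (auto simp: dist_real_def v0_def intro!: d(2))
qed

text \<open>The term \<open>c * \<omega> N\<close>, used with \<open>c = 1\<close> and
  \<open>c = -1\<close>, is of smaller order than the standard deviation
  \<open>sqrt (v N * k N)\<close> and does not move the limit; nor does exchanging
  \<open>v N\<close> and \<open>v0 N\<close>, whose ratio tends to 1.\<close>

lemma surprisal_sum_limit:
  "(\<lambda>N. measure_pmf.prob (\<mu> N \<alpha>) {w. (\<Sum>i<k N. surprisal dir (S N \<alpha>) (w i) - entropy1 dir (S N \<alpha>)) \<le> - \<alpha> * sqrt (v0 N * k N) + c * \<omega> N})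
    \<longlonglongrightarrow> Gauss_tail \<alpha>"
proof -
  define v where "v N = surprisal_var dir (S N \<alpha>)" for N
  define a where "a N = (- \<alpha> * sqrt (v0 N * k N) + c * \<omega> N) / sqrt (v N * k N)" for N
  obtain lo hi where b: "0 < lo" "\<And>s. s \<ge> 100 \<Longrightarrow> lo \<le> surprisal_var dir s" "\<And>s. s \<ge> 100 \<Longrightarrow> surprisal_var dir s \<le> hi"
    using surprisal_var_bounds[of dir] by blast
  obtain K where K: "\<And>s. s \<ge> 1 \<Longrightarrow> measure_pmf.expectation (xi dir s) (\<lambda>x. \<bar>surprisal dir s x - entropy1 dir s\<bar> ^ 3) \<le> K"
    using surprisal_third_moment[of dir] by blast
  have vlo: "\<forall>\<^sub>F N in sequentially. lo \<le> v N \<and> lo \<le> v0 N"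
    using eventually_S[of \<alpha>] eventually_S_0 by eventually_elim (auto simp: v_def v0_def intro!: b)
  have kk: "filterlim (\<lambda>N. \<omega> N) at_top sequentially"
    unfolding \<omega>_def by (intro filterlim_compose[OF sqrt_at_top] kr_at_top)
  have r1: "(\<lambda>N. v0 N / v N) \<longlonglongrightarrow> 1"
  proof -
    have "(\<lambda>N. (v N - v0 N) / v N) \<longlonglongrightarrow> 0"
    proof (rule Lim_null_comparison)
      show "(\<lambda>N. \<bar>v N - v0 N\<bar> / lo) \<longlonglongrightarrow> 0"
        using tendsto_divide[OF tendsto_rabs_zero[OF var_diff_tendsto_0[of \<alpha>]] tendsto_const[of lo]] b(1) by (simp add: v_def)
      show "\<forall>\<^sub>F N in sequentially. norm ((v N - v0 N) / v N) \<le> \<bar>v N - v0 N\<bar> / lo"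
        using vlo by eventually_elim (use b(1) in \<open>auto simp: abs_divide intro!: divide_left_mono mult_pos_pos\<close>)
    qed
    from tendsto_diff[OF tendsto_const[of 1] this] have "(\<lambda>N. 1 - (v N - v0 N) / v N) \<longlonglongrightarrow> 1" by simp
    moreover have "\<forall>\<^sub>F N in sequentially. 1 - (v N - v0 N) / v N = v0 N / v N"
      using vlo by eventually_elim (use b(1) in \<open>simp add: field_simps\<close>)
    ultimately show ?thesis by (rule Lim_transform_eventually)
  qed
  have r2: "(\<lambda>N. c / (sqrt (v N) * \<omega> N)) \<longlonglongrightarrow> 0"
  proof (rule Lim_null_comparison)
    show "(\<lambda>N. \<bar>c\<bar> / sqrt lo / \<omega> N) \<longlonglongrightarrow> 0"
      by (intro tendsto_divide_0[OF tendsto_const] filterlim_at_top_imp_at_infinity kk)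
    show "\<forall>\<^sub>F N in sequentially. norm (c / (sqrt (v N) * \<omega> N)) \<le> \<bar>c\<bar> / sqrt lo / \<omega> N"
      using vlo
    proof eventually_elim
      case (elim N)
      have "\<omega> N > 0" using k_pos[of N] by (simp add: \<omega>_def)
      thus ?case using elim b(1) by (auto simp: abs_divide abs_mult intro!: divide_left_mono mult_right_mono mult_pos_pos)
    qed
  qed
  have "(\<lambda>N. - \<alpha> * sqrt (v0 N / v N) + c / (sqrt (v N) * \<omega> N)) \<longlonglongrightarrow> - \<alpha> * sqrt 1 + 0"
    by (intro tendsto_add tendsto_mult tendsto_const tendsto_real_sqrt r1 r2)
  moreover have "\<forall>\<^sub>F N in sequentially. - \<alpha> * sqrt (v0 N / v N) + c / (sqrt (v N) * \<omega> N) = a N"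
    using vlo
  proof eventually_elim
    case (elim N)
    define q where "q = sqrt (real (k N))"
    have q: "q > 0" using k_pos[of N] by (simp add: q_def)
    have w: "\<omega> N > 0" "\<omega> N * \<omega> N = q" using q by (simp_all add: \<omega>_def q_def)
    have sv: "sqrt (v N) > 0" using elim b(1) by simp
    have "\<omega> N / q = 1 / \<omega> N" unfolding w(2)[symmetric] using w(1) by simp
    hence "c * \<omega> N / (sqrt (v N) * q) = c / (sqrt (v N) * \<omega> N)"
      by (metis (no_types, opaque_lifting) mult.commute mult.right_neutral times_divide_times_eq)
    moreover have "\<alpha> * (sqrt (v0 N) * q) / (sqrt (v N) * q) = \<alpha> * sqrt (v0 N / v N)" using q by (simp add: real_sqrt_divide)
    moreover have "a N = - (\<alpha> * (sqrt (v0 N) * q) / (sqrt (v N) * q)) + c * \<omega> N / (sqrt (v N) * q)"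
      unfolding a_def real_sqrt_mult q_def[symmetric] by (simp only: add_divide_distrib minus_divide_left mult_minus_left)
    ultimately show ?case by simp
  qed
  ultimately have a: "a \<longlonglongrightarrow> - \<alpha>" by (simp add: Lim_transform_eventually)
  have "(\<lambda>N. measure_pmf.prob (Pi_pmf {..<k N} 0 (\<lambda>_. xi dir (S N \<alpha>)))
      {w. (\<Sum>i<k N. surprisal dir (S N \<alpha>) (w i) - entropy1 dir (S N \<alpha>)) \<le> a N * sqrt (v N * k N)}) \<longlonglongrightarrow> cdf std_normal_distribution (- \<alpha>)"
  proof (rule row_iid_central_limit[OF k_at_top b(1) _ a, where K = K])
    show "\<forall>\<^sub>F N in sequentially. integrable (xi dir (S N \<alpha>)) (\<lambda>x. \<bar>surprisal dir (S N \<alpha>) x - entropy1 dir (S N \<alpha>)\<bar> ^ 3) \<and>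
      measure_pmf.expectation (xi dir (S N \<alpha>)) (\<lambda>x. surprisal dir (S N \<alpha>) x - entropy1 dir (S N \<alpha>)) = 0 \<and>
      measure_pmf.expectation (xi dir (S N \<alpha>)) (\<lambda>x. (surprisal dir (S N \<alpha>) x - entropy1 dir (S N \<alpha>))\<^sup>2) = v N \<and> lo \<le> v N \<and>
      measure_pmf.expectation (xi dir (S N \<alpha>)) (\<lambda>x. \<bar>surprisal dir (S N \<alpha>) x - entropy1 dir (S N \<alpha>)\<bar> ^ 3) \<le> K"
      using eventually_S[of \<alpha>] vlo
    proof eventually_elim
      case (elim N)
      have s: "S N \<alpha> > 0" using elim by simp
      have "integrable (xi dir (S N \<alpha>)) (\<lambda>x. \<bar>surprisal dir (S N \<alpha>) x - entropy1 dir (S N \<alpha>)\<bar> ^ 3)"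
        using s by (intro integrable_xi poly_growth_power poly_growth_abs poly_growth_diff) auto
      moreover have "integrable (xi dir (S N \<alpha>)) (surprisal dir (S N \<alpha>))" using s by auto
      ultimately show ?case using elim K[of "S N \<alpha>"] s
        by (simp add: v_def surprisal_var_def entropy1_def)
    qed
  qed
  moreover have "\<forall>\<^sub>F N in sequentially. measure_pmf.prob (Pi_pmf {..<k N} 0 (\<lambda>_. xi dir (S N \<alpha>)))
      {w. (\<Sum>i<k N. surprisal dir (S N \<alpha>) (w i) - entropy1 dir (S N \<alpha>)) \<le> a N * sqrt (v N * k N)} =
    measure_pmf.prob (\<mu> N \<alpha>) {w. (\<Sum>i<k N. surprisal dir (S N \<alpha>) (w i) - entropy1 dir (S N \<alpha>)) \<le> - \<alpha> * sqrt (v0 N * k N) + c * \<omega> N}"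
    using vlo
  proof eventually_elim
    case (elim N)
    have "sqrt (v N * k N) > 0" using elim b(1) k_pos[of N] by simp
    moreover have "x / y * y = x" if "y > 0" for x y :: real using that by simp
    ultimately have "a N * sqrt (v N * k N) = - \<alpha> * sqrt (v0 N * k N) + c * \<omega> N" unfolding a_def by blast
    thus ?case by (simp only: \<mu>_def)
  qed
  ultimately show ?thesis by (simp add: Gauss_tail_eq_cdf Lim_transform_eventually)
qed

lemma S_eq: "tau N \<alpha> / k N = S N \<alpha>" "S N \<alpha> * k N = tau N \<alpha>"
  using k_pos[of N] by (simp_all add: S_def)

lemma order_pos: "real (order (G N)) > 0"
proof -
  interpret comm_group "G N" by (rule grp)
  show ?thesis using fin[of N] order_gt_0_iff_finite by simp
qed

text \<open>By the choice of the time, \<open>k N\<close> times the entropy is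
  \<open>ln (order (G N)) + \<alpha> * sqrt (v0 N * k N)\<close>; subtracting it centres the sum of
  surprisals.\<close>

lemma likelihood_iff:
  assumes S: "S N \<alpha> > 0" and H: "entropy1 dir (S N \<alpha>) = H0 N + \<alpha> * \<rho> N" and v: "v0 N \<ge> 0" and w: "w \<in> set_pmf (\<mu> N \<alpha>)"
  shows "real (order (G N)) * pmf (\<mu> N \<alpha>) w > 0"
    and "ln (real (order (G N)) * pmf (\<mu> N \<alpha>) w) =
    - (\<Sum>i<k N. surprisal dir (S N \<alpha>) (w i) - entropy1 dir (S N \<alpha>)) - \<alpha> * sqrt (v0 N * k N)"
proof -
  have w0: "\<forall>i. i \<notin> {..<k N} \<longrightarrow> w i = 0" and sup: "\<And>i. i < k N \<Longrightarrow> pmf (xi dir (S N \<alpha>)) (w i) > 0"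
    using w by (auto simp: \<mu>_def set_Pi_pmf PiE_dflt_def pmf_positive)
  have p: "pmf (\<mu> N \<alpha>) w = (\<Prod>i<k N. pmf (xi dir (S N \<alpha>)) (w i))"
    unfolding \<mu>_def using w0 by (intro pmf_Pi') auto
  have p0: "pmf (\<mu> N \<alpha>) w > 0" unfolding p using sup by (intro prod_pos) auto
  thus "real (order (G N)) * pmf (\<mu> N \<alpha>) w > 0" using order_pos by simp
  have "ln (pmf (\<mu> N \<alpha>) w) = (\<Sum>i<k N. ln (pmf (xi dir (S N \<alpha>)) (w i)))"
    unfolding p by (intro ln_prod) (simp, metis less_irrefl lessThan_iff sup)
  also have "\<dots> = - (\<Sum>i<k N. surprisal dir (S N \<alpha>) (w i))" by (simp add: surprisal_def sum_negf)
  finally have l: "ln (pmf (\<mu> N \<alpha>) w) = - (\<Sum>i<k N. surprisal dir (S N \<alpha>) (w i))" .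
  have "k N * entropy1 dir (S N \<alpha>) = ln (real (order (G N))) + \<alpha> * sqrt (v0 N * k N)"
    using k_rho[OF v] k_pos[of N] by (simp add: H H0_def algebra_simps)
  thus "ln (real (order (G N)) * pmf (\<mu> N \<alpha>) w) =
    - (\<Sum>i<k N. surprisal dir (S N \<alpha>) (w i) - entropy1 dir (S N \<alpha>)) - \<alpha> * sqrt (v0 N * k N)"
    using p0 order_pos[of N] l by (simp add: ln_mult_pos sum_subtractf)
qed

text \<open>Free of the generators, which makes the lower bound deterministic. The subtracted term
  is the cost of the likelihood threshold \<open>exp (\<omega> N)\<close>.\<close>

definition "LB N \<alpha> = measure_pmf.prob (\<mu> N \<alpha>) {w. (\<Sum>i<k N. surprisal dir (S N \<alpha>) (w i) - entropy1 dir (S N \<alpha>)) \<le> - \<alpha> * sqrt (v0 N * k N) + - 1 * \<omega> N} - 1 / exp (\<omega> N)"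

lemma omega_at_top: "filterlim \<omega> at_top sequentially"
  unfolding \<omega>_def by (intro filterlim_compose[OF sqrt_at_top] kr_at_top)

lemma exp_omega_tendsto_0: "(\<lambda>N. 1 / exp (\<omega> N)) \<longlonglongrightarrow> 0"
  by (intro tendsto_divide_0[OF tendsto_const] filterlim_at_top_imp_at_infinity filterlim_compose[OF exp_at_top] omega_at_top)

lemma LB_tendsto: "(\<lambda>N. LB N \<alpha>) \<longlonglongrightarrow> Gauss_tail \<alpha>"
  using tendsto_diff[OF surprisal_sum_limit[of \<alpha> "-1"] exp_omega_tendsto_0] by (simp add: LB_def)

lemma eventually_mix_dist_ge:
  "\<forall>\<^sub>F N in sequentially. \<forall>Z. size Z = k N \<and> set_mset Z \<subseteq> carrier (G N) \<longrightarrow> LB N \<alpha> \<le> mix_dist dir (G N) Z (tau N \<alpha>)"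
proof -
  obtain lo hi where b: "0 < lo" "\<forall>\<^sub>F N in sequentially. lo \<le> v0 N \<and> v0 N \<le> hi" using v0_bounds .
  show ?thesis using eventually_S[of \<alpha>] b(2)
  proof (eventually_elim, intro allI impI)
    fix N Z assume N: "S N \<alpha> \<ge> 100 \<and> entropy1 dir (S N \<alpha>) = H0 N + \<alpha> * \<rho> N" "lo \<le> v0 N \<and> v0 N \<le> hi"
      and Z: "size Z = k N \<and> set_mset Z \<subseteq> carrier (G N)"
    interpret comm_group "G N" by (rule grp)
    have S: "S N \<alpha> > 0" and v: "v0 N \<ge> 0" using N b(1) by auto
    have t: "tau N \<alpha> \<ge> 0" unfolding S_eq(2)[of N \<alpha>, symmetric] using S by simp
    have "measure_pmf.prob (\<mu> N \<alpha>) {w. (\<Sum>i<k N. surprisal dir (S N \<alpha>) (w i) - entropy1 dir (S N \<alpha>)) \<le> - \<alpha> * sqrt (v0 N * k N) + - 1 * \<omega> N} =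
      measure_pmf.prob (\<mu> N \<alpha>) {w. real (order (G N)) * pmf (\<mu> N \<alpha>) w \<ge> exp (\<omega> N)}"
    proof (rule measure_pmf.finite_measure_eq_AE[OF AE_pmfI])
      fix w assume w: "w \<in> set_pmf (\<mu> N \<alpha>)"
      note l = likelihood_iff[OF S conjunct2[OF N(1)] v w]
      have "real (order (G N)) * pmf (\<mu> N \<alpha>) w \<ge> exp (\<omega> N) \<longleftrightarrow> ln (real (order (G N)) * pmf (\<mu> N \<alpha>) w) \<ge> \<omega> N"
        using ln_ge_iff[OF l(1), of "\<omega> N"] by simp
      thus "(w \<in> {w. (\<Sum>i<k N. surprisal dir (S N \<alpha>) (w i) - entropy1 dir (S N \<alpha>)) \<le> - \<alpha> * sqrt (v0 N * k N) + - 1 * \<omega> N}) =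
        (w \<in> {w. real (order (G N)) * pmf (\<mu> N \<alpha>) w \<ge> exp (\<omega> N)})"
        unfolding l(2) mem_Collect_eq by linarith
    qed simp_all
    moreover have "mix_dist dir (G N) Z (tau N \<alpha>) \<ge> measure_pmf.prob (\<mu> N \<alpha>) {w. real (order (G N)) * pmf (\<mu> N \<alpha>) w \<ge> exp (\<omega> N)} - 1 / exp (\<omega> N)"
      using mix_dist_ge[OF fin k_pos[of N] t, where e = "exp (\<omega> N)" and Z = Z and dir = dir] Z unfolding S_eq by (simp add: \<mu>_def)
    ultimately show "LB N \<alpha> \<le> mix_dist dir (G N) Z (tau N \<alpha>)" unfolding LB_def by linarith
  qed
qed

text \<open>Here the constants of the hypothesis are spent. The small divisors need
  \<open>K \<le> (K - d) / 2 * ln B\<close>, the large ones that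
  \<open>L ^ (d + 1) * (2 / B) ^ K\<close> be exponentially small. Up to explicit factors, and
  \<open>ln K\<close> in the case of \<open>L\<close>, both \<open>L\<close> and \<open>B\<close>
  have size \<open>exp H\<close>, so both requirements reduce to the bound on
  \<open>(K - d - 1) * H\<close>.\<close>

lemma eventually_gcd_sum_le:
  "\<forall>\<^sub>F N in sequentially. (\<Sum>g=2..nat \<lceil>2 * ln (k N) * sqrt (S N \<alpha>)\<rceil>. real g ^ min_gens (G N) * (1 / real g + 2 / sqrt (S N \<alpha>)) ^ k N) \<le>
    4 * 2 powr (- (real (k N) - min_gens (G N)) / 2) + exp (- real (k N) / 10)"
  using eventually_basic eventually_S[of \<alpha>] eventually_rho_le[of "1/10" \<alpha>, simplified] eventually_rho_pos
proof eventually_elim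
  case (elim N)
  define K where "K = real (k N)"
  define d where "d = real (min_gens (G N))"
  define c where "c = ln (ln K)"
  define s where "s = S N \<alpha>"
  define H where "H = entropy1 dir s"
  define L where "L = nat \<lceil>2 * ln K * sqrt s\<rceil>"
  \<comment> \<open>\<open>1 / B\<close> is the bound on the mode; \<open>L\<close> bounds the
    difference of two coordinates that lie within \<open>ln K\<close> standard deviations of the
    mean.\<close>
  define B where "B = sqrt s / 2"
  have K: "K \<ge> 100" "d + 4 \<le> K" and d0: "d \<ge> 0" and c: "0 \<le> c" "c \<le> K / 10" and H0: "H0 N \<ge> 5" "(K - d - 1) * H0 N \<ge> 5 * K + 2 * d * c"
    and s: "s \<ge> 100" and H: "H = H0 N + \<alpha> * \<rho> N"
    using elim by (auto simp: K_def d_def c_def s_def H_def)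
  have s10: "sqrt s \<ge> 10" using s real_sqrt_le_mono[of 100 s] by simp
  have ar: "\<bar>\<alpha> * \<rho> N\<bar> < 1/10" using elim by (simp add: abs_mult)
  hence H49: "H \<ge> 49/10" using H0 H by linarith
  \<comment> \<open>Passing from \<open>H0 N\<close> to \<open>H\<close> changes the entropy by less
    than 1/10, which lowers the constant 5 to 49/10.\<close>
  have "(K - d - 1) * (\<alpha> * \<rho> N) \<ge> (K - d - 1) * (- (1/10))" using ar K by (intro mult_left_mono) auto
  moreover have "(K - d - 1) * (- (1/10)) = - (K / 10) + d / 10 + 1/10" by (simp add: field_simps)
  ultimately have KH: "(K - d - 1) * H \<ge> 49/10 * K + 2 * d * c" using H0(2) d0 unfolding H distrib_left by linarith
  have B5: "B \<ge> 5" using s10 by (simp add: B_def)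
  have lnB: "ln B = ln s / 2 - ln 2" using s by (simp add: B_def ln_div ln_sqrt)
  have ln2: "ln (2::real) \<le> 25/36" by (rule ln2_le_25_over_36)
  have Hle: "H \<le> ln s / 2 + 37/20" and Hge: "H \<ge> ln s / 2 - ln 2"
    unfolding H_def using entropy1_le[OF s] entropy1_ge[OF s] by auto
  have kB: "K \<le> (K - d) / 2 * ln B"
  proof -
    \<comment> \<open>Here \<open>ln B \<ge> H - 37/20 - 25/36\<close>, and
      \<open>13/25 * (49/10)\<close> still exceeds \<open>37/20 + 25/36\<close>. Afterwards
      \<open>12/50 * (49/10) > 1\<close> gives the claim.\<close>
    have "ln B \<ge> 12/25 * H" using Hle lnB ln2 H49 by linarith
    hence "(K - d) * ln B \<ge> (K - d - 1) * (12/25 * H)" using K H49 by (intro mult_mono) auto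
    moreover have "(K - d - 1) * (12/25 * H) = 12/25 * ((K - d - 1) * H)" by simp
    moreover have "2 * d * c \<ge> 0" using d0 c by simp
    moreover have "(K - d) / 2 * ln B = (K - d) * ln B / 2" by simp
    ultimately show ?thesis using KH K by linarith
  qed
  have sum: "(\<Sum>g=2..L. real g ^ min_gens (G N) * (1 / real g + 1 / B) ^ k N) \<le>
    4 * 2 powr (- (real (k N - min_gens (G N)) / 2)) + real L ^ (min_gens (G N) + 1) * (2 / B) ^ k N"
  proof (rule sum_gcd_terms_le)
    show "B \<ge> 4" using B5 by simp
    show "min_gens (G N) + 4 \<le> k N" using elim by simp
    show "real (k N) \<le> real (k N - min_gens (G N)) / 2 * ln B"
      using kB elim by (simp add: K_def d_def of_nat_diff)
  qed
  have lnK: "ln K \<ge> 4"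
  proof -
    have "exp 4 \<le> (3::real) ^ 4" using power_mono[OF exp_le, of 4] by (simp flip: exp_of_nat_mult)
    also have "\<dots> \<le> K" using K by simp
    finally show ?thesis using K by (subst ln_ge_iff) auto
  qed
  \<comment> \<open>The surplus 1/80 pays for rounding up, as the rounded number is at least 80;
    \<open>ln s / 2\<close> has been replaced by \<open>H + ln 2\<close>.\<close>
  have L: "real L > 0" "ln L \<le> 2 * ln 2 + c + H + 1/80"
  proof -
    define M where "M = 2 * ln K * sqrt s"
    have "4 * 10 \<le> ln K * sqrt s" using lnK s10 by (intro mult_mono) auto
    hence M: "M \<ge> 80" unfolding M_def mult.assoc by linarith
    show L0: "real L > 0" using M by (simp add: L_def M_def)
    have "real L \<le> M + 1" using M unfolding L_def M_def[symmetric] by linarith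
    also have "M + 1 \<le> M * (1 + 1/80)" using M by simp
    finally have "ln L \<le> ln (M * (1 + 1/80))" using L0 M by (subst ln_le_cancel_iff) auto
    also have "\<dots> = ln M + ln (1 + 1/80)" using M by (subst ln_mult_pos) auto
    also have "ln (1 + 1/80) \<le> (1/80 :: real)" by (rule ln_add_one_self_le_self) simp
    also have "ln M = ln 2 + c + ln s / 2" using lnK s by (simp add: M_def ln_mult_pos c_def ln_sqrt)
    finally show "ln L \<le> 2 * ln 2 + c + H + 1/80" using Hge by simp
  qed
  have "real L ^ (min_gens (G N) + 1) * (2 / B) ^ k N \<le> exp (- K / 10)"
  proof -
    have B0: "2 / B > 0" using B5 by simp
    have "ln (real L ^ (min_gens (G N) + 1) * (2 / B) ^ k N) = (d + 1) * ln L + K * ln (2 / B)"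
      using L(1) B0 by (simp add: ln_mult_pos ln_realpow d_def K_def del: power_Suc)
    also have "\<dots> \<le> (d + 1) * (2 * ln 2 + c + H + 1/80) + K * (2 * ln 2 + 37/20 - H)"
    proof (intro add_mono mult_left_mono L)
      have "ln (2 / B) = ln 2 - ln B" using B5 by (simp add: ln_div)
      thus "ln (2 / B) \<le> 2 * ln 2 + 37/20 - H" using lnB Hle by simp
    qed (use d0 K in auto)
    also have "\<dots> = - ((K - d - 1) * H) + (d + 1) * c + (d + 1) * (2 * ln 2 + 1/80) + K * (2 * ln 2 + 37/20)"
      by (simp add: algebra_simps)
    also have "\<dots> \<le> - (49/10 * K + 2 * d * c) + (d + 1) * c + K * (2 * (25/36) + 1/80) + K * (2 * (25/36) + 37/20)"
    proof -
      have "(d + 1) * (2 * ln 2 + 1/80) \<le> K * (2 * (25/36) + 1/80)"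
        using KH K d0 ln2 by (intro mult_mono) auto
      moreover have "K * (2 * ln 2 + 37/20) \<le> K * (2 * (25/36) + 37/20)"
        using K ln2 by (intro mult_left_mono) auto
      ultimately show ?thesis using KH by linarith
    qed
    \<comment> \<open>The term \<open>2 * d * c\<close> of the hypothesis pays for
      \<open>(d + 1) * c\<close> up to \<open>c \<le> K / 10\<close>. The bracket exceeds 1/4, so
      more than 1/10 remains.\<close>
    also have "\<dots> = c - d * c - (49/10 - 50/36 - 1/80 - 50/36 - 37/20) * K" by (simp add: algebra_simps)
    also have "\<dots> \<le> K / 10 - 0 - (49/10 - 50/36 - 1/80 - 50/36 - 37/20) * K" using c d0 by (intro diff_mono) auto
    also have "\<dots> \<le> - K / 10" using K by simp
    finally have "ln (real L ^ (min_gens (G N) + 1) * (2 / B) ^ k N) \<le> - K / 10" .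
    hence "exp (ln (real L ^ (min_gens (G N) + 1) * (2 / B) ^ k N)) \<le> exp (- K / 10)" by simp
    thus ?thesis using L(1) B0 by (subst (asm) exp_ln) (auto intro!: mult_pos_pos)
  qed
  hence "(\<Sum>g=2..L. real g ^ min_gens (G N) * (1 / real g + 1 / B) ^ k N) \<le>
    4 * 2 powr (- (real (k N - min_gens (G N)) / 2)) + exp (- K / 10)"
    using sum by linarith
  moreover have "real (k N - min_gens (G N)) = K - d" using elim by (simp add: K_def d_def of_nat_diff)
  moreover have "1 / B = 2 / sqrt s" by (simp add: B_def)
  moreover have "- (real (k N) - real (min_gens (G N))) / 2 = - ((K - d) / 2)" unfolding K_def d_def by (rule minus_divide_left[symmetric])
  ultimately show ?case by (simp only: L_def K_def s_def d_def)
qed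

lemma set_random_gens': "Z \<in> set_pmf (random_gens (k N) (G N)) \<Longrightarrow> size Z = k N \<and> set_mset Z \<subseteq> carrier (G N)"
proof -
  interpret comm_group "G N" by (rule grp)
  show "Z \<in> set_pmf (random_gens (k N) (G N)) \<Longrightarrow> ?thesis"
    using set_random_gens[OF fin carrier_not_empty] .
qed

text \<open>The margin \<open>\<eta>\<close> is halved: one half covers the mass of the discarded
  words against its limit, the other is the level of the concentration bound, whose error
  \<open>E N\<close> vanishes.\<close>

lemma mix_dist_upper:
  assumes \<eta>: "\<eta> > 0"
  shows "(\<lambda>N. measure_pmf.prob (random_gens (k N) (G N)) {Z. mix_dist dir (G N) Z (tau N \<alpha>) > Gauss_tail \<alpha> + \<eta>}) \<longlonglongrightarrow> 0"
proof -
  define P where "P N = measure_pmf.prob (\<mu> N \<alpha>) {w. (\<Sum>i<k N. surprisal dir (S N \<alpha>) (w i) - entropy1 dir (S N \<alpha>)) \<le> - \<alpha> * sqrt (v0 N * k N) + 1 * \<omega> N}" for N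
  \<comment> \<open>The union bound for some coordinate exceeding \<open>ln x\<close> standard
    deviations when there are \<open>x\<close> coordinates; it is of order
    \<open>1 / x\<close>.\<close>
  define tail where "tail x = x * (2 * exp 4 * exp (- 2 * ln x))" for x :: real
  obtain lo hi where b: "0 < lo" "\<forall>\<^sub>F N in sequentially. lo \<le> v0 N \<and> v0 N \<le> hi" using v0_bounds .
  have "(tail \<longlongrightarrow> 0) at_top" unfolding tail_def by real_asymp
  hence tl: "(\<lambda>N. tail (real (k N))) \<longlonglongrightarrow> 0" by (rule filterlim_compose[OF _ kr_at_top])
  have "(\<lambda>N. P N + tail (real (k N))) \<longlonglongrightarrow> Gauss_tail \<alpha> + 0"
    unfolding P_def by (intro tendsto_add surprisal_sum_limit tl)
  hence Pt: "\<forall>\<^sub>F N in sequentially. P N + tail (real (k N)) < Gauss_tail \<alpha> + \<eta> / 2"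
    using \<eta> by (intro order_tendstoD(2)) auto
  define E where "E N = (1 / exp (\<omega> N) + (4 * 2 powr (- (real (k N) - min_gens (G N)) / 2) + exp (- real (k N) / 10))) / (\<eta> / 2)\<^sup>2" for N
  have "((\<lambda>x::real. 4 * 2 powr (- x / 2)) \<longlongrightarrow> 0) at_top" by real_asymp
  hence e2: "(\<lambda>N. 4 * 2 powr (- (real (k N) - min_gens (G N)) / 2)) \<longlonglongrightarrow> 0" by (rule filterlim_compose[OF _ gap_lim])
  have "((\<lambda>x::real. exp (- x / 10)) \<longlongrightarrow> 0) at_top" by real_asymp
  hence e3: "(\<lambda>N. exp (- real (k N) / 10)) \<longlonglongrightarrow> 0" by (rule filterlim_compose[OF _ kr_at_top])
  have "E \<longlonglongrightarrow> (0 + (0 + 0)) / (\<eta> / 2)\<^sup>2"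
    unfolding E_def using \<eta> by (intro tendsto_divide tendsto_add tendsto_const exp_omega_tendsto_0 e2 e3) auto
  hence E0: "E \<longlonglongrightarrow> 0" by simp
  have "\<forall>\<^sub>F N in sequentially. measure_pmf.prob (random_gens (k N) (G N)) {Z. mix_dist dir (G N) Z (tau N \<alpha>) > Gauss_tail \<alpha> + \<eta>} \<le> E N"
    using eventually_S[of \<alpha>] b(2) Pt eventually_gcd_sum_le[of \<alpha>] eventually_basic
  proof eventually_elim
    case (elim N)
    interpret comm_group "G N" by (rule grp)
    define s where "s = S N \<alpha>"
    have s: "s \<ge> 100" and v: "v0 N \<ge> 0" using elim b(1) by (auto simp: s_def)
    have S0: "S N \<alpha> > 0" using s by (simp add: s_def)
    have t: "tau N \<alpha> > 0" unfolding S_eq(2)[of N \<alpha>, symmetric] using S0 k_pos[of N] by simp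
    define e where "e = 1 / exp (\<omega> N)"
    define r where "r = ln (real (k N))"
    define n where "n = real (order (G N))"
    define T where "T = {w \<in> PiE_dflt {..<k N} 0 (\<lambda>_. {x. \<bar>zscore dir s x\<bar> \<le> r}). n * pmf (\<mu> N \<alpha>) w \<le> e}"
    have "1 - measure_pmf.prob (\<mu> N \<alpha>) T \<le> measure_pmf.prob (\<mu> N \<alpha>) {w. n * pmf (\<mu> N \<alpha>) w > e} + tail (real (k N))"
      using prob_typical_ge[of s "k N" dir r n e] s by (simp add: T_def \<mu>_def s_def tail_def r_def)
    also have "measure_pmf.prob (\<mu> N \<alpha>) {w. n * pmf (\<mu> N \<alpha>) w > e} \<le> P N"
      unfolding P_def
    proof (rule measure_pmf.finite_measure_mono_AE[OF AE_pmfI])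
      fix w assume w: "w \<in> set_pmf (\<mu> N \<alpha>)"
      have H: "entropy1 dir (S N \<alpha>) = H0 N + \<alpha> * \<rho> N" using elim by simp
      note l = likelihood_iff[OF S0 H v w]
      have "ln (n * pmf (\<mu> N \<alpha>) w) > - \<omega> N" if "n * pmf (\<mu> N \<alpha>) w > e"
      proof -
        have "ln e < ln (n * pmf (\<mu> N \<alpha>) w)" using that by (subst ln_less_cancel_iff) (auto simp: e_def intro: less_trans[rotated])
        thus ?thesis by (simp add: e_def ln_div)
      qed
      thus "w \<in> {w. n * pmf (\<mu> N \<alpha>) w > e} \<longrightarrow> w \<in> {w. (\<Sum>i<k N. surprisal dir (S N \<alpha>) (w i) - entropy1 dir (S N \<alpha>)) \<le> - \<alpha> * sqrt (v0 N * k N) + 1 * \<omega> N}"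
        unfolding n_def l(2) mem_Collect_eq by linarith
    qed simp_all
    finally have \<tau>: "1 - measure_pmf.prob (\<mu> N \<alpha>) T \<le> Gauss_tail \<alpha> + \<eta> / 2" using elim by linarith
    have "measure_pmf.prob (random_gens (k N) (G N)) {Z. mix_dist dir (G N) Z (tau N \<alpha>) > Gauss_tail \<alpha> + \<eta>} \<le>
      measure_pmf.prob (random_gens (k N) (G N)) {Z. mix_dist dir (G N) Z (tau N \<alpha>) > (1 - measure_pmf.prob (\<mu> N \<alpha>) T) + \<eta> / 2}"
      using \<tau> by (intro measure_pmf.finite_measure_mono) auto
    also have "\<dots> \<le> (e + (\<Sum>g=2..nat \<lceil>2 * r * sqrt s\<rceil>. real g ^ min_gens (G N) * (1 / real g + 2 / sqrt s) ^ k N)) / (\<eta> / 2)\<^sup>2"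
    proof -
      have "2 * r * sqrt (tau N \<alpha> / k N) \<le> real (nat \<lceil>2 * r * sqrt s\<rceil>)"
        unfolding S_eq s_def by linarith
      moreover have "pmf (xi dir (tau N \<alpha> / k N)) (mode dir (tau N \<alpha> / k N)) \<le> 2 / sqrt s"
        unfolding S_eq using pmf_xi_mode_le[OF s, of dir] by (simp add: s_def)
      ultimately show ?thesis
        using mix_dist_concentrated[OF fin k_pos[of N] t, where e = e and \<eta> = "\<eta> / 2" and r = r and dir = dir] \<eta>
        unfolding T_def n_def s_def \<mu>_def S_eq by (simp add: e_def)
    qed
    also have "\<dots> \<le> E N"
      using elim unfolding E_def e_def r_def s_def by (intro divide_right_mono add_mono) auto
    finally show ?case .
  qed
  thus ?thesis by (intro tendsto_sandwich[OF _ _ tendsto_const E0]) auto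
qed

lemma eventually_mix_dist_lower:
  assumes "\<eta> > 0"
  shows "\<forall>\<^sub>F N in sequentially. \<forall>Z. size Z = k N \<and> set_mset Z \<subseteq> carrier (G N) \<longrightarrow> Gauss_tail \<alpha> - \<eta> < mix_dist dir (G N) Z (tau N \<alpha>)"
proof -
  have "\<forall>\<^sub>F N in sequentially. LB N \<alpha> > Gauss_tail \<alpha> - \<eta>"
    using assms by (intro order_tendstoD(1)[OF LB_tendsto]) auto
  with eventually_mix_dist_ge[of \<alpha>] show ?thesis by eventually_elim (meson less_le_trans)
qed

lemma mix_dist_in_prob:
  "tendsto_in_prob (\<lambda>N. random_gens (k N) (G N)) (\<lambda>N Z. mix_dist dir (G N) Z (tau N \<alpha>)) (Gauss_tail \<alpha>)"
  unfolding tendsto_in_prob_def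
proof (intro allI impI)
  fix \<eta> :: real assume \<eta>: "\<eta> > 0"
  have "\<forall>\<^sub>F N in sequentially. measure_pmf.prob (random_gens (k N) (G N)) {Z. \<bar>mix_dist dir (G N) Z (tau N \<alpha>) - Gauss_tail \<alpha>\<bar> > \<eta>} \<le>
    measure_pmf.prob (random_gens (k N) (G N)) {Z. mix_dist dir (G N) Z (tau N \<alpha>) > Gauss_tail \<alpha> + \<eta>}"
    using eventually_mix_dist_lower[OF \<eta>, of \<alpha>]
  proof eventually_elim
    case (elim N)
    show ?case
    proof (rule measure_pmf.finite_measure_mono_AE[OF AE_pmfI])
      fix Z assume "Z \<in> set_pmf (random_gens (k N) (G N))"
      hence "Gauss_tail \<alpha> - \<eta> < mix_dist dir (G N) Z (tau N \<alpha>)" using elim set_random_gens' by blast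
      thus "Z \<in> {Z. \<bar>mix_dist dir (G N) Z (tau N \<alpha>) - Gauss_tail \<alpha>\<bar> > \<eta>} \<longrightarrow> Z \<in> {Z. mix_dist dir (G N) Z (tau N \<alpha>) > Gauss_tail \<alpha> + \<eta>}"
        by auto
    qed simp
  qed
  thus "(\<lambda>N. measure_pmf.prob (random_gens (k N) (G N)) {Z. \<bar>mix_dist dir (G N) Z (tau N \<alpha>) - Gauss_tail \<alpha>\<bar> > \<eta>}) \<longlonglongrightarrow> 0"
    by (intro tendsto_sandwich[OF _ _ tendsto_const mix_dist_upper[OF \<eta>]]) auto
qed

section \<open>Mixing times\<close>

definition window :: "nat \<Rightarrow> real \<Rightarrow> real \<Rightarrow> 'a multiset set" where
  "window N \<alpha> \<delta> = {Z. tau N (\<alpha> - \<delta>) \<le> t_mix dir (G N) Z (Gauss_tail \<alpha>) \<and> t_mix dir (G N) Z (Gauss_tail \<alpha>) \<le> tau N (\<alpha> + \<delta>)}"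

text \<open>At \<open>\<alpha> + \<delta>\<close> the distance is at most
  \<open>Gauss_tail \<alpha>\<close> with high probability; at \<open>\<alpha> - \<delta>\<close> it
  exceeds this level for all generators once \<open>N\<close> is large. Monotonicity in time
  brackets the infimum, so only a failure at \<open>\<alpha> + \<delta>\<close> is charged.\<close>

lemma prob_window:
  assumes \<delta>: "\<delta> > 0"
  shows "(\<lambda>N. measure_pmf.prob (random_gens (k N) (G N)) (- window N \<alpha> \<delta>)) \<longlonglongrightarrow> 0"
proof -
  define \<epsilon> where "\<epsilon> = Gauss_tail \<alpha>"
  define \<eta> where "\<eta> = \<epsilon> - Gauss_tail (\<alpha> + \<delta>)"
  define \<eta>' where "\<eta>' = Gauss_tail (\<alpha> - \<delta>) - \<epsilon>"
  have \<eta>: "\<eta> > 0" "\<eta>' > 0"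
    using Gauss_tail_strict_antimono[of \<alpha> "\<alpha> + \<delta>"] Gauss_tail_strict_antimono[of "\<alpha> - \<delta>" \<alpha>] \<delta> by (auto simp: \<eta>_def \<eta>'_def \<epsilon>_def)
  have "\<forall>\<^sub>F N in sequentially. measure_pmf.prob (random_gens (k N) (G N)) (- window N \<alpha> \<delta>) \<le>
    measure_pmf.prob (random_gens (k N) (G N)) {Z. mix_dist dir (G N) Z (tau N (\<alpha> + \<delta>)) > Gauss_tail (\<alpha> + \<delta>) + \<eta>}"
    using eventually_mix_dist_lower[OF \<eta>(2), of "\<alpha> - \<delta>"] eventually_S[of "\<alpha> + \<delta>"] eventually_S[of "\<alpha> - \<delta>"]
  proof eventually_elim
    case (elim N)
    interpret comm_group "G N" by (rule grp)
    have t: "tau N (\<alpha> + \<delta>) \<ge> 0" "tau N (\<alpha> - \<delta>) \<ge> 0"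
      unfolding S_eq(2)[symmetric] using elim by auto
    show ?case
    proof (rule measure_pmf.finite_measure_mono_AE[OF AE_pmfI], rule impI, rule CollectI, rule ccontr)
      fix Z assume Z: "Z \<in> set_pmf (random_gens (k N) (G N))" "Z \<in> - window N \<alpha> \<delta>"
        "\<not> Gauss_tail (\<alpha> + \<delta>) + \<eta> < mix_dist dir (G N) Z (tau N (\<alpha> + \<delta>))"
      have sz: "size Z = k N" "set_mset Z \<subseteq> carrier (G N)" using set_random_gens'[OF Z(1)] by auto
      have Z0: "Z \<noteq> {#}" using sz k_pos[of N] by auto
      define A where "A = {t. t \<ge> 0 \<and> mix_dist dir (G N) Z t \<le> \<epsilon>}"
      \<comment> \<open>This also shows that the set is nonempty, so that its infimum is a genuine
        mixing time.\<close>
      have tA: "tau N (\<alpha> + \<delta>) \<in> A" using Z(3) t by (simp add: A_def \<eta>_def)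
      have up: "Inf A \<le> tau N (\<alpha> + \<delta>)" by (rule cInf_lower[OF tA]) (auto simp: A_def intro!: bdd_belowI[of _ 0])
      have gt: "\<epsilon> < mix_dist dir (G N) Z (tau N (\<alpha> - \<delta>))" using elim sz by (auto simp: \<eta>'_def)
      have low: "tau N (\<alpha> - \<delta>) \<le> Inf A"
      proof (rule cInf_greatest)
        show "A \<noteq> {}" using tA by blast
        fix t assume tt: "t \<in> A"
        show "tau N (\<alpha> - \<delta>) \<le> t"
        proof (rule ccontr)
          assume "\<not> tau N (\<alpha> - \<delta>) \<le> t"
          hence "mix_dist dir (G N) Z (tau N (\<alpha> - \<delta>)) \<le> mix_dist dir (G N) Z t"
            using tt by (intro mix_dist_antimono[OF fin Z0 sz(2)]) (auto simp: A_def)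
          thus False using gt tt by (simp add: A_def)
        qed
      qed
      have "t_mix dir (G N) Z (Gauss_tail \<alpha>) = Inf A" by (simp add: t_mix_def A_def \<epsilon>_def)
      thus False using up low Z(2) by (simp add: window_def)
    qed simp
  qed
  thus ?thesis by (intro tendsto_sandwich[OF _ _ tendsto_const mix_dist_upper[OF \<eta>(1)]]) auto
qed

text \<open>A window of fixed width suffices here, because the times at \<open>\<alpha> - 1\<close>
  and \<open>\<alpha> + 1\<close> are both asymptotic to t_0.\<close>

lemma t_mix_ratio_in_prob:
  "tendsto_in_prob (\<lambda>N. random_gens (k N) (G N)) (\<lambda>N Z. t_mix dir (G N) Z (Gauss_tail \<alpha>) / tau N 0) 1"
  unfolding tendsto_in_prob_def
proof (intro allI impI)
  fix \<eta> :: real assume \<eta>: "\<eta> > 0"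
  have "\<forall>\<^sub>F N in sequentially. measure_pmf.prob (random_gens (k N) (G N)) {Z. \<bar>t_mix dir (G N) Z (Gauss_tail \<alpha>) / tau N 0 - 1\<bar> > \<eta>} \<le>
    measure_pmf.prob (random_gens (k N) (G N)) (- window N \<alpha> 1)"
    using tendstoD[OF S_ratio_tendsto_1[of "\<alpha> + 1" 0] \<eta>] tendstoD[OF S_ratio_tendsto_1[of "\<alpha> - 1" 0] \<eta>] eventually_S_0
  proof eventually_elim
    case (elim N)
    have t0: "tau N 0 > 0" unfolding S_eq(2)[symmetric] using elim k_pos[of N] by auto
    show ?case
    proof (rule measure_pmf.finite_measure_mono)
      show "{Z. \<bar>t_mix dir (G N) Z (Gauss_tail \<alpha>) / tau N 0 - 1\<bar> > \<eta>} \<subseteq> - window N \<alpha> 1"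
      proof (rule subsetI, rule ComplI)
        fix Z assume Z: "Z \<in> {Z. \<bar>t_mix dir (G N) Z (Gauss_tail \<alpha>) / tau N 0 - 1\<bar> > \<eta>}" "Z \<in> window N \<alpha> 1"
        have "tau N (\<alpha> - 1) / tau N 0 \<le> t_mix dir (G N) Z (Gauss_tail \<alpha>) / tau N 0"
          "t_mix dir (G N) Z (Gauss_tail \<alpha>) / tau N 0 \<le> tau N (\<alpha> + 1) / tau N 0"
          using Z(2) t0 by (auto simp: window_def intro!: divide_right_mono)
        thus False using Z(1) elim unfolding tau_ratio dist_real_def by auto
      qed
    qed simp
  qed
  thus "(\<lambda>N. measure_pmf.prob (random_gens (k N) (G N)) {Z. \<bar>t_mix dir (G N) Z (Gauss_tail \<alpha>) / tau N 0 - 1\<bar> > \<eta>}) \<longlonglongrightarrow> 0"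
    by (intro tendsto_sandwich[OF _ _ tendsto_const prob_window[of 1 \<alpha>]]) auto
qed

text \<open>Turns logarithmic ratios into differences by
  \<open>x \<le> exp x - 1 \<le> 2 * x\<close> on the unit interval and by
  \<open>S N \<alpha>\<close> being within a factor 2 of \<open>S N 0\<close>; hence
  \<open>6 = 3 * 2\<close> and \<open>128 = 32 * 2 * 2\<close>.\<close>

lemma eventually_S_diff:
  assumes "\<alpha> \<le> \<beta>"
  shows "\<forall>\<^sub>F N in sequentially. (\<beta> - \<alpha>) * \<rho> N * S N 0 / 6 \<le> S N \<beta> - S N \<alpha> \<and> S N \<beta> - S N \<alpha> \<le> 128 * ((\<beta> - \<alpha>) * \<rho> N * S N 0)"
  using eventually_S_ratio[OF assms] eventually_S[of \<alpha>] eventually_S[of \<beta>] eventually_S_0 eventually_rho_pos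
    eventually_rho_le[of "1/32" "\<beta> - \<alpha>", simplified] tendstoD[OF S_ratio_tendsto_1[of \<alpha> 0], of "1/2", simplified]
proof eventually_elim
  case (elim N)
  define x where "x = ln (S N \<beta> / S N \<alpha>)"
  define y where "y = (\<beta> - \<alpha>) * \<rho> N"
  have y: "y \<ge> 0" "y < 1/32" using elim assms by (auto simp: y_def)
  have x: "y / 3 \<le> x" "x \<le> 32 * y" using elim by (auto simp: x_def y_def algebra_simps)
  have pos: "S N \<alpha> > 0" "S N \<beta> > 0" "S N 0 > 0" using elim by auto
  have "S N \<beta> = S N \<alpha> * exp x" using pos by (simp add: x_def)
  hence d: "S N \<beta> - S N \<alpha> = S N \<alpha> * (exp x - 1)" by (simp add: algebra_simps)
  have x01: "0 \<le> x" "x \<le> 1" using x y by auto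
  have lo: "y / 3 \<le> exp x - 1" using x exp_ge_add_one_self[of x] by linarith
  have "x\<^sup>2 \<le> x" using x01 by (simp add: power2_eq_square mult_left_le)
  hence hi: "exp x - 1 \<le> 64 * y" using exp_le_quadratic[of x] x x01 by simp
  have "\<bar>S N \<alpha> / S N 0 - 1\<bar> < 1/2" using elim by (simp add: dist_real_def)
  hence "1/2 \<le> S N \<alpha> / S N 0" "S N \<alpha> / S N 0 \<le> 2" by linarith+
  hence r: "S N 0 / 2 \<le> S N \<alpha>" "S N \<alpha> \<le> 2 * S N 0" using pos by (auto simp: field_simps)
  have "S N 0 / 2 * (y / 3) \<le> S N \<alpha> * (exp x - 1)" using r lo y pos by (intro mult_mono) auto
  moreover have "S N \<alpha> * (exp x - 1) \<le> (2 * S N 0) * (64 * y)" using r hi y pos x01 by (intro mult_mono) auto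
  ultimately show ?case unfolding d y_def[symmetric] by (simp add: mult_ac)
qed

lemma t_mix_window:
  assumes \<eta>: "\<eta> > 0"
  shows "(\<lambda>N. measure_pmf.prob (random_gens (k N) (G N))
     {Z. \<bar>(t_mix dir (G N) Z (Gauss_tail \<alpha>) - t_mix dir (G N) Z (1/2)) - (tau N \<alpha> - tau N 0)\<bar> \<le> \<eta> * \<bar>tau N \<alpha> - tau N 0\<bar>}) \<longlonglongrightarrow> 1"
proof (cases "\<alpha> = 0")
  case True
  thus ?thesis by (simp add: Gauss_tail_0)
next
  case False
  \<comment> \<open>Each of the two mixing times is located up to
    \<open>256 * \<delta> * \<rho> N * S N 0\<close> after division by \<open>k N\<close>, and the
    entropic times are at least \<open>\<bar>\<alpha>\<bar> * \<rho> N * S N 0 / 6\<close> apart on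
    that scale; \<open>3072 = 512 * 6\<close>.\<close>
  define \<delta> where "\<delta> = \<eta> * \<bar>\<alpha>\<bar> / 3072"
  have \<delta>: "\<delta> > 0" using False \<eta> by (simp add: \<delta>_def)
  define Good where "Good N = {Z. \<bar>(t_mix dir (G N) Z (Gauss_tail \<alpha>) - t_mix dir (G N) Z (1/2)) - (tau N \<alpha> - tau N 0)\<bar> \<le> \<eta> * \<bar>tau N \<alpha> - tau N 0\<bar>}" for N
  define P where "P N A = measure_pmf.prob (random_gens (k N) (G N)) A" for N A
  have far: "\<forall>\<^sub>F N in sequentially. \<bar>\<alpha>\<bar> * \<rho> N * S N 0 / 6 \<le> \<bar>S N \<alpha> - S N 0\<bar>"
  proof (cases "\<alpha> > 0")
    case True
    have "\<forall>\<^sub>F N in sequentially. (\<alpha> - 0) * \<rho> N * S N 0 / 6 \<le> S N \<alpha> - S N 0"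
      using eventually_S_diff[of 0 \<alpha>] True by (auto elim: eventually_mono)
    thus ?thesis
    proof eventually_elim
      case (elim N)
      thus ?case using abs_ge_self[of "S N \<alpha> - S N 0"] unfolding abs_of_pos[OF True] diff_zero by linarith
    qed
  next
    case False
    have "\<forall>\<^sub>F N in sequentially. (0 - \<alpha>) * \<rho> N * S N 0 / 6 \<le> S N 0 - S N \<alpha>"
      using eventually_S_diff[of \<alpha> 0] False by (auto elim: eventually_mono)
    thus ?thesis
    proof eventually_elim
      case (elim N)
      thus ?case using abs_ge_minus_self[of "S N \<alpha> - S N 0"] unfolding abs_of_nonpos[OF leI[OF False]] diff_0 by linarith
    qed
  qed
  have le: "\<alpha> - \<delta> \<le> \<alpha> + \<delta>" "- \<delta> \<le> \<delta>" "\<alpha> - \<delta> \<le> \<alpha>" "\<alpha> \<le> \<alpha> + \<delta>" "- \<delta> \<le> 0" "0 \<le> \<delta>"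
    using \<delta> by auto
  have lower: "\<forall>\<^sub>F N in sequentially. 1 - (P N (- window N \<alpha> \<delta>) + P N (- window N 0 \<delta>)) \<le> P N (Good N)"
    using far eventually_S_diff[OF le(1)] eventually_S_diff[OF le(2)]
      eventually_S_ratio[OF le(3)] eventually_S_ratio[OF le(4)] eventually_S_ratio[OF le(5)] eventually_S_ratio[OF le(6)]
  proof eventually_elim
    case (elim N)
    have "window N \<alpha> \<delta> \<inter> window N 0 \<delta> \<subseteq> Good N"
    proof
      fix Z assume Z: "Z \<in> window N \<alpha> \<delta> \<inter> window N 0 \<delta>"
      have K: "real (k N) > 0" using k_pos[of N] by simp
      define a where "a = t_mix dir (G N) Z (Gauss_tail \<alpha>) / k N"
      define b where "b = t_mix dir (G N) Z (1/2) / k N"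
      have ab: "S N (\<alpha> - \<delta>) \<le> a" "a \<le> S N (\<alpha> + \<delta>)" "S N (- \<delta>) \<le> b" "b \<le> S N \<delta>"
        using Z K unfolding S_def a_def b_def by (auto simp: window_def Gauss_tail_0 intro!: divide_right_mono)
      have m: "S N (\<alpha> - \<delta>) \<le> S N \<alpha>" "S N \<alpha> \<le> S N (\<alpha> + \<delta>)" "S N (- \<delta>) \<le> S N 0" "S N 0 \<le> S N \<delta>"
        using elim \<delta> by auto
      define u where "u = \<delta> * \<rho> N * S N 0"
      have d: "S N (\<alpha> + \<delta>) - S N (\<alpha> - \<delta>) \<le> 256 * u" "S N \<delta> - S N (- \<delta>) \<le> 256 * u"
        using elim by (auto simp: u_def algebra_simps)
      have "\<bar>(a - b) - (S N \<alpha> - S N 0)\<bar> \<le> 512 * u" using ab m d by linarith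
      also have "512 * u = \<eta> * (\<bar>\<alpha>\<bar> * \<rho> N * S N 0 / 6)" by (simp add: u_def \<delta>_def)
      also have "\<dots> \<le> \<eta> * \<bar>S N \<alpha> - S N 0\<bar>" using elim \<eta> by (intro mult_left_mono) auto
      finally have "k N * \<bar>(a - b) - (S N \<alpha> - S N 0)\<bar> \<le> k N * (\<eta> * \<bar>S N \<alpha> - S N 0\<bar>)" using K by (intro mult_left_mono) auto
      moreover have "k N * \<bar>(a - b) - (S N \<alpha> - S N 0)\<bar> = \<bar>k N * ((a - b) - (S N \<alpha> - S N 0))\<bar>" using K by (simp add: abs_mult)
      moreover have "k N * (\<eta> * \<bar>S N \<alpha> - S N 0\<bar>) = \<eta> * \<bar>k N * (S N \<alpha> - S N 0)\<bar>" using K by (simp add: abs_mult)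
      moreover have "k N * (S N \<alpha> - S N 0) = tau N \<alpha> - tau N 0" using K by (simp add: S_def right_diff_distrib)
      moreover have "k N * ((a - b) - (S N \<alpha> - S N 0)) = (t_mix dir (G N) Z (Gauss_tail \<alpha>) - t_mix dir (G N) Z (1/2)) - (tau N \<alpha> - tau N 0)"
        using K by (simp add: a_def b_def S_def right_diff_distrib)
      ultimately show "Z \<in> Good N" by (simp add: Good_def)
    qed
    hence "P N (- Good N) \<le> P N (- window N \<alpha> \<delta> \<union> - window N 0 \<delta>)"
      unfolding P_def by (intro measure_pmf.finite_measure_mono) auto
    also have "\<dots> \<le> P N (- window N \<alpha> \<delta>) + P N (- window N 0 \<delta>)" unfolding P_def by (rule measure_Un_le) auto
    finally have "P N (- Good N) \<le> P N (- window N \<alpha> \<delta>) + P N (- window N 0 \<delta>)" .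
    moreover have "P N (- Good N) = 1 - P N (Good N)"
      unfolding P_def using measure_pmf.prob_compl[of "Good N" "random_gens (k N) (G N)"] by (simp add: Compl_eq_Diff_UNIV)
    ultimately show ?case by linarith
  qed
  have "(\<lambda>N. 1 - (P N (- window N \<alpha> \<delta>) + P N (- window N 0 \<delta>))) \<longlonglongrightarrow> 1 - (0 + 0)"
    unfolding P_def using \<delta> by (intro tendsto_diff tendsto_add tendsto_const prob_window)
  hence lim: "(\<lambda>N. 1 - (P N (- window N \<alpha> \<delta>) + P N (- window N 0 \<delta>))) \<longlonglongrightarrow> 1" by simp
  have "(\<lambda>N. P N (Good N)) \<longlonglongrightarrow> 1"
  proof (rule tendsto_sandwich[OF lower _ lim tendsto_const])
    show "\<forall>\<^sub>F N in sequentially. P N (Good N) \<le> 1" by (simp add: P_def)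
  qed
  thus ?thesis by (simp add: P_def Good_def)
qed

lemma deterministic_lower_bound:
  "\<exists>\<delta>. \<delta> \<longlonglongrightarrow> 0 \<and> (\<forall>N Z. size Z = k N \<and> set_mset Z \<subseteq> carrier (G N) \<longrightarrow> mix_dist dir (G N) Z (tau N \<alpha>) \<ge> Gauss_tail \<alpha> - \<delta> N)"
proof -
  obtain N0 where N0: "\<And>N Z. N \<ge> N0 \<Longrightarrow> size Z = k N \<and> set_mset Z \<subseteq> carrier (G N) \<Longrightarrow> LB N \<alpha> \<le> mix_dist dir (G N) Z (tau N \<alpha>)"
    using eventually_mix_dist_ge[of \<alpha>] unfolding eventually_sequentially by blast
  \<comment> \<open>For the finitely many earlier \<open>N\<close> the value 1 makes the bound
    trivial, since \<open>Gauss_tail \<alpha> \<le> 1\<close> and the distance is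
    nonnegative.\<close>
  define \<delta> where "\<delta> N = (if N \<ge> N0 then Gauss_tail \<alpha> - LB N \<alpha> else 1)" for N
  have "(\<lambda>N. Gauss_tail \<alpha> - LB N \<alpha>) \<longlonglongrightarrow> Gauss_tail \<alpha> - Gauss_tail \<alpha>"
    by (intro tendsto_diff tendsto_const LB_tendsto)
  hence "(\<lambda>N. Gauss_tail \<alpha> - LB N \<alpha>) \<longlonglongrightarrow> 0" by simp
  hence "\<delta> \<longlonglongrightarrow> 0"
    by (rule Lim_transform_eventually) (auto simp: \<delta>_def eventually_sequentially intro!: exI[of _ N0])
  moreover have "mix_dist dir (G N) Z (tau N \<alpha>) \<ge> Gauss_tail \<alpha> - \<delta> N" if "size Z = k N \<and> set_mset Z \<subseteq> carrier (G N)" for N Z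
    using N0[of N Z] that Gauss_tail_01(2)[of \<alpha>] tv_dist_bounds(1)[of "cayley_walk dir (G N) Z (tau N \<alpha>)" "pmf_of_set (carrier (G N))"]
    by (auto simp: \<delta>_def mix_dist_def)
  ultimately show ?thesis by blast
qed

end

theorem theorem2p5:
  fixes dir :: orientation
    and k :: "nat \<Rightarrow> nat"
    and G :: "nat \<Rightarrow> ('a, 'b) monoid_scheme"
    and t :: "nat \<Rightarrow> real \<Rightarrow> real"
  assumes k_pos: "\<And>N. k N \<ge> 1"
    and grp: "\<And>N. comm_group (G N)"
    and fin: "\<And>N. finite (carrier (G N))"
    and order_lim: "filterlim (\<lambda>N. order (G N)) at_top sequentially"
    and gap_lim: "filterlim (\<lambda>N. real (k N) - real (min_gens (G N))) at_top sequentially"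
    and cond: "\<And>N. (real (k N) - real (min_gens (G N)) - 1) / real (k N)
        \<ge> 5 * (real (k N) / ln (real (order (G N))))
          + 2 * (real (min_gens (G N)) * ln (ln (real (k N))) / ln (real (order (G N))))"
  defines "t \<equiv> (\<lambda>N \<alpha>. ent_time dir (k N) (order (G N)) \<alpha>)"
  shows
    "(\<forall>\<alpha>::real.
        (\<lambda>N. t N \<alpha> / t N 0) \<longlonglongrightarrow> 1 \<and>
        tendsto_in_prob (\<lambda>N. random_gens (k N) (G N))
          (\<lambda>N Z. mix_dist dir (G N) Z (t N \<alpha>)) (Gauss_tail \<alpha>)) \<and>
     (\<forall>\<epsilon>::real. 0 < \<epsilon> \<and> \<epsilon> < 1 \<longrightarrow>
        tendsto_in_prob (\<lambda>N. random_gens (k N) (G N))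
          (\<lambda>N Z. t_mix dir (G N) Z \<epsilon> / t N 0) 1 \<and>
        (\<forall>\<eta>>0.
          (\<lambda>N. measure_pmf.prob (random_gens (k N) (G N))
             {Z. \<bar>(t_mix dir (G N) Z \<epsilon> - t_mix dir (G N) Z (1/2))
                   - (t N (the_inv Gauss_tail \<epsilon>) - t N 0)\<bar>
                 \<le> \<eta> * \<bar>t N (the_inv Gauss_tail \<epsilon>) - t N 0\<bar>}) \<longlonglongrightarrow> 1)) \<and>
     (\<forall>\<alpha>::real. \<exists>\<delta> :: nat \<Rightarrow> real. \<delta> \<longlonglongrightarrow> 0 \<and>
        (\<forall>N Z. size Z = k N \<and> set_mset Z \<subseteq> carrier (G N) \<longrightarrow>
           mix_dist dir (G N) Z (t N \<alpha>) \<ge> Gauss_tail \<alpha> - \<delta> N))"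
proof -
  interpret cutoff_sequence dir k G
    by (rule cutoff_sequence.intro) (fact k_pos grp fin order_lim gap_lim cond)+
  have t: "t = tau" by (simp add: t_def fun_eq_iff tau_def)
  show ?thesis
    unfolding t
  proof (intro conjI allI impI)
    fix \<alpha> show "(\<lambda>N. tau N \<alpha> / tau N 0) \<longlonglongrightarrow> 1" unfolding tau_ratio by (rule S_ratio_tendsto_1)
  next
    fix \<alpha> show "tendsto_in_prob (\<lambda>N. random_gens (k N) (G N)) (\<lambda>N Z. mix_dist dir (G N) Z (tau N \<alpha>)) (Gauss_tail \<alpha>)"
      by (rule mix_dist_in_prob)
  next
    fix \<epsilon> :: real assume "0 < \<epsilon> \<and> \<epsilon> < 1"
    hence "\<epsilon> = Gauss_tail (the_inv Gauss_tail \<epsilon>)" using Gauss_tail_the_inv by simp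
    thus "tendsto_in_prob (\<lambda>N. random_gens (k N) (G N)) (\<lambda>N Z. t_mix dir (G N) Z \<epsilon> / tau N 0) 1"
      using t_mix_ratio_in_prob[of "the_inv Gauss_tail \<epsilon>"] by simp
  next
    fix \<epsilon> \<eta> :: real assume "0 < \<epsilon> \<and> \<epsilon> < 1" "\<eta> > 0"
    thus "(\<lambda>N. measure_pmf.prob (random_gens (k N) (G N))
             {Z. \<bar>(t_mix dir (G N) Z \<epsilon> - t_mix dir (G N) Z (1/2)) - (tau N (the_inv Gauss_tail \<epsilon>) - tau N 0)\<bar>
                 \<le> \<eta> * \<bar>tau N (the_inv Gauss_tail \<epsilon>) - tau N 0\<bar>}) \<longlonglongrightarrow> 1"
      using t_mix_window[of \<eta> "the_inv Gauss_tail \<epsilon>"] Gauss_tail_the_inv[of \<epsilon>] by simp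
  next
    fix \<alpha> show "\<exists>\<delta> :: nat \<Rightarrow> real. \<delta> \<longlonglongrightarrow> 0 \<and>
        (\<forall>N Z. size Z = k N \<and> set_mset Z \<subseteq> carrier (G N) \<longrightarrow> mix_dist dir (G N) Z (tau N \<alpha>) \<ge> Gauss_tail \<alpha> - \<delta> N)"
      by (rule deterministic_lower_bound)
  qed
qed

end
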